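(* Let $q\in(0,1)$, $\mathfrak g=\mathfrak{sl}_2$, and let $\mathrm{Pol}(\mathfrak g_{-1})_q$ be the covariant $*$-algebra described in the context, with the elements $a_+\in\mathbb C[\mathfrak g_{-1}]_q$, $a_-\in\mathbb C[\overline{\mathfrak g}_{-1}]_q$ defined there, regarded as elements of $\mathrm{Pol}(\mathfrak g_{-1})_q$. Then $a_+,a_-$ generate $\mathrm{Pol}(\mathfrak g_{-1})_q$ and $$a_-a_+=q^2a_+a_-+q(1-q^2)$$ is a complete list of relations between them, i.e. the natural map $$\mathbb C\langle a_+,a_-\rangle/\bigl(a_-a_+-q^2a_+a_--q(1-q^2)\bigr)\to\mathrm{Pol}(\mathfrak g_{-1})_q$$ is an isomorphism of algebras. The action of $U_q\mathfrak{sl}_2$ is determined by $$K^{\pm1}a_-=q^{\mp2}a_-,\quad Ea_-=1,\quad Fa_-=-q\,a_-^2,\qquad K^{\pm1}a_+=q^{\pm2}a_+,\quad Fa_+=1,\quad Ea_+=-q\,a_+^2,$$ and the involution is determined by $a_+^*=q^{-2}a_-$, $a_-^*=q^2a_+$. Consequently, for $z=q^{1/2}a_+$ one has $z^*=q^{-3/2}a_-$ and $$z^*z-q^2zz^*=1-q^2 .$$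
   Context: $U_q\mathfrak{sl}_2$ is the Hopf algebra with generators $K^{\pm1},E,F$ and relations $KK^{-1}=K^{-1}K=1$, $K^{\pm1}E=q^{\pm2}EK^{\pm1}$, $K^{\pm1}F=q^{\mp2}FK^{\pm1}$, $EF-FE=(K-K^{-1})/(q-q^{-1})$; $\Delta(E)=E\otimes1+K\otimes E$, $\Delta(F)=F\otimes K^{-1}+1\otimes F$, $\Delta(K^{\pm1})=K^{\pm1}\otimes K^{\pm1}$; $\varepsilon(E)=\varepsilon(F)=0$, $\varepsilon(K^{\pm1})=1$; $S(E)=-K^{-1}E$, $S(F)=-FK$, $S(K^{\pm1})=K^{\mp1}$. The antilinear antiautomorphism $*$ is $E^*=-KF$, $F^*=-EK^{-1}$, $(K^{\pm1})^*=K^{\pm1}$. $V_+(0)$ is the $U_q\mathfrak{sl}_2$-module with one generator $v_+(0)$ and relations $Fv_+(0)=0$, $K^{\pm1}v_+(0)=v_+(0)$; $V_-(0)$ is the module with one generator $v_-(0)$ and relations $Ev_-(0)=0$, $K^{\pm1}v_-(0)=v_-(0)$. They are graded with components $V_+(0)_j=\mathbb C E^jv_+(0)$ and $V_-(0)_{-j}=\mathbb C F^jv_-(0)$, $j\ge0$. With $V_\pm(0)\otimes V_\pm(0)$ made a module via the opposite comultiplication $\Delta^{op}$, the maps $v_\pm(0)\mapsto v_\pm(0)\otimes v_\pm(0)$, $v_\pm(0)\mapsto1$ extend uniquely to module morphisms $\Delta_\pm$, $\varepsilon_\pm$ making $V_\pm(0)$ coalgebras. $\mathbb C[\mathfrak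 g_{-1}]_q=\bigoplus_j(V_-(0)_j)^*$ and $\mathbb C[\overline{\mathfrak g}_{-1}]_q=\bigoplus_j(V_+(0)_j)^*$ carry the dual algebra structures (multiplications $m_+$, resp. $m_-$, dual to $\Delta_-$, resp. $\Delta_+$) and the action $(\xi f)(v)=f(S(\xi)v)$, which make them $U_q\mathfrak{sl}_2$-module algebras. The functionals $a_\pm$ are defined by $a_+(S(F^j)v_-(0))=\delta_{j,1}$ and $a_-(S(E^j)v_+(0))=\delta_{j,1}$, $j\ge0$. $\mathrm{Pol}(\mathfrak g_{-1})_q=\mathbb C[\mathfrak g_{-1}]_q\otimes\mathbb C[\overline{\mathfrak g}_{-1}]_q$, with the tensor product module structure via $\Delta$ and the associative multiplication $(\varphi_+\otimes\varphi_-)(\psi_+\otimes\psi_-)=(m_+\otimes m_-)(\varphi_+\otimes\check R(\varphi_-\otimes\psi_+)\otimes\psi_-)$, where $\check R=\sigma R$, $\sigma(a\otimes b)=b\otimes a$, and $R=\exp_{q^2}((q^{-1}-q)E\otimes F)\cdot T$ acts on $\mathbb C[\overline{\mathfrak g}_{-1}]_q\otimes\mathbb C[\mathfrak g_{-1}]_q$; here $\exp_t(x)=\sum_{n\ge0}x^n\bigl(\prod_{j=1}^n\frac{1-t^j}{1-t}\bigr)^{-1}$ and $T(x\otimes y)=q^{-mn/2}x\otimes y$ if $Kx=q^mx$, $Ky=q^ny$. The algebras $\mathbb C[\mathfrak g_{-1}]_q$, $\mathbb C[\overline{\mathfrak g}_{-1}]_q$ are embedded via $f\mapsto f\otimes1$,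 $f\mapsto1\otimes f$. The involution: antilinear maps $*:V_\pm(0)\to V_\mp(0)$ are given by $(\xi v_\pm(0))^*=(S^{-1}(\xi))^*v_\mp(0)$; for $f$ in either of the dual algebras $f^*(v)=\overline{f(v^* )}$; and $(f_+\otimes f_-)^*=f_-^*\otimes f_+^*$. It satisfies $(f_1f_2)^*=f_2^*f_1^*$ and $(\xi f)^*=(S(\xi))^*f^*$. *)

theory Defs
  imports Complex_Main "HOL-Library.Poly_Mapping" "HOL-Algebra.QuotRing" "HOL-Algebra.Subrings" "HOL-Algebra.Module"
begin

section \<open>Complex vector spaces and algebras\<close>

text \<open>
  A complex vector space is a record of type \<open>(complex, 'a) module\<close>. If it is only a vector space,
  the fields \<open>mult\<close> and \<open>one\<close> are irrelevant; if it is an algebra, they hold its multiplication and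
  unit. (The locale \<open>algebra\<close> of HOL-Algebra is restricted to commutative algebras.)
\<close>

definition cplx :: "(complex, complex) module" where
  "cplx = \<lparr>carrier = UNIV, monoid.mult = (*), one = 1, ring.zero = 0, add = (+), smult = (*)\<rparr>"

definition calgebra :: "(complex, 'a) module \<Rightarrow> bool" where
  "calgebra A \<longleftrightarrow> ring A \<and> Module.module cplx A \<and>
     (\<forall>c. \<forall>x \<in> carrier A. \<forall>y \<in> carrier A.
        (c \<odot>\<^bsub>A\<^esub> x) \<otimes>\<^bsub>A\<^esub> y = c \<odot>\<^bsub>A\<^esub> (x \<otimes>\<^bsub>A\<^esub> y) \<and>
        x \<otimes>\<^bsub>A\<^esub> (c \<odot>\<^bsub>A\<^esub> y) = c \<odot>\<^bsub>A\<^esub> (x \<otimes>\<^bsub>A\<^esub> y))"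

definition lin_maps :: "(complex, 'a) module \<Rightarrow> (complex, 'b) module \<Rightarrow> ('a \<Rightarrow> 'b) set" where
  "lin_maps V W = {f \<in> carrier V \<rightarrow>\<^sub>E carrier W.
     (\<forall>x \<in> carrier V. \<forall>y \<in> carrier V. f (x \<oplus>\<^bsub>V\<^esub> y) = f x \<oplus>\<^bsub>W\<^esub> f y) \<and>
     (\<forall>c. \<forall>x \<in> carrier V. f (c \<odot>\<^bsub>V\<^esub> x) = c \<odot>\<^bsub>W\<^esub> f x)}"

definition calg_hom :: "(complex, 'a) module \<Rightarrow> (complex, 'b) module \<Rightarrow> ('a \<Rightarrow> 'b) set" where
  "calg_hom A B = {h \<in> ring_hom A B. \<forall>c. \<forall>x \<in> carrier A. h (c \<odot>\<^bsub>A\<^esub> x) = c \<odot>\<^bsub>B\<^esub> h x}"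

definition calg_iso :: "(complex, 'a) module \<Rightarrow> (complex, 'b) module \<Rightarrow> ('a \<Rightarrow> 'b) set" where
  "calg_iso A B = {h \<in> calg_hom A B. bij_betw h (carrier A) (carrier B)}"

text \<open>
  Opposite algebra and complex conjugate space: an antihomomorphism \<open>A \<rightarrow> B\<close> is a homomorphism
  \<open>A \<rightarrow> opp_alg B\<close>, an antilinear map \<open>V \<rightarrow> W\<close> is a linear map \<open>V \<rightarrow> conj_sp W\<close>.
\<close>

definition opp_alg :: "(complex, 'a) module \<Rightarrow> (complex, 'a) module" where
  "opp_alg A = A\<lparr>monoid.mult := (\<lambda>x y. y \<otimes>\<^bsub>A\<^esub> x)\<rparr>"

definition conj_sp :: "(complex, 'a) module \<Rightarrow> (complex, 'a) module" where
  "conj_sp A = A\<lparr>smult := (\<lambda>c x. cnj c \<odot>\<^bsub>A\<^esub> x)\<rparr>"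

definition subspace_gen :: "(complex, 'a) module \<Rightarrow> 'a set \<Rightarrow> 'a set" where
  "subspace_gen V S = \<Inter>{H. submodule H cplx V \<and> S \<subseteq> H}"

definition subalg_gen :: "(complex, 'a) module \<Rightarrow> 'a set \<Rightarrow> 'a set" where
  "subalg_gen A S = \<Inter>{B. subring B A \<and> submodule B cplx A \<and> S \<subseteq> B}"

definition left_ideal_gen :: "(complex, 'a) module \<Rightarrow> 'a set \<Rightarrow> 'a set" where
  "left_ideal_gen A S = \<Inter>{J. additive_subgroup J A \<and>
     (\<forall>a \<in> carrier A. \<forall>x \<in> J. a \<otimes>\<^bsub>A\<^esub> x \<in> J) \<and> S \<subseteq> J}"

text \<open>
  The quotient by a subspace \<open>N\<close>; if \<open>N\<close> is a two-sided ideal of an algebra this is the quotient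
  algebra.
\<close>

definition quot :: "(complex, 'a) module \<Rightarrow> 'a set \<Rightarrow> (complex, 'a set) module" where
  "quot V N = \<lparr>carrier = carrier (V Quot N), monoid.mult = monoid.mult (V Quot N), one = one (V Quot N),
     ring.zero = ring.zero (V Quot N), add = add (V Quot N),
     smult = (\<lambda>c X. \<Union>x \<in> X. N +>\<^bsub>V\<^esub> (c \<odot>\<^bsub>V\<^esub> x))\<rparr>"

text \<open>
  Maps out of a quotient are written below as \<open>the_elem (f ` X)\<close>: the common value of \<open>f\<close> on all
  representatives of the class \<open>X\<close>.
\<close>


section \<open>Algebras given by generators and relations\<close>

text \<open>Words form the free monoid, so \<open>'x list \<Rightarrow>\<^sub>0 complex\<close> is the free algebra on \<open>'x\<close>.\<close>

instantiation list :: (type) monoid_add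
begin
definition zero_list :: "'a list" where "zero_list = []"
definition plus_list :: "'a list \<Rightarrow> 'a list \<Rightarrow> 'a list" where "plus_list = (@)"
instance by standard (simp_all add: zero_list_def plus_list_def)
end

type_synonym 'x free = "'x list \<Rightarrow>\<^sub>0 complex"

definition free_alg :: "(complex, 'x free) module" where
  "free_alg = \<lparr>carrier = UNIV, monoid.mult = (*), one = 1, ring.zero = 0, add = (+),
     smult = (\<lambda>c. Poly_Mapping.map ((*) c))\<rparr>"

abbreviation fgen :: "'x \<Rightarrow> 'x free" where
  "fgen x \<equiv> Poly_Mapping.single [x] 1"

abbreviation fconst :: "complex \<Rightarrow> 'x free" where
  "fconst c \<equiv> Poly_Mapping.single [] c"

definition free_ext :: "(complex, 'b) module \<Rightarrow> ('x \<Rightarrow> 'b) \<Rightarrow> 'x free \<Rightarrow> 'b" where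
  "free_ext B g p = (\<Oplus>\<^bsub>B\<^esub>w \<in> Poly_Mapping.keys p.
     Poly_Mapping.lookup p w \<odot>\<^bsub>B\<^esub> foldr (\<lambda>x r. g x \<otimes>\<^bsub>B\<^esub> r) w \<one>\<^bsub>B\<^esub>)"

definition presented_alg :: "'x free set \<Rightarrow> (complex, 'x free set) module" where
  "presented_alg rels = quot free_alg (Idl\<^bsub>free_alg\<^esub> rels)"

definition pgen :: "'x free set \<Rightarrow> 'x \<Rightarrow> 'x free set" where
  "pgen rels x = (Idl\<^bsub>free_alg\<^esub> rels) +>\<^bsub>free_alg\<^esub> fgen x"

text \<open>The homomorphism from a presented algebra to \<open>B\<close> with prescribed values on the generators.\<close>

definition presented_ext :: "(complex, 'b) module \<Rightarrow> ('x \<Rightarrow> 'b) \<Rightarrow> 'x free set \<Rightarrow> 'b" where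
  "presented_ext B g X = the_elem (free_ext B g ` X)"


section \<open>Tensor products\<close>

definition free_space :: "'a set \<Rightarrow> (complex, 'a \<Rightarrow>\<^sub>0 complex) module" where
  "free_space S = \<lparr>carrier = {p. Poly_Mapping.keys p \<subseteq> S}, monoid.mult = undefined, one = undefined,
     ring.zero = 0, add = (+), smult = (\<lambda>c. Poly_Mapping.map ((*) c))\<rparr>"

type_synonym ('a, 'b) tens = "('a \<times> 'b \<Rightarrow>\<^sub>0 complex) set"

definition bilin_rels :: "(complex, 'a) module \<Rightarrow> (complex, 'b) module \<Rightarrow> ('a \<times> 'b \<Rightarrow>\<^sub>0 complex) set"
  where
  "bilin_rels V W =
     {Poly_Mapping.single (x \<oplus>\<^bsub>V\<^esub> x', y) 1 - Poly_Mapping.single (x, y) 1 - Poly_Mapping.single (x', y) 1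
        | x x' y. x \<in> carrier V \<and> x' \<in> carrier V \<and> y \<in> carrier W} \<union>
     {Poly_Mapping.single (x, y \<oplus>\<^bsub>W\<^esub> y') 1 - Poly_Mapping.single (x, y) 1 - Poly_Mapping.single (x, y') 1
        | x y y'. x \<in> carrier V \<and> y \<in> carrier W \<and> y' \<in> carrier W} \<union>
     {Poly_Mapping.single (c \<odot>\<^bsub>V\<^esub> x, y) 1 - Poly_Mapping.single (x, y) c
        | c x y. x \<in> carrier V \<and> y \<in> carrier W} \<union>
     {Poly_Mapping.single (x, c \<odot>\<^bsub>W\<^esub> y) 1 - Poly_Mapping.single (x, y) c
        | c x y. x \<in> carrier V \<and> y \<in> carrier W}"

definition bilin_null :: "(complex, 'a) module \<Rightarrow> (complex, 'b) module \<Rightarrow> ('a \<times> 'b \<Rightarrow>\<^sub>0 complex) set"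
  where
  "bilin_null V W = subspace_gen (free_space (carrier V \<times> carrier W)) (bilin_rels V W)"

definition tensor :: "(complex, 'a) module \<Rightarrow> (complex, 'b) module \<Rightarrow> (complex, ('a, 'b) tens) module"
  where
  "tensor V W = quot (free_space (carrier V \<times> carrier W)) (bilin_null V W)"

definition ptens :: "(complex, 'a) module \<Rightarrow> (complex, 'b) module \<Rightarrow> 'a \<Rightarrow> 'b \<Rightarrow> ('a, 'b) tens" where
  "ptens V W x y =
     bilin_null V W +>\<^bsub>free_space (carrier V \<times> carrier W)\<^esub> Poly_Mapping.single (x, y) 1"

text \<open>The linear map \<open>V \<otimes> W \<rightarrow> Z\<close> induced by a bilinear map \<open>b\<close>.\<close>

definition tensor_ext :: "(complex, 'c) module \<Rightarrow> ('a \<Rightarrow> 'b \<Rightarrow> 'c) \<Rightarrow> ('a, 'b) tens \<Rightarrow> 'c" where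
  "tensor_ext Z b X = the_elem ((\<lambda>p. \<Oplus>\<^bsub>Z\<^esub>xy \<in> Poly_Mapping.keys p.
     Poly_Mapping.lookup p xy \<odot>\<^bsub>Z\<^esub> b (fst xy) (snd xy)) ` X)"

definition tensor_flip :: "(complex, 'a) module \<Rightarrow> (complex, 'b) module \<Rightarrow> ('a, 'b) tens \<Rightarrow> ('b, 'a) tens"
  where
  "tensor_flip V W = tensor_ext (tensor W V) (\<lambda>x y. ptens W V y x)"

definition tensor_alg :: "(complex, 'a) module \<Rightarrow> (complex, 'b) module \<Rightarrow> (complex, ('a, 'b) tens) module"
  where
  "tensor_alg A B = (tensor A B)
     \<lparr>monoid.mult := (\<lambda>X Y. tensor_ext (tensor A B) (\<lambda>a b.
        tensor_ext (tensor A B) (\<lambda>a' b'. ptens A B (a \<otimes>\<^bsub>A\<^esub> a') (b \<otimes>\<^bsub>B\<^esub> b')) Y) X),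
      one := ptens A B \<one>\<^bsub>A\<^esub> \<one>\<^bsub>B\<^esub>\<rparr>"


section \<open>Modules over an algebra\<close>

definition left_module ::
    "(complex, 'u) module \<Rightarrow> (complex, 'v) module \<Rightarrow> ('u \<Rightarrow> 'v \<Rightarrow> 'v) \<Rightarrow> bool" where
  "left_module U V act \<longleftrightarrow> Module.module cplx V \<and>
     (\<forall>\<xi> \<in> carrier U. \<forall>v \<in> carrier V. act \<xi> v \<in> carrier V) \<and>
     (\<forall>\<xi> \<in> carrier U. \<forall>v \<in> carrier V. \<forall>w \<in> carrier V. act \<xi> (v \<oplus>\<^bsub>V\<^esub> w) = act \<xi> v \<oplus>\<^bsub>V\<^esub> act \<xi> w) \<and>
     (\<forall>\<xi> \<in> carrier U. \<forall>c. \<forall>v \<in> carrier V. act \<xi> (c \<odot>\<^bsub>V\<^esub> v) = c \<odot>\<^bsub>V\<^esub> act \<xi> v) \<and>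
     (\<forall>\<xi> \<in> carrier U. \<forall>\<eta> \<in> carrier U. \<forall>v \<in> carrier V. act (\<xi> \<oplus>\<^bsub>U\<^esub> \<eta>) v = act \<xi> v \<oplus>\<^bsub>V\<^esub> act \<eta> v) \<and>
     (\<forall>c. \<forall>\<xi> \<in> carrier U. \<forall>v \<in> carrier V. act (c \<odot>\<^bsub>U\<^esub> \<xi>) v = c \<odot>\<^bsub>V\<^esub> act \<xi> v) \<and>
     (\<forall>\<xi> \<in> carrier U. \<forall>\<eta> \<in> carrier U. \<forall>v \<in> carrier V. act (\<xi> \<otimes>\<^bsub>U\<^esub> \<eta>) v = act \<xi> (act \<eta> v)) \<and>
     (\<forall>v \<in> carrier V. act \<one>\<^bsub>U\<^esub> v = v)"

text \<open>
  The left module with one generator \<open>v\<close> and relations \<open>\<xi> v = 0\<close> for \<open>\<xi> \<in> S\<close>. A morphism out of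
  it is determined by the image of \<open>v\<close>; its value on the class \<open>X\<close> of \<open>\<xi>\<close>, i.e. on \<open>\<xi> v\<close>, is
  \<open>\<xi>\<close> applied to that image.
\<close>

definition cyclic :: "(complex, 'u) module \<Rightarrow> 'u set \<Rightarrow> (complex, 'u set) module" where
  "cyclic U S = quot U (left_ideal_gen U S)"

definition cyclic_gen :: "(complex, 'u) module \<Rightarrow> 'u set \<Rightarrow> 'u set" where
  "cyclic_gen U S = left_ideal_gen U S +>\<^bsub>U\<^esub> \<one>\<^bsub>U\<^esub>"

definition cyclic_act :: "(complex, 'u) module \<Rightarrow> 'u set \<Rightarrow> 'u \<Rightarrow> 'u set \<Rightarrow> 'u set" where
  "cyclic_act U S \<xi> X = (\<Union>x \<in> X. left_ideal_gen U S +>\<^bsub>U\<^esub> (\<xi> \<otimes>\<^bsub>U\<^esub> x))"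

definition cyclic_ext :: "('u \<Rightarrow> 'v \<Rightarrow> 'v) \<Rightarrow> 'v \<Rightarrow> 'u set \<Rightarrow> 'v" where
  "cyclic_ext act w X = the_elem ((\<lambda>\<xi>. act \<xi> w) ` X)"

text \<open>
  The action of \<open>U\<close> on \<open>V \<otimes> W\<close> obtained by pulling back the action of \<open>U \<otimes> U\<close> along
  \<open>D :: U \<rightarrow> U \<otimes> U\<close>.
\<close>

definition tensor_act ::
    "('u \<Rightarrow> ('u, 'u) tens) \<Rightarrow> (complex, 'v) module \<Rightarrow> ('u \<Rightarrow> 'v \<Rightarrow> 'v) \<Rightarrow>
     (complex, 'w) module \<Rightarrow> ('u \<Rightarrow> 'w \<Rightarrow> 'w) \<Rightarrow> 'u \<Rightarrow> ('v, 'w) tens \<Rightarrow> ('v, 'w) tens" where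
  "tensor_act D V actV W actW \<xi> t =
     tensor_ext (tensor V W) (\<lambda>\<xi>1 \<xi>2.
       tensor_ext (tensor V W) (\<lambda>v w. ptens V W (actV \<xi>1 v) (actW \<xi>2 w)) t) (D \<xi>)"


section \<open>The Hopf algebra $U_q\mathfrak{sl}_2$\<close>

datatype uq_gen = gK | gKi | gE | gF   \<comment> \<open>\<open>gKi\<close> stands for $K^{-1}$\<close>

type_synonym uq = "uq_gen free set"

definition uq_rels :: "real \<Rightarrow> uq_gen free set" where
  "uq_rels q =
     {fgen gK * fgen gKi - 1,
      fgen gKi * fgen gK - 1,
      fgen gK * fgen gE - fconst (of_real (q\<^sup>2)) * fgen gE * fgen gK,
      fgen gKi * fgen gE - fconst (of_real (1 / q\<^sup>2)) * fgen gE * fgen gKi,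
      fgen gK * fgen gF - fconst (of_real (1 / q\<^sup>2)) * fgen gF * fgen gK,
      fgen gKi * fgen gF - fconst (of_real (q\<^sup>2)) * fgen gF * fgen gKi,
      fgen gE * fgen gF - fgen gF * fgen gE
        - fconst (of_real (1 / (q - 1 / q))) * (fgen gK - fgen gKi)}"

definition Uq :: "real \<Rightarrow> (complex, uq) module" where
  "Uq q = presented_alg (uq_rels q)"

definition ugen :: "real \<Rightarrow> uq_gen \<Rightarrow> uq" where
  "ugen q x = pgen (uq_rels q) x"

definition uq_comult :: "real \<Rightarrow> uq \<Rightarrow> (uq, uq) tens" where
  "uq_comult q = presented_ext (tensor_alg (Uq q) (Uq q)) (\<lambda>x.
     let U = Uq q; pt = ptens U U; K = ugen q gK; Ki = ugen q gKi; E = ugen q gE; F = ugen q gF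
     in case x of
          gK \<Rightarrow> pt K K
        | gKi \<Rightarrow> pt Ki Ki
        | gE \<Rightarrow> pt E \<one>\<^bsub>U\<^esub> \<oplus>\<^bsub>tensor U U\<^esub> pt K E
        | gF \<Rightarrow> pt F Ki \<oplus>\<^bsub>tensor U U\<^esub> pt \<one>\<^bsub>U\<^esub> F)"

definition uq_comult_op :: "real \<Rightarrow> uq \<Rightarrow> (uq, uq) tens" where
  "uq_comult_op q \<xi> = tensor_flip (Uq q) (Uq q) (uq_comult q \<xi>)"

definition uq_counit :: "uq \<Rightarrow> complex" where
  "uq_counit = presented_ext cplx (\<lambda>x. case x of gK \<Rightarrow> 1 | gKi \<Rightarrow> 1 | gE \<Rightarrow> 0 | gF \<Rightarrow> 0)"

definition uq_antipode :: "real \<Rightarrow> uq \<Rightarrow> uq" where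
  "uq_antipode q = presented_ext (opp_alg (Uq q)) (\<lambda>x.
     case x of
       gK \<Rightarrow> ugen q gKi
     | gKi \<Rightarrow> ugen q gK
     | gE \<Rightarrow> \<ominus>\<^bsub>Uq q\<^esub> (ugen q gKi \<otimes>\<^bsub>Uq q\<^esub> ugen q gE)
     | gF \<Rightarrow> \<ominus>\<^bsub>Uq q\<^esub> (ugen q gF \<otimes>\<^bsub>Uq q\<^esub> ugen q gK))"

definition uq_antipode_inv :: "real \<Rightarrow> uq \<Rightarrow> uq" where
  "uq_antipode_inv q = inv_into (carrier (Uq q)) (uq_antipode q)"

definition uq_star :: "real \<Rightarrow> uq \<Rightarrow> uq" where
  "uq_star q = presented_ext (conj_sp (opp_alg (Uq q))) (\<lambda>x.
     case x of
       gK \<Rightarrow> ugen q gK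
     | gKi \<Rightarrow> ugen q gKi
     | gE \<Rightarrow> \<ominus>\<^bsub>Uq q\<^esub> (ugen q gK \<otimes>\<^bsub>Uq q\<^esub> ugen q gF)
     | gF \<Rightarrow> \<ominus>\<^bsub>Uq q\<^esub> (ugen q gE \<otimes>\<^bsub>Uq q\<^esub> ugen q gKi))"

definition module_algebra :: "real \<Rightarrow> (complex, 'a) module \<Rightarrow> (uq \<Rightarrow> 'a \<Rightarrow> 'a) \<Rightarrow> bool" where
  "module_algebra q A act \<longleftrightarrow> calgebra A \<and> left_module (Uq q) A act \<and>
     (\<forall>\<xi> \<in> carrier (Uq q). act \<xi> \<one>\<^bsub>A\<^esub> = uq_counit \<xi> \<odot>\<^bsub>A\<^esub> \<one>\<^bsub>A\<^esub>) \<and>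
     (\<forall>\<xi> \<in> carrier (Uq q). \<forall>f \<in> carrier A. \<forall>g \<in> carrier A.
        act \<xi> (f \<otimes>\<^bsub>A\<^esub> g) =
          tensor_ext A (\<lambda>\<xi>1 \<xi>2. act \<xi>1 f \<otimes>\<^bsub>A\<^esub> act \<xi>2 g) (uq_comult q \<xi>))"


section \<open>The modules $V_\pm(0)$ and their graded duals\<close>

datatype sgn = Plus | Minus

fun flip_sgn :: "sgn \<Rightarrow> sgn" where
  "flip_sgn Plus = Minus" | "flip_sgn Minus = Plus"

fun killing :: "sgn \<Rightarrow> uq_gen" where
  "killing Plus = gF" | "killing Minus = gE"

fun generating :: "sgn \<Rightarrow> uq_gen" where
  "generating Plus = gE" | "generating Minus = gF"

type_synonym vq = "uq set"

definition V_rels :: "real \<Rightarrow> sgn \<Rightarrow> uq set" where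
  "V_rels q s = {ugen q (killing s), ugen q gK \<ominus>\<^bsub>Uq q\<^esub> \<one>\<^bsub>Uq q\<^esub>, ugen q gKi \<ominus>\<^bsub>Uq q\<^esub> \<one>\<^bsub>Uq q\<^esub>}"

definition V_mod :: "real \<Rightarrow> sgn \<Rightarrow> (complex, vq) module" where
  "V_mod q s = cyclic (Uq q) (V_rels q s)"

definition V_gen :: "real \<Rightarrow> sgn \<Rightarrow> vq" where
  "V_gen q s = cyclic_gen (Uq q) (V_rels q s)"

definition V_act :: "real \<Rightarrow> sgn \<Rightarrow> uq \<Rightarrow> vq \<Rightarrow> vq" where
  "V_act q s = cyclic_act (Uq q) (V_rels q s)"

text \<open>The component of degree \<open>j\<close> of $V_+(0)$, respectively of degree \<open>-j\<close> of $V_-(0)$.\<close>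

definition V_comp :: "real \<Rightarrow> sgn \<Rightarrow> nat \<Rightarrow> vq set" where
  "V_comp q s j = {c \<odot>\<^bsub>V_mod q s\<^esub>
     V_act q s (ugen q (generating s) [^]\<^bsub>Uq q\<^esub> j) (V_gen q s) | c. True}"

definition V_comult :: "real \<Rightarrow> sgn \<Rightarrow> vq \<Rightarrow> (vq, vq) tens" where
  "V_comult q s =
     cyclic_ext (tensor_act (uq_comult_op q) (V_mod q s) (V_act q s) (V_mod q s) (V_act q s))
       (ptens (V_mod q s) (V_mod q s) (V_gen q s) (V_gen q s))"

definition V_counit :: "vq \<Rightarrow> complex" where
  "V_counit = cyclic_ext (\<lambda>\<xi> c. uq_counit \<xi> * c) 1"

type_synonym dq = "vq \<Rightarrow> complex"

text \<open>
  The direct sum of the duals of the components, realised as the space of those linear functionals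
  that vanish on all but finitely many components. Functionals are \<open>undefined\<close> outside the carrier.
\<close>

definition dual_alg :: "real \<Rightarrow> sgn \<Rightarrow> (complex, dq) module" where
  "dual_alg q s = (let V = V_mod q s in
     \<lparr>carrier = {f \<in> lin_maps V cplx. finite {j. \<exists>v \<in> V_comp q s j. f v \<noteq> 0}},
      monoid.mult = (\<lambda>f g. \<lambda>v \<in> carrier V. tensor_ext cplx (\<lambda>x y. f x * g y) (V_comult q s v)),
      one = (\<lambda>v \<in> carrier V. V_counit v),
      ring.zero = (\<lambda>v \<in> carrier V. 0),
      add = (\<lambda>f g. \<lambda>v \<in> carrier V. f v + g v),
      smult = (\<lambda>c f. \<lambda>v \<in> carrier V. c * f v)\<rparr>)"

definition dual_act :: "real \<Rightarrow> sgn \<Rightarrow> uq \<Rightarrow> dq \<Rightarrow> dq" where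
  "dual_act q s \<xi> f = (\<lambda>v \<in> carrier (V_mod q s). f (V_act q s (uq_antipode q \<xi>) v))"

text \<open>Note the sign switch: $\mathbb C[\mathfrak g_{-1}]_q$ is dual to $V_-(0)$.\<close>

abbreviation Cg :: "real \<Rightarrow> (complex, dq) module" where   \<comment> \<open>$\mathbb C[\mathfrak g_{-1}]_q$\<close>
  "Cg q \<equiv> dual_alg q Minus"

abbreviation Cgbar :: "real \<Rightarrow> (complex, dq) module" where   \<comment> \<open>$\mathbb C[\overline{\mathfrak g}_{-1}]_q$\<close>
  "Cgbar q \<equiv> dual_alg q Plus"

definition dual_coord :: "real \<Rightarrow> sgn \<Rightarrow> dq" where
  "dual_coord q s = (THE f. f \<in> carrier (dual_alg q s) \<and>
     (\<forall>j::nat. f (V_act q s (uq_antipode q (ugen q (generating s) [^]\<^bsub>Uq q\<^esub> j)) (V_gen q s)) =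
          (if j = 1 then 1 else 0)))"


section \<open>The algebra $\mathrm{Pol}(\mathfrak g_{-1})_q$\<close>

type_synonym polq = "(dq, dq) tens"

definition pol_sp :: "real \<Rightarrow> (complex, polq) module" where
  "pol_sp q = tensor (Cg q) (Cgbar q)"

definition weight_vec :: "real \<Rightarrow> sgn \<Rightarrow> int \<Rightarrow> dq \<Rightarrow> bool" where
  "weight_vec q s m x \<longleftrightarrow> x \<in> carrier (dual_alg q s) \<and>
     dual_act q s (ugen q gK) x = of_real (q powi m) \<odot>\<^bsub>dual_alg q s\<^esub> x"

definition R_weight :: "real \<Rightarrow> polq \<Rightarrow> polq" where   \<comment> \<open>the operator \<open>T\<close>\<close>
  "R_weight q = (THE T. T \<in> lin_maps (tensor (Cgbar q) (Cg q)) (tensor (Cgbar q) (Cg q)) \<and>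
     (\<forall>m n x y. weight_vec q Plus m x \<longrightarrow> weight_vec q Minus n y \<longrightarrow>
        T (ptens (Cgbar q) (Cg q) x y) =
          of_real (q powr (- of_int (m * n) / 2)) \<odot>\<^bsub>tensor (Cgbar q) (Cg q)\<^esub>
            ptens (Cgbar q) (Cg q) x y))"

definition R_EF :: "real \<Rightarrow> polq \<Rightarrow> polq" where   \<comment> \<open>$(q^{-1}-q) E\otimes F$\<close>
  "R_EF q t = of_real (1 / q - q) \<odot>\<^bsub>tensor (Cgbar q) (Cg q)\<^esub>
     tensor_ext (tensor (Cgbar q) (Cg q)) (\<lambda>x y.
       ptens (Cgbar q) (Cg q) (dual_act q Plus (ugen q gE) x) (dual_act q Minus (ugen q gF) y)) t"

definition qfact :: "real \<Rightarrow> nat \<Rightarrow> real" where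
  "qfact t n = (\<Prod>j = 1..n. (1 - t ^ j) / (1 - t))"

text \<open>
  The \<open>q\<close>-exponential of a locally nilpotent operator \<open>X\<close>: on each vector only the finitely many
  nonzero terms are summed.
\<close>

definition qexp_op :: "real \<Rightarrow> (complex, 'v) module \<Rightarrow> ('v \<Rightarrow> 'v) \<Rightarrow> 'v \<Rightarrow> 'v" where
  "qexp_op t V X v = (\<Oplus>\<^bsub>V\<^esub>n \<in> {n. (X ^^ n) v \<noteq> \<zero>\<^bsub>V\<^esub>}. of_real (1 / qfact t n) \<odot>\<^bsub>V\<^esub> (X ^^ n) v)"

definition R_op :: "real \<Rightarrow> polq \<Rightarrow> polq" where
  "R_op q t = qexp_op (q\<^sup>2) (tensor (Cgbar q) (Cg q)) (R_EF q) (R_weight q t)"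

definition R_check :: "real \<Rightarrow> polq \<Rightarrow> polq" where
  "R_check q t = tensor_flip (Cgbar q) (Cg q) (R_op q t)"

definition Pol :: "real \<Rightarrow> (complex, polq) module" where
  "Pol q = (pol_sp q)
     \<lparr>monoid.mult := (\<lambda>X Y.
        tensor_ext (pol_sp q) (\<lambda>\<phi>p \<phi>m.
          tensor_ext (pol_sp q) (\<lambda>\<psi>p \<psi>m.
            tensor_ext (pol_sp q)
              (\<lambda>a b. ptens (Cg q) (Cgbar q) (\<phi>p \<otimes>\<^bsub>Cg q\<^esub> a) (b \<otimes>\<^bsub>Cgbar q\<^esub> \<psi>m))
              (R_check q (ptens (Cgbar q) (Cg q) \<phi>m \<psi>p))) Y) X),
      one := ptens (Cg q) (Cgbar q) \<one>\<^bsub>Cg q\<^esub> \<one>\<^bsub>Cgbar q\<^esub>\<rparr>"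

definition Pol_act :: "real \<Rightarrow> uq \<Rightarrow> polq \<Rightarrow> polq" where
  "Pol_act q = tensor_act (uq_comult q) (Cg q) (dual_act q Minus) (Cgbar q) (dual_act q Plus)"

definition ap :: "real \<Rightarrow> polq" where   \<comment> \<open>$a_+\otimes 1$\<close>
  "ap q = ptens (Cg q) (Cgbar q) (dual_coord q Minus) \<one>\<^bsub>Cgbar q\<^esub>"

definition am :: "real \<Rightarrow> polq" where   \<comment> \<open>$1\otimes a_-$\<close>
  "am q = ptens (Cg q) (Cgbar q) \<one>\<^bsub>Cg q\<^esub> (dual_coord q Plus)"


subsection \<open>The involution\<close>

text \<open>\<open>V_star q s\<close> maps \<open>V_mod q s\<close> to \<open>V_mod q (flip_sgn s)\<close>.\<close>

definition V_star :: "real \<Rightarrow> sgn \<Rightarrow> vq \<Rightarrow> vq" where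
  "V_star q s = cyclic_ext (\<lambda>\<xi>. V_act q (flip_sgn s) (uq_star q (uq_antipode_inv q \<xi>)))
     (V_gen q (flip_sgn s))"

definition dual_star :: "real \<Rightarrow> sgn \<Rightarrow> dq \<Rightarrow> dq" where
  "dual_star q s f =
     (\<lambda>v \<in> carrier (V_mod q (flip_sgn s)). cnj (f (V_star q (flip_sgn s) v)))"

definition Pol_star :: "real \<Rightarrow> polq \<Rightarrow> polq" where
  "Pol_star q = tensor_ext (conj_sp (pol_sp q)) (\<lambda>fp fm.
     ptens (Cg q) (Cgbar q) (dual_star q Plus fm) (dual_star q Minus fp))"

definition star_structure :: "(complex, 'a) module \<Rightarrow> ('a \<Rightarrow> 'a) \<Rightarrow> bool" where
  "star_structure A st \<longleftrightarrow> calgebra A \<and> st \<in> calg_hom A (conj_sp (opp_alg A)) \<and>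
     (\<forall>x \<in> carrier A. st (st x) = x)"


subsection \<open>The abstract algebra on two generators\<close>

datatype pol_gen = gAp | gAm

definition pol_rels :: "real \<Rightarrow> pol_gen free set" where
  "pol_rels q = {fgen gAm * fgen gAp - fconst (of_real (q\<^sup>2)) * fgen gAp * fgen gAm
     - fconst (of_real (q * (1 - q\<^sup>2)))}"

text \<open>The formulas for the action and the involution, as conditions on an arbitrary candidate.\<close>

definition action_formulas :: "real \<Rightarrow> (uq \<Rightarrow> polq \<Rightarrow> polq) \<Rightarrow> bool" where
  "action_formulas q act \<longleftrightarrow>
     act (ugen q gK) (am q) = of_real (1 / q\<^sup>2) \<odot>\<^bsub>Pol q\<^esub> am q \<and>
     act (ugen q gKi) (am q) = of_real (q\<^sup>2) \<odot>\<^bsub>Pol q\<^esub> am q \<and>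
     act (ugen q gE) (am q) = \<one>\<^bsub>Pol q\<^esub> \<and>
     act (ugen q gF) (am q) = of_real (- q) \<odot>\<^bsub>Pol q\<^esub> (am q \<otimes>\<^bsub>Pol q\<^esub> am q) \<and>
     act (ugen q gK) (ap q) = of_real (q\<^sup>2) \<odot>\<^bsub>Pol q\<^esub> ap q \<and>
     act (ugen q gKi) (ap q) = of_real (1 / q\<^sup>2) \<odot>\<^bsub>Pol q\<^esub> ap q \<and>
     act (ugen q gF) (ap q) = \<one>\<^bsub>Pol q\<^esub> \<and>
     act (ugen q gE) (ap q) = of_real (- q) \<odot>\<^bsub>Pol q\<^esub> (ap q \<otimes>\<^bsub>Pol q\<^esub> ap q)"

definition star_formulas :: "real \<Rightarrow> (polq \<Rightarrow> polq) \<Rightarrow> bool" where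
  "star_formulas q st \<longleftrightarrow>
     st (ap q) = of_real (1 / q\<^sup>2) \<odot>\<^bsub>Pol q\<^esub> am q \<and>
     st (am q) = of_real (q\<^sup>2) \<odot>\<^bsub>Pol q\<^esub> ap q"

end

theory Submission
  imports Defs
begin

text \<open>
  The module $V_\pm(0)$ acts by explicit shift operators on complex sequences; the coordinates obtained in this
  way show that the vectors $E^jv_+(0)$, resp. $F^jv_-(0)$, form a basis. Hence the two dual algebras are the
  polynomial algebras in $a_+$ and $a_-$, and the vectors $a_+^i\otimes a_-^j$ form a basis of
  $\mathrm{Pol}(\mathfrak g_{-1})_q$. The quantum exponential gives a closed formula for
  $\check R(a_-^b\otimes a_+^c)$, which is also the normal ordering formula for $Y^bX^c$ when
  $YX=q^2XY+q(1-q^2)$. Such operators $X$, $Y$ exist on the functions on pairs of natural numbers with all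
  $X^iY^j$ linearly independent, so $a_+^i\otimes a_-^j\mapsto X^iY^j$ is injective and multiplicative; this
  yields associativity and the presentation. Covariance and the involution are then verified on products of a
  generator with a basis element and on the defining relation.
\<close>

section \<open>Linear algebra over records\<close>

text \<open>Every object in the statement is a quotient by a generated ideal or subspace, or a
  definite description, so none comes with a basis or with the structure it is meant to carry.
  Independence is therefore always obtained from a linear map into a concrete function space, and
  spanning from a span being stable under the generators. In the abstract, associativity and
  covariance of \<open>Pol\<close> rest on the hexagon identities and the naturality of the
  R-matrix; but R is an infinite series that acts on these modules without lying in U tensor U. Both
  facts are instead reduced to coefficients: the operators X, Y are the left regular representation
  of the expected algebra, written on coefficients of X^i Y^j, and applying an operator to the
  indicator of (0, 0) recovers all coordinates. The constant in the relation is q(1-q^2) = q^2 (1/q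
  - q): T contributes q^2 on a_- tensor a_+, the prefactor of E tensor F contributes 1/q - q, and E
  a_- = F a_+ = 1. The powers of a_+ and a_- carry q-factorials because the comultiplication of
  V_+(0) and V_-(0) has Gaussian binomial coefficients.\<close>

abbreviation vs :: "(complex, 'a) module \<Rightarrow> bool" where
  "vs V \<equiv> Module.module cplx V"

lemma cplx_simps [simp]:
  "carrier cplx = UNIV" "\<zero>\<^bsub>cplx\<^esub> = 0" "\<one>\<^bsub>cplx\<^esub> = 1" "x \<oplus>\<^bsub>cplx\<^esub> y = x + y"
  "x \<otimes>\<^bsub>cplx\<^esub> y = x * y" "x \<odot>\<^bsub>cplx\<^esub> y = x * y"
  by (simp_all add: cplx_def)

lemma cring_cplx: "cring cplx"
proof (rule cringI)
  show "abelian_group cplx"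
    by (rule abelian_groupI) (auto intro: exI[of _ "- x" for x] simp: algebra_simps)
  show "Group.comm_monoid cplx"
    by unfold_locales (auto simp: algebra_simps)
qed (auto simp: algebra_simps)

text \<open>The additive inverse of x is obtained as (-1) x, which is what the condition on
  \<open>0 \<odot> x\<close> is for.\<close>

lemma vsI:
  fixes V (structure)
  assumes "\<And>x y. x \<in> carrier V \<Longrightarrow> y \<in> carrier V \<Longrightarrow> x \<oplus> y \<in> carrier V"
    and "\<zero> \<in> carrier V"
    and "\<And>x y z. x \<in> carrier V \<Longrightarrow> y \<in> carrier V \<Longrightarrow> z \<in> carrier V \<Longrightarrow> (x \<oplus> y) \<oplus> z = x \<oplus> (y \<oplus> z)"
    and "\<And>x y. x \<in> carrier V \<Longrightarrow> y \<in> carrier V \<Longrightarrow> x \<oplus> y = y \<oplus> x"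
    and "\<And>x. x \<in> carrier V \<Longrightarrow> \<zero> \<oplus> x = x"
    and "\<And>c x. x \<in> carrier V \<Longrightarrow> c \<odot> x \<in> carrier V"
    and "\<And>c d x. x \<in> carrier V \<Longrightarrow> (c + d) \<odot> x = c \<odot> x \<oplus> d \<odot> x"
    and "\<And>c x y. x \<in> carrier V \<Longrightarrow> y \<in> carrier V \<Longrightarrow> c \<odot> (x \<oplus> y) = c \<odot> x \<oplus> c \<odot> y"
    and "\<And>c d x. x \<in> carrier V \<Longrightarrow> (c * d) \<odot> x = c \<odot> (d \<odot> x)"
    and "\<And>x. x \<in> carrier V \<Longrightarrow> 1 \<odot> x = x"
    and "\<And>x. x \<in> carrier V \<Longrightarrow> 0 \<odot> x = \<zero>"
  shows "vs V"
proof (rule moduleI[OF cring_cplx])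
  show "abelian_group V"
  proof (rule abelian_groupI)
    fix x assume x: "x \<in> carrier V"
    have "(-1) \<odot> x \<oplus> x = (-1) \<odot> x \<oplus> 1 \<odot> x"
      using assms(10) x by simp
    also have "\<dots> = ((-1) + 1) \<odot> x"
      using assms(7) x by metis
    also have "\<dots> = \<zero>" using assms(11) x by simp
    finally show "\<exists>y\<in>carrier V. y \<oplus> x = \<zero>" using assms(6) x by blast
  qed (use assms in auto)
qed (use assms in auto)

context
  fixes V :: "(complex, 'a) module" (structure)
  assumes V: "vs V"
begin

interpretation Module.module cplx V by (rule V)

lemma vs_abelian_group: "abelian_group V"
  using V by (simp add: Module.module_def)
lemma vs_abelian_monoid: "abelian_monoid V"
  using vs_abelian_group by (simp add: abelian_group_def)

lemma vs_add_closed [simp, intro]: "x \<in> carrier V \<Longrightarrow> y \<in> carrier V \<Longrightarrow> x \<oplus> y \<in> carrier V"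
  by simp
lemma vs_zero_closed [simp, intro]: "\<zero> \<in> carrier V" by simp
lemma vs_smult_closed [simp, intro]: "x \<in> carrier V \<Longrightarrow> c \<odot> x \<in> carrier V" by simp
lemma vs_a_assoc: "x \<in> carrier V \<Longrightarrow> y \<in> carrier V \<Longrightarrow> z \<in> carrier V \<Longrightarrow> (x \<oplus> y) \<oplus> z = x \<oplus> (y \<oplus> z)"
  by (rule M.a_assoc)
lemma vs_a_comm: "x \<in> carrier V \<Longrightarrow> y \<in> carrier V \<Longrightarrow> x \<oplus> y = y \<oplus> x"
  by (rule M.a_comm)
lemma vs_a_lcomm: "x \<in> carrier V \<Longrightarrow> y \<in> carrier V \<Longrightarrow> z \<in> carrier V \<Longrightarrow> x \<oplus> (y \<oplus> z) = y \<oplus> (x \<oplus> z)"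
  by (rule M.a_lcomm)
lemma vs_l_zero [simp]: "x \<in> carrier V \<Longrightarrow> \<zero> \<oplus> x = x" by simp
lemma vs_r_zero [simp]: "x \<in> carrier V \<Longrightarrow> x \<oplus> \<zero> = x" by simp
lemma vs_smult_l_distr: "x \<in> carrier V \<Longrightarrow> (c + d) \<odot> x = c \<odot> x \<oplus> d \<odot> x"
  using smult_l_distr[of c d x] by simp
lemma vs_smult_r_distr: "x \<in> carrier V \<Longrightarrow> y \<in> carrier V \<Longrightarrow> c \<odot> (x \<oplus> y) = c \<odot> x \<oplus> c \<odot> y"
  using smult_r_distr[of c x y] by simp
lemma vs_smult_smult: "x \<in> carrier V \<Longrightarrow> c \<odot> (d \<odot> x) = (c * d) \<odot> x"
  using smult_assoc1[of c d x] by simp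
lemma vs_smult_one [simp]: "x \<in> carrier V \<Longrightarrow> 1 \<odot> x = x"
  using smult_one[of x] by simp
lemma vs_smult_0 [simp]: "x \<in> carrier V \<Longrightarrow> 0 \<odot> x = \<zero>"
  using smult_l_null[of x] by simp
lemma vs_smult_zero [simp]: "c \<odot> \<zero> = \<zero>"
  using smult_r_null[of c] by simp
lemma vs_a_inv: "x \<in> carrier V \<Longrightarrow> \<ominus> x = (-1) \<odot> x"
proof -
  assume x: "x \<in> carrier V"
  have "(-1) \<odot> x \<oplus> x = ((-1) + 1) \<odot> x"
    using x by (subst vs_smult_l_distr) auto
  also have "\<dots> = \<zero>" using x by simp
  finally show ?thesis using x by (metis M.minus_equality vs_smult_closed)
qed
lemma vs_minus: "x \<in> carrier V \<Longrightarrow> y \<in> carrier V \<Longrightarrow> x \<ominus> y = x \<oplus> (-1) \<odot> y"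
  by (simp add: M.minus_eq vs_a_inv)
lemma vs_minus_self: "x \<in> carrier V \<Longrightarrow> x \<oplus> (-1) \<odot> x = \<zero>"
  using vs_smult_l_distr[of x 1 "-1"] by simp
lemma vs_minus_eq_zero_iff: "x \<in> carrier V \<Longrightarrow> y \<in> carrier V \<Longrightarrow> x \<oplus> (-1) \<odot> y = \<zero> \<longleftrightarrow> x = y"
  by (metis M.add.inv_closed M.minus_equality M.add.inv_inv vs_a_inv M.r_neg)

lemma submodule_vs_iff:
  "submodule H cplx V \<longleftrightarrow> H \<subseteq> carrier V \<and> \<zero> \<in> H \<and> (\<forall>x\<in>H. \<forall>y\<in>H. x \<oplus> y \<in> H) \<and> (\<forall>c. \<forall>x\<in>H. c \<odot> x \<in> H)"
  (is "_ \<longleftrightarrow> ?R")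
proof
  assume ?R
  then show "submodule H cplx V"
    by (intro submoduleI) (auto simp: vs_a_inv subset_iff)
next
  assume a: "submodule H cplx V"
  show ?R using submoduleE[OF a] submodule.axioms(1)[OF a] subgroup.one_closed[of H "add_monoid V"]
    by auto
qed

end

subsection \<open>Linear and bilinear maps\<close>

text \<open>Unlike \<open>lin_maps\<close> this prescribes no values outside the carrier, so that
  lambda terms and \<open>the_elem\<close> expressions qualify as they stand.\<close>

definition lin :: "(complex, 'a) module \<Rightarrow> (complex, 'b) module \<Rightarrow> ('a \<Rightarrow> 'b) \<Rightarrow> bool" where
  "lin V W f \<longleftrightarrow> (\<forall>x\<in>carrier V. f x \<in> carrier W) \<and>
     (\<forall>x\<in>carrier V. \<forall>y\<in>carrier V. f (x \<oplus>\<^bsub>V\<^esub> y) = f x \<oplus>\<^bsub>W\<^esub> f y) \<and>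
     (\<forall>c. \<forall>x\<in>carrier V. f (c \<odot>\<^bsub>V\<^esub> x) = c \<odot>\<^bsub>W\<^esub> f x)"

definition bilin :: "(complex, 'a) module \<Rightarrow> (complex, 'b) module \<Rightarrow> (complex, 'c) module \<Rightarrow>
    ('a \<Rightarrow> 'b \<Rightarrow> 'c) \<Rightarrow> bool" where
  "bilin V W Z b \<longleftrightarrow> (\<forall>y\<in>carrier W. lin V Z (\<lambda>x. b x y)) \<and> (\<forall>x\<in>carrier V. lin W Z (b x))"

text \<open>Spanning is phrased by subspaces instead of finite sums: \<open>spans_induct\<close> is
  then immediate, and every linearity argument becomes a submodule condition.\<close>

definition spans :: "(complex, 'a) module \<Rightarrow> 'a set \<Rightarrow> bool" where
  "spans V S \<longleftrightarrow> S \<subseteq> carrier V \<and> (\<forall>H. submodule H cplx V \<and> S \<subseteq> H \<longrightarrow> carrier V \<subseteq> H)"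

lemma linI:
  assumes "\<And>x. x \<in> carrier V \<Longrightarrow> f x \<in> carrier W"
    and "\<And>x y. x \<in> carrier V \<Longrightarrow> y \<in> carrier V \<Longrightarrow> f (x \<oplus>\<^bsub>V\<^esub> y) = f x \<oplus>\<^bsub>W\<^esub> f y"
    and "\<And>c x. x \<in> carrier V \<Longrightarrow> f (c \<odot>\<^bsub>V\<^esub> x) = c \<odot>\<^bsub>W\<^esub> f x"
  shows "lin V W f"
  using assms by (simp add: lin_def)

lemma lin_closed: "lin V W f \<Longrightarrow> x \<in> carrier V \<Longrightarrow> f x \<in> carrier W"
  by (simp add: lin_def)
lemma lin_add: "lin V W f \<Longrightarrow> x \<in> carrier V \<Longrightarrow> y \<in> carrier V \<Longrightarrow> f (x \<oplus>\<^bsub>V\<^esub> y) = f x \<oplus>\<^bsub>W\<^esub> f y"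
  by (simp add: lin_def)
lemma lin_smult: "lin V W f \<Longrightarrow> x \<in> carrier V \<Longrightarrow> f (c \<odot>\<^bsub>V\<^esub> x) = c \<odot>\<^bsub>W\<^esub> f x"
  by (simp add: lin_def)
lemma lin_zero: "lin V W f \<Longrightarrow> vs V \<Longrightarrow> vs W \<Longrightarrow> f \<zero>\<^bsub>V\<^esub> = \<zero>\<^bsub>W\<^esub>"
  using lin_smult[of V W f "\<zero>\<^bsub>V\<^esub>" 0] lin_closed[of V W f "\<zero>\<^bsub>V\<^esub>"] by simp
lemma lin_minus: "lin V W f \<Longrightarrow> vs V \<Longrightarrow> vs W \<Longrightarrow> x \<in> carrier V \<Longrightarrow> y \<in> carrier V \<Longrightarrow>
    f (x \<ominus>\<^bsub>V\<^esub> y) = f x \<ominus>\<^bsub>W\<^esub> f y"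
  by (simp add: vs_minus lin_closed lin_add lin_smult)
lemma lin_cong: "(\<And>x. x \<in> carrier V \<Longrightarrow> f x = g x) \<Longrightarrow> vs V \<Longrightarrow> lin V W f \<longleftrightarrow> lin V W g"
  by (simp add: lin_def)

lemma lin_id: "lin V V (\<lambda>x. x)"
  by (simp add: lin_def)
lemma lin_comp: "lin V W f \<Longrightarrow> lin W Z g \<Longrightarrow> lin V Z (\<lambda>x. g (f x))"
  by (simp add: lin_def)
lemma lin_add_fun: "vs W \<Longrightarrow> lin V W f \<Longrightarrow> lin V W g \<Longrightarrow> lin V W (\<lambda>x. f x \<oplus>\<^bsub>W\<^esub> g x)"
  by (auto simp: lin_def vs_a_assoc vs_a_comm vs_a_lcomm vs_smult_r_distr)
lemma lin_smult_fun: "vs W \<Longrightarrow> lin V W f \<Longrightarrow> lin V W (\<lambda>x. c \<odot>\<^bsub>W\<^esub> f x)"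
  by (auto simp: lin_def vs_smult_r_distr vs_smult_smult mult.commute)
lemma lin_zero_fun: "vs W \<Longrightarrow> lin V W (\<lambda>x. \<zero>\<^bsub>W\<^esub>)"
  by (auto simp: lin_def)
lemma lin_functional_smult: "vs W \<Longrightarrow> lin V cplx f \<Longrightarrow> w \<in> carrier W \<Longrightarrow> lin V W (\<lambda>x. f x \<odot>\<^bsub>W\<^esub> w)"
  by (auto simp: lin_def vs_smult_smult vs_smult_l_distr)

lemma submodule_equalizer:
  assumes "vs V" "vs W" "lin V W f" "lin V W g"
  shows "submodule {x \<in> carrier V. f x = g x} cplx V"
  using assms by (auto simp: submodule_vs_iff lin_add lin_smult lin_zero)

lemma submodule_vimage:
  assumes "vs V" "vs W" "lin V W f" "submodule H cplx W"
  shows "submodule {x \<in> carrier V. f x \<in> H} cplx V"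
  using assms by (auto simp: submodule_vs_iff lin_add lin_smult lin_zero)

lemma submodule_Int:
  assumes "vs V" "submodule H cplx V" "submodule K cplx V"
  shows "submodule (H \<inter> K) cplx V"
  using assms by (auto simp: submodule_vs_iff)

lemma submodule_carrier: "vs V \<Longrightarrow> submodule (carrier V) cplx V"
  by (simp add: submodule_vs_iff)

lemma submodule_Inter:
  assumes "vs V" "\<And>H. H \<in> F \<Longrightarrow> submodule H cplx V" "F \<noteq> {}"
  shows "submodule (\<Inter>F) cplx V"
  using assms unfolding submodule_vs_iff[OF assms(1)] by blast

lemma spans_subset: "spans V S \<Longrightarrow> S \<subseteq> carrier V" by (simp add: spans_def)

lemma spans_induct:
  assumes "spans V S" "submodule {x \<in> carrier V. P x} cplx V" "\<And>x. x \<in> S \<Longrightarrow> P x" "x \<in> carrier V"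
  shows "P x"
  using assms unfolding spans_def by blast

lemma spansI:
  assumes "S \<subseteq> carrier V" "\<And>H. submodule H cplx V \<Longrightarrow> S \<subseteq> H \<Longrightarrow> carrier V \<subseteq> H"
  shows "spans V S"
  using assms by (simp add: spans_def)

lemma lin_eq_on_span:
  assumes "spans V S" "vs V" "vs W" "lin V W f" "lin V W g" "\<And>x. x \<in> S \<Longrightarrow> f x = g x" "x \<in> carrier V"
  shows "f x = g x"
  by (rule spans_induct[OF assms(1) submodule_equalizer[OF assms(2-5)] assms(6) assms(7)])

lemma spans_image:
  assumes "spans V S" "vs V" "vs W" "lin V W f" "f ` carrier V = carrier W"
  shows "spans W (f ` S)"
proof (rule spansI)
  show "f ` S \<subseteq> carrier W" using assms spans_subset by blast
  fix H assume H: "submodule H cplx W" "f ` S \<subseteq> H"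
  have "f x \<in> H" if "x \<in> carrier V" for x
    by (rule spans_induct[OF assms(1) submodule_vimage[OF assms(2-4) H(1)] _ that]) (use H(2) in auto)
  then show "carrier W \<subseteq> H" unfolding assms(5)[symmetric] by auto
qed

lemma bilinI:
  assumes "\<And>y. y \<in> carrier W \<Longrightarrow> lin V Z (\<lambda>x. b x y)" "\<And>x. x \<in> carrier V \<Longrightarrow> lin W Z (b x)"
  shows "bilin V W Z b"
  using assms by (simp add: bilin_def)
lemma bilin_l: "bilin V W Z b \<Longrightarrow> y \<in> carrier W \<Longrightarrow> lin V Z (\<lambda>x. b x y)"
  by (simp add: bilin_def)
lemma bilin_r: "bilin V W Z b \<Longrightarrow> x \<in> carrier V \<Longrightarrow> lin W Z (b x)"
  by (simp add: bilin_def)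
lemma bilin_closed: "bilin V W Z b \<Longrightarrow> x \<in> carrier V \<Longrightarrow> y \<in> carrier W \<Longrightarrow> b x y \<in> carrier Z"
  by (simp add: bilin_def lin_def)
lemma bilin_lin_comp:
  assumes "bilin V W Z b" "lin V' V f" "lin W' W g"
  shows "bilin V' W' Z (\<lambda>x y. b (f x) (g y))"
  using assms by (simp add: bilin_def lin_def)
lemma bilin_swap: "bilin V W Z b \<Longrightarrow> bilin W V Z (\<lambda>y x. b x y)"
  by (simp add: bilin_def)

subsection \<open>Finite linear combinations\<close>

text \<open>The common form of \<open>free_ext\<close> and of the map under
  \<open>tensor_ext\<close>, so that linearity is proved once for both.\<close>

definition lincomb :: "(complex, 'a) module \<Rightarrow> ('i \<Rightarrow> 'a) \<Rightarrow> ('i \<Rightarrow>\<^sub>0 complex) \<Rightarrow> 'a" where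
  "lincomb V h p = (\<Oplus>\<^bsub>V\<^esub>i \<in> Poly_Mapping.keys p. Poly_Mapping.lookup p i \<odot>\<^bsub>V\<^esub> h i)"

lemma lookup_map_mult [simp]:
  "Poly_Mapping.lookup (Poly_Mapping.map ((*) c) p) k = (c::complex) * Poly_Mapping.lookup p k"
  by (simp add: map.rep_eq when_def)

lemma keys_map_mult: "Poly_Mapping.keys (Poly_Mapping.map ((*) (c::complex)) p) \<subseteq> Poly_Mapping.keys p"
  by (auto simp: in_keys_iff)

lemma map_mult_single [simp]:
  "Poly_Mapping.map ((*) (c::complex)) (Poly_Mapping.single k d) = Poly_Mapping.single k (c * d)"
  by simp

lemma free_space_simps [simp]:
  "carrier (free_space S) = {p. Poly_Mapping.keys p \<subseteq> S}" "\<zero>\<^bsub>free_space S\<^esub> = 0"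
  "p \<oplus>\<^bsub>free_space S\<^esub> r = p + r" "c \<odot>\<^bsub>free_space S\<^esub> p = Poly_Mapping.map ((*) c) p"
  by (simp_all add: free_space_def)

lemma vs_free_space [simp]: "vs (free_space S)"
proof (rule vsI)
  fix p r :: "'a \<Rightarrow>\<^sub>0 complex" assume "p \<in> carrier (free_space S)" "r \<in> carrier (free_space S)"
  then show "p \<oplus>\<^bsub>free_space S\<^esub> r \<in> carrier (free_space S)"
    using keys_add[of p r] by auto
next
  fix c and p :: "'a \<Rightarrow>\<^sub>0 complex" assume "p \<in> carrier (free_space S)"
  then show "c \<odot>\<^bsub>free_space S\<^esub> p \<in> carrier (free_space S)"
    using keys_map_mult[of c p] by auto
qed (auto simp: algebra_simps poly_mapping_eq_iff fun_eq_iff lookup_add)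

text \<open>Supports change under addition, so the sum over the support is not visibly additive;
  over a fixed finite set containing all supports it is.\<close>

lemma lincomb_superset:
  assumes "vs V" "finite A" "Poly_Mapping.keys p \<subseteq> A" "\<And>i. i \<in> A \<Longrightarrow> h i \<in> carrier V"
  shows "lincomb V h p = (\<Oplus>\<^bsub>V\<^esub>i \<in> A. Poly_Mapping.lookup p i \<odot>\<^bsub>V\<^esub> h i)"
proof -
  interpret abelian_monoid V by (rule vs_abelian_monoid[OF assms(1)])
  show ?thesis unfolding lincomb_def
    by (rule add.finprod_mono_neutral_cong_left)
      (use assms in \<open>auto simp: in_keys_iff\<close>)
qed

lemma finsum_smult:
  assumes "vs V" "finite A" "\<And>i. i \<in> A \<Longrightarrow> f i \<in> carrier V"
  shows "c \<odot>\<^bsub>V\<^esub> (\<Oplus>\<^bsub>V\<^esub>i\<in>A. f i) = (\<Oplus>\<^bsub>V\<^esub>i\<in>A. c \<odot>\<^bsub>V\<^esub> f i)"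
proof -
  interpret abelian_monoid V by (rule vs_abelian_monoid[OF assms(1)])
  show ?thesis using assms(2,3)
    by (induction A rule: finite_induct) (use assms(1) in \<open>auto simp: vs_smult_r_distr finsum_insert Pi_iff\<close>)
qed

lemma finsum_lin:
  assumes "vs V" "vs W" "lin V W f" "finite A" "\<And>i. i \<in> A \<Longrightarrow> g i \<in> carrier V"
  shows "f (\<Oplus>\<^bsub>V\<^esub>i\<in>A. g i) = (\<Oplus>\<^bsub>W\<^esub>i\<in>A. f (g i))"
proof -
  interpret V: abelian_monoid V by (rule vs_abelian_monoid[OF assms(1)])
  interpret W: abelian_monoid W by (rule vs_abelian_monoid[OF assms(2)])
  show ?thesis using assms(4,5)
    by (induction A rule: finite_induct)
      (use assms(1-3) in \<open>auto simp: lin_zero lin_add lin_closed Pi_iff\<close>)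
qed

lemma lin_lincomb:
  assumes V: "vs V" and h: "\<And>i. i \<in> S \<Longrightarrow> h i \<in> carrier V"
  shows "lin (free_space S) V (lincomb V h)"
proof (rule linI)
  interpret abelian_monoid V by (rule vs_abelian_monoid[OF V])
  fix p r assume p: "p \<in> carrier (free_space S)" and r: "r \<in> carrier (free_space S)"
  let ?A = "Poly_Mapping.keys p \<union> Poly_Mapping.keys r"
  have A: "finite ?A" "\<And>i. i \<in> ?A \<Longrightarrow> h i \<in> carrier V" using p r h by auto
  have "lincomb V h (p + r) = (\<Oplus>\<^bsub>V\<^esub>i\<in>?A. Poly_Mapping.lookup (p + r) i \<odot>\<^bsub>V\<^esub> h i)"
    by (rule lincomb_superset[OF V A(1) keys_add A(2)])
  also have "\<dots> = (\<Oplus>\<^bsub>V\<^esub>i\<in>?A. Poly_Mapping.lookup p i \<odot>\<^bsub>V\<^esub> h i \<oplus>\<^bsub>V\<^esub> Poly_Mapping.lookup r i \<odot>\<^bsub>V\<^esub> h i)"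
    by (rule finsum_cong') (use A V in \<open>auto simp: lookup_add vs_smult_l_distr\<close>)
  also have "\<dots> = lincomb V h p \<oplus>\<^bsub>V\<^esub> lincomb V h r"
    using lincomb_superset[of V ?A p h] lincomb_superset[of V ?A r h] A V
    by (subst finsum_addf) (auto simp: Pi_iff)
  finally show "lincomb V h (p \<oplus>\<^bsub>free_space S\<^esub> r) = lincomb V h p \<oplus>\<^bsub>V\<^esub> lincomb V h r" by simp
next
  interpret abelian_monoid V by (rule vs_abelian_monoid[OF V])
  fix c p assume p: "p \<in> carrier (free_space S)"
  have A: "\<And>i. i \<in> Poly_Mapping.keys p \<Longrightarrow> h i \<in> carrier V" using p h by auto
  show "lincomb V h (c \<odot>\<^bsub>free_space S\<^esub> p) = c \<odot>\<^bsub>V\<^esub> lincomb V h p"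
    unfolding lincomb_def[of V h p]
    using lincomb_superset[of V "Poly_Mapping.keys p" "Poly_Mapping.map ((*) c) p" h] A V keys_map_mult[of c p]
    by (subst finsum_smult[OF V]) (simp_all add: vs_smult_smult cong: finsum_cong)
next
  interpret abelian_monoid V by (rule vs_abelian_monoid[OF V])
  fix p assume "p \<in> carrier (free_space S)"
  then show "lincomb V h p \<in> carrier V"
    unfolding lincomb_def using h V by (intro finsum_closed) auto
qed

lemma lincomb_single [simp]:
  assumes V: "vs V" and h: "h i \<in> carrier V"
  shows "lincomb V h (Poly_Mapping.single i c) = c \<odot>\<^bsub>V\<^esub> h i"
proof -
  interpret abelian_monoid V by (rule vs_abelian_monoid[OF V])
  show ?thesis
    using assms by (subst lincomb_superset[of V "{i}"]) (auto split: if_splits)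
qed

lemma spans_free_space: "spans (free_space S) ((\<lambda>i. Poly_Mapping.single i 1) ` S)"
proof (rule spansI)
  show "(\<lambda>i. Poly_Mapping.single i 1) ` S \<subseteq> carrier (free_space S)" by auto
  fix H assume H: "submodule H cplx (free_space S)" "(\<lambda>i. Poly_Mapping.single i (1::complex)) ` S \<subseteq> H"
  have *: "Poly_Mapping.keys p \<subseteq> S \<longrightarrow> p \<in> H" for p :: "'a \<Rightarrow>\<^sub>0 complex"
  proof (induction p rule: update_induct)
    case const
    show ?case using H(1) by (auto simp: submodule_vs_iff)
  next
    case (update f a b)
    have "Poly_Mapping.update a b f = f + Poly_Mapping.map ((*) b) (Poly_Mapping.single a 1)"
      using update(1) by (auto simp: poly_mapping_eq_iff fun_eq_iff lookup_update lookup_add lookup_single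
          in_keys_iff when_def)
    moreover have "Poly_Mapping.keys (Poly_Mapping.update a b f) = insert a (Poly_Mapping.keys f)"
      using update(2) by (auto simp: keys_update)
    moreover have "\<And>p r. p \<in> H \<Longrightarrow> r \<in> H \<Longrightarrow> p + r \<in> H" "\<And>p c. p \<in> H \<Longrightarrow> Poly_Mapping.map ((*) c) p \<in> H"
      using H(1) by (auto simp: submodule_vs_iff)
    moreover have "a \<in> S \<Longrightarrow> Poly_Mapping.single a 1 \<in> H"
      using H(2) by auto
    ultimately show ?case using update(3) by (auto simp del: map_mult_single map_single)
  qed
  then show "carrier (free_space S) \<subseteq> H" by auto
qed

subsection \<open>Quotients\<close>

context
  fixes V :: "(complex, 'a) module" and N
  assumes V: "vs V" and N: "submodule N cplx V"
begin

interpretation N: abelian_subgroup N V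
  using abelian_subgroupI3[OF additive_subgroupI[OF submodule.axioms(1)[OF N]] vs_abelian_group[OF V]] .

lemma quot_simps:
  "carrier (quot V N) = (\<lambda>x. N +>\<^bsub>V\<^esub> x) ` carrier V" "\<zero>\<^bsub>quot V N\<^esub> = N"
  "x \<in> carrier V \<Longrightarrow> y \<in> carrier V \<Longrightarrow> (N +>\<^bsub>V\<^esub> x) \<oplus>\<^bsub>quot V N\<^esub> (N +>\<^bsub>V\<^esub> y) = N +>\<^bsub>V\<^esub> (x \<oplus>\<^bsub>V\<^esub> y)"
  by (auto simp: quot_def FactRing_def A_RCOSETS_def' N.a_rcos_sum)

lemma coset_iff: "x \<in> carrier V \<Longrightarrow> y \<in> N +>\<^bsub>V\<^esub> x \<longleftrightarrow> y \<in> carrier V \<and> y \<oplus>\<^bsub>V\<^esub> (-1) \<odot>\<^bsub>V\<^esub> x \<in> N"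
  using N.a_rcos_module[of x y] N.a_elemrcos_carrier[of x y] by (auto simp: vs_a_inv[OF V])

lemma coset_eq_iff: "x \<in> carrier V \<Longrightarrow> y \<in> carrier V \<Longrightarrow>
    N +>\<^bsub>V\<^esub> x = N +>\<^bsub>V\<^esub> y \<longleftrightarrow> x \<oplus>\<^bsub>V\<^esub> (-1) \<odot>\<^bsub>V\<^esub> y \<in> N"
  using N.a_repr_independence'[of x y] N.a_repr_independenceD[of x y] coset_iff by metis

lemma coset_mem: "x \<in> carrier V \<Longrightarrow> x \<in> N +>\<^bsub>V\<^esub> x"
  by (rule N.a_rcos_self)

lemma coset_zero_iff: "x \<in> carrier V \<Longrightarrow> N +>\<^bsub>V\<^esub> x = N \<longleftrightarrow> x \<in> N"
  using coset_mem N.a_rcos_const by blast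

text \<open>Scalar multiplication on \<open>quot\<close> and the action \<open>cyclic_act\<close>
  are unions over all representatives. Since f maps N into M, all these cosets coincide and the
  union is the coset of one representative.\<close>

lemma UN_coset:
  assumes W: "vs W" and f: "lin V W f" and M: "submodule M cplx W" and NM: "\<And>n. n \<in> N \<Longrightarrow> f n \<in> M"
    and x: "x \<in> carrier V"
  shows "(\<Union>y \<in> N +>\<^bsub>V\<^esub> x. M +>\<^bsub>W\<^esub> f y) = M +>\<^bsub>W\<^esub> f x"
proof -
  have "M +>\<^bsub>W\<^esub> f y = M +>\<^bsub>W\<^esub> f x" if y: "y \<in> N +>\<^bsub>V\<^esub> x" for y
  proof -
    interpret M: abelian_subgroup M W
      using abelian_subgroupI3[OF additive_subgroupI[OF submodule.axioms(1)[OF M]] vs_abelian_group[OF W]] .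
    have yc: "y \<in> carrier V" and "y \<oplus>\<^bsub>V\<^esub> (-1) \<odot>\<^bsub>V\<^esub> x \<in> N" using y x by (auto simp: coset_iff)
    then have "f y \<oplus>\<^bsub>W\<^esub> (-1) \<odot>\<^bsub>W\<^esub> f x \<in> M"
      using NM[of "y \<oplus>\<^bsub>V\<^esub> (-1) \<odot>\<^bsub>V\<^esub> x"] f x V by (simp add: lin_add lin_smult)
    then have "f y \<in> M +>\<^bsub>W\<^esub> f x"
      using M.a_rcos_module[of "f x" "f y"] lin_closed[OF f] x yc by (simp add: vs_a_inv[OF W])
    then show ?thesis using M.a_repr_independence'[of "f y" "f x"] lin_closed[OF f] x by simp
  qed
  then show ?thesis using coset_mem[OF x] by blast
qed

lemma quot_smult: "x \<in> carrier V \<Longrightarrow> c \<odot>\<^bsub>quot V N\<^esub> (N +>\<^bsub>V\<^esub> x) = N +>\<^bsub>V\<^esub> (c \<odot>\<^bsub>V\<^esub> x)"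
  using UN_coset[OF V lin_smult_fun[OF V lin_id] N] N by (simp add: quot_def submodule_vs_iff[OF V])

lemma vs_quot: "vs (quot V N)"
proof -
  have z: "\<zero>\<^bsub>quot V N\<^esub> = N +>\<^bsub>V\<^esub> \<zero>\<^bsub>V\<^esub>"
    using coset_zero_iff[of "\<zero>\<^bsub>V\<^esub>"] N by (auto simp: submodule_vs_iff[OF V] quot_simps V)
  show ?thesis
    by (rule vsI) (auto simp: V z quot_simps(1,3) quot_smult vs_a_assoc vs_smult_l_distr
        vs_smult_r_distr vs_smult_smult vs_a_comm vs_a_lcomm)
qed

lemma lin_coset: "lin V (quot V N) (\<lambda>x. N +>\<^bsub>V\<^esub> x)"
  by (rule linI) (auto simp: quot_simps quot_smult)

text \<open>f kills N, hence is constant on the class, and its image there is a singleton. All maps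
  out of quotients are evaluated in this way.\<close>

lemma the_elem_coset:
  assumes W: "vs W" and f: "lin V W f" and 0: "\<And>n. n \<in> N \<Longrightarrow> f n = \<zero>\<^bsub>W\<^esub>" and x: "x \<in> carrier V"
  shows "the_elem (f ` (N +>\<^bsub>V\<^esub> x)) = f x"
proof -
  have "f y = f x" if "y \<in> N +>\<^bsub>V\<^esub> x" for y
  proof -
    have yc: "y \<in> carrier V" and "y \<oplus>\<^bsub>V\<^esub> (-1) \<odot>\<^bsub>V\<^esub> x \<in> N" using that x by (auto simp: coset_iff)
    then have "f y \<oplus>\<^bsub>W\<^esub> (-1) \<odot>\<^bsub>W\<^esub> f x = \<zero>\<^bsub>W\<^esub>"
      using 0[of "y \<oplus>\<^bsub>V\<^esub> (-1) \<odot>\<^bsub>V\<^esub> x"] f x V by (simp add: lin_add lin_smult)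
    then show ?thesis using lin_closed[OF f] x yc by (simp add: vs_minus_eq_zero_iff[OF W])
  qed
  then have "f ` (N +>\<^bsub>V\<^esub> x) = {f x}" using coset_mem[OF x] by blast
  then show ?thesis by simp
qed

lemma lin_the_elem:
  assumes W: "vs W" and f: "lin V W f" and 0: "\<And>n. n \<in> N \<Longrightarrow> f n = \<zero>\<^bsub>W\<^esub>"
  shows "lin (quot V N) W (\<lambda>X. the_elem (f ` X))"
  by (rule linI) (auto simp: quot_simps quot_smult the_elem_coset[OF assms] V W
      lin_closed[OF f] lin_add[OF f] lin_smult[OF f])

lemma spans_quot:
  assumes "spans V S" shows "spans (quot V N) ((\<lambda>x. N +>\<^bsub>V\<^esub> x) ` S)"
  by (rule spans_image[OF assms V vs_quot lin_coset]) (simp add: quot_simps)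

end

section \<open>Algebras\<close>

context
  fixes A :: "(complex, 'a) module" (structure)
  assumes A: "calgebra A"
begin

lemma calgebra_ring: "ring A" using A by (simp add: calgebra_def)
lemma calgebra_vs: "vs A" using A by (simp add: calgebra_def)

interpretation ring A by (rule calgebra_ring)

lemma calg_mult_closed [simp, intro]: "x \<in> carrier A \<Longrightarrow> y \<in> carrier A \<Longrightarrow> x \<otimes> y \<in> carrier A" by simp
lemma calg_one_closed [simp, intro]: "\<one> \<in> carrier A" by simp
lemma calg_m_assoc: "x \<in> carrier A \<Longrightarrow> y \<in> carrier A \<Longrightarrow> z \<in> carrier A \<Longrightarrow> (x \<otimes> y) \<otimes> z = x \<otimes> (y \<otimes> z)"
  by (rule m_assoc)
lemma calg_l_one [simp]: "x \<in> carrier A \<Longrightarrow> \<one> \<otimes> x = x" by simp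
lemma calg_r_one [simp]: "x \<in> carrier A \<Longrightarrow> x \<otimes> \<one> = x" by simp
lemma calg_l_distr: "x \<in> carrier A \<Longrightarrow> y \<in> carrier A \<Longrightarrow> z \<in> carrier A \<Longrightarrow> (x \<oplus> y) \<otimes> z = x \<otimes> z \<oplus> y \<otimes> z"
  by (rule l_distr)
lemma calg_r_distr: "x \<in> carrier A \<Longrightarrow> y \<in> carrier A \<Longrightarrow> z \<in> carrier A \<Longrightarrow> z \<otimes> (x \<oplus> y) = z \<otimes> x \<oplus> z \<otimes> y"
  by (rule r_distr)
lemma calg_smult_l: "x \<in> carrier A \<Longrightarrow> y \<in> carrier A \<Longrightarrow> (c \<odot> x) \<otimes> y = c \<odot> (x \<otimes> y)"
  using A by (simp add: calgebra_def)
lemma calg_smult_r: "x \<in> carrier A \<Longrightarrow> y \<in> carrier A \<Longrightarrow> x \<otimes> (c \<odot> y) = c \<odot> (x \<otimes> y)"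
  using A by (simp add: calgebra_def)
lemma calg_l_null [simp]: "x \<in> carrier A \<Longrightarrow> \<zero> \<otimes> x = \<zero>" by simp
lemma calg_r_null [simp]: "x \<in> carrier A \<Longrightarrow> x \<otimes> \<zero> = \<zero>" by simp

lemma calg_bilin: "bilin A A A (\<lambda>x y. x \<otimes> y)"
  by (intro bilinI linI) (auto simp: l_distr r_distr calg_smult_l calg_smult_r)

end

lemmas calg_lin_l = bilin_l[OF calg_bilin]
lemmas calg_lin_r = bilin_r[OF calg_bilin]

lemma calgebraI:
  fixes A (structure)
  assumes V: "vs A" and b: "bilin A A A (\<lambda>x y. x \<otimes> y)" and 1: "\<one> \<in> carrier A"
    and assoc: "\<And>x y z. x \<in> carrier A \<Longrightarrow> y \<in> carrier A \<Longrightarrow> z \<in> carrier A \<Longrightarrow> (x \<otimes> y) \<otimes> z = x \<otimes> (y \<otimes> z)"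
    and "\<And>x. x \<in> carrier A \<Longrightarrow> \<one> \<otimes> x = x" "\<And>x. x \<in> carrier A \<Longrightarrow> x \<otimes> \<one> = x"
  shows "calgebra A"
proof -
  have "ring A"
  proof (rule ringI)
    show "abelian_group A" by (rule vs_abelian_group[OF V])
    show "Group.monoid A"
      by (rule monoidI) (use assms in \<open>auto simp: bilin_closed[OF b]\<close>)
  qed (auto simp: lin_add[OF bilin_l[OF b]] lin_add[OF bilin_r[OF b]])
  then show ?thesis
    using V by (auto simp: calgebra_def lin_smult[OF bilin_l[OF b]] lin_smult[OF bilin_r[OF b]])
qed

lemma calg_homI:
  assumes "lin A B h" "\<And>x y. x \<in> carrier A \<Longrightarrow> y \<in> carrier A \<Longrightarrow> h (x \<otimes>\<^bsub>A\<^esub> y) = h x \<otimes>\<^bsub>B\<^esub> h y"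
    "h \<one>\<^bsub>A\<^esub> = \<one>\<^bsub>B\<^esub>"
  shows "h \<in> calg_hom A B"
  using assms by (auto simp: calg_hom_def ring_hom_def lin_def)

lemma calg_hom_lin: "h \<in> calg_hom A B \<Longrightarrow> lin A B h"
  by (auto simp: calg_hom_def ring_hom_def lin_def)
lemma calg_hom_mult: "h \<in> calg_hom A B \<Longrightarrow> x \<in> carrier A \<Longrightarrow> y \<in> carrier A \<Longrightarrow> h (x \<otimes>\<^bsub>A\<^esub> y) = h x \<otimes>\<^bsub>B\<^esub> h y"
  by (auto simp: calg_hom_def ring_hom_def)
lemma calg_hom_one: "h \<in> calg_hom A B \<Longrightarrow> h \<one>\<^bsub>A\<^esub> = \<one>\<^bsub>B\<^esub>"
  by (auto simp: calg_hom_def ring_hom_def)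
lemma calg_hom_closed: "h \<in> calg_hom A B \<Longrightarrow> x \<in> carrier A \<Longrightarrow> h x \<in> carrier B"
  by (auto simp: calg_hom_def ring_hom_def)

lemma calg_hom_comp: "f \<in> calg_hom A B \<Longrightarrow> g \<in> calg_hom B C \<Longrightarrow> (\<lambda>x. g (f x)) \<in> calg_hom A C"
  by (rule calg_homI) (auto intro: lin_comp calg_hom_lin simp: calg_hom_mult calg_hom_one calg_hom_closed)

lemma calgebra_cplx: "calgebra cplx"
proof -
  interpret ring cplx using cring_cplx by (rule cring.axioms)
  have "vs cplx"
    by (rule moduleI[OF cring_cplx]) (auto simp: algebra_simps is_abelian_group)
  then show ?thesis by (auto simp: calgebra_def ring_axioms)
qed

lemma vs_cplx [simp]: "vs cplx" by (rule calgebra_vs[OF calgebra_cplx])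

text \<open>Associativity and the unit laws are pulled back from B along the injective map h. It
  serves for \<open>Pol\<close>, with B an algebra of operators.\<close>

lemma calgebra_inj:
  fixes A (structure)
  assumes V: "vs A" and b: "bilin A A A (\<lambda>x y. x \<otimes> y)" and 1: "\<one> \<in> carrier A" and B: "calgebra B"
    and h: "lin A B h" "inj_on h (carrier A)" "h \<one> = \<one>\<^bsub>B\<^esub>"
    "\<And>x y. x \<in> carrier A \<Longrightarrow> y \<in> carrier A \<Longrightarrow> h (x \<otimes> y) = h x \<otimes>\<^bsub>B\<^esub> h y"
  shows "calgebra A"
proof (rule calgebraI[OF V b 1])
  note [simp] = bilin_closed[OF b] h(3,4) lin_closed[OF h(1)] 1
  fix x y z assume [simp]: "x \<in> carrier A" "y \<in> carrier A" "z \<in> carrier A"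
  show "(x \<otimes> y) \<otimes> z = x \<otimes> (y \<otimes> z)"
    by (rule inj_onD[OF h(2)]) (simp_all add: calg_m_assoc[OF B])
next
  note [simp] = bilin_closed[OF b] h(3,4) lin_closed[OF h(1)] 1 B
  fix x assume [simp]: "x \<in> carrier A"
  show "\<one> \<otimes> x = x" by (rule inj_onD[OF h(2)]) simp_all
  show "x \<otimes> \<one> = x" by (rule inj_onD[OF h(2)]) simp_all
qed

subsection \<open>Opposite algebras and conjugate spaces\<close>

lemma opp_alg_simps [simp]:
  "carrier (opp_alg A) = carrier A" "\<zero>\<^bsub>opp_alg A\<^esub> = \<zero>\<^bsub>A\<^esub>" "\<one>\<^bsub>opp_alg A\<^esub> = \<one>\<^bsub>A\<^esub>"
  "x \<oplus>\<^bsub>opp_alg A\<^esub> y = x \<oplus>\<^bsub>A\<^esub> y" "c \<odot>\<^bsub>opp_alg A\<^esub> x = c \<odot>\<^bsub>A\<^esub> x" "x \<otimes>\<^bsub>opp_alg A\<^esub> y = y \<otimes>\<^bsub>A\<^esub> x"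
  by (simp_all add: opp_alg_def)

lemma conj_sp_simps [simp]:
  "carrier (conj_sp A) = carrier A" "\<zero>\<^bsub>conj_sp A\<^esub> = \<zero>\<^bsub>A\<^esub>" "\<one>\<^bsub>conj_sp A\<^esub> = \<one>\<^bsub>A\<^esub>"
  "x \<oplus>\<^bsub>conj_sp A\<^esub> y = x \<oplus>\<^bsub>A\<^esub> y" "c \<odot>\<^bsub>conj_sp A\<^esub> x = cnj c \<odot>\<^bsub>A\<^esub> x" "x \<otimes>\<^bsub>conj_sp A\<^esub> y = x \<otimes>\<^bsub>A\<^esub> y"
  by (simp_all add: conj_sp_def)

lemma lin_opp_alg [simp]: "lin (opp_alg A) B h = lin A B h" "lin A (opp_alg B) h = lin A B h"
  by (simp_all add: lin_def)

lemma vs_opp_alg [simp]: "vs A \<Longrightarrow> vs (opp_alg A)"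
  by (rule vsI) (auto simp: vs_a_assoc vs_a_comm vs_a_lcomm vs_smult_l_distr vs_smult_r_distr vs_smult_smult)

lemma vs_conj_sp [simp]: "vs A \<Longrightarrow> vs (conj_sp A)"
  by (rule vsI) (auto simp: vs_a_assoc vs_a_comm vs_a_lcomm vs_smult_l_distr vs_smult_r_distr vs_smult_smult)

lemma calgebra_opp_alg: "calgebra A \<Longrightarrow> calgebra (opp_alg A)"
  by (rule calgebraI) (auto simp: calgebra_vs calg_m_assoc intro!: bilinI calg_lin_l calg_lin_r)

lemma lin_conj_sp_conj_sp: "lin A B h \<Longrightarrow> lin (conj_sp A) (conj_sp B) h"
  by (simp add: lin_def)
lemma lin_conj_sp_comp: "lin A (conj_sp B) f \<Longrightarrow> lin B (conj_sp C) g \<Longrightarrow> lin A C (\<lambda>x. g (f x))"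
  by (simp add: lin_def)
lemma calgebra_conj_sp: "calgebra A \<Longrightarrow> calgebra (conj_sp A)"
  by (rule calgebraI)
    (auto simp: calgebra_vs calg_m_assoc intro!: bilinI lin_conj_sp_conj_sp calg_lin_l calg_lin_r)

subsection \<open>Operators on a function space\<close>

definition fun_sp :: "(complex, 'i \<Rightarrow> complex) module" where
  "fun_sp = \<lparr>carrier = UNIV, monoid.mult = undefined, one = undefined, ring.zero = (\<lambda>_. 0),
     add = (\<lambda>u v i. u i + v i), smult = (\<lambda>c u i. c * u i)\<rparr>"

text \<open>The target of representations: a homomorphism into this algebra makes
  \<open>fun_sp\<close> a module, and such homomorphisms come from the universal property of
  presented algebras.\<close>

definition op_alg :: "(complex, ('i \<Rightarrow> complex) \<Rightarrow> ('i \<Rightarrow> complex)) module" where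
  "op_alg = \<lparr>carrier = {f. lin fun_sp fun_sp f}, monoid.mult = (\<circ>), one = (\<lambda>u. u), ring.zero = (\<lambda>_ _. 0),
     add = (\<lambda>f g u i. f u i + g u i), smult = (\<lambda>c f u i. c * f u i)\<rparr>"

lemma fun_sp_simps [simp]:
  "carrier fun_sp = UNIV" "\<zero>\<^bsub>fun_sp\<^esub> = (\<lambda>_. 0)" "u \<oplus>\<^bsub>fun_sp\<^esub> v = (\<lambda>i. u i + v i)"
  "c \<odot>\<^bsub>fun_sp\<^esub> u = (\<lambda>i. c * u i)"
  by (simp_all add: fun_sp_def)

lemma op_alg_simps [simp]:
  "carrier op_alg = {f. lin fun_sp fun_sp f}" "\<zero>\<^bsub>op_alg\<^esub> = (\<lambda>_ _. 0)" "\<one>\<^bsub>op_alg\<^esub> = (\<lambda>u. u)"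
  "f \<oplus>\<^bsub>op_alg\<^esub> g = (\<lambda>u i. f u i + g u i)" "c \<odot>\<^bsub>op_alg\<^esub> f = (\<lambda>u i. c * f u i)" "f \<otimes>\<^bsub>op_alg\<^esub> g = (\<lambda>u. f (g u))"
  by (auto simp: op_alg_def)

lemma vs_fun_sp [simp]: "vs fun_sp"
  by (rule vsI) (auto simp: algebra_simps)

lemma calgebra_op_alg: "calgebra op_alg"
proof (rule calgebraI)
  show "vs (op_alg :: (complex, ('i \<Rightarrow> complex) \<Rightarrow> ('i \<Rightarrow> complex)) module)"
    by (rule vsI) (auto simp: lin_def algebra_simps)
qed (auto simp: lin_def bilin_def algebra_simps)

lemma vs_op_alg [simp]: "vs op_alg" by (rule calgebra_vs[OF calgebra_op_alg])

subsection \<open>Ideals and quotient algebras\<close>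

text \<open>Ring ideals are closed under scalars because c x = (c 1) x.\<close>

lemma ideal_submodule:
  assumes A: "calgebra A" and I: "ideal I A"
  shows "submodule I cplx A"
proof -
  interpret ideal I A by (rule I)
  note V = calgebra_vs[OF A]
  have "c \<odot>\<^bsub>A\<^esub> x \<in> I" if "x \<in> I" for c x
  proof -
    have x: "x \<in> carrier A" using a_Hcarr[OF that] .
    have "c \<odot>\<^bsub>A\<^esub> x = (c \<odot>\<^bsub>A\<^esub> \<one>\<^bsub>A\<^esub>) \<otimes>\<^bsub>A\<^esub> x" using x A V by (simp add: calg_smult_l)
    then show ?thesis using I_l_closed[OF that, of "c \<odot>\<^bsub>A\<^esub> \<one>\<^bsub>A\<^esub>"] A V by simp
  qed
  then show ?thesis
    using a_subset zero_closed by (auto simp: submodule_vs_iff[OF V] additive_subgroup.a_closed[OF is_additive_subgroup])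
qed

context
  fixes A :: "(complex, 'a) module" and I
  assumes A: "calgebra A" and I: "ideal I A"
begin

interpretation ideal I A by (rule I)

lemma quot_mult: "x \<in> carrier A \<Longrightarrow> y \<in> carrier A \<Longrightarrow> (I +>\<^bsub>A\<^esub> x) \<otimes>\<^bsub>quot A I\<^esub> (I +>\<^bsub>A\<^esub> y) = I +>\<^bsub>A\<^esub> (x \<otimes>\<^bsub>A\<^esub> y)"
  by (simp add: quot_def FactRing_def rcoset_mult_add)

lemma quot_one: "\<one>\<^bsub>quot A I\<^esub> = I +>\<^bsub>A\<^esub> \<one>\<^bsub>A\<^esub>"
  by (simp add: quot_def FactRing_def)

lemma calgebra_quot: "calgebra (quot A I)"
proof -
  note V = calgebra_vs[OF A] and S = ideal_submodule[OF A I]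
  note [simp] = quot_simps[OF V S] quot_mult quot_one A V quot_smult[OF V S]
  have b: "bilin (quot A I) (quot A I) (quot A I) (\<lambda>x y. x \<otimes>\<^bsub>quot A I\<^esub> y)"
    by (intro bilinI linI) (auto simp: calg_l_distr calg_r_distr calg_smult_l calg_smult_r)
  show ?thesis
    by (rule calgebraI[OF vs_quot[OF V S] b]) (auto simp: calg_m_assoc)
qed

lemma coset_calg_hom: "(\<lambda>x. I +>\<^bsub>A\<^esub> x) \<in> calg_hom A (quot A I)"
  by (rule calg_homI[OF lin_coset[OF calgebra_vs[OF A] ideal_submodule[OF A I]]])
    (auto simp: quot_mult quot_one)

end

subsection \<open>Free algebras and presentations\<close>

lemma free_alg_simps [simp]:
  "carrier free_alg = UNIV" "\<zero>\<^bsub>free_alg\<^esub> = 0" "\<one>\<^bsub>free_alg\<^esub> = 1" "p \<oplus>\<^bsub>free_alg\<^esub> r = p + r"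
  "p \<otimes>\<^bsub>free_alg\<^esub> r = p * r" "c \<odot>\<^bsub>free_alg\<^esub> p = Poly_Mapping.map ((*) c) p"
  by (simp_all add: free_alg_def)

lemma calgebra_free_alg: "calgebra free_alg"
proof (rule calgebraI)
  show "vs free_alg"
    by (rule vsI) (auto simp: algebra_simps poly_mapping_eq_iff fun_eq_iff lookup_add)
  have *: "Poly_Mapping.map ((*) c) (p * r) = p * Poly_Mapping.map ((*) c) r" for c and p r :: "'a free"
  proof -
    \<comment> \<open>Scalars are multiples of the empty word, which is the \<open>0\<close> of the
      monoid of words. They are central, so a scalar may be moved past the left factor.\<close>
    have "Poly_Mapping.single 0 c * p = p * Poly_Mapping.single 0 c"
    proof (rule poly_mapping_eqI)
      fix k :: "'a list"
      have "Sum_any (\<lambda>b. (c when b = 0) when k = a + b) = (c when k = a)" for a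
        by (subst when_commute) simp
      then show "Poly_Mapping.lookup (Poly_Mapping.single 0 c * p) k = Poly_Mapping.lookup (p * Poly_Mapping.single 0 c) k"
        by (simp add: lookup_mult lookup_single when_mult mult_when)
    qed
    then show ?thesis by (simp add: mult_map_scale_conv_mult flip: mult.assoc)
  qed
  show "bilin free_alg free_alg free_alg (\<lambda>x y. x \<otimes>\<^bsub>free_alg\<^esub> (y :: 'a free))"
    by (intro bilinI linI) (auto simp: distrib_left distrib_right *[symmetric], simp add: mult_map_scale_conv_mult mult.assoc)
qed (auto simp: mult.assoc)

lemma vs_free_alg [simp]: "vs free_alg" by (rule calgebra_vs[OF calgebra_free_alg])

lemma spans_free_alg: "spans free_alg (range (\<lambda>w. Poly_Mapping.single w 1))"
  using spans_free_space[of UNIV] unfolding spans_def by (simp add: submodule_vs_iff)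

lemma lin_free_space_UNIV: "lin (free_space UNIV) V f \<longleftrightarrow> lin free_alg V f"
  by (simp add: lin_def)

context
  fixes B :: "(complex, 'b) module" and g :: "'x \<Rightarrow> 'b"
  assumes B: "calgebra B" and g: "\<And>x. g x \<in> carrier B"
begin

private lemma word_closed: "foldr (\<lambda>x r. g x \<otimes>\<^bsub>B\<^esub> r) w \<one>\<^bsub>B\<^esub> \<in> carrier B"
  by (induction w) (auto simp: B g)

lemma lin_free_ext: "lin free_alg B (free_ext B g)"
proof -
  have "free_ext B g = lincomb B (\<lambda>w. foldr (\<lambda>x r. g x \<otimes>\<^bsub>B\<^esub> r) w \<one>\<^bsub>B\<^esub>)"
    by (rule ext) (simp add: free_ext_def lincomb_def)
  then show ?thesis
    using lin_lincomb[of B UNIV "\<lambda>w. foldr (\<lambda>x r. g x \<otimes>\<^bsub>B\<^esub> r) w \<one>\<^bsub>B\<^esub>"]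
    by (simp add: calgebra_vs[OF B] word_closed lin_free_space_UNIV)
qed

lemma free_ext_single: "free_ext B g (Poly_Mapping.single w c) = c \<odot>\<^bsub>B\<^esub> foldr (\<lambda>x r. g x \<otimes>\<^bsub>B\<^esub> r) w \<one>\<^bsub>B\<^esub>"
  using lincomb_single[of B "\<lambda>w. foldr (\<lambda>x r. g x \<otimes>\<^bsub>B\<^esub> r) w \<one>\<^bsub>B\<^esub>" w c]
  by (simp add: calgebra_vs[OF B] word_closed free_ext_def lincomb_def)

lemma free_ext_fgen: "free_ext B g (fgen x) = g x"
  by (simp add: free_ext_single B g calgebra_vs)

lemma free_ext_fconst: "free_ext B g (fconst c) = c \<odot>\<^bsub>B\<^esub> \<one>\<^bsub>B\<^esub>"
  by (simp add: free_ext_single)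

lemma free_ext_hom: "free_ext B g \<in> calg_hom free_alg B"
proof (rule calg_homI[OF lin_free_ext])
  note V = calgebra_vs[OF B]
  note [simp] = B V word_closed
  have one: "(1 :: 'x free) = Poly_Mapping.single [] 1"
    by (metis single_one zero_list_def)
  show "free_ext B g \<one>\<^bsub>free_alg\<^esub> = \<one>\<^bsub>B\<^esub>"
    by (simp add: one free_ext_single)
  have app: "foldr (\<lambda>x r. g x \<otimes>\<^bsub>B\<^esub> r) (w @ w') \<one>\<^bsub>B\<^esub> =
      foldr (\<lambda>x r. g x \<otimes>\<^bsub>B\<^esub> r) w \<one>\<^bsub>B\<^esub> \<otimes>\<^bsub>B\<^esub> foldr (\<lambda>x r. g x \<otimes>\<^bsub>B\<^esub> r) w' \<one>\<^bsub>B\<^esub>" for w w'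
    by (induction w) (simp_all add: calg_m_assoc[OF B] g)
  \<comment> \<open>Multiplicativity for a word on the left, by linearity in the right factor; the
    left factor is then freed by linearity as well.\<close>
  have *: "free_ext B g (Poly_Mapping.single w 1 * p) = free_ext B g (Poly_Mapping.single w 1) \<otimes>\<^bsub>B\<^esub> free_ext B g p" for w p
  proof (rule lin_eq_on_span[where f = "\<lambda>p. free_ext B g (Poly_Mapping.single w 1 * p)"
        and g = "\<lambda>p. free_ext B g (Poly_Mapping.single w 1) \<otimes>\<^bsub>B\<^esub> free_ext B g p", OF spans_free_alg vs_free_alg V])
    show "lin free_alg B (\<lambda>p. free_ext B g (Poly_Mapping.single w 1 * p))"
      using lin_comp[OF calg_lin_r[OF calgebra_free_alg, of "Poly_Mapping.single w 1"] lin_free_ext] by simp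
    show "lin free_alg B (\<lambda>p. free_ext B g (Poly_Mapping.single w 1) \<otimes>\<^bsub>B\<^esub> free_ext B g p)"
      by (rule lin_comp[OF lin_free_ext calg_lin_r[OF B]]) (simp add: lin_closed[OF lin_free_ext])
  qed (auto simp: mult_single free_ext_single plus_list_def app calg_smult_l[OF B] simp del: foldr_append)
  fix x y :: "'x free"
  have "free_ext B g (x * y) = free_ext B g x \<otimes>\<^bsub>B\<^esub> free_ext B g y"
  proof (rule lin_eq_on_span[where f = "\<lambda>x. free_ext B g (x * y)"
        and g = "\<lambda>x. free_ext B g x \<otimes>\<^bsub>B\<^esub> free_ext B g y", OF spans_free_alg vs_free_alg V])
    show "lin free_alg B (\<lambda>x. free_ext B g (x * y))"
      using lin_comp[OF calg_lin_l[OF calgebra_free_alg, of y] lin_free_ext] by simp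
    show "lin free_alg B (\<lambda>p. free_ext B g p \<otimes>\<^bsub>B\<^esub> free_ext B g y)"
      by (rule lin_comp[OF lin_free_ext calg_lin_l[OF B]]) (simp add: lin_closed[OF lin_free_ext])
  qed (auto simp: *)
  then show "free_ext B g (x \<otimes>\<^bsub>free_alg\<^esub> y) = free_ext B g x \<otimes>\<^bsub>B\<^esub> free_ext B g y" by simp
qed

end

lemma ideal_Idl_free: "ideal (Idl\<^bsub>free_alg\<^esub> rels) free_alg"
proof -
  interpret ring free_alg by (rule calgebra_ring[OF calgebra_free_alg])
  show ?thesis by (rule genideal_ideal) simp
qed

lemma calg_hom_kernel_ideal:
  assumes A: "calgebra A" and B: "calgebra B" and h: "h \<in> calg_hom A B"
  shows "ideal {x \<in> carrier A. h x = \<zero>\<^bsub>B\<^esub>} A"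
proof -
  note V = calgebra_vs[OF A] calgebra_vs[OF B]
  note [simp] = calg_hom_mult[OF h] calg_hom_closed[OF h] A B V
    lin_zero[OF calg_hom_lin[OF h] V] lin_add[OF calg_hom_lin[OF h]] lin_smult[OF calg_hom_lin[OF h]]
  have "submodule {x \<in> carrier A. h x = \<zero>\<^bsub>B\<^esub>} cplx A"
    by (auto simp: submodule_vs_iff)
  then show ?thesis
    by (intro idealI calgebra_ring[OF A]) (auto dest: submodule.axioms)
qed

lemma calgebra_presented_alg: "calgebra (presented_alg rels)"
  unfolding presented_alg_def by (rule calgebra_quot[OF calgebra_free_alg ideal_Idl_free])

definition pres_proj :: "'x free set \<Rightarrow> 'x free \<Rightarrow> 'x free set" where
  "pres_proj rels p = Idl\<^bsub>free_alg\<^esub> rels +>\<^bsub>free_alg\<^esub> p"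

lemma pres_proj_hom: "pres_proj rels \<in> calg_hom free_alg (presented_alg rels)"
  using coset_calg_hom[OF calgebra_free_alg ideal_Idl_free]
  unfolding presented_alg_def pres_proj_def[abs_def] .

lemma carrier_presented_alg: "carrier (presented_alg rels) = range (pres_proj rels)"
  unfolding presented_alg_def pres_proj_def[abs_def]
  by (simp add: quot_simps[OF vs_free_alg ideal_submodule[OF calgebra_free_alg ideal_Idl_free]])

lemma pgen_pres_proj: "pgen rels x = pres_proj rels (fgen x)"
  by (simp add: pgen_def pres_proj_def)

lemma pgen_closed [simp]: "pgen rels x \<in> carrier (presented_alg rels)"
  by (simp add: carrier_presented_alg pgen_pres_proj)

lemma pres_proj_rel:
  assumes "r \<in> rels" shows "pres_proj rels r = \<zero>\<^bsub>presented_alg rels\<^esub>"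
proof -
  interpret ring free_alg by (rule calgebra_ring[OF calgebra_free_alg])
  note S = ideal_submodule[OF calgebra_free_alg ideal_Idl_free[of rels]]
  have "r \<in> Idl\<^bsub>free_alg\<^esub> rels" using genideal_self[of rels] assms by auto
  then show ?thesis
    by (simp add: pres_proj_def presented_alg_def quot_simps(2)[OF vs_free_alg S] coset_zero_iff[OF vs_free_alg S])
qed

text \<open>Words grow on the left by one generator at a time. A linear statement about a presented
  algebra is thus reduced to the unit and to left multiplication by generators.\<close>

lemma presented_induct:
  assumes x: "x \<in> carrier (presented_alg rels)"
    and S: "submodule {x \<in> carrier (presented_alg rels). P x} cplx (presented_alg rels)"
    and 1: "P \<one>\<^bsub>presented_alg rels\<^esub>"
    and step: "\<And>g x. x \<in> carrier (presented_alg rels) \<Longrightarrow> P x \<Longrightarrow> P (pgen rels g \<otimes>\<^bsub>presented_alg rels\<^esub> x)"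
  shows "P x"
proof -
  note h = pres_proj_hom[of rels]
  have w: "P (pres_proj rels (Poly_Mapping.single w 1))" for w
  proof (induction w)
    case Nil
    have one: "(1 :: 'a free) = Poly_Mapping.single [] 1"
      by (metis single_one zero_list_def)
    show ?case using 1 calg_hom_one[OF h] by (simp add: one)
  next
    case (Cons g w)
    have "Poly_Mapping.single (g # w) (1::complex) = fgen g * Poly_Mapping.single w 1"
      by (simp add: mult_single plus_list_def)
    then show ?case
      using step[OF _ Cons, of g] calg_hom_mult[OF h, of "fgen g" "Poly_Mapping.single w 1"]
      by (simp add: pgen_pres_proj carrier_presented_alg)
  qed
  have "spans (presented_alg rels) (pres_proj rels ` range (\<lambda>w. Poly_Mapping.single w 1))"
    by (rule spans_image[OF spans_free_alg vs_free_alg calgebra_vs[OF calgebra_presented_alg] calg_hom_lin[OF h]])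
      (simp add: carrier_presented_alg)
  from spans_induct[OF this S _ x] w show ?thesis by auto
qed

context
  fixes B :: "(complex, 'b) module" and g :: "'x \<Rightarrow> 'b" and rels :: "'x free set"
  assumes B: "calgebra B" and g: "\<And>x. g x \<in> carrier B"
    and rels: "\<And>r. r \<in> rels \<Longrightarrow> free_ext B g r = \<zero>\<^bsub>B\<^esub>"
begin

text \<open>The kernel of the homomorphism \<open>free_ext B g\<close> is an ideal containing the
  relations, hence contains the ideal they generate.\<close>

lemma presented_ext_pres_proj: "presented_ext B g (pres_proj rels p) = free_ext B g p"
proof -
  interpret ring free_alg by (rule calgebra_ring[OF calgebra_free_alg])
  have "Idl\<^bsub>free_alg\<^esub> rels \<subseteq> {x \<in> carrier free_alg. free_ext B g x = \<zero>\<^bsub>B\<^esub>}"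
    by (rule genideal_minimal[OF calg_hom_kernel_ideal[OF calgebra_free_alg B free_ext_hom[OF B g]]])
      (use rels in auto)
  then show ?thesis unfolding presented_ext_def pres_proj_def
    by (intro the_elem_coset[OF vs_free_alg ideal_submodule[OF calgebra_free_alg ideal_Idl_free] calgebra_vs[OF B] lin_free_ext[OF B g]])
      auto
qed

lemma presented_ext_pgen: "presented_ext B g (pgen rels x) = g x"
  by (simp add: pgen_pres_proj presented_ext_pres_proj free_ext_fgen[OF B g])

lemma presented_ext_hom: "presented_ext B g \<in> calg_hom (presented_alg rels) B"
proof (rule calg_homI)
  note h = pres_proj_hom[of rels] and f = free_ext_hom[OF B g]
  show "presented_ext B g \<one>\<^bsub>presented_alg rels\<^esub> = \<one>\<^bsub>B\<^esub>"
    using calg_hom_one[OF h] calg_hom_one[OF f] presented_ext_pres_proj[of 1] by simp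
  show "lin (presented_alg rels) B (presented_ext B g)"
    by (rule linI)
      (auto simp: carrier_presented_alg presented_ext_pres_proj calg_hom_closed[OF f]
        lin_add[OF calg_hom_lin[OF h], symmetric] lin_smult[OF calg_hom_lin[OF h], symmetric]
        lin_add[OF calg_hom_lin[OF f], simplified] lin_smult[OF calg_hom_lin[OF f], simplified]
        simp del: free_alg_simps(4,6), simp_all add: presented_ext_pres_proj
        lin_add[OF calg_hom_lin[OF f], simplified] lin_smult[OF calg_hom_lin[OF f], simplified])
  fix x y assume "x \<in> carrier (presented_alg rels)" "y \<in> carrier (presented_alg rels)"
  then obtain p r where "x = pres_proj rels p" "y = pres_proj rels r" by (auto simp: carrier_presented_alg)
  then show "presented_ext B g (x \<otimes>\<^bsub>presented_alg rels\<^esub> y) = presented_ext B g x \<otimes>\<^bsub>B\<^esub> presented_ext B g y"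
    using calg_hom_mult[OF h, of p r] calg_hom_mult[OF f, of p r] presented_ext_pres_proj[of "p * r"]
    by (simp add: presented_ext_pres_proj)
qed

end

lemma presented_hom_eqI:
  assumes B: "calgebra B" and f: "f \<in> calg_hom (presented_alg rels) B" and g: "g \<in> calg_hom (presented_alg rels) B"
    and eq: "\<And>x. f (pgen rels x) = g (pgen rels x)" and x: "x \<in> carrier (presented_alg rels)"
  shows "f x = g x"
  by (rule presented_induct[OF x submodule_equalizer[OF calgebra_vs[OF calgebra_presented_alg] calgebra_vs[OF B]
        calg_hom_lin[OF f] calg_hom_lin[OF g]]])
    (simp_all add: calg_hom_one[OF f] calg_hom_one[OF g] calg_hom_mult[OF f] calg_hom_mult[OF g] eq)

section \<open>Tensor products\<close>

lemma map_mult_minus_one [simp]: "Poly_Mapping.map ((*) (-1::complex)) p = - p"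
  by (rule poly_mapping_eqI) simp

context
  fixes V :: "(complex, 'a) module" and W :: "(complex, 'b) module"
  assumes V: "vs V" and W: "vs W"
begin

private abbreviation "FS \<equiv> free_space (carrier V \<times> carrier W)"

private lemma rels_subset: "bilin_rels V W \<subseteq> carrier FS"
  by (auto simp: bilin_rels_def in_keys_iff lookup_minus lookup_single when_def V W split: if_splits)

private lemma null_submodule: "submodule (bilin_null V W) cplx FS"
  unfolding bilin_null_def subspace_gen_def
  using rels_subset submodule_carrier[OF vs_free_space]
  by (intro submodule_Inter[OF vs_free_space]) auto

private lemma null_rels: "bilin_rels V W \<subseteq> bilin_null V W"
  unfolding bilin_null_def subspace_gen_def by auto

private lemma null_least: "submodule H cplx FS \<Longrightarrow> bilin_rels V W \<subseteq> H \<Longrightarrow> bilin_null V W \<subseteq> H"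
  unfolding bilin_null_def subspace_gen_def by auto

lemma vs_tensor [simp]: "vs (tensor V W)"
  unfolding tensor_def by (rule vs_quot[OF vs_free_space null_submodule])

lemma bilin_ptens: "bilin V W (tensor V W) (ptens V W)"
proof -
  note [simp] = quot_simps[OF vs_free_space null_submodule] quot_smult[OF vs_free_space null_submodule]
     coset_eq_iff[OF vs_free_space null_submodule]
  have inN: "p \<in> bilin_rels V W \<Longrightarrow> p \<in> bilin_null V W" for p using null_rels by auto
  show ?thesis
  proof (intro bilinI linI)
    fix x y assume [simp]: "x \<in> carrier V" "y \<in> carrier W"
    show "ptens V W x y \<in> carrier (tensor V W)" by (simp add: ptens_def tensor_def)
    fix c :: complex
    show "ptens V W (c \<odot>\<^bsub>V\<^esub> x) y = c \<odot>\<^bsub>tensor V W\<^esub> ptens V W x y"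
      by (simp add: ptens_def tensor_def V W)
        (rule inN, unfold bilin_rels_def, rule UnI1, rule UnI2,
          intro CollectI exI[of _ c] exI[of _ x] exI[of _ y] conjI, simp_all add: single_uminus)
    show "ptens V W x (c \<odot>\<^bsub>W\<^esub> y) = c \<odot>\<^bsub>tensor V W\<^esub> ptens V W x y"
      by (simp add: ptens_def tensor_def V W)
        (rule inN, unfold bilin_rels_def, rule UnI2,
          intro CollectI exI[of _ c] exI[of _ x] exI[of _ y] conjI, simp_all add: single_uminus)
  next
    fix x x' y assume [simp]: "x \<in> carrier V" "x' \<in> carrier V" "y \<in> carrier W"
    have k: "Poly_Mapping.keys (Poly_Mapping.single (x, y) (1::complex) + Poly_Mapping.single (x', y) 1) \<subseteq> carrier V \<times> carrier W"
      using keys_add[of "Poly_Mapping.single (x, y) (1::complex)" "Poly_Mapping.single (x', y) 1"] by auto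
    show "ptens V W (x \<oplus>\<^bsub>V\<^esub> x') y = ptens V W x y \<oplus>\<^bsub>tensor V W\<^esub> ptens V W x' y"
      using k by (simp add: ptens_def tensor_def V W)
        (rule inN, unfold bilin_rels_def, rule UnI1, rule UnI1, rule UnI1,
          intro CollectI exI[of _ x] exI[of _ x'] exI[of _ y] conjI, simp_all)
  next
    fix x y y' assume [simp]: "x \<in> carrier V" "y \<in> carrier W" "y' \<in> carrier W"
    have k: "Poly_Mapping.keys (Poly_Mapping.single (x, y) (1::complex) + Poly_Mapping.single (x, y') 1) \<subseteq> carrier V \<times> carrier W"
      using keys_add[of "Poly_Mapping.single (x, y) (1::complex)" "Poly_Mapping.single (x, y') 1"] by auto
    show "ptens V W x (y \<oplus>\<^bsub>W\<^esub> y') = ptens V W x y \<oplus>\<^bsub>tensor V W\<^esub> ptens V W x y'"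
      using k by (simp add: ptens_def tensor_def V W)
        (rule inN, unfold bilin_rels_def, rule UnI1, rule UnI1, rule UnI2,
          intro CollectI exI[of _ x] exI[of _ y] exI[of _ y'] conjI, simp_all)
  qed (simp add: ptens_def tensor_def)
qed

lemma ptens_closed [simp, intro]: "x \<in> carrier V \<Longrightarrow> y \<in> carrier W \<Longrightarrow> ptens V W x y \<in> carrier (tensor V W)"
  by (rule bilin_closed[OF bilin_ptens])

lemmas ptens_add_l = lin_add[OF bilin_l[OF bilin_ptens]]
lemmas ptens_add_r = lin_add[OF bilin_r[OF bilin_ptens]]
lemmas ptens_smult_l = lin_smult[OF bilin_l[OF bilin_ptens]]
lemmas ptens_smult_r = lin_smult[OF bilin_r[OF bilin_ptens]]

lemma spans_tensor: "spans (tensor V W) {ptens V W x y | x y. x \<in> carrier V \<and> y \<in> carrier W}"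
proof -
  have "{ptens V W x y | x y. x \<in> carrier V \<and> y \<in> carrier W} =
      (\<lambda>x. bilin_null V W +>\<^bsub>FS\<^esub> x) ` (\<lambda>i. Poly_Mapping.single i 1) ` (carrier V \<times> carrier W)"
    by (auto simp: ptens_def)
  then show ?thesis
    unfolding tensor_def using spans_quot[OF vs_free_space null_submodule spans_free_space] by simp
qed

lemma tensor_induct:
  assumes "X \<in> carrier (tensor V W)"
    and "submodule {X \<in> carrier (tensor V W). P X} cplx (tensor V W)"
    and "\<And>x y. x \<in> carrier V \<Longrightarrow> y \<in> carrier W \<Longrightarrow> P (ptens V W x y)"
  shows "P X"
  by (rule spans_induct[OF spans_tensor assms(2) _ assms(1)]) (use assms(3) in auto)

lemma lin_eq_on_tensor:
  assumes "vs Z" "lin (tensor V W) Z f" "lin (tensor V W) Z g"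
    and "\<And>x y. x \<in> carrier V \<Longrightarrow> y \<in> carrier W \<Longrightarrow> f (ptens V W x y) = g (ptens V W x y)"
    and "X \<in> carrier (tensor V W)"
  shows "f X = g X"
  by (rule lin_eq_on_span[OF spans_tensor vs_tensor assms(1-3) _ assms(5)]) (use assms(4) in auto)

context
  fixes Z :: "(complex, 'c) module" and b
  assumes Z: "vs Z" and b: "bilin V W Z b"
begin

private abbreviation "L \<equiv> lincomb Z (\<lambda>xy. b (fst xy) (snd xy))"

private lemma lin_L: "lin FS Z L"
  by (rule lin_lincomb[OF Z]) (auto simp: bilin_closed[OF b])

private lemma L_single: "x \<in> carrier V \<Longrightarrow> y \<in> carrier W \<Longrightarrow> L (Poly_Mapping.single (x, y) c) = c \<odot>\<^bsub>Z\<^esub> b x y"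
  using lincomb_single[OF Z, of "\<lambda>xy. b (fst xy) (snd xy)"] by (simp add: bilin_closed[OF b])

private lemma L_diff: "p \<in> carrier FS \<Longrightarrow> r \<in> carrier FS \<Longrightarrow> L (p - r) = L p \<oplus>\<^bsub>Z\<^esub> (-1) \<odot>\<^bsub>Z\<^esub> L r"
proof -
  assume p: "p \<in> carrier FS" "r \<in> carrier FS"
  have "p - r = p \<oplus>\<^bsub>FS\<^esub> (-1) \<odot>\<^bsub>FS\<^esub> r" by simp
  then show ?thesis
    using lin_add[OF lin_L p(1) vs_smult_closed[OF vs_free_space p(2), of "-1"]] lin_smult[OF lin_L p(2), of "-1"]
    by simp
qed

private lemma L_null: "n \<in> bilin_null V W \<Longrightarrow> L n = \<zero>\<^bsub>Z\<^esub>"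
proof -
  note [simp] = vs_minus_self[OF Z] bilin_closed[OF b] V W Z
  have k: "Poly_Mapping.keys (p - r) \<subseteq> A" if "Poly_Mapping.keys p \<subseteq> A" "Poly_Mapping.keys r \<subseteq> A"
    for p r :: "'a \<times> 'b \<Rightarrow>\<^sub>0 complex" and A
    using keys_diff[of p r] that by blast
  have c: "(z \<oplus>\<^bsub>Z\<^esub> w) \<oplus>\<^bsub>Z\<^esub> (-1) \<odot>\<^bsub>Z\<^esub> z \<oplus>\<^bsub>Z\<^esub> (-1) \<odot>\<^bsub>Z\<^esub> w = \<zero>\<^bsub>Z\<^esub>" if "z \<in> carrier Z" "w \<in> carrier Z" for z w
  proof -
    have "(z \<oplus>\<^bsub>Z\<^esub> w) \<oplus>\<^bsub>Z\<^esub> (-1) \<odot>\<^bsub>Z\<^esub> z \<oplus>\<^bsub>Z\<^esub> (-1) \<odot>\<^bsub>Z\<^esub> w = (z \<oplus>\<^bsub>Z\<^esub> w) \<oplus>\<^bsub>Z\<^esub> (-1) \<odot>\<^bsub>Z\<^esub> (z \<oplus>\<^bsub>Z\<^esub> w)"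
      using that by (simp add: vs_smult_r_distr vs_a_assoc)
    then show ?thesis using that by simp
  qed
  have "bilin_rels V W \<subseteq> {x \<in> carrier FS. L x = \<zero>\<^bsub>Z\<^esub>}"
  proof
    fix p assume p: "p \<in> bilin_rels V W"
    have "L p = \<zero>\<^bsub>Z\<^esub>"
      using p unfolding bilin_rels_def
      by (auto simp: L_diff k L_single lin_add[OF bilin_l[OF b]] lin_add[OF bilin_r[OF b]]
        lin_smult[OF bilin_l[OF b]] lin_smult[OF bilin_r[OF b]] c)
    then show "p \<in> {x \<in> carrier FS. L x = \<zero>\<^bsub>Z\<^esub>}" using p rels_subset by auto
  qed
  from null_least[OF submodule_equalizer[OF vs_free_space Z lin_L lin_zero_fun[OF Z]] this]
  show "n \<in> bilin_null V W \<Longrightarrow> L n = \<zero>\<^bsub>Z\<^esub>" by auto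
qed

private lemma tensor_ext_alt: "tensor_ext Z b = (\<lambda>X. the_elem (L ` X))"
  by (simp add: tensor_ext_def lincomb_def fun_eq_iff)

lemma lin_tensor_ext: "lin (tensor V W) Z (tensor_ext Z b)"
  unfolding tensor_ext_alt tensor_def
  by (rule lin_the_elem[OF vs_free_space null_submodule Z lin_L L_null])

lemma tensor_ext_ptens: "x \<in> carrier V \<Longrightarrow> y \<in> carrier W \<Longrightarrow> tensor_ext Z b (ptens V W x y) = b x y"
  unfolding tensor_ext_alt ptens_def
  by (subst the_elem_coset[OF vs_free_space null_submodule Z lin_L L_null])
    (auto simp: L_single Z bilin_closed[OF b])

end

text \<open>Here the tensor X is fixed and the bilinear map varies with p. The tensors for which the
  dependence on p is linear form a subspace that contains the pure ones. This is what makes one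
  \<open>tensor_ext\<close> nested in another bilinear.\<close>

lemma lin_tensor_ext_param:
  assumes Z: "vs Z" and P: "vs P" and "\<And>x y. x \<in> carrier V \<Longrightarrow> y \<in> carrier W \<Longrightarrow> lin P Z (\<lambda>p. b p x y)"
    and b: "\<And>p. p \<in> carrier P \<Longrightarrow> bilin V W Z (b p)" and X: "X \<in> carrier (tensor V W)"
  shows "lin P Z (\<lambda>p. tensor_ext Z (b p) X)"
proof (rule tensor_induct[OF X])
  note [simp] = lin_add[OF lin_tensor_ext[OF Z b]] lin_smult[OF lin_tensor_ext[OF Z b]] lin_zero[OF lin_tensor_ext[OF Z b]]
  have "lin P Z (\<lambda>p. tensor_ext Z (b p) (X \<oplus>\<^bsub>tensor V W\<^esub> Y))"
    if "X \<in> carrier (tensor V W)" "lin P Z (\<lambda>p. tensor_ext Z (b p) X)"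
      "Y \<in> carrier (tensor V W)" "lin P Z (\<lambda>p. tensor_ext Z (b p) Y)" for X Y
    using lin_add_fun[OF Z that(2,4)] by (subst lin_cong[OF _ P]) (use that P Z in auto)
  moreover have "lin P Z (\<lambda>p. tensor_ext Z (b p) (c \<odot>\<^bsub>tensor V W\<^esub> X))"
    if "X \<in> carrier (tensor V W)" "lin P Z (\<lambda>p. tensor_ext Z (b p) X)" for X c
    using lin_smult_fun[OF Z that(2), of c] by (subst lin_cong[OF _ P]) (use that P Z in auto)
  moreover have "lin P Z (\<lambda>p. tensor_ext Z (b p) \<zero>\<^bsub>tensor V W\<^esub>)"
    using lin_zero_fun[OF Z] by (subst lin_cong[OF _ P]) (use P Z in auto)
  ultimately show "submodule {X \<in> carrier (tensor V W). lin P Z (\<lambda>p. tensor_ext Z (b p) X)} cplx (tensor V W)"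
    by (auto simp: submodule_vs_iff)
next
  fix x y assume "x \<in> carrier V" "y \<in> carrier W"
  then show "lin P Z (\<lambda>p. tensor_ext Z (b p) (ptens V W x y))"
    using assms by (subst lin_cong[OF _ P]) (auto simp: tensor_ext_ptens)
qed

end

context
  fixes V :: "(complex, 'a) module" and W :: "(complex, 'b) module"
    and V' :: "(complex, 'c) module" and W' :: "(complex, 'd) module"
    and Z :: "(complex, 'e) module" and f
  assumes V: "vs V" and W: "vs W" and V': "vs V'" and W': "vs W'" and Z: "vs Z"
    and f1: "\<And>x' y'. x' \<in> carrier V' \<Longrightarrow> y' \<in> carrier W' \<Longrightarrow> bilin V W Z (\<lambda>x y. f x y x' y')"
    and f2: "\<And>x y. x \<in> carrier V \<Longrightarrow> y \<in> carrier W \<Longrightarrow> bilin V' W' Z (f x y)"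
begin

private lemma inner_bilin: "Y \<in> carrier (tensor V' W') \<Longrightarrow> bilin V W Z (\<lambda>x y. tensor_ext Z (f x y) Y)"
proof (rule bilinI)
  fix y assume "Y \<in> carrier (tensor V' W')" "y \<in> carrier W"
  then show "lin V Z (\<lambda>x. tensor_ext Z (f x y) Y)"
    by (intro lin_tensor_ext_param[OF V' W' Z V]) (auto intro: f2 bilin_l[OF f1])
next
  fix x assume "Y \<in> carrier (tensor V' W')" "x \<in> carrier V"
  then show "lin W Z (\<lambda>y. tensor_ext Z (f x y) Y)"
    by (intro lin_tensor_ext_param[OF V' W' Z W]) (auto intro: f2 bilin_r[OF f1])
qed

text \<open>The common pattern of the products of \<open>tensor_alg\<close> and \<open>Pol\<close>
  and of the action on a tensor product.\<close>

lemma bilin_tensor_ext2: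
  "bilin (tensor V W) (tensor V' W') Z (\<lambda>X Y. tensor_ext Z (\<lambda>x y. tensor_ext Z (f x y) Y) X)"
proof (rule bilinI)
  fix Y assume "Y \<in> carrier (tensor V' W')"
  then show "lin (tensor V W) Z (\<lambda>X. tensor_ext Z (\<lambda>x y. tensor_ext Z (f x y) Y) X)"
    by (intro lin_tensor_ext[OF V W Z] inner_bilin)
next
  fix X assume "X \<in> carrier (tensor V W)"
  then show "lin (tensor V' W') Z (\<lambda>Y. tensor_ext Z (\<lambda>x y. tensor_ext Z (f x y) Y) X)"
    using V' W' by (intro lin_tensor_ext_param[OF V W Z]) (auto intro: inner_bilin lin_tensor_ext[OF V' W' Z f2])
qed

lemma tensor_ext2_ptens:
  assumes "x \<in> carrier V" "y \<in> carrier W" "x' \<in> carrier V'" "y' \<in> carrier W'"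
  shows "tensor_ext Z (\<lambda>x y. tensor_ext Z (f x y) (ptens V' W' x' y')) (ptens V W x y) = f x y x' y'"
  using assms
  by (subst tensor_ext_ptens[OF V W Z inner_bilin]) (auto simp: V' W' tensor_ext_ptens[OF V' W' Z f2])

end

lemma bilin_flip: "vs V \<Longrightarrow> vs W \<Longrightarrow> bilin V W (tensor W V) (\<lambda>x y. ptens W V y x)"
  by (rule bilin_swap[OF bilin_ptens])

lemma lin_tensor_flip: "vs V \<Longrightarrow> vs W \<Longrightarrow> lin (tensor V W) (tensor W V) (tensor_flip V W)"
  unfolding tensor_flip_def by (intro lin_tensor_ext bilin_flip) auto

lemma tensor_flip_ptens:
  "vs V \<Longrightarrow> vs W \<Longrightarrow> x \<in> carrier V \<Longrightarrow> y \<in> carrier W \<Longrightarrow> tensor_flip V W (ptens V W x y) = ptens W V y x"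
  unfolding tensor_flip_def by (subst tensor_ext_ptens[OF _ _ _ bilin_flip]) auto

subsection \<open>Tensor products of algebras\<close>

lemma tensor_alg_simps [simp]:
  "carrier (tensor_alg A B) = carrier (tensor A B)" "\<zero>\<^bsub>tensor_alg A B\<^esub> = \<zero>\<^bsub>tensor A B\<^esub>"
  "X \<oplus>\<^bsub>tensor_alg A B\<^esub> Y = X \<oplus>\<^bsub>tensor A B\<^esub> Y" "c \<odot>\<^bsub>tensor_alg A B\<^esub> X = c \<odot>\<^bsub>tensor A B\<^esub> X"
  "\<one>\<^bsub>tensor_alg A B\<^esub> = ptens A B \<one>\<^bsub>A\<^esub> \<one>\<^bsub>B\<^esub>"
  by (simp_all add: tensor_alg_def)

lemma lin_tensor_alg_dom [simp]: "lin (tensor_alg A B) Z h = lin (tensor A B) Z h"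
  by (simp add: lin_def)

lemma lin_tensor_alg_cod [simp]: "lin Z (tensor_alg A B) h = lin Z (tensor A B) h"
  by (simp add: lin_def)

context
  fixes A :: "(complex, 'a) module" and B :: "(complex, 'b) module"
  assumes A: "calgebra A" and B: "calgebra B"
begin

private lemma VA: "vs A" and VB: "vs B"
  using A B by (auto intro: calgebra_vs)

private lemma mult_multilinear:
  "x' \<in> carrier A \<Longrightarrow> y' \<in> carrier B \<Longrightarrow> bilin A B (tensor A B) (\<lambda>x y. ptens A B (x \<otimes>\<^bsub>A\<^esub> x') (y \<otimes>\<^bsub>B\<^esub> y'))"
  "x \<in> carrier A \<Longrightarrow> y \<in> carrier B \<Longrightarrow> bilin A B (tensor A B) (\<lambda>x' y'. ptens A B (x \<otimes>\<^bsub>A\<^esub> x') (y \<otimes>\<^bsub>B\<^esub> y'))"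
  by (auto intro!: bilin_lin_comp[OF bilin_ptens[OF VA VB]] calg_lin_l[OF A] calg_lin_r[OF A] calg_lin_l[OF B] calg_lin_r[OF B])

lemma bilin_tensor_alg_mult: "bilin (tensor A B) (tensor A B) (tensor A B) (\<lambda>X Y. X \<otimes>\<^bsub>tensor_alg A B\<^esub> Y)"
  using bilin_tensor_ext2[OF VA VB VA VB vs_tensor[OF VA VB] mult_multilinear] by (simp add: tensor_alg_def)

lemma tensor_alg_mult_ptens:
  "x \<in> carrier A \<Longrightarrow> y \<in> carrier B \<Longrightarrow> x' \<in> carrier A \<Longrightarrow> y' \<in> carrier B \<Longrightarrow>
    ptens A B x y \<otimes>\<^bsub>tensor_alg A B\<^esub> ptens A B x' y' = ptens A B (x \<otimes>\<^bsub>A\<^esub> x') (y \<otimes>\<^bsub>B\<^esub> y')"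
  using tensor_ext2_ptens[OF VA VB VA VB vs_tensor[OF VA VB] mult_multilinear] by (simp add: tensor_alg_def)

lemma calgebra_tensor_alg: "calgebra (tensor_alg A B)"
proof (rule calgebraI)
  note VT = vs_tensor[OF VA VB]
  note [simp] = VA VB VT A B tensor_alg_mult_ptens bilin_closed[OF bilin_tensor_alg_mult]
  note l = bilin_l[OF bilin_tensor_alg_mult] and r = bilin_r[OF bilin_tensor_alg_mult]
  show "vs (tensor_alg A B)"
    by (rule vsI) (auto simp: vs_a_assoc vs_a_comm vs_a_lcomm vs_smult_l_distr vs_smult_r_distr vs_smult_smult)
  show "bilin (tensor_alg A B) (tensor_alg A B) (tensor_alg A B) (\<lambda>X Y. X \<otimes>\<^bsub>tensor_alg A B\<^esub> Y)"
    using bilin_tensor_alg_mult by (simp add: bilin_def)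
  show "\<one>\<^bsub>tensor_alg A B\<^esub> \<in> carrier (tensor_alg A B)" by simp
  let ?m = "\<lambda>X Y. X \<otimes>\<^bsub>tensor_alg A B\<^esub> Y"
  fix X assume X: "X \<in> carrier (tensor_alg A B)"
  show "\<one>\<^bsub>tensor_alg A B\<^esub> \<otimes>\<^bsub>tensor_alg A B\<^esub> X = X"
    by (rule lin_eq_on_tensor[where f = "?m \<one>\<^bsub>tensor_alg A B\<^esub>" and g = "\<lambda>X. X", OF VA VB VT r lin_id]) (use X in auto)
  show "X \<otimes>\<^bsub>tensor_alg A B\<^esub> \<one>\<^bsub>tensor_alg A B\<^esub> = X"
    by (rule lin_eq_on_tensor[where f = "\<lambda>X. ?m X \<one>\<^bsub>tensor_alg A B\<^esub>" and g = "\<lambda>X. X", OF VA VB VT l lin_id]) (use X in auto)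
  fix Y Z assume Y: "Y \<in> carrier (tensor_alg A B)" and Z: "Z \<in> carrier (tensor_alg A B)"
  have 1: "?m (?m (ptens A B x y) (ptens A B x' y')) Z = ?m (ptens A B x y) (?m (ptens A B x' y') Z)"
    if [simp]: "x \<in> carrier A" "y \<in> carrier B" "x' \<in> carrier A" "y' \<in> carrier B" for x y x' y'
    by (rule lin_eq_on_tensor[where f = "?m (?m (ptens A B x y) (ptens A B x' y'))"
          and g = "\<lambda>Z. ?m (ptens A B x y) (?m (ptens A B x' y') Z)", OF VA VB VT r lin_comp[OF r r]])
      (use Z in \<open>auto simp: calg_m_assoc\<close>)
  have 2: "?m (?m (ptens A B x y) Y) Z = ?m (ptens A B x y) (?m Y Z)"
    if [simp]: "x \<in> carrier A" "y \<in> carrier B" for x y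
    by (rule lin_eq_on_tensor[where f = "\<lambda>Y. ?m (?m (ptens A B x y) Y) Z"
          and g = "\<lambda>Y. ?m (ptens A B x y) (?m Y Z)", OF VA VB VT lin_comp[OF r l] lin_comp[OF l r]])
      (use Y Z 1 in auto)
  show "?m (?m X Y) Z = ?m X (?m Y Z)"
    by (rule lin_eq_on_tensor[where f = "\<lambda>X. ?m (?m X Y) Z"
          and g = "\<lambda>X. ?m X (?m Y Z)", OF VA VB VT lin_comp[OF l l] l])
      (use X Y Z 2 in auto)
qed

end

lemma tensor_flip_hom:
  assumes A: "calgebra A" and B: "calgebra B"
  shows "tensor_flip A B \<in> calg_hom (tensor_alg A B) (tensor_alg B A)"
proof (rule calg_homI)
  note VA = calgebra_vs[OF A] and VB = calgebra_vs[OF B]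
  note VT = vs_tensor[OF VA VB] and VT' = vs_tensor[OF VB VA]
  note l = bilin_l[OF bilin_tensor_alg_mult] and r = bilin_r[OF bilin_tensor_alg_mult]
  note F = lin_tensor_flip[OF VA VB]
  note [simp] = VA VB VT A B tensor_alg_mult_ptens bilin_closed[OF bilin_tensor_alg_mult] tensor_flip_ptens lin_closed[OF F]
  show "lin (tensor_alg A B) (tensor_alg B A) (tensor_flip A B)" using F by simp
  show "tensor_flip A B \<one>\<^bsub>tensor_alg A B\<^esub> = \<one>\<^bsub>tensor_alg B A\<^esub>" by simp
  fix X Y assume X: "X \<in> carrier (tensor_alg A B)" and Y: "Y \<in> carrier (tensor_alg A B)"
  have 1: "tensor_flip A B (ptens A B x y \<otimes>\<^bsub>tensor_alg A B\<^esub> Y) = ptens B A y x \<otimes>\<^bsub>tensor_alg B A\<^esub> tensor_flip A B Y"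
    if [simp]: "x \<in> carrier A" "y \<in> carrier B" for x y
    by (rule lin_eq_on_tensor[where f = "\<lambda>Y. tensor_flip A B (ptens A B x y \<otimes>\<^bsub>tensor_alg A B\<^esub> Y)"
          and g = "\<lambda>Y. ptens B A y x \<otimes>\<^bsub>tensor_alg B A\<^esub> tensor_flip A B Y",
          OF VA VB VT' lin_comp[OF r[OF A B] F] lin_comp[OF F r[OF B A]]]) (use Y in auto)
  show "tensor_flip A B (X \<otimes>\<^bsub>tensor_alg A B\<^esub> Y) = tensor_flip A B X \<otimes>\<^bsub>tensor_alg B A\<^esub> tensor_flip A B Y"
    by (rule lin_eq_on_tensor[where f = "\<lambda>X. tensor_flip A B (X \<otimes>\<^bsub>tensor_alg A B\<^esub> Y)"
          and g = "\<lambda>X. tensor_flip A B X \<otimes>\<^bsub>tensor_alg B A\<^esub> tensor_flip A B Y",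
          OF VA VB VT' lin_comp[OF l[OF A B] F] lin_comp[OF F l[OF B A]]]) (use X Y 1 in auto)
qed

subsection \<open>Bases\<close>

text \<open>Independence is encoded by a linear coordinate map c that is dual to b; in every
  application c comes from an explicit model, so it is carried along as data.\<close>

definition basis :: "(complex, 'a) module \<Rightarrow> ('i \<Rightarrow> 'a) \<Rightarrow> ('a \<Rightarrow> 'i \<Rightarrow> complex) \<Rightarrow> bool" where
  "basis V b c \<longleftrightarrow> vs V \<and> spans V (range b) \<and> lin V fun_sp c \<and> (\<forall>i. c (b i) = (\<lambda>j. if j = i then 1 else 0))"

definition lin_ext :: "(complex, 'b) module \<Rightarrow> ('a \<Rightarrow> 'i \<Rightarrow> complex) \<Rightarrow> ('i \<Rightarrow> 'b) \<Rightarrow> 'a \<Rightarrow> 'b" where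
  "lin_ext W c h v = lincomb W h (Abs_poly_mapping (c v))"

context
  fixes V :: "(complex, 'a) module" and b :: "'i \<Rightarrow> 'a" and c
  assumes b: "basis V b c"
begin

lemma basis_vs: "vs V" and basis_spans: "spans V (range b)" and basis_lin: "lin V fun_sp c"
  and basis_coord: "c (b i) = (\<lambda>j. if j = i then 1 else 0)"
  using b by (auto simp: basis_def)

lemma basis_closed: "b i \<in> carrier V"
  using spans_subset[OF basis_spans] by auto

lemma basis_induct:
  assumes "v \<in> carrier V" "submodule {v \<in> carrier V. P v} cplx V" "\<And>i. P (b i)"
  shows "P v"
  by (rule spans_induct[OF basis_spans assms(2) _ assms(1)]) (use assms(3) in auto)

lemma basis_lin_eqI:
  assumes "vs W" "lin V W f" "lin V W g" "\<And>i. f (b i) = g (b i)" "v \<in> carrier V"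
  shows "f v = g v"
  by (rule lin_eq_on_span[OF basis_spans basis_vs assms(1-3) _ assms(5)]) (use assms(4) in auto)

lemma basis_finite: "v \<in> carrier V \<Longrightarrow> finite {i. c v i \<noteq> 0}"
proof (erule basis_induct)
  have "finite {i. u i + v i \<noteq> (0::complex)}" if "finite {i. u i \<noteq> 0}" "finite {i. v i \<noteq> 0}" for u v :: "'i \<Rightarrow> complex"
    by (rule finite_subset[OF _ finite_UnI[OF that]]) auto
  moreover have "finite {i. k * v i \<noteq> (0::complex)}" if "finite {i. v i \<noteq> 0}" for v :: "'i \<Rightarrow> complex" and k
    by (rule finite_subset[OF _ that]) auto
  ultimately show "submodule {v \<in> carrier V. finite {i. c v i \<noteq> 0}} cplx V"
    using basis_vs by (auto simp: submodule_vs_iff lin_add[OF basis_lin] lin_smult[OF basis_lin] lin_zero[OF basis_lin])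
qed (simp add: basis_coord)

lemma lin_lin_ext:
  assumes W: "vs W" and h: "\<And>i. h i \<in> carrier W"
  shows "lin V W (lin_ext W c h)"
proof -
  have "lin V (free_space UNIV) (\<lambda>v. Abs_poly_mapping (c v))"
  proof (rule linI)
    note [simp] = basis_vs lookup_Abs_poly_mapping[OF basis_finite]
    fix v w k assume [simp]: "v \<in> carrier V" "w \<in> carrier V"
    show "Abs_poly_mapping (c (v \<oplus>\<^bsub>V\<^esub> w)) = Abs_poly_mapping (c v) \<oplus>\<^bsub>free_space UNIV\<^esub> Abs_poly_mapping (c w)"
      by (rule poly_mapping_eqI) (simp add: lookup_add, simp add: lin_add[OF basis_lin])
    show "Abs_poly_mapping (c (k \<odot>\<^bsub>V\<^esub> v)) = k \<odot>\<^bsub>free_space UNIV\<^esub> Abs_poly_mapping (c v)"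
      by (rule poly_mapping_eqI) (simp, simp add: lin_smult[OF basis_lin])
  qed simp
  then show ?thesis
    unfolding lin_ext_def[abs_def] by (rule lin_comp) (simp add: lin_lincomb W h)
qed

lemma lin_ext_basis:
  assumes W: "vs W" and h: "h i \<in> carrier W"
  shows "lin_ext W c h (b i) = h i"
proof -
  have "Abs_poly_mapping (c (b i)) = Poly_Mapping.single i 1"
    by (rule poly_mapping_eqI) (simp add: basis_coord lookup_single when_def)
  then show ?thesis using assms by (simp add: lin_ext_def)
qed

text \<open>Rebuilding a vector from its coordinates, \<open>lin_ext V c b\<close>, is the identity
  because it is so on the basis vectors.\<close>

lemma basis_inj:
  assumes v: "v \<in> carrier V" "w \<in> carrier V" and eq: "c v = c w"
  shows "v = w"
proof -
  have "lin_ext V c b v = v" if "v \<in> carrier V" for v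
    by (rule basis_lin_eqI[where f = "lin_ext V c b" and g = "\<lambda>v. v", OF basis_vs lin_lin_ext[OF basis_vs basis_closed] lin_id _ that])
      (simp add: lin_ext_basis basis_vs basis_closed)
  then show ?thesis using v eq unfolding lin_ext_def by metis
qed

end

text \<open>Products of coordinates are bilinear and so descend to the tensor product, where they
  separate the pure tensors of basis vectors.\<close>

lemma basis_tensor:
  assumes b: "basis V b c" and b': "basis W b' c'"
  shows "basis (tensor V W) (\<lambda>(i, j). ptens V W (b i) (b' j)) (tensor_ext fun_sp (\<lambda>v w (i, j). c v i * c' w j))"
    (is "basis ?T ?b ?c")
proof -
  note V = basis_vs[OF b] and W = basis_vs[OF b']
  note [simp] = V W basis_closed[OF b] basis_closed[OF b']
  have bil: "bilin V W fun_sp (\<lambda>v w (i, j). c v i * c' w j)"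
    by (intro bilinI linI)
      (auto simp: lin_add[OF basis_lin[OF b]] lin_add[OF basis_lin[OF b']] lin_smult[OF basis_lin[OF b]]
        lin_smult[OF basis_lin[OF b']] algebra_simps fun_eq_iff)
  have "spans ?T (range ?b)"
  proof (rule spansI)
    fix H assume H: "submodule H cplx ?T" "range ?b \<subseteq> H"
    have 1: "ptens V W (b i) w \<in> H" if w: "w \<in> carrier W" for i w
      by (rule basis_induct[OF b' w submodule_vimage[OF W vs_tensor[OF V W] bilin_r[OF bilin_ptens[OF V W]] H(1)]])
        (use H(2) in \<open>auto simp: image_subset_iff\<close>)
    have 2: "ptens V W v w \<in> H" if v: "v \<in> carrier V" and w: "w \<in> carrier W" for v w
      by (rule basis_induct[OF b v submodule_vimage[OF V vs_tensor[OF V W] bilin_l[OF bilin_ptens[OF V W] w] H(1)] 1[OF w]])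
    show "carrier ?T \<subseteq> H"
      using 2 spans_tensor[OF V W] H(1) unfolding spans_def by (auto simp: subset_iff)
  qed auto
  then show ?thesis
    unfolding basis_def
    by (auto simp: lin_tensor_ext[OF V W vs_fun_sp bil] tensor_ext_ptens[OF V W vs_fun_sp bil]
        basis_coord[OF b] basis_coord[OF b'] fun_eq_iff)
qed

section \<open>Modules over an algebra\<close>

lemma left_moduleI:
  assumes "vs V" "bilin U V V act"
    and "\<And>\<xi> \<eta> v. \<xi> \<in> carrier U \<Longrightarrow> \<eta> \<in> carrier U \<Longrightarrow> v \<in> carrier V \<Longrightarrow> act (\<xi> \<otimes>\<^bsub>U\<^esub> \<eta>) v = act \<xi> (act \<eta> v)"
    and "\<And>v. v \<in> carrier V \<Longrightarrow> act \<one>\<^bsub>U\<^esub> v = v"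
  shows "left_module U V act"
  using assms unfolding left_module_def bilin_def lin_def by blast

lemma left_module_vs: "left_module U V act \<Longrightarrow> vs V"
  by (simp add: left_module_def)
lemma left_module_bilin: "left_module U V act \<Longrightarrow> bilin U V V act"
  unfolding left_module_def bilin_def lin_def by blast
lemma left_module_mult: "left_module U V act \<Longrightarrow> \<xi> \<in> carrier U \<Longrightarrow> \<eta> \<in> carrier U \<Longrightarrow> v \<in> carrier V \<Longrightarrow>
    act (\<xi> \<otimes>\<^bsub>U\<^esub> \<eta>) v = act \<xi> (act \<eta> v)"
  by (simp add: left_module_def)
lemma left_module_one: "left_module U V act \<Longrightarrow> v \<in> carrier V \<Longrightarrow> act \<one>\<^bsub>U\<^esub> v = v"
  by (simp add: left_module_def)

lemmas left_module_lin_l = bilin_l[OF left_module_bilin]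
lemmas left_module_lin_r = bilin_r[OF left_module_bilin]
lemmas left_module_closed = bilin_closed[OF left_module_bilin]

lemma left_module_comp:
  assumes "h \<in> calg_hom U U'" "left_module U' V act"
  shows "left_module U V (\<lambda>\<xi>. act (h \<xi>))"
  using assms
  by (intro left_moduleI bilin_lin_comp[OF left_module_bilin[OF assms(2)] calg_hom_lin[OF assms(1)] lin_id])
    (auto simp: left_module_vs left_module_mult left_module_one calg_hom_mult calg_hom_one calg_hom_closed)

lemma left_module_conj_sp:
  "left_module U V act \<Longrightarrow> left_module (conj_sp U) (conj_sp V) act"
  by (rule left_moduleI)
    (auto simp: left_module_vs left_module_mult left_module_one
      intro!: bilinI lin_conj_sp_conj_sp left_module_lin_l left_module_lin_r)

lemma left_module_hom: "h \<in> calg_hom U op_alg \<Longrightarrow> left_module U fun_sp h"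
  by (rule left_moduleI)
    (auto simp: calg_hom_mult calg_hom_one lin_def bilin_def lin_add[OF calg_hom_lin] lin_smult[OF calg_hom_lin]
      dest: calg_hom_closed)

text \<open>The action of the whole tensor product algebra, from which \<open>tensor_act\<close>
  arises by inserting D. Module axioms can be checked on pure tensors here, whereas values of D need
  not be pure.\<close>

definition tens_act ::
    "(complex, 'v) module \<Rightarrow> ('u \<Rightarrow> 'v \<Rightarrow> 'v) \<Rightarrow> (complex, 'w) module \<Rightarrow> ('u' \<Rightarrow> 'w \<Rightarrow> 'w) \<Rightarrow>
     ('u, 'u') tens \<Rightarrow> ('v, 'w) tens \<Rightarrow> ('v, 'w) tens" where
  "tens_act V actV W actW X t = tensor_ext (tensor V W) (\<lambda>\<xi> \<eta>.
      tensor_ext (tensor V W) (\<lambda>v w. ptens V W (actV \<xi> v) (actW \<eta> w)) t) X"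

lemma tensor_act_tens_act: "tensor_act D V actV W actW \<xi> = tens_act V actV W actW (D \<xi>)"
  by (simp add: tensor_act_def tens_act_def fun_eq_iff)

lemma left_module_tensor:
  assumes V: "left_module U V actV" and W: "left_module U' W actW" and U: "calgebra U" and U': "calgebra U'"
  shows "left_module (tensor_alg U U') (tensor V W) (tens_act V actV W actW)"
    and "\<And>\<xi> \<eta> v w. \<xi> \<in> carrier U \<Longrightarrow> \<eta> \<in> carrier U' \<Longrightarrow> v \<in> carrier V \<Longrightarrow> w \<in> carrier W \<Longrightarrow>
      tens_act V actV W actW (ptens U U' \<xi> \<eta>) (ptens V W v w) = ptens V W (actV \<xi> v) (actW \<eta> w)"
proof -
  note VV = left_module_vs[OF V] and VW = left_module_vs[OF W] and VU = calgebra_vs[OF U] and VU' = calgebra_vs[OF U']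
  note VT = vs_tensor[OF VV VW]
  let ?A = "tensor_alg U U'" and ?T = "tensor V W" and ?act = "tens_act V actV W actW"
  have ml: "v \<in> carrier V \<Longrightarrow> w \<in> carrier W \<Longrightarrow> bilin U U' ?T (\<lambda>\<xi> \<eta>. ptens V W (actV \<xi> v) (actW \<eta> w))"
    "\<xi> \<in> carrier U \<Longrightarrow> \<eta> \<in> carrier U' \<Longrightarrow> bilin V W ?T (\<lambda>v w. ptens V W (actV \<xi> v) (actW \<eta> w))" for v w \<xi> \<eta>
    by (auto intro!: bilin_lin_comp[OF bilin_ptens[OF VV VW]] left_module_lin_l[OF V] left_module_lin_r[OF V]
        left_module_lin_l[OF W] left_module_lin_r[OF W])
  note b = bilin_tensor_ext2[OF VU VU' VV VW VT ml, folded tens_act_def]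
  note e = tensor_ext2_ptens[OF VU VU' VV VW VT ml, folded tens_act_def]
  show "\<And>\<xi> \<eta> v w. \<xi> \<in> carrier U \<Longrightarrow> \<eta> \<in> carrier U' \<Longrightarrow> v \<in> carrier V \<Longrightarrow> w \<in> carrier W \<Longrightarrow>
      ?act (ptens U U' \<xi> \<eta>) (ptens V W v w) = ptens V W (actV \<xi> v) (actW \<eta> w)"
    by (rule e)
  note [simp] = VV VW VU VU' VT U U' left_module_closed[OF V] left_module_closed[OF W] tensor_alg_mult_ptens[OF U U']
    bilin_closed[OF bilin_tensor_alg_mult[OF U U']] bilin_closed[OF b] e
  note l = bilin_l[OF b] and r = bilin_r[OF b]
  note ml = bilin_l[OF bilin_tensor_alg_mult[OF U U']] and mr = bilin_r[OF bilin_tensor_alg_mult[OF U U']]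
  let ?m = "\<lambda>X Y. X \<otimes>\<^bsub>?A\<^esub> Y"
  show "left_module ?A ?T ?act"
  proof (rule left_moduleI[OF VT])
    show "bilin ?A ?T ?T ?act" using b by (simp add: bilin_def)
    fix t assume t: "t \<in> carrier ?T"
    show "?act \<one>\<^bsub>?A\<^esub> t = t"
      by (rule lin_eq_on_tensor[where f = "?act \<one>\<^bsub>?A\<^esub>" and g = "\<lambda>t. t", OF VV VW VT r lin_id _ t])
        (simp_all add: left_module_one[OF V] left_module_one[OF W])
    fix X Y assume X: "X \<in> carrier ?A" and Y: "Y \<in> carrier ?A"
    have 1: "?act (?m (ptens U U' \<xi> \<eta>) (ptens U U' \<xi>' \<eta>')) t = ?act (ptens U U' \<xi> \<eta>) (?act (ptens U U' \<xi>' \<eta>') t)"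
      if [simp]: "\<xi> \<in> carrier U" "\<eta> \<in> carrier U'" "\<xi>' \<in> carrier U" "\<eta>' \<in> carrier U'" for \<xi> \<eta> \<xi>' \<eta>'
      by (rule lin_eq_on_tensor[where f = "?act (?m (ptens U U' \<xi> \<eta>) (ptens U U' \<xi>' \<eta>'))"
            and g = "\<lambda>t. ?act (ptens U U' \<xi> \<eta>) (?act (ptens U U' \<xi>' \<eta>') t)", OF VV VW VT r lin_comp[OF r r] _ t])
        (simp_all add: left_module_mult[OF V] left_module_mult[OF W])
    have 2: "?act (?m (ptens U U' \<xi> \<eta>) Y) t = ?act (ptens U U' \<xi> \<eta>) (?act Y t)"
      if [simp]: "\<xi> \<in> carrier U" "\<eta> \<in> carrier U'" for \<xi> \<eta>
      by (rule lin_eq_on_tensor[where f = "\<lambda>Y. ?act (?m (ptens U U' \<xi> \<eta>) Y) t"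
            and g = "\<lambda>Y. ?act (ptens U U' \<xi> \<eta>) (?act Y t)", OF VU VU' VT lin_comp[OF mr l] lin_comp[OF l r]])
        (use Y t 1 in auto)
    show "?act (?m X Y) t = ?act X (?act Y t)"
      by (rule lin_eq_on_tensor[where f = "\<lambda>X. ?act (?m X Y) t"
            and g = "\<lambda>X. ?act X (?act Y t)", OF VU VU' VT lin_comp[OF ml l] l])
        (use X Y t 2 in auto)
  qed
qed

lemma left_module_tensor_act:
  assumes "left_module U V actV" "left_module U W actW" "calgebra U" "D \<in> calg_hom U (tensor_alg U U)"
  shows "left_module U (tensor V W) (tensor_act D V actV W actW)"
  using left_module_comp[OF assms(4) left_module_tensor(1)[OF assms(1,2,3,3)]]
  unfolding tensor_act_tens_act[abs_def] .

subsection \<open>Cyclic modules\<close>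

context
  fixes U :: "(complex, 'u) module" and S
  assumes U: "calgebra U" and S: "S \<subseteq> carrier U"
begin

private abbreviation "LI \<equiv> left_ideal_gen U S"

private lemma carrier_left_ideal: "additive_subgroup (carrier U) U"
  by (rule additive_subgroupI, rule group.group_incl_imp_subgroup)
    (use vs_abelian_group[OF calgebra_vs[OF U]] in
      \<open>auto intro!: abelian_group.a_group group.group_incl_imp_subgroup\<close>)

private lemma LI_subset: "S \<subseteq> LI" and LI_mult: "a \<in> carrier U \<Longrightarrow> x \<in> LI \<Longrightarrow> a \<otimes>\<^bsub>U\<^esub> x \<in> LI"
  unfolding left_ideal_gen_def by auto

private lemma LI_carrier: "LI \<subseteq> carrier U"
  unfolding left_ideal_gen_def using carrier_left_ideal S U by (intro Inter_lower) auto

private lemma LI_least: "submodule J cplx U \<Longrightarrow> (\<And>a x. a \<in> carrier U \<Longrightarrow> x \<in> J \<Longrightarrow> a \<otimes>\<^bsub>U\<^esub> x \<in> J) \<Longrightarrow> S \<subseteq> J \<Longrightarrow> LI \<subseteq> J"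
  unfolding left_ideal_gen_def using submodule.axioms(1)[of J cplx U]
  by (intro Inter_lower) (auto intro: additive_subgroupI)

private lemma LI_submodule: "submodule LI cplx U"
proof -
  note V = calgebra_vs[OF U]
  have "c \<odot>\<^bsub>U\<^esub> x \<in> LI" if "x \<in> LI" for c x
  proof -
    have "x \<in> carrier U" using that LI_carrier by auto
    then have "(c \<odot>\<^bsub>U\<^esub> \<one>\<^bsub>U\<^esub>) \<otimes>\<^bsub>U\<^esub> x = c \<odot>\<^bsub>U\<^esub> x" using U V by (simp add: calg_smult_l)
    then show ?thesis using LI_mult[OF _ that, of "c \<odot>\<^bsub>U\<^esub> \<one>\<^bsub>U\<^esub>"] U V by simp
  qed
  moreover have "\<zero>\<^bsub>U\<^esub> \<in> LI" "\<And>x y. x \<in> LI \<Longrightarrow> y \<in> LI \<Longrightarrow> x \<oplus>\<^bsub>U\<^esub> y \<in> LI"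
    unfolding left_ideal_gen_def by (auto intro: additive_subgroup.zero_closed additive_subgroup.a_closed)
  ultimately show ?thesis using LI_carrier by (auto simp: submodule_vs_iff[OF V])
qed

private lemma carrier_cyclic': "carrier (cyclic U S) = (\<lambda>x. LI +>\<^bsub>U\<^esub> x) ` carrier U"
  unfolding cyclic_def by (rule quot_simps(1)[OF calgebra_vs[OF U] LI_submodule])

private lemma cyclic_act_coset:
  "\<xi> \<in> carrier U \<Longrightarrow> x \<in> carrier U \<Longrightarrow> cyclic_act U S \<xi> (LI +>\<^bsub>U\<^esub> x) = LI +>\<^bsub>U\<^esub> (\<xi> \<otimes>\<^bsub>U\<^esub> x)"
  unfolding cyclic_act_def
  by (rule UN_coset[OF calgebra_vs[OF U] LI_submodule calgebra_vs[OF U] calg_lin_r[OF U] LI_submodule LI_mult])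

private lemma act_gen: "\<xi> \<in> carrier U \<Longrightarrow> cyclic_act U S \<xi> (cyclic_gen U S) = LI +>\<^bsub>U\<^esub> \<xi>"
  unfolding cyclic_gen_def using U by (simp add: cyclic_act_coset)

lemma left_module_cyclic: "left_module U (cyclic U S) (cyclic_act U S)"
proof -
  note V = calgebra_vs[OF U]
  note [simp] = U V cyclic_act_coset quot_simps(3)[OF V LI_submodule] quot_smult[OF V LI_submodule]
  show ?thesis
    apply (rule left_moduleI)
       apply (unfold cyclic_def, rule vs_quot[OF V LI_submodule])
    by (intro bilinI linI; auto simp: quot_simps(1)[OF V LI_submodule] calg_l_distr calg_r_distr
        calg_smult_l calg_smult_r)
      (auto simp: quot_simps(1)[OF V LI_submodule] calg_m_assoc)
qed

lemma cyclic_gen_closed: "cyclic_gen U S \<in> carrier (cyclic U S)"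
  unfolding cyclic_gen_def carrier_cyclic' using U by simp

lemma carrier_cyclic: "carrier (cyclic U S) = (\<lambda>\<xi>. cyclic_act U S \<xi> (cyclic_gen U S)) ` carrier U"
  by (simp add: carrier_cyclic' act_gen)

lemma cyclic_gen_rel: "s \<in> S \<Longrightarrow> cyclic_act U S s (cyclic_gen U S) = \<zero>\<^bsub>cyclic U S\<^esub>"
  using S LI_subset
  by (simp add: act_gen subset_iff cyclic_def quot_simps(2)[OF calgebra_vs[OF U] LI_submodule]
      coset_zero_iff[OF calgebra_vs[OF U] LI_submodule])

context
  fixes W :: "(complex, 'w) module" and act w
  assumes W: "left_module U W act" and w: "w \<in> carrier W" and rel: "\<And>s. s \<in> S \<Longrightarrow> act s w = \<zero>\<^bsub>W\<^esub>"
begin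

text \<open>The annihilator of w is a left ideal that contains S. This makes the morphism sending
  the cyclic generator to w well defined.\<close>

private lemma LI_kills: "\<xi> \<in> LI \<Longrightarrow> act \<xi> w = \<zero>\<^bsub>W\<^esub>"
proof -
  note V = calgebra_vs[OF U] and VW = left_module_vs[OF W]
  have "LI \<subseteq> {\<xi> \<in> carrier U. act \<xi> w = \<zero>\<^bsub>W\<^esub>}"
    by (rule LI_least[OF submodule_equalizer[OF V VW left_module_lin_l[OF W w] lin_zero_fun[OF VW]]])
      (use S U rel in \<open>auto simp: left_module_mult[OF W] w lin_zero[OF left_module_lin_r[OF W] VW VW]\<close>)
  then show "\<xi> \<in> LI \<Longrightarrow> act \<xi> w = \<zero>\<^bsub>W\<^esub>" by auto
qed

lemma cyclic_ext_act_gen: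
  "\<xi> \<in> carrier U \<Longrightarrow> cyclic_ext act w (cyclic_act U S \<xi> (cyclic_gen U S)) = act \<xi> w"
  unfolding cyclic_ext_def act_gen
  by (rule the_elem_coset[OF calgebra_vs[OF U] LI_submodule left_module_vs[OF W] left_module_lin_l[OF W w] LI_kills])

lemma lin_cyclic_ext: "lin (cyclic U S) W (cyclic_ext act w)"
  unfolding cyclic_def cyclic_ext_def[abs_def]
  by (rule lin_the_elem[OF calgebra_vs[OF U] LI_submodule left_module_vs[OF W] left_module_lin_l[OF W w] LI_kills])

lemma cyclic_ext_gen: "cyclic_ext act w (cyclic_gen U S) = w"
  using cyclic_ext_act_gen[of "\<one>\<^bsub>U\<^esub>"] U left_module_one[OF W w]
    left_module_one[OF left_module_cyclic cyclic_gen_closed] by simp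

lemma cyclic_ext_act:
  assumes "\<xi> \<in> carrier U" "v \<in> carrier (cyclic U S)"
  shows "cyclic_ext act w (cyclic_act U S \<xi> v) = act \<xi> (cyclic_ext act w v)"
  using assms U unfolding carrier_cyclic
  by (auto simp: left_module_mult[OF left_module_cyclic _ _ cyclic_gen_closed, symmetric] cyclic_ext_act_gen
      left_module_mult[OF W _ _ w])

end

end

section \<open>The Hopf algebra $U_q\mathfrak{sl}_2$\<close>

text \<open>Homomorphisms from \<open>Uq q\<close> to B correspond to such quadruples
  (\<open>uq_ext_hom\<close>), so each structure map is obtained by checking this predicate in a
  suitable B.\<close>

definition uq_rep :: "real \<Rightarrow> (complex, 'b) module \<Rightarrow> 'b \<Rightarrow> 'b \<Rightarrow> 'b \<Rightarrow> 'b \<Rightarrow> bool" where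
  "uq_rep q B k ki e f \<longleftrightarrow> k \<in> carrier B \<and> ki \<in> carrier B \<and> e \<in> carrier B \<and> f \<in> carrier B \<and>
     k \<otimes>\<^bsub>B\<^esub> ki = \<one>\<^bsub>B\<^esub> \<and> ki \<otimes>\<^bsub>B\<^esub> k = \<one>\<^bsub>B\<^esub> \<and>
     k \<otimes>\<^bsub>B\<^esub> e = of_real (q\<^sup>2) \<odot>\<^bsub>B\<^esub> (e \<otimes>\<^bsub>B\<^esub> k) \<and> ki \<otimes>\<^bsub>B\<^esub> e = of_real (1 / q\<^sup>2) \<odot>\<^bsub>B\<^esub> (e \<otimes>\<^bsub>B\<^esub> ki) \<and>
     k \<otimes>\<^bsub>B\<^esub> f = of_real (1 / q\<^sup>2) \<odot>\<^bsub>B\<^esub> (f \<otimes>\<^bsub>B\<^esub> k) \<and> ki \<otimes>\<^bsub>B\<^esub> f = of_real (q\<^sup>2) \<odot>\<^bsub>B\<^esub> (f \<otimes>\<^bsub>B\<^esub> ki) \<and>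
     e \<otimes>\<^bsub>B\<^esub> f = f \<otimes>\<^bsub>B\<^esub> e \<oplus>\<^bsub>B\<^esub> of_real (1 / (q - 1 / q)) \<odot>\<^bsub>B\<^esub> (k \<oplus>\<^bsub>B\<^esub> (-1) \<odot>\<^bsub>B\<^esub> ki)"

lemma calgebra_Uq: "calgebra (Uq q)"
  unfolding Uq_def by (rule calgebra_presented_alg)

lemma vs_Uq [simp]: "vs (Uq q)" by (rule calgebra_vs[OF calgebra_Uq])

lemma ugen_closed [simp]: "ugen q x \<in> carrier (Uq q)"
  by (simp add: ugen_def Uq_def)

lemma vs_diff_eq_iff:
  assumes "vs V" "x \<in> carrier V" "y \<in> carrier V" "z \<in> carrier V"
  shows "x \<oplus>\<^bsub>V\<^esub> (-1) \<odot>\<^bsub>V\<^esub> y = z \<longleftrightarrow> x = y \<oplus>\<^bsub>V\<^esub> z"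
proof
  assume "x \<oplus>\<^bsub>V\<^esub> (-1) \<odot>\<^bsub>V\<^esub> y = z"
  then have "y \<oplus>\<^bsub>V\<^esub> z = x \<oplus>\<^bsub>V\<^esub> (y \<oplus>\<^bsub>V\<^esub> (-1) \<odot>\<^bsub>V\<^esub> y)"
    using assms by (auto simp: vs_a_lcomm)
  then show "x = y \<oplus>\<^bsub>V\<^esub> z" using assms by (simp add: vs_minus_self)
next
  assume "x = y \<oplus>\<^bsub>V\<^esub> z"
  then have "x \<oplus>\<^bsub>V\<^esub> (-1) \<odot>\<^bsub>V\<^esub> y = z \<oplus>\<^bsub>V\<^esub> (y \<oplus>\<^bsub>V\<^esub> (-1) \<odot>\<^bsub>V\<^esub> y)"
    using assms by (simp add: vs_a_assoc[symmetric] vs_a_comm[of V z y])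
  then show "x \<oplus>\<^bsub>V\<^esub> (-1) \<odot>\<^bsub>V\<^esub> y = z" using assms by (simp add: vs_minus_self)
qed

context
  fixes q :: real and B :: "(complex, 'b) module" and g :: "uq_gen \<Rightarrow> 'b"
  assumes B: "calgebra B" and g: "\<And>x. g x \<in> carrier B"
begin

lemma free_ext_uq_rels:
  "(\<forall>r\<in>uq_rels q. free_ext B g r = \<zero>\<^bsub>B\<^esub>) \<longleftrightarrow> uq_rep q B (g gK) (g gKi) (g gE) (g gF)"
proof -
  note h = free_ext_hom[OF B g] and V = calgebra_vs[OF B]
  have m: "free_ext B g (p * r) = free_ext B g p \<otimes>\<^bsub>B\<^esub> free_ext B g r" for p r
    using calg_hom_mult[OF h] by simp
  have d: "free_ext B g (p - r) = free_ext B g p \<oplus>\<^bsub>B\<^esub> (-1) \<odot>\<^bsub>B\<^esub> free_ext B g r" for p r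
    using lin_minus[OF calg_hom_lin[OF h] vs_free_alg V, of p r]
    by (simp add: vs_minus[OF V] vs_minus[OF vs_free_alg] calg_hom_closed[OF h])
  have o: "free_ext B g 1 = \<one>\<^bsub>B\<^esub>"
    using calg_hom_one[OF h] by simp
  note [simp] = m d o B V g free_ext_fgen[OF B g] free_ext_fconst[OF B g] vs_diff_eq_iff calg_smult_l
  show ?thesis
    unfolding uq_rels_def uq_rep_def by simp
qed

lemma uq_ext_hom:
  assumes "uq_rep q B (g gK) (g gKi) (g gE) (g gF)"
  shows "presented_ext B g \<in> calg_hom (Uq q) B" "presented_ext B g (ugen q x) = g x"
  using presented_ext_hom[OF B g, of "uq_rels q"] presented_ext_pgen[OF B g, of "uq_rels q"] assms free_ext_uq_rels
  by (auto simp: Uq_def ugen_def)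

end

text \<open>The extension of the generators to the free algebra, with values in the quotient, is the
  projection itself, and the projection kills the relations.\<close>

lemma uq_rep_Uq: "uq_rep q (Uq q) (ugen q gK) (ugen q gKi) (ugen q gE) (ugen q gF)"
proof -
  have "free_ext (Uq q) (ugen q) r = pres_proj (uq_rels q) r" for r
  proof (rule lin_eq_on_span[where f = "free_ext (Uq q) (ugen q)", OF spans_free_alg vs_free_alg vs_Uq])
    note h = free_ext_hom[where g = "ugen q", OF calgebra_Uq[of q] ugen_closed] and p = pres_proj_hom[of "uq_rels q"]
    show "lin free_alg (Uq q) (free_ext (Uq q) (ugen q))" by (rule calg_hom_lin[OF h])
    show "lin free_alg (Uq q) (pres_proj (uq_rels q))" unfolding Uq_def by (rule calg_hom_lin[OF p])
    have "free_ext (Uq q) (ugen q) (Poly_Mapping.single w 1) = pres_proj (uq_rels q) (Poly_Mapping.single w 1)" for w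
    proof (induction w)
      case Nil
      have one: "(1 :: uq_gen free) = Poly_Mapping.single [] 1"
        by (metis single_one zero_list_def)
      show ?case using calg_hom_one[OF h] calg_hom_one[OF p] by (simp add: Uq_def flip: one)
    next
      case (Cons x w)
      have "Poly_Mapping.single (x # w) (1::complex) = fgen x * Poly_Mapping.single w 1"
        by (simp add: mult_single plus_list_def)
      moreover have ug: "pres_proj (uq_rels q) (fgen x) = ugen q x"
        by (simp add: ugen_def pgen_pres_proj)
      ultimately show ?case
        using calg_hom_mult[OF h, of "fgen x" "Poly_Mapping.single w 1"] Cons
          calg_hom_mult[OF p, of "fgen x" "Poly_Mapping.single w 1"]
        free_ext_fgen[where g = "ugen q", OF calgebra_Uq[of q] ugen_closed, of x]
        ug by (simp add: Uq_def)
    qed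
    then show "\<And>x. x \<in> range (\<lambda>w. Poly_Mapping.single w 1) \<Longrightarrow> free_ext (Uq q) (ugen q) x = pres_proj (uq_rels q) x"
      by auto
  qed simp
  then have "\<forall>r\<in>uq_rels q. free_ext (Uq q) (ugen q) r = \<zero>\<^bsub>Uq q\<^esub>"
    by (auto simp: pres_proj_rel Uq_def)
  then show ?thesis
    using free_ext_uq_rels[where g = "ugen q", OF calgebra_Uq[of q] ugen_closed, of q] by blast
qed

lemma Uq_induct:
  assumes "\<xi> \<in> carrier (Uq q)" "submodule {\<xi> \<in> carrier (Uq q). P \<xi>} cplx (Uq q)" "P \<one>\<^bsub>Uq q\<^esub>"
    and "\<And>x \<xi>. \<xi> \<in> carrier (Uq q) \<Longrightarrow> P \<xi> \<Longrightarrow> P (ugen q x \<otimes>\<^bsub>Uq q\<^esub> \<xi>)"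
  shows "P \<xi>"
  using presented_induct[of \<xi> "uq_rels q" P] assms by (simp add: Uq_def ugen_def)

lemma Uq_hom_eqI:
  assumes "calgebra B" "f \<in> calg_hom (Uq q) B" "g \<in> calg_hom (Uq q) B"
    and "\<And>x. f (ugen q x) = g (ugen q x)" "\<xi> \<in> carrier (Uq q)"
  shows "f \<xi> = g \<xi>"
  using presented_hom_eqI[of B f "uq_rels q" g \<xi>] assms by (simp add: Uq_def ugen_def)

subsection \<open>Linear identities by coefficient comparison\<close>

text \<open>A linear identity is proved by writing both sides over one list of vectors; equality of
  the coefficient lists, which is complex arithmetic, is then enough.\<close>

primrec lcomb :: "(complex, 'a) module \<Rightarrow> 'a list \<Rightarrow> complex list \<Rightarrow> 'a" where
  "lcomb V [] cs = \<zero>\<^bsub>V\<^esub>"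
| "lcomb V (t # ts) cs = hd cs \<odot>\<^bsub>V\<^esub> t \<oplus>\<^bsub>V\<^esub> lcomb V ts (tl cs)"

lemma lcomb_closed: "vs V \<Longrightarrow> set ts \<subseteq> carrier V \<Longrightarrow> lcomb V ts cs \<in> carrier V"
  by (induction ts arbitrary: cs) auto

lemma lcomb_add:
  assumes "vs V" "set ts \<subseteq> carrier V" "length cs = length ts" "length ds = length ts"
  shows "lcomb V ts cs \<oplus>\<^bsub>V\<^esub> lcomb V ts ds = lcomb V ts (map2 (+) cs ds)"
  using assms(2-)
proof (induction ts arbitrary: cs ds)
  case (Cons t ts)
  obtain c cs' d ds' where [simp]: "cs = c # cs'" "ds = d # ds'"
    using Cons.prems by (metis length_Suc_conv)
  have "lcomb V ts cs' \<in> carrier V" "lcomb V ts ds' \<in> carrier V"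
    using Cons.prems assms(1) by (auto intro: lcomb_closed)
  then show ?case
    using Cons.prems assms(1) by (simp add: Cons.IH[symmetric] vs_smult_l_distr vs_a_assoc vs_a_lcomm)
qed (simp add: assms(1))

lemma lcomb_smult:
  assumes "vs V" "set ts \<subseteq> carrier V" "length cs = length ts"
  shows "c \<odot>\<^bsub>V\<^esub> lcomb V ts cs = lcomb V ts (map ((*) c) cs)"
  using assms(2-)
proof (induction ts arbitrary: cs)
  case (Cons t ts)
  obtain d cs' where [simp]: "cs = d # cs'"
    using Cons.prems by (metis length_Suc_conv)
  show ?case
    using Cons.prems assms(1) by (simp add: Cons.IH[symmetric] vs_smult_r_distr vs_smult_smult lcomb_closed)
qed (simp add: assms(1))

subsection \<open>The structure maps\<close>

context
  fixes q :: real and B :: "(complex, 'b) module" and k ki e f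
  assumes B: "calgebra B" and rep: "uq_rep q B k ki e f" and q: "q \<noteq> 0"
begin

lemma uq_rep_closed: "k \<in> carrier B" "ki \<in> carrier B" "e \<in> carrier B" "f \<in> carrier B"
  using rep by (simp_all add: uq_rep_def)

lemma uq_rep_rules:
  "k \<otimes>\<^bsub>B\<^esub> ki = \<one>\<^bsub>B\<^esub>" "ki \<otimes>\<^bsub>B\<^esub> k = \<one>\<^bsub>B\<^esub>"
  "k \<otimes>\<^bsub>B\<^esub> e = of_real (q\<^sup>2) \<odot>\<^bsub>B\<^esub> (e \<otimes>\<^bsub>B\<^esub> k)" "ki \<otimes>\<^bsub>B\<^esub> e = of_real (1 / q\<^sup>2) \<odot>\<^bsub>B\<^esub> (e \<otimes>\<^bsub>B\<^esub> ki)"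
  "k \<otimes>\<^bsub>B\<^esub> f = of_real (1 / q\<^sup>2) \<odot>\<^bsub>B\<^esub> (f \<otimes>\<^bsub>B\<^esub> k)" "ki \<otimes>\<^bsub>B\<^esub> f = of_real (q\<^sup>2) \<odot>\<^bsub>B\<^esub> (f \<otimes>\<^bsub>B\<^esub> ki)"
  "e \<otimes>\<^bsub>B\<^esub> f = f \<otimes>\<^bsub>B\<^esub> e \<oplus>\<^bsub>B\<^esub> of_real (1 / (q - 1 / q)) \<odot>\<^bsub>B\<^esub> (k \<oplus>\<^bsub>B\<^esub> (-1) \<odot>\<^bsub>B\<^esub> ki)"
  using rep by (simp_all add: uq_rep_def)

private lemma assoc2:
  assumes "x \<in> carrier B" "y \<in> carrier B" "z \<in> carrier B" "x' \<in> carrier B" "y' \<in> carrier B"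
    and "x \<otimes>\<^bsub>B\<^esub> y = c \<odot>\<^bsub>B\<^esub> (y' \<otimes>\<^bsub>B\<^esub> x')"
  shows "x \<otimes>\<^bsub>B\<^esub> (y \<otimes>\<^bsub>B\<^esub> z) = c \<odot>\<^bsub>B\<^esub> (y' \<otimes>\<^bsub>B\<^esub> (x' \<otimes>\<^bsub>B\<^esub> z))"
  using assms B by (simp add: calg_m_assoc[symmetric] calg_smult_l)

text \<open>The relations with a trailing factor z, so that rewriting towards the order F, E, K also
  works inside products nested to the right.\<close>

lemma uq_rep_rules_assoc:
  assumes z: "z \<in> carrier B"
  shows "k \<otimes>\<^bsub>B\<^esub> (ki \<otimes>\<^bsub>B\<^esub> z) = z" "ki \<otimes>\<^bsub>B\<^esub> (k \<otimes>\<^bsub>B\<^esub> z) = z"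
  "k \<otimes>\<^bsub>B\<^esub> (e \<otimes>\<^bsub>B\<^esub> z) = of_real (q\<^sup>2) \<odot>\<^bsub>B\<^esub> (e \<otimes>\<^bsub>B\<^esub> (k \<otimes>\<^bsub>B\<^esub> z))"
  "ki \<otimes>\<^bsub>B\<^esub> (e \<otimes>\<^bsub>B\<^esub> z) = of_real (1 / q\<^sup>2) \<odot>\<^bsub>B\<^esub> (e \<otimes>\<^bsub>B\<^esub> (ki \<otimes>\<^bsub>B\<^esub> z))"
  "k \<otimes>\<^bsub>B\<^esub> (f \<otimes>\<^bsub>B\<^esub> z) = of_real (1 / q\<^sup>2) \<odot>\<^bsub>B\<^esub> (f \<otimes>\<^bsub>B\<^esub> (k \<otimes>\<^bsub>B\<^esub> z))"
  "ki \<otimes>\<^bsub>B\<^esub> (f \<otimes>\<^bsub>B\<^esub> z) = of_real (q\<^sup>2) \<odot>\<^bsub>B\<^esub> (f \<otimes>\<^bsub>B\<^esub> (ki \<otimes>\<^bsub>B\<^esub> z))"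
  "e \<otimes>\<^bsub>B\<^esub> (f \<otimes>\<^bsub>B\<^esub> z) = f \<otimes>\<^bsub>B\<^esub> (e \<otimes>\<^bsub>B\<^esub> z) \<oplus>\<^bsub>B\<^esub> of_real (1 / (q - 1 / q)) \<odot>\<^bsub>B\<^esub> (k \<otimes>\<^bsub>B\<^esub> z \<oplus>\<^bsub>B\<^esub> (-1) \<odot>\<^bsub>B\<^esub> (ki \<otimes>\<^bsub>B\<^esub> z))"
proof -
  note [simp] = uq_rep_closed B z calgebra_vs[OF B]
  show "k \<otimes>\<^bsub>B\<^esub> (ki \<otimes>\<^bsub>B\<^esub> z) = z" "ki \<otimes>\<^bsub>B\<^esub> (k \<otimes>\<^bsub>B\<^esub> z) = z"
    by (simp_all add: calg_m_assoc[OF B, symmetric] uq_rep_rules(1,2))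
  show "e \<otimes>\<^bsub>B\<^esub> (f \<otimes>\<^bsub>B\<^esub> z) = f \<otimes>\<^bsub>B\<^esub> (e \<otimes>\<^bsub>B\<^esub> z) \<oplus>\<^bsub>B\<^esub> of_real (1 / (q - 1 / q)) \<odot>\<^bsub>B\<^esub> (k \<otimes>\<^bsub>B\<^esub> z \<oplus>\<^bsub>B\<^esub> (-1) \<odot>\<^bsub>B\<^esub> (ki \<otimes>\<^bsub>B\<^esub> z))"
    by (simp add: calg_m_assoc[OF B, symmetric] uq_rep_rules(7) calg_l_distr[OF B] calg_smult_l[OF B] del: of_real_divide of_real_diff)
qed (rule assoc2; (rule uq_rep_closed z uq_rep_rules))+

end

lemmas Uq_rules = uq_rep_rules[OF calgebra_Uq uq_rep_Uq] and Uq_rules_assoc = uq_rep_rules_assoc[OF calgebra_Uq uq_rep_Uq]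

lemma scal_cancel:
  assumes "q \<noteq> (0::real)"
  shows "complex_of_real (q\<^sup>2) * complex_of_real (1 / q\<^sup>2) = 1" "complex_of_real (1 / q\<^sup>2) * complex_of_real (q\<^sup>2) = 1"
  using assms by auto

locale uq =
  fixes q :: real
  assumes q: "0 < q" "q < 1"
begin

abbreviation (input) "U \<equiv> Uq q"
abbreviation "KK \<equiv> ugen q gK"
abbreviation "KI \<equiv> ugen q gKi"
abbreviation "EE \<equiv> ugen q gE"
abbreviation "FF \<equiv> ugen q gF"
abbreviation "gg s \<equiv> ugen q (generating s)"
abbreviation "cc \<equiv> complex_of_real (1 / (q - 1 / q))"
abbreviation "c0 \<equiv> complex_of_real (q * (1 - q\<^sup>2))"
abbreviation "QQ \<equiv> complex_of_real (q\<^sup>2)"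
abbreviation "RR \<equiv> complex_of_real (1 / q\<^sup>2)"

lemma q0: "q \<noteq> 0" using q by simp

context
begin

private lemmas QR = scal_cancel[OF q0]
private lemmas rules = Uq_rules[OF q0] Uq_rules_assoc[OF q0] QR

private lemma QR_assoc: "QQ * (RR * x) = x" "RR * (QQ * x) = x" "QQ * (x * RR) = x" "RR * (x * QQ) = x"
  using QR by (metis mult.assoc mult.commute mult_1)+

private lemmas U_simps = calgebra_Uq vs_Uq ugen_closed calg_smult_l calg_smult_r calg_l_distr calg_r_distr
  calg_m_assoc vs_smult_r_distr vs_smult_smult vs_a_inv

lemma uq_antipode_hom: "uq_antipode q \<in> calg_hom U (opp_alg U)"
  and uq_antipode_gen: "uq_antipode q KK = KI" "uq_antipode q KI = KK"
    "uq_antipode q EE = (-1) \<odot>\<^bsub>U\<^esub> (KI \<otimes>\<^bsub>U\<^esub> EE)" "uq_antipode q FF = (-1) \<odot>\<^bsub>U\<^esub> (FF \<otimes>\<^bsub>U\<^esub> KK)"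
proof -
  let ?g = "\<lambda>x. case x of gK \<Rightarrow> KI | gKi \<Rightarrow> KK | gE \<Rightarrow> \<ominus>\<^bsub>U\<^esub> (KI \<otimes>\<^bsub>U\<^esub> EE) | gF \<Rightarrow> \<ominus>\<^bsub>U\<^esub> (FF \<otimes>\<^bsub>U\<^esub> KK)"
  have g: "?g x \<in> carrier (opp_alg U)" for x
    by (simp add: U_simps split: uq_gen.split)
  have rep: "uq_rep q (opp_alg U) (?g gK) (?g gKi) (?g gE) (?g gF)"
  proof -
    define A where "A = FF \<otimes>\<^bsub>U\<^esub> EE"
    have [simp]: "A \<in> carrier U" by (simp add: A_def U_simps)
    \<comment> \<open>Once K and K^{-1} cancel, the relation between S(E) and S(F) in the opposite
      algebra reads FE = EF + (K^{-1} - K)/(q - q^{-1}); inserting the commutator for EF leaves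
      this.\<close>
    have 1: "A = (A \<oplus>\<^bsub>U\<^esub> cc \<odot>\<^bsub>U\<^esub> (KK \<oplus>\<^bsub>U\<^esub> (-1) \<odot>\<^bsub>U\<^esub> KI)) \<oplus>\<^bsub>U\<^esub> cc \<odot>\<^bsub>U\<^esub> (KI \<oplus>\<^bsub>U\<^esub> (-1) \<odot>\<^bsub>U\<^esub> KK)"
      (is "_ = ?rhs")
    proof -
      define ts where "ts = [A, KK, KI]"
      have ts: "set ts \<subseteq> carrier U" "length ts = 3" by (simp_all add: ts_def)
      have l: "A = lcomb U ts [1,0,0]" "KK = lcomb U ts [0,1,0]" "KI = lcomb U ts [0,0,1]"
        by (simp_all add: ts_def U_simps)
      show ?thesis unfolding l by (simp add: lcomb_add lcomb_smult ts del: of_real_divide of_real_diff)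
    qed
    have "uq_rep q (opp_alg U) KI KK ((-1) \<odot>\<^bsub>U\<^esub> (KI \<otimes>\<^bsub>U\<^esub> EE)) ((-1) \<odot>\<^bsub>U\<^esub> (FF \<otimes>\<^bsub>U\<^esub> KK))"
      unfolding uq_rep_def opp_alg_simps
    proof (intro conjI)
      show "(- 1 \<odot>\<^bsub>U\<^esub> (FF \<otimes>\<^bsub>U\<^esub> KK)) \<otimes>\<^bsub>U\<^esub> (- 1 \<odot>\<^bsub>U\<^esub> (KI \<otimes>\<^bsub>U\<^esub> EE)) =
        (- 1 \<odot>\<^bsub>U\<^esub> (KI \<otimes>\<^bsub>U\<^esub> EE)) \<otimes>\<^bsub>U\<^esub> (- 1 \<odot>\<^bsub>U\<^esub> (FF \<otimes>\<^bsub>U\<^esub> KK)) \<oplus>\<^bsub>U\<^esub> cc \<odot>\<^bsub>U\<^esub> (KI \<oplus>\<^bsub>U\<^esub> - 1 \<odot>\<^bsub>U\<^esub> KK)"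
        using 1 unfolding A_def
        by (simp add: U_simps rules QR_assoc mult.assoc mult.commute mult.left_commute del: of_real_divide of_real_diff of_real_power)
    qed (simp_all add: U_simps rules QR_assoc mult.assoc mult.left_commute mult.commute del: of_real_divide of_real_diff of_real_power)
    then show ?thesis by (simp add: U_simps)
  qed
  note h = uq_ext_hom[OF calgebra_opp_alg[OF calgebra_Uq] g rep]
  show "uq_antipode q \<in> calg_hom U (opp_alg U)" using h(1) by (simp add: uq_antipode_def)
  show "uq_antipode q KK = KI" "uq_antipode q KI = KK"
    "uq_antipode q EE = (-1) \<odot>\<^bsub>U\<^esub> (KI \<otimes>\<^bsub>U\<^esub> EE)" "uq_antipode q FF = (-1) \<odot>\<^bsub>U\<^esub> (FF \<otimes>\<^bsub>U\<^esub> KK)"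
    using h(2)[of gK] h(2)[of gKi] h(2)[of gE] h(2)[of gF] by (simp_all add: uq_antipode_def U_simps)
qed

text \<open>The same cancellation as for the antipode, with scalars distributed, as it is left over
  from the commutator relation for the inverse antipode.\<close>

private lemma FE_eq: "FF \<otimes>\<^bsub>U\<^esub> EE = FF \<otimes>\<^bsub>U\<^esub> EE \<oplus>\<^bsub>U\<^esub> (cc \<odot>\<^bsub>U\<^esub> KK \<oplus>\<^bsub>U\<^esub> - cc \<odot>\<^bsub>U\<^esub> KI) \<oplus>\<^bsub>U\<^esub>
     (cc \<odot>\<^bsub>U\<^esub> KI \<oplus>\<^bsub>U\<^esub> - cc \<odot>\<^bsub>U\<^esub> KK)"
proof -
  define A where "A = FF \<otimes>\<^bsub>U\<^esub> EE"
  have [simp]: "A \<in> carrier U" by (simp add: A_def U_simps)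
  define ts where "ts = [A, KK, KI]"
  have ts: "set ts \<subseteq> carrier U" "length ts = 3" by (simp_all add: ts_def)
  have l: "A = lcomb U ts [1,0,0]" "KK = lcomb U ts [0,1,0]" "KI = lcomb U ts [0,0,1]"
    by (simp_all add: ts_def U_simps)
  show ?thesis unfolding A_def[symmetric] unfolding l
    by (simp add: lcomb_add lcomb_smult ts del: of_real_divide of_real_diff)
qed

text \<open>The inverse antipode, S^{-1}(E) = -E K^{-1} and S^{-1}(F) = -K F, as a homomorphism into
  the opposite algebra. \<open>uq_antipode_inv\<close> is a set-theoretic inverse, whose values are
  accessible only once bijectivity is known.\<close>

definition uq_antipode' :: "uq \<Rightarrow> uq" where
  "uq_antipode' = presented_ext (opp_alg U) (\<lambda>x. case x of gK \<Rightarrow> KI | gKi \<Rightarrow> KK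
     | gE \<Rightarrow> (-1) \<odot>\<^bsub>U\<^esub> (EE \<otimes>\<^bsub>U\<^esub> KI) | gF \<Rightarrow> (-1) \<odot>\<^bsub>U\<^esub> (KK \<otimes>\<^bsub>U\<^esub> FF))"

lemma uq_antipode'_hom: "uq_antipode' \<in> calg_hom U (opp_alg U)"
  and uq_antipode'_gen: "uq_antipode' KK = KI" "uq_antipode' KI = KK"
    "uq_antipode' EE = (-1) \<odot>\<^bsub>U\<^esub> (EE \<otimes>\<^bsub>U\<^esub> KI)" "uq_antipode' FF = (-1) \<odot>\<^bsub>U\<^esub> (KK \<otimes>\<^bsub>U\<^esub> FF)"
proof -
  let ?g = "\<lambda>x. case x of gK \<Rightarrow> KI | gKi \<Rightarrow> KK | gE \<Rightarrow> (-1) \<odot>\<^bsub>U\<^esub> (EE \<otimes>\<^bsub>U\<^esub> KI) | gF \<Rightarrow> (-1) \<odot>\<^bsub>U\<^esub> (KK \<otimes>\<^bsub>U\<^esub> FF)"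
  note [simp del] = of_real_divide of_real_diff of_real_power
  have g: "?g x \<in> carrier (opp_alg U)" for x
    by (simp add: U_simps split: uq_gen.split)
  have rep: "uq_rep q (opp_alg U) (?g gK) (?g gKi) (?g gE) (?g gF)"
    unfolding uq_rep_def opp_alg_simps uq_gen.case
    by (intro conjI; (simp add: U_simps rules QR_assoc mult.assoc mult.left_commute mult.commute)?)
      (rule FE_eq)
  note h = uq_ext_hom[OF calgebra_opp_alg[OF calgebra_Uq] g rep]
  show "uq_antipode' \<in> calg_hom U (opp_alg U)" using h(1) by (simp add: uq_antipode'_def)
  show "uq_antipode' KK = KI" "uq_antipode' KI = KK"
    "uq_antipode' EE = (-1) \<odot>\<^bsub>U\<^esub> (EE \<otimes>\<^bsub>U\<^esub> KI)" "uq_antipode' FF = (-1) \<odot>\<^bsub>U\<^esub> (KK \<otimes>\<^bsub>U\<^esub> FF)"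
    using h(2)[of gK] h(2)[of gKi] h(2)[of gE] h(2)[of gF] by (simp_all add: uq_antipode'_def U_simps)
qed

lemma uq_star_hom: "uq_star q \<in> calg_hom U (conj_sp (opp_alg U))"
  and uq_star_gen: "uq_star q KK = KK" "uq_star q KI = KI"
    "uq_star q EE = (-1) \<odot>\<^bsub>U\<^esub> (KK \<otimes>\<^bsub>U\<^esub> FF)" "uq_star q FF = (-1) \<odot>\<^bsub>U\<^esub> (EE \<otimes>\<^bsub>U\<^esub> KI)"
proof -
  let ?g = "\<lambda>x. case x of gK \<Rightarrow> KK | gKi \<Rightarrow> KI | gE \<Rightarrow> \<ominus>\<^bsub>U\<^esub> (KK \<otimes>\<^bsub>U\<^esub> FF) | gF \<Rightarrow> \<ominus>\<^bsub>U\<^esub> (EE \<otimes>\<^bsub>U\<^esub> KI)"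
  note [simp del] = of_real_divide of_real_diff of_real_power
  have g: "?g x \<in> carrier (conj_sp (opp_alg U))" for x
    by (simp add: U_simps split: uq_gen.split)
  have "uq_rep q (conj_sp (opp_alg U)) KK KI ((-1) \<odot>\<^bsub>U\<^esub> (KK \<otimes>\<^bsub>U\<^esub> FF)) ((-1) \<odot>\<^bsub>U\<^esub> (EE \<otimes>\<^bsub>U\<^esub> KI))"
    unfolding uq_rep_def opp_alg_simps conj_sp_simps complex_cnj_complex_of_real
    by (intro conjI; simp add: U_simps rules QR_assoc mult.assoc mult.left_commute mult.commute)
  then have rep: "uq_rep q (conj_sp (opp_alg U)) (?g gK) (?g gKi) (?g gE) (?g gF)"
    by (simp add: U_simps)
  note h = uq_ext_hom[OF calgebra_conj_sp[OF calgebra_opp_alg[OF calgebra_Uq]] g rep]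
  show "uq_star q \<in> calg_hom U (conj_sp (opp_alg U))" using h(1) by (simp add: uq_star_def)
  show "uq_star q KK = KK" "uq_star q KI = KI"
    "uq_star q EE = (-1) \<odot>\<^bsub>U\<^esub> (KK \<otimes>\<^bsub>U\<^esub> FF)" "uq_star q FF = (-1) \<odot>\<^bsub>U\<^esub> (EE \<otimes>\<^bsub>U\<^esub> KI)"
    using h(2)[of gK] h(2)[of gKi] h(2)[of gE] h(2)[of gF] by (simp_all add: uq_star_def U_simps)
qed

lemma uq_counit_hom: "uq_counit \<in> calg_hom U cplx"
  and uq_counit_gen: "uq_counit KK = 1" "uq_counit KI = 1" "uq_counit EE = 0" "uq_counit FF = 0"
proof -
  let ?g = "\<lambda>x. case x of gK \<Rightarrow> (1::complex) | gKi \<Rightarrow> 1 | gE \<Rightarrow> 0 | gF \<Rightarrow> 0"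
  have g: "?g x \<in> carrier cplx" for x by simp
  have rep: "uq_rep q cplx (?g gK) (?g gKi) (?g gE) (?g gF)"
    by (simp add: uq_rep_def)
  note h = uq_ext_hom[OF calgebra_cplx g rep]
  show "uq_counit \<in> calg_hom U cplx" using h(1) by (simp add: uq_counit_def)
  show "uq_counit KK = 1" "uq_counit KI = 1" "uq_counit EE = 0" "uq_counit FF = 0"
    using h(2)[of gK] h(2)[of gKi] h(2)[of gE] h(2)[of gF] by (simp_all add: uq_counit_def)
qed

private lemmas S_simps = calg_hom_mult[OF uq_antipode_hom] calg_hom_one[OF uq_antipode_hom]
  calg_hom_closed[OF uq_antipode_hom] lin_add[OF calg_hom_lin[OF uq_antipode_hom]]
  lin_smult[OF calg_hom_lin[OF uq_antipode_hom]] uq_antipode_gen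
private lemmas S'_simps = calg_hom_mult[OF uq_antipode'_hom] calg_hom_one[OF uq_antipode'_hom]
  calg_hom_closed[OF uq_antipode'_hom] lin_add[OF calg_hom_lin[OF uq_antipode'_hom]]
  lin_smult[OF calg_hom_lin[OF uq_antipode'_hom]] uq_antipode'_gen
private lemmas star_simps = calg_hom_mult[OF uq_star_hom] calg_hom_one[OF uq_star_hom]
  calg_hom_closed[OF uq_star_hom] lin_add[OF calg_hom_lin[OF uq_star_hom]]
  lin_smult[OF calg_hom_lin[OF uq_star_hom]] uq_star_gen

lemma uq_antipode_antipode': "\<xi> \<in> carrier U \<Longrightarrow> uq_antipode q (uq_antipode' \<xi>) = \<xi>"
proof (rule Uq_hom_eqI[where f = "\<lambda>\<xi>. uq_antipode q (uq_antipode' \<xi>)" and g = "\<lambda>\<xi>. \<xi>", OF calgebra_Uq])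
  note [simp del] = of_real_divide of_real_diff of_real_power
  show "(\<lambda>\<xi>. uq_antipode q (uq_antipode' \<xi>)) \<in> calg_hom U U"
    by (rule calg_homI[OF lin_comp[OF calg_hom_lin[OF uq_antipode'_hom, simplified] calg_hom_lin[OF uq_antipode_hom, simplified]]])
      (simp_all add: S_simps[simplified] S'_simps[simplified])
  show "(\<lambda>\<xi>. \<xi>) \<in> calg_hom U U" by (rule calg_homI[OF lin_id]) auto
  show "uq_antipode q (uq_antipode' (ugen q x)) = ugen q x" for x
    by (cases x) (simp_all add: S_simps[simplified] S'_simps[simplified] U_simps rules)
qed

lemma uq_antipode'_antipode: "\<xi> \<in> carrier U \<Longrightarrow> uq_antipode' (uq_antipode q \<xi>) = \<xi>"
proof (rule Uq_hom_eqI[where f = "\<lambda>\<xi>. uq_antipode' (uq_antipode q \<xi>)" and g = "\<lambda>\<xi>. \<xi>", OF calgebra_Uq])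
  note [simp del] = of_real_divide of_real_diff of_real_power
  show "(\<lambda>\<xi>. uq_antipode' (uq_antipode q \<xi>)) \<in> calg_hom U U"
    by (rule calg_homI[OF lin_comp[OF calg_hom_lin[OF uq_antipode_hom, simplified] calg_hom_lin[OF uq_antipode'_hom, simplified]]])
      (simp_all add: S_simps[simplified] S'_simps[simplified])
  show "(\<lambda>\<xi>. \<xi>) \<in> calg_hom U U" by (rule calg_homI[OF lin_id]) auto
  show "uq_antipode' (uq_antipode q (ugen q x)) = ugen q x" for x
    by (cases x) (simp_all add: S_simps[simplified] S'_simps[simplified] U_simps rules)
qed

lemma uq_antipode_inv_eq: "\<xi> \<in> carrier U \<Longrightarrow> uq_antipode_inv q \<xi> = uq_antipode' \<xi>"
proof -
  assume x: "\<xi> \<in> carrier U"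
  have "inj_on (uq_antipode q) (carrier U)"
    by (metis inj_onI uq_antipode'_antipode)
  moreover have "uq_antipode' \<xi> \<in> carrier U" using x by (simp add: S'_simps[simplified])
  ultimately have "inv_into (carrier U) (uq_antipode q) (uq_antipode q (uq_antipode' \<xi>)) = uq_antipode' \<xi>"
    by (rule inv_into_f_f)
  then show ?thesis using x by (simp add: uq_antipode_inv_def uq_antipode_antipode')
qed

text \<open>The involution and S^{-1} both reverse products, so the composite is an antilinear
  automorphism. It exchanges E with F and K with K^{-1}, which is why the star map goes from V_+(0)
  to V_-(0) and back.\<close>

definition uq_theta :: "uq \<Rightarrow> uq" where
  "uq_theta \<xi> = uq_star q (uq_antipode' \<xi>)"

lemma uq_theta_hom: "uq_theta \<in> calg_hom U (conj_sp U)"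
  unfolding uq_theta_def[abs_def]
  by (rule calg_homI, rule linI) (simp_all add: star_simps[simplified] S'_simps[simplified])

lemma uq_theta_gen: "uq_theta KK = KI" "uq_theta KI = KK" "uq_theta EE = FF" "uq_theta FF = EE"
  by (simp_all add: uq_theta_def star_simps[simplified] S'_simps[simplified] U_simps rules
      del: of_real_divide of_real_diff of_real_power)

private abbreviation (input) "TT \<equiv> tensor_alg U U"
private abbreviation "pt \<equiv> ptens U U"

lemma uq_comult_hom: "uq_comult q \<in> calg_hom U TT"
  and uq_comult_gen: "uq_comult q KK = pt KK KK" "uq_comult q KI = pt KI KI"
    "uq_comult q EE = pt EE \<one>\<^bsub>U\<^esub> \<oplus>\<^bsub>tensor U U\<^esub> pt KK EE"
    "uq_comult q FF = pt FF KI \<oplus>\<^bsub>tensor U U\<^esub> pt \<one>\<^bsub>U\<^esub> FF"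
proof -
  let ?g = "\<lambda>x. case x of gK \<Rightarrow> pt KK KK | gKi \<Rightarrow> pt KI KI | gE \<Rightarrow> pt EE \<one>\<^bsub>U\<^esub> \<oplus>\<^bsub>tensor U U\<^esub> pt KK EE
      | gF \<Rightarrow> pt FF KI \<oplus>\<^bsub>tensor U U\<^esub> pt \<one>\<^bsub>U\<^esub> FF"
  note [simp del] = of_real_divide of_real_diff of_real_power
  have g: "?g x \<in> carrier TT" for x
    by (simp add: calgebra_Uq split: uq_gen.split)
  note T = calgebra_tensor_alg[OF calgebra_Uq[of q] calgebra_Uq[of q]]
  note distr = calg_l_distr[OF T, simplified] calg_r_distr[OF T, simplified] calg_smult_l[OF T, simplified] calg_smult_r[OF T, simplified]
  note pt = ptens_add_l[OF vs_Uq vs_Uq] ptens_add_r[OF vs_Uq vs_Uq] ptens_smult_l[OF vs_Uq vs_Uq] ptens_smult_r[OF vs_Uq vs_Uq]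
    tensor_alg_mult_ptens[OF calgebra_Uq calgebra_Uq]
  have rep: "uq_rep q TT (?g gK) (?g gKi) (?g gE) (?g gF)"
    unfolding uq_rep_def uq_gen.case tensor_alg_simps
  proof (intro conjI)
    \<comment> \<open>These pure tensors are all that remains after normal ordering. B and C occur
      equally on both sides, and X = K tensor K^{-1} cancels between the commutators in the two
      tensor factors.\<close>
    define A B C D X Y Z where defs: "A = pt (FF \<otimes>\<^bsub>U\<^esub> EE) KI" "B = pt EE FF" "C = pt (FF \<otimes>\<^bsub>U\<^esub> KK) (EE \<otimes>\<^bsub>U\<^esub> KI)"
      "D = pt KK (FF \<otimes>\<^bsub>U\<^esub> EE)" "X = pt KK KI" "Y = pt KI KI" "Z = pt KK KK"
    define ts where "ts = [A, B, C, D, X, Y, Z]"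
    have ts: "set ts \<subseteq> carrier (tensor U U)" "length ts = 7" by (simp_all add: ts_def defs calgebra_Uq)
    have l: "A = lcomb (tensor U U) ts [1,0,0,0,0,0,0]" "B = lcomb (tensor U U) ts [0,1,0,0,0,0,0]"
      "C = lcomb (tensor U U) ts [0,0,1,0,0,0,0]" "D = lcomb (tensor U U) ts [0,0,0,1,0,0,0]"
      "X = lcomb (tensor U U) ts [0,0,0,0,1,0,0]" "Y = lcomb (tensor U U) ts [0,0,0,0,0,1,0]"
      "Z = lcomb (tensor U U) ts [0,0,0,0,0,0,1]"
      by (simp_all add: ts_def defs U_simps)
    show "(pt EE \<one>\<^bsub>U\<^esub> \<oplus>\<^bsub>tensor U U\<^esub> pt KK EE) \<otimes>\<^bsub>TT\<^esub> (pt FF KI \<oplus>\<^bsub>tensor U U\<^esub> pt \<one>\<^bsub>U\<^esub> FF) =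
      (pt FF KI \<oplus>\<^bsub>tensor U U\<^esub> pt \<one>\<^bsub>U\<^esub> FF) \<otimes>\<^bsub>TT\<^esub> (pt EE \<one>\<^bsub>U\<^esub> \<oplus>\<^bsub>tensor U U\<^esub> pt KK EE) \<oplus>\<^bsub>tensor U U\<^esub>
        cc \<odot>\<^bsub>tensor U U\<^esub> (pt KK KK \<oplus>\<^bsub>tensor U U\<^esub> - 1 \<odot>\<^bsub>tensor U U\<^esub> pt KI KI)"
      apply (simp add: distr pt U_simps rules)
      apply (fold defs)
      unfolding l
      by (simp add: lcomb_add lcomb_smult ts)
  qed (simp_all add: distr pt U_simps rules)
  note h = uq_ext_hom[OF T g rep]
  show "uq_comult q \<in> calg_hom U TT" using h(1) by (simp add: uq_comult_def Let_def)
  show "uq_comult q KK = pt KK KK" "uq_comult q KI = pt KI KI"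
    "uq_comult q EE = pt EE \<one>\<^bsub>U\<^esub> \<oplus>\<^bsub>tensor U U\<^esub> pt KK EE"
    "uq_comult q FF = pt FF KI \<oplus>\<^bsub>tensor U U\<^esub> pt \<one>\<^bsub>U\<^esub> FF"
    using h(2)[of gK] h(2)[of gKi] h(2)[of gE] h(2)[of gF] by (simp_all add: uq_comult_def Let_def)
qed

lemma uq_comult_op_hom: "uq_comult_op q \<in> calg_hom U TT"
  unfolding uq_comult_op_def[abs_def]
  by (rule calg_hom_comp[OF uq_comult_hom tensor_flip_hom[OF calgebra_Uq calgebra_Uq]])

lemma uq_comult_op_gen: "uq_comult_op q KK = pt KK KK" "uq_comult_op q KI = pt KI KI"
    "uq_comult_op q EE = pt \<one>\<^bsub>U\<^esub> EE \<oplus>\<^bsub>tensor U U\<^esub> pt EE KK"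
    "uq_comult_op q FF = pt KI FF \<oplus>\<^bsub>tensor U U\<^esub> pt FF \<one>\<^bsub>U\<^esub>"
  by (simp_all add: uq_comult_op_def uq_comult_gen tensor_flip_ptens lin_add[OF lin_tensor_flip] calgebra_Uq)

end

end

section \<open>The modules $V_\pm(0)$\<close>

text \<open>Spanning follows from injectivity of c: a vector and the combination built from its
  finitely many coordinates have the same image.\<close>

lemma basisI:
  assumes V: "vs V" and b: "\<And>i. b i \<in> carrier V" and c: "lin V fun_sp c"
    and cb: "\<And>i. c (b i) = (\<lambda>j. if j = i then 1 else 0)"
    and fin: "\<And>v. v \<in> carrier V \<Longrightarrow> finite {i. c v i \<noteq> 0}"
    and inj: "\<And>v w. v \<in> carrier V \<Longrightarrow> w \<in> carrier V \<Longrightarrow> c v = c w \<Longrightarrow> v = w"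
  shows "basis V b c"
proof -
  have L: "lin (free_space UNIV) V (lincomb V b)" by (rule lin_lincomb[OF V b])
  have cl: "c (lincomb V b p) = Poly_Mapping.lookup p" for p
  proof (rule lin_eq_on_span[where f = "\<lambda>p. c (lincomb V b p)", OF spans_free_space vs_free_space vs_fun_sp lin_comp[OF L c]])
    show "lin (free_space UNIV) fun_sp Poly_Mapping.lookup"
      by (rule linI) (auto simp: lookup_add fun_eq_iff)
  qed (auto simp: V b cb fun_eq_iff lookup_single when_def)
  have "spans V (range b)"
  proof (rule spansI)
    fix H assume H: "submodule H cplx V" "range b \<subseteq> H"
    show "carrier V \<subseteq> H"
    proof
      fix v assume v: "v \<in> carrier V"
      let ?p = "Abs_poly_mapping (c v)"
      have "lincomb V b ?p \<in> H"
        by (rule spans_induct[OF spans_free_space submodule_vimage[OF vs_free_space V L H(1)]])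
          (use H(2) V b in auto)
      moreover have "lincomb V b ?p = v"
        by (rule inj) (use v fin[OF v] lin_closed[OF L] in \<open>simp_all add: cl\<close>)
      ultimately show "v \<in> H" by simp
    qed
  qed (use b in auto)
  then show ?thesis using V c cb by (simp add: basis_def)
qed

lemma left_module_cong:
  assumes "left_module U V act" "calgebra U" "\<And>\<xi>. \<xi> \<in> carrier U \<Longrightarrow> act \<xi> = act' \<xi>"
  shows "left_module U V act'"
  using assms(1,2) calgebra_vs[OF assms(2)]
  by (simp add: left_module_def assms(3)[symmetric])

text \<open>The j-th power is the eigenvalue of K on E^j v_+(0), respectively F^j v_-(0).\<close>

definition kap :: "real \<Rightarrow> sgn \<Rightarrow> complex" where
  "kap q s = (case s of Plus \<Rightarrow> of_real (q\<^sup>2) | Minus \<Rightarrow> of_real (1 / q\<^sup>2))"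

text \<open>The q-integer [n] = 1 + q^2 + ... + q^(2(n-1)) at base q^2; \<open>qf\<close> is its
  factorial.\<close>

definition qn :: "real \<Rightarrow> nat \<Rightarrow> complex" where
  "qn q n = (\<Sum>i<n. of_real (q\<^sup>2) ^ i)"

primrec qf :: "real \<Rightarrow> nat \<Rightarrow> complex" where
  "qf q 0 = 1" | "qf q (Suc n) = qn q (Suc n) * qf q n"

text \<open>The commutator of \<open>E\<close> and \<open>F\<close> forces $v_{j+1}\mapsto-\mu_jv_j$ for the lowering generator of $V_\pm(0)$.\<close>

definition mu :: "real \<Rightarrow> nat \<Rightarrow> complex" where
  "mu q j = of_real q * qn q (Suc j) * qn q j * of_real (1 / q\<^sup>2) ^ j"

text \<open>The operators act on coefficient sequences: passing from v_j to v_{j+1} becomes the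
  right shift with 0 in front, and lowering reads the entry at j+1.\<close>

fun V_op :: "real \<Rightarrow> sgn \<Rightarrow> uq_gen \<Rightarrow> (nat \<Rightarrow> complex) \<Rightarrow> nat \<Rightarrow> complex" where
  "V_op q s gK u = (\<lambda>j. kap q s ^ j * u j)"
| "V_op q s gKi u = (\<lambda>j. (1 / kap q s) ^ j * u j)"
| "V_op q s x u = (if x = generating s then (\<lambda>j. case j of 0 \<Rightarrow> 0 | Suc i \<Rightarrow> u i) else (\<lambda>j. - mu q j * u (Suc j)))"

definition V_rep :: "real \<Rightarrow> sgn \<Rightarrow> uq \<Rightarrow> (nat \<Rightarrow> complex) \<Rightarrow> nat \<Rightarrow> complex" where
  "V_rep q s = presented_ext op_alg (V_op q s)"

text \<open>The morphism into the sequence model that sends the generator to the indicator of 0. Its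
  j-th entry turns out to be the coefficient at \<open>V_bas q s j\<close>.\<close>

definition V_coord :: "real \<Rightarrow> sgn \<Rightarrow> vq \<Rightarrow> nat \<Rightarrow> complex" where
  "V_coord q s = cyclic_ext (V_rep q s) (\<lambda>j. if j = 0 then 1 else 0)"

definition V_bas :: "real \<Rightarrow> sgn \<Rightarrow> nat \<Rightarrow> vq" where
  "V_bas q s j = V_act q s (ugen q (generating s) [^]\<^bsub>Uq q\<^esub> j) (V_gen q s)"

lemma qn_0 [simp]: "qn q 0 = 0" by (simp add: qn_def)
lemma qn_Suc: "qn q (Suc n) = qn q n + of_real (q\<^sup>2) ^ n" by (simp add: qn_def)
lemma qn_1 [simp]: "qn q (Suc 0) = 1" by (simp add: qn_def)

lemma qn_add: "qn q (m + n) = qn q m + of_real (q\<^sup>2) ^ m * qn q n"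
  by (induction n) (simp_all add: qn_Suc power_add algebra_simps)

lemma qn_Suc': "qn q (Suc n) = 1 + of_real (q\<^sup>2) * qn q n"
  using qn_add[of q 1 n] by simp

lemma qn_nonzero: "0 < q \<Longrightarrow> n > 0 \<Longrightarrow> qn q n \<noteq> 0"
proof -
  assume q: "0 < q" "n > 0"
  have "qn q n = of_real (\<Sum>i<n. (q\<^sup>2) ^ i)" by (simp add: qn_def)
  moreover have "(\<Sum>i<n. (q\<^sup>2) ^ i) > 0" using q by (intro sum_pos) auto
  ultimately show ?thesis by (metis of_real_eq_0_iff less_irrefl)
qed

lemma qf_nonzero: "0 < q \<Longrightarrow> qf q n \<noteq> 0"
  by (induction n) (auto simp: qn_nonzero)

context uq
begin

context
begin

text \<open>The relation for EF - FE, evaluated on the basis vector of index j+1: the difference of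
  consecutive \<open>mu\<close> has to be the eigenvalue of the commutator there, up to the sign
  that distinguishes V_+(0) from V_-(0).\<close>

lemma mu_Suc: "mu q (Suc j) = mu q j + of_real (1 / (q - 1 / q)) * (of_real (q\<^sup>2) ^ Suc j - of_real (1 / q\<^sup>2) ^ Suc j)"
proof -
  define c where "c = complex_of_real q"
  have c: "c \<noteq> 0" "c\<^sup>2 \<noteq> 1"
    using q by (auto simp: c_def power2_eq_1_iff simp flip: of_real_power)
  have s: "(c\<^sup>2 - 1) * qn q n = (c\<^sup>2) ^ n - 1" for n
    by (induction n) (simp_all add: qn_Suc c_def algebra_simps)
  have n: "qn q n = ((c\<^sup>2) ^ n - 1) / (c\<^sup>2 - 1)" for n
    using s[of n] c by (simp add: field_simps)
  have R: "RR ^ k = 1 / (c\<^sup>2) ^ k" for k by (simp add: c_def power_divide)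
  define x where "x = (c\<^sup>2) ^ j"
  have x: "x \<noteq> 0" using c by (simp add: x_def)
  have cc: "cc = c * (1 / (c\<^sup>2 - 1))" using c by (simp add: c_def field_simps power2_eq_square)
  \<comment> \<open>With d = q^2 - 1 and x = q^(2j) as independent variables the claim is an
    identity of rational functions.\<close>
  have key: "((d + 1) * ((d + 1) * x) - 1) / d * (((d + 1) * x - 1) / d) * (1 / ((d + 1) * x)) =
      ((d + 1) * x - 1) / d * ((x - 1) / d) * (1 / x) + 1 / d * ((d + 1) * x - 1 / ((d + 1) * x))"
    if "d \<noteq> 0" "d + 1 \<noteq> 0" for d
    using that x by (simp add: divide_simps, simp add: algebra_simps)
  have "((c\<^sup>2) ^ Suc (Suc j) - 1) / (c\<^sup>2 - 1) * (((c\<^sup>2) ^ Suc j - 1) / (c\<^sup>2 - 1)) * (1 / (c\<^sup>2) ^ Suc j) =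
      ((c\<^sup>2) ^ Suc j - 1) / (c\<^sup>2 - 1) * (((c\<^sup>2) ^ j - 1) / (c\<^sup>2 - 1)) * (1 / (c\<^sup>2) ^ j) +
      1 / (c\<^sup>2 - 1) * ((c\<^sup>2) ^ Suc j - 1 / (c\<^sup>2) ^ Suc j)"
    using key[of "c\<^sup>2 - 1"] c by (simp add: x_def)
  then have "c * (((c\<^sup>2) ^ Suc (Suc j) - 1) / (c\<^sup>2 - 1) * (((c\<^sup>2) ^ Suc j - 1) / (c\<^sup>2 - 1)) * (1 / (c\<^sup>2) ^ Suc j)) =
      c * (((c\<^sup>2) ^ Suc j - 1) / (c\<^sup>2 - 1) * (((c\<^sup>2) ^ j - 1) / (c\<^sup>2 - 1)) * (1 / (c\<^sup>2) ^ j) +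
      1 / (c\<^sup>2 - 1) * ((c\<^sup>2) ^ Suc j - 1 / (c\<^sup>2) ^ Suc j))"
    by (rule arg_cong)
  moreover have "QQ ^ k = (c\<^sup>2) ^ k" for k by (simp add: c_def)
  ultimately show ?thesis
    unfolding mu_def n R cc c_def[symmetric] by (simp only: distrib_left mult.assoc)
qed

lemma mu_0: "mu q 0 = 0" by (simp add: mu_def)

lemma kap_nonzero: "kap q s \<noteq> 0"
  using q0 by (cases s) (simp_all add: kap_def)

lemma V_op_lin: "lin fun_sp fun_sp (V_op q s x)"
  by (cases x) (auto simp: lin_def fun_eq_iff algebra_simps split: nat.split)

lemma V_op_rep: "uq_rep q op_alg (V_op q s gK) (V_op q s gKi) (V_op q s gE) (V_op q s gF)"
proof -
  have 1: "of_real (1 / (q - 1 / q)) * (of_real (q\<^sup>2) ^ Suc j - of_real (1 / q\<^sup>2) ^ Suc j) = mu q (Suc j) - mu q j" for j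
    using mu_Suc[of j] by simp
  have 2: "mu q j * x + cc * ((QQ ^ Suc j) * x - RR ^ Suc j * x) = mu q (Suc j) * x" for j x
    by (simp only: mu_Suc) (simp add: algebra_simps)
  have 3: "kap q s ^ j * (1 / kap q s) ^ j = 1" for j
    using kap_nonzero[of s] by (simp add: power_divide)
  have k: "1 / RR = QQ" "1 / QQ = RR" by simp_all
  note QR = scal_cancel[OF q0]
  have 4: "QQ * (RR * x) = x" "RR * (QQ * x) = x" "QQ * (x * RR) = x" "RR * (x * QQ) = x" for x
    using QR by (metis mult.assoc mult.commute mult_1)+
  have 5: "QQ ^ n * RR ^ n = 1" "RR ^ n * QQ ^ n = 1" for n
    using QR by (metis power_mult_distrib power_one)+
  note [simp del] = of_real_divide of_real_diff of_real_power
  show ?thesis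
  proof (cases s)
    case Plus
    show ?thesis unfolding uq_rep_def using V_op_lin
      apply (auto simp: fun_eq_iff Plus kap_def k 3 4 5 mult.assoc mult.left_commute mult.commute mu_0 split: nat.split)
      using 2 by (auto simp: algebra_simps)
  next
    case Minus
    show ?thesis unfolding uq_rep_def using V_op_lin
      apply (auto simp: fun_eq_iff Minus kap_def k 3 4 5 mult.assoc mult.left_commute mult.commute mu_0 split: nat.split)
      using 2 by (auto simp: algebra_simps)
  qed
qed

lemma V_rep_hom: "V_rep q s \<in> calg_hom U op_alg"
  and V_rep_gen: "V_rep q s (ugen q x) = V_op q s x"
  using uq_ext_hom[where g = "V_op q s", OF calgebra_op_alg _ V_op_rep] V_op_lin[of s] by (simp_all add: V_rep_def)

lemma V_rep_module: "left_module U fun_sp (V_rep q s)"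
  by (rule left_module_hom[OF V_rep_hom])

lemma V_rels_closed: "V_rels q s \<subseteq> carrier U"
  by (cases s) (auto simp: V_rels_def vs_minus calgebra_Uq)

lemma V_module: "left_module U (V_mod q s) (V_act q s)"
  unfolding V_mod_def V_act_def by (rule left_module_cyclic[OF calgebra_Uq V_rels_closed])

lemma vs_V_mod [simp]: "vs (V_mod q s)"
  by (rule left_module_vs[OF V_module])

lemma V_gen_closed [simp]: "V_gen q s \<in> carrier (V_mod q s)"
  unfolding V_mod_def V_gen_def by (rule cyclic_gen_closed[OF calgebra_Uq V_rels_closed])

lemma V_act_closed [simp]: "\<xi> \<in> carrier U \<Longrightarrow> v \<in> carrier (V_mod q s) \<Longrightarrow> V_act q s \<xi> v \<in> carrier (V_mod q s)"
  by (rule left_module_closed[OF V_module])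

lemma carrier_V_mod: "carrier (V_mod q s) = (\<lambda>\<xi>. V_act q s \<xi> (V_gen q s)) ` carrier U"
  unfolding V_mod_def V_act_def V_gen_def by (rule carrier_cyclic[OF calgebra_Uq V_rels_closed])

lemma V_rels_kill:
  assumes W: "left_module U W act" and w: "w \<in> carrier W"
  shows "(\<forall>r\<in>V_rels q s. act r w = \<zero>\<^bsub>W\<^esub>) \<longleftrightarrow> act (ugen q (killing s)) w = \<zero>\<^bsub>W\<^esub> \<and> act KK w = w \<and> act KI w = w"
proof -
  note V = left_module_vs[OF W]
  have "act (ugen q x \<ominus>\<^bsub>U\<^esub> \<one>\<^bsub>U\<^esub>) w = act (ugen q x) w \<oplus>\<^bsub>W\<^esub> (-1) \<odot>\<^bsub>W\<^esub> w" for x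
    using lin_minus[OF left_module_lin_l[OF W w] vs_Uq V, of "ugen q x" "\<one>\<^bsub>U\<^esub>"] w
    by (simp add: calgebra_Uq vs_minus[OF V] left_module_one[OF W] left_module_closed[OF W])
  then show ?thesis
    using w by (simp add: V_rels_def vs_minus_eq_zero_iff[OF V] left_module_closed[OF W])
qed

lemma V_gen_rels: "V_act q s (ugen q (killing s)) (V_gen q s) = \<zero>\<^bsub>V_mod q s\<^esub>"
  "V_act q s KK (V_gen q s) = V_gen q s" "V_act q s KI (V_gen q s) = V_gen q s"
  using V_rels_kill[OF V_module[of s] V_gen_closed, of s] cyclic_gen_rel[OF calgebra_Uq V_rels_closed[of s]]
  by (simp_all add: V_mod_def V_act_def V_gen_def)

section \<open>Morphisms out of V_+(0), V_-(0), and coordinates on these modules\<close>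

context
  fixes W :: "(complex, 'w) module" and act w s
  assumes W: "left_module U W act" and w: "w \<in> carrier W"
    and rel: "act (ugen q (killing s)) w = \<zero>\<^bsub>W\<^esub>" "act KK w = w" "act KI w = w"
begin

private lemma rel': "\<And>r. r \<in> V_rels q s \<Longrightarrow> act r w = \<zero>\<^bsub>W\<^esub>"
  using V_rels_kill[OF W w, of s] rel by blast

lemma lin_V_ext: "lin (V_mod q s) W (cyclic_ext act w)"
  unfolding V_mod_def by (rule lin_cyclic_ext[OF calgebra_Uq V_rels_closed W w rel'])

lemma V_ext_gen: "cyclic_ext act w (V_gen q s) = w"
  unfolding V_gen_def by (rule cyclic_ext_gen[OF calgebra_Uq V_rels_closed W w rel'])

lemma V_ext_act: "\<xi> \<in> carrier U \<Longrightarrow> v \<in> carrier (V_mod q s) \<Longrightarrow>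
    cyclic_ext act w (V_act q s \<xi> v) = act \<xi> (cyclic_ext act w v)"
  unfolding V_mod_def V_act_def by (rule cyclic_ext_act[OF calgebra_Uq V_rels_closed W w rel'])

end

private lemma coord_rel:
  "V_rep q s (ugen q (killing s)) (\<lambda>j. if j = 0 then 1 else 0) = \<zero>\<^bsub>fun_sp\<^esub>"
  "V_rep q s KK (\<lambda>j. if j = 0 then 1 else 0) = (\<lambda>j. if j = 0 then 1 else 0)"
  "V_rep q s KI (\<lambda>j. if j = 0 then 1 else 0) = (\<lambda>j. if j = 0 then 1 else 0)"
  by (cases s; auto simp: V_rep_gen fun_eq_iff)+

private lemma delta_closed: "(\<lambda>j. if j = 0 then 1 else 0) \<in> carrier fun_sp" by simp

lemma lin_V_coord: "lin (V_mod q s) fun_sp (V_coord q s)"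
  unfolding V_coord_def by (rule lin_V_ext[OF V_rep_module delta_closed coord_rel])

lemma V_coord_act: "\<xi> \<in> carrier U \<Longrightarrow> v \<in> carrier (V_mod q s) \<Longrightarrow> V_coord q s (V_act q s \<xi> v) = V_rep q s \<xi> (V_coord q s v)"
  unfolding V_coord_def by (rule V_ext_act[OF V_rep_module delta_closed coord_rel])

lemma V_coord_gen: "V_coord q s (V_gen q s) = (\<lambda>j. if j = 0 then 1 else 0)"
  unfolding V_coord_def by (rule V_ext_gen[OF V_rep_module delta_closed coord_rel])

private lemma pow_closed [simp]: "gg s [^]\<^bsub>U\<^esub> (j::nat) \<in> carrier U"
proof -
  interpret ring U by (rule calgebra_ring[OF calgebra_Uq])
  show ?thesis by simp
qed

private lemma pow_Suc: "gg s [^]\<^bsub>U\<^esub> Suc j = gg s \<otimes>\<^bsub>U\<^esub> (gg s [^]\<^bsub>U\<^esub> j)"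
proof -
  interpret ring U by (rule calgebra_ring[OF calgebra_Uq])
  show ?thesis by (rule nat_pow_Suc2) simp
qed

lemma V_bas_closed [simp]: "V_bas q s j \<in> carrier (V_mod q s)"
  by (simp add: V_bas_def)

lemma V_bas_0: "V_bas q s 0 = V_gen q s"
  by (simp add: V_bas_def left_module_one[OF V_module])

lemma V_bas_Suc: "V_bas q s (Suc j) = V_act q s (gg s) (V_bas q s j)"
  unfolding V_bas_def pow_Suc by (simp add: left_module_mult[OF V_module])

lemma V_coord_bas: "V_coord q s (V_bas q s i) = (\<lambda>j. if j = i then 1 else 0)"
proof (induction i)
  case 0
  then show ?case by (simp add: V_bas_0 V_coord_gen)
next
  case (Suc i)
  then show ?case
    by (cases s) (auto simp: V_bas_Suc V_coord_act V_rep_gen fun_eq_iff split: nat.split)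
qed

private lemmas V_act_simps = left_module_mult[OF V_module, symmetric] lin_smult[OF left_module_lin_r[OF V_module]]
  lin_smult[OF left_module_lin_l[OF V_module]] lin_add[OF left_module_lin_l[OF V_module]] vs_smult_smult calgebra_Uq

lemma V_act_K_bas: "V_act q s KK (V_bas q s j) = kap q s ^ j \<odot>\<^bsub>V_mod q s\<^esub> V_bas q s j"
  and V_act_Ki_bas: "V_act q s KI (V_bas q s j) = (1 / kap q s) ^ j \<odot>\<^bsub>V_mod q s\<^esub> V_bas q s j"
proof -
  note [simp del] = of_real_divide of_real_diff of_real_power
  have c: "KK \<otimes>\<^bsub>U\<^esub> gg s = kap q s \<odot>\<^bsub>U\<^esub> (gg s \<otimes>\<^bsub>U\<^esub> KK)"
    using Uq_rules[OF q0] by (cases s) (simp_all add: kap_def)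
  have "1 / RR = QQ" "1 / QQ = RR" by (simp_all add: of_real_divide)
  then have ci: "KI \<otimes>\<^bsub>U\<^esub> gg s = (1 / kap q s) \<odot>\<^bsub>U\<^esub> (gg s \<otimes>\<^bsub>U\<^esub> KI)"
    using Uq_rules[OF q0] by (cases s) (simp_all add: kap_def)
  show "V_act q s KK (V_bas q s j) = kap q s ^ j \<odot>\<^bsub>V_mod q s\<^esub> V_bas q s j"
  proof (induction j)
    case (Suc j)
    have "V_act q s KK (V_bas q s (Suc j)) = kap q s \<odot>\<^bsub>V_mod q s\<^esub> V_act q s (gg s) (V_act q s KK (V_bas q s j))"
      by (simp add: V_bas_Suc V_act_simps c)
    then show ?case by (simp add: Suc lin_smult[OF left_module_lin_r[OF V_module]] vs_smult_smult V_bas_Suc)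
  qed (simp add: V_bas_0 V_gen_rels)
  show "V_act q s KI (V_bas q s j) = (1 / kap q s) ^ j \<odot>\<^bsub>V_mod q s\<^esub> V_bas q s j"
  proof (induction j)
    case (Suc j)
    have "V_act q s KI (V_bas q s (Suc j)) = (1 / kap q s) \<odot>\<^bsub>V_mod q s\<^esub> V_act q s (gg s) (V_act q s KI (V_bas q s j))"
      by (simp add: V_bas_Suc V_act_simps ci)
    then show ?case by (simp add: Suc lin_smult[OF left_module_lin_r[OF V_module]] vs_smult_smult V_bas_Suc)
  qed (simp add: V_bas_0 V_gen_rels)
qed

text \<open>Moving the lowering generator past one raising generator adds a multiple of K - K^{-1},
  so the coefficients satisfy the recursion \<open>mu_Suc\<close>. The sign e accounts for FE
  against EF.\<close>

lemma V_act_killing_bas: "V_act q s (ugen q (killing s)) (V_bas q s (Suc j)) = (- mu q j) \<odot>\<^bsub>V_mod q s\<^esub> V_bas q s j"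
proof -
  define e :: complex where "e = (case s of Plus \<Rightarrow> -1 | Minus \<Rightarrow> 1)"
  let ?k = "ugen q (killing s)"
  note [simp del] = of_real_divide of_real_diff of_real_power
  have c: "?k \<otimes>\<^bsub>U\<^esub> gg s = gg s \<otimes>\<^bsub>U\<^esub> ?k \<oplus>\<^bsub>U\<^esub> (e * cc) \<odot>\<^bsub>U\<^esub> (KK \<oplus>\<^bsub>U\<^esub> (-1) \<odot>\<^bsub>U\<^esub> KI)"
  proof (cases s)
    case Minus
    then show ?thesis using Uq_rules[OF q0] by (simp add: e_def)
  next
    case Plus
    define A B where "A = FF \<otimes>\<^bsub>U\<^esub> EE" "B = cc \<odot>\<^bsub>U\<^esub> (KK \<oplus>\<^bsub>U\<^esub> (-1) \<odot>\<^bsub>U\<^esub> KI)"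
    have [simp]: "A \<in> carrier U" "B \<in> carrier U" by (simp_all add: A_B_def calgebra_Uq)
    have "(- cc) \<odot>\<^bsub>U\<^esub> (KK \<oplus>\<^bsub>U\<^esub> (-1) \<odot>\<^bsub>U\<^esub> KI) = (-1) \<odot>\<^bsub>U\<^esub> B"
      by (simp add: A_B_def vs_smult_smult calgebra_Uq)
    moreover have "EE \<otimes>\<^bsub>U\<^esub> FF = A \<oplus>\<^bsub>U\<^esub> B" using Uq_rules[OF q0] by (simp add: A_B_def)
    moreover have "A = (A \<oplus>\<^bsub>U\<^esub> B) \<oplus>\<^bsub>U\<^esub> (-1) \<odot>\<^bsub>U\<^esub> B" by (simp add: vs_a_assoc vs_minus_self)
    ultimately show ?thesis using Plus by (simp add: e_def A_B_def(1))
  qed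
  \<comment> \<open>Sign and eigenvalue change together between the two modules, so both lead to the
    same sequence \<open>mu\<close>.\<close>
  have k: "e * (kap q s ^ j - (1 / kap q s) ^ j) = - (QQ ^ j - RR ^ j)" for j
    by (cases s) (simp_all add: kap_def e_def of_real_divide)
  have step: "V_act q s ?k (V_bas q s (Suc j)) = V_act q s (gg s) (V_act q s ?k (V_bas q s j)) \<oplus>\<^bsub>V_mod q s\<^esub>
      (cc * - (QQ ^ j - RR ^ j)) \<odot>\<^bsub>V_mod q s\<^esub> V_bas q s j" for j
  proof -
    have "V_act q s ?k (V_bas q s (Suc j)) = V_act q s (gg s) (V_act q s ?k (V_bas q s j)) \<oplus>\<^bsub>V_mod q s\<^esub>
      (e * cc) \<odot>\<^bsub>V_mod q s\<^esub> (kap q s ^ j \<odot>\<^bsub>V_mod q s\<^esub> V_bas q s j \<oplus>\<^bsub>V_mod q s\<^esub> (-1) \<odot>\<^bsub>V_mod q s\<^esub> ((1 / kap q s) ^ j \<odot>\<^bsub>V_mod q s\<^esub> V_bas q s j))"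
      unfolding V_bas_Suc V_act_K_bas[symmetric] V_act_Ki_bas[symmetric]
      by (simp add: V_act_simps c del: left_module_mult)
    also have "(e * cc) \<odot>\<^bsub>V_mod q s\<^esub> (kap q s ^ j \<odot>\<^bsub>V_mod q s\<^esub> V_bas q s j \<oplus>\<^bsub>V_mod q s\<^esub> (-1) \<odot>\<^bsub>V_mod q s\<^esub> ((1 / kap q s) ^ j \<odot>\<^bsub>V_mod q s\<^esub> V_bas q s j)) =
      (cc * (e * (kap q s ^ j - (1 / kap q s) ^ j))) \<odot>\<^bsub>V_mod q s\<^esub> V_bas q s j"
      by (simp add: vs_smult_smult vs_smult_l_distr[symmetric] algebra_simps)
    finally show ?thesis unfolding k .
  qed
  show ?thesis
  proof (induction j)
    case 0
    show ?case using step[of 0] by (simp add: mu_0 V_bas_0 V_gen_rels lin_zero[OF left_module_lin_r[OF V_module] vs_V_mod vs_V_mod])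
  next
    case (Suc j)
    show ?case
      unfolding step[of "Suc j"] Suc mu_Suc
      by (simp add: lin_smult[OF left_module_lin_r[OF V_module]] V_bas_Suc[symmetric] vs_smult_l_distr[symmetric],
          simp add: algebra_simps)
  qed
qed

text \<open>The span of the vectors contains the generator and is stable under E, F, K and K^{-1},
  hence is everything; independence is \<open>V_coord_bas\<close>.\<close>

lemma V_basis: "basis (V_mod q s) (V_bas q s) (V_coord q s)"
proof -
  let ?V = "V_mod q s"
  define H where "H = \<Inter>{H. submodule H cplx ?V \<and> range (V_bas q s) \<subseteq> H}"
  have H: "submodule H cplx ?V" unfolding H_def
    by (rule submodule_Inter) (use submodule_carrier[OF vs_V_mod[of s]] in auto)
  have Hb: "V_bas q s j \<in> H" for j unfolding H_def by auto
  have Hl: "H \<subseteq> K" if "submodule K cplx ?V" "range (V_bas q s) \<subseteq> K" for K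
    unfolding H_def using that by auto
  have sm: "c \<odot>\<^bsub>?V\<^esub> x \<in> H" if "x \<in> H" for c x
    using H that by (simp add: submodule_vs_iff)
  have z: "\<zero>\<^bsub>?V\<^esub> \<in> H" using H by (simp add: submodule_vs_iff)
  have kb: "V_act q s (ugen q (killing s)) (V_bas q s j) \<in> H" for j
    by (cases j) (simp_all add: V_act_killing_bas sm Hb V_bas_0 V_gen_rels z)
  have gb: "V_act q s (gg s) (V_bas q s j) \<in> H" for j
    by (simp add: V_bas_Suc[symmetric] Hb)
  have "x = gK \<or> x = gKi \<or> x = generating s \<or> x = killing s" for x
    by (cases s; cases x) auto
  then have b: "V_act q s (ugen q x) (V_bas q s j) \<in> H" for x j
    using kb[of j] gb[of j] V_act_K_bas[of s j] V_act_Ki_bas[of s j] sm[OF Hb] by metis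
  have st: "V_act q s (ugen q x) v \<in> H" if "v \<in> H" for x v
  proof -
    have "range (V_bas q s) \<subseteq> {v \<in> carrier ?V. V_act q s (ugen q x) v \<in> H}" using b by auto
    from Hl[OF submodule_vimage[OF vs_V_mod vs_V_mod left_module_lin_r[OF V_module ugen_closed[of q x]] H] this] that
    show ?thesis by auto
  qed
  have "V_act q s \<xi> (V_gen q s) \<in> H" if "\<xi> \<in> carrier U" for \<xi>
    by (rule Uq_induct[OF that submodule_vimage[OF vs_Uq vs_V_mod left_module_lin_l[OF V_module V_gen_closed] H]])
      (use Hb[of 0] st in \<open>simp_all add: left_module_one[OF V_module] V_bas_0 left_module_mult[OF V_module]\<close>)
  then have "carrier ?V \<subseteq> H" by (auto simp: carrier_V_mod)
  then have "spans ?V (range (V_bas q s))" unfolding H_def by (intro spansI) auto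
  then show ?thesis by (simp add: basis_def lin_V_coord V_coord_bas)
qed

end

end

section \<open>The dual algebras\<close>

text \<open>S(E) v_+(0) = -q^(-2) E v_+(0) and S(F) v_-(0) = -F v_-(0). Hence a_- takes the value
  -q^2 on E v_+(0), and a_+ the value -1 on F v_-(0).\<close>

definition tau :: "real \<Rightarrow> sgn \<Rightarrow> complex" where
  "tau q s = (case s of Plus \<Rightarrow> of_real (q\<^sup>2) | Minus \<Rightarrow> 1)"

text \<open>The value of the a-th power of a_+ or a_- on \<open>V_bas q s a\<close>. The q-factorial
  makes up for the Gaussian binomials of \<open>tc_comult\<close>.\<close>

definition dbeta :: "real \<Rightarrow> sgn \<Rightarrow> nat \<Rightarrow> complex" where
  "dbeta q s a = (- tau q s) ^ a * qf q a"

text \<open>Normalised so that \<open>dual_bas q s k\<close> is the \<open>k\<close>-th power of $a_\pm$.\<close>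

definition dual_bas :: "real \<Rightarrow> sgn \<Rightarrow> nat \<Rightarrow> dq" where
  "dual_bas q s k = (\<lambda>v \<in> carrier (V_mod q s). dbeta q s k * V_coord q s v k)"

definition dual_cf :: "real \<Rightarrow> sgn \<Rightarrow> dq \<Rightarrow> nat \<Rightarrow> complex" where
  "dual_cf q s f k = f (V_bas q s k) / dbeta q s k"

context uq
begin

context
begin

private abbreviation "V s \<equiv> V_mod q s"
private abbreviation "D s \<equiv> dual_alg q s"

lemma tau_nonzero: "tau q s \<noteq> 0"
  using q by (cases s) (simp_all add: tau_def)

lemma dbeta_nonzero: "dbeta q s k \<noteq> 0"
  using q by (simp add: dbeta_def tau_nonzero qf_nonzero)

lemma dbeta_Suc: "dbeta q s (Suc k) = - tau q s * qn q (Suc k) * dbeta q s k"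
  by (simp add: dbeta_def)

lemma dbeta_0 [simp]: "dbeta q s 0 = 1"
  by (simp add: dbeta_def)

lemma dual_alg_simps [simp]:
  "f \<otimes>\<^bsub>D s\<^esub> g = (\<lambda>v \<in> carrier (V s). tensor_ext cplx (\<lambda>x y. f x * g y) (V_comult q s v))"
  "\<one>\<^bsub>D s\<^esub> = (\<lambda>v \<in> carrier (V s). V_counit v)" "\<zero>\<^bsub>D s\<^esub> = (\<lambda>v \<in> carrier (V s). 0)"
  "f \<oplus>\<^bsub>D s\<^esub> g = (\<lambda>v \<in> carrier (V s). f v + g v)" "c \<odot>\<^bsub>D s\<^esub> f = (\<lambda>v \<in> carrier (V s). c * f v)"
  by (simp_all add: dual_alg_def Let_def)

text \<open>Each component is the line through one basis vector, so the finiteness condition can be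
  tested on basis vectors.\<close>

lemma carrier_dual_alg: "f \<in> carrier (D s) \<longleftrightarrow>
    lin (V s) cplx f \<and> f \<in> extensional (carrier (V s)) \<and> finite {j. f (V_bas q s j) \<noteq> 0}"
proof -
  have "lin (V s) cplx f \<Longrightarrow> (\<exists>v\<in>V_comp q s j. f v \<noteq> 0) \<longleftrightarrow> f (V_bas q s j) \<noteq> 0" for j
    using q V_bas_closed[of s j]
    by (auto simp: V_comp_def V_bas_def[symmetric] lin_smult intro!: exI[of _ 1])
  then show ?thesis
    by (auto simp: dual_alg_def Let_def lin_maps_def lin_def PiE_def)
qed

private lemma dual_lin: "f \<in> carrier (D s) \<Longrightarrow> lin (V s) cplx f"
  by (simp add: carrier_dual_alg)

lemma dual_eqI:
  assumes "lin (V s) cplx f" "f \<in> extensional (carrier (V s))" "lin (V s) cplx g" "g \<in> extensional (carrier (V s))"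
    and "\<And>a. f (V_bas q s a) = g (V_bas q s a)"
  shows "f = g"
proof (rule extensionalityI[OF assms(2,4)])
  fix v assume v: "v \<in> carrier (V s)"
  show "f v = g v"
    by (rule basis_lin_eqI[OF V_basis vs_cplx assms(1,3,5) v])
qed

lemma vs_dual_alg [simp]: "vs (D s)"
proof (rule vsI)
  note [simp] = V_bas_closed vs_V_mod
  fix f g assume f: "f \<in> carrier (D s)" and g: "g \<in> carrier (D s)"
  have "{j. f (V_bas q s j) + g (V_bas q s j) \<noteq> 0} \<subseteq> {j. f (V_bas q s j) \<noteq> 0} \<union> {j. g (V_bas q s j) \<noteq> 0}"
    by auto
  then have "finite {j. f (V_bas q s j) + g (V_bas q s j) \<noteq> 0}"
    by (rule finite_subset) (use f g in \<open>auto simp: carrier_dual_alg\<close>)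
  then show "f \<oplus>\<^bsub>D s\<^esub> g \<in> carrier (D s)"
    using f g by (auto simp: carrier_dual_alg lin_def algebra_simps)
next
  note [simp] = V_bas_closed vs_V_mod
  fix f c assume f: "f \<in> carrier (D s)"
  have "{j. c * f (V_bas q s j) \<noteq> 0} \<subseteq> {j. f (V_bas q s j) \<noteq> 0}" by auto
  then have "finite {j. c * f (V_bas q s j) \<noteq> 0}"
    by (rule finite_subset) (use f in \<open>auto simp: carrier_dual_alg\<close>)
  then show "c \<odot>\<^bsub>D s\<^esub> f \<in> carrier (D s)"
    using f by (auto simp: carrier_dual_alg lin_def algebra_simps)
next
  note [simp] = V_bas_closed vs_V_mod
  show "\<zero>\<^bsub>D s\<^esub> \<in> carrier (D s)" by (auto simp: carrier_dual_alg lin_def)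
qed (auto simp: carrier_dual_alg algebra_simps extensional_def fun_eq_iff)

lemma dual_bas_closed [simp]: "dual_bas q s a \<in> carrier (D s)"
proof -
  have "{j. dual_bas q s a (V_bas q s j) \<noteq> 0} \<subseteq> {a}"
    by (auto simp: dual_bas_def V_coord_bas V_bas_closed)
  then have "finite {j. dual_bas q s a (V_bas q s j) \<noteq> 0}" by (rule finite_subset) simp
  moreover have "lin (V s) cplx (dual_bas q s a)"
    using lin_V_coord[of s] vs_V_mod[of s] by (auto simp: dual_bas_def lin_def algebra_simps)
  ultimately show ?thesis by (auto simp: carrier_dual_alg dual_bas_def)
qed

lemma dual_bas_bas: "dual_bas q s a (V_bas q s j) = (if j = a then dbeta q s a else 0)"
  by (auto simp: dual_bas_def V_coord_bas V_bas_closed)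

lemma dual_basis: "basis (D s) (dual_bas q s) (dual_cf q s)"
proof (rule basisI)
  show "lin (D s) fun_sp (dual_cf q s)"
    by (rule linI) (auto simp: dual_cf_def V_bas_closed fun_eq_iff add_divide_distrib)
  show "dual_cf q s (dual_bas q s i) = (\<lambda>j. if j = i then 1 else 0)" for i
    by (auto simp: dual_cf_def dual_bas_bas dbeta_nonzero)
  show "finite {i. dual_cf q s f i \<noteq> 0}" if "f \<in> carrier (D s)" for f
    using that by (simp add: dual_cf_def dbeta_nonzero carrier_dual_alg)
  show "f = g" if "f \<in> carrier (D s)" "g \<in> carrier (D s)" "dual_cf q s f = dual_cf q s g" for f g
    by (rule dual_eqI) (use that in \<open>auto simp: carrier_dual_alg dual_cf_def fun_eq_iff dbeta_nonzero\<close>)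
qed simp_all

subsection \<open>The comultiplication of $V_\pm(0)$\<close>

private abbreviation "ptV s \<equiv> ptens (V s) (V s)"
private abbreviation "VT s \<equiv> tensor (V s) (V s)"
private abbreviation "ta s \<equiv> tens_act (V s) (V_act q s) (V s) (V_act q s)"

private lemmas VV = vs_V_mod V_bas_closed V_gen_closed V_act_closed

private lemma tensor_module: "left_module U (VT s) (tensor_act (uq_comult_op q) (V s) (V_act q s) (V s) (V_act q s))"
  by (rule left_module_tensor_act[OF V_module V_module calgebra_Uq uq_comult_op_hom])

private lemma ta_module: "left_module (tensor_alg U U) (VT s) (ta s)"
  by (rule left_module_tensor(1)[OF V_module V_module calgebra_Uq calgebra_Uq])

private lemma ta_pt: "\<xi> \<in> carrier U \<Longrightarrow> \<eta> \<in> carrier U \<Longrightarrow> v \<in> carrier (V s) \<Longrightarrow> w \<in> carrier (V s) \<Longrightarrow>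
    ta s (ptens U U \<xi> \<eta>) (ptV s v w) = ptV s (V_act q s \<xi> v) (V_act q s \<eta> w)"
  by (rule left_module_tensor(2)[OF V_module V_module calgebra_Uq calgebra_Uq])

private lemma ta_add: "X \<in> carrier (tensor U U) \<Longrightarrow> Y \<in> carrier (tensor U U) \<Longrightarrow> t \<in> carrier (VT s) \<Longrightarrow>
    ta s (X \<oplus>\<^bsub>tensor U U\<^esub> Y) t = ta s X t \<oplus>\<^bsub>VT s\<^esub> ta s Y t"
  using lin_add[OF left_module_lin_l[OF ta_module]] by simp

private lemma pt_zero: "v \<in> carrier (V s) \<Longrightarrow> ptV s v \<zero>\<^bsub>V s\<^esub> = \<zero>\<^bsub>VT s\<^esub>" "v \<in> carrier (V s) \<Longrightarrow> ptV s \<zero>\<^bsub>V s\<^esub> v = \<zero>\<^bsub>VT s\<^esub>"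
  using lin_zero[OF bilin_r[OF bilin_ptens[OF VV(1) VV(1)]] VV(1) vs_tensor[OF VV(1) VV(1)]]
    lin_zero[OF bilin_l[OF bilin_ptens[OF VV(1) VV(1)]] VV(1) vs_tensor[OF VV(1) VV(1)]] by blast+

text \<open>What makes \<open>V_comult\<close> well defined: every summand of the opposite
  comultiplication of the killing generator has that generator in one factor, and K acts trivially
  on both factors.\<close>

private lemma comult_rel:
  "tensor_act (uq_comult_op q) (V s) (V_act q s) (V s) (V_act q s) (ugen q (killing s)) (ptV s (V_gen q s) (V_gen q s)) = \<zero>\<^bsub>VT s\<^esub>"
  "tensor_act (uq_comult_op q) (V s) (V_act q s) (V s) (V_act q s) KK (ptV s (V_gen q s) (V_gen q s)) = ptV s (V_gen q s) (V_gen q s)"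
  "tensor_act (uq_comult_op q) (V s) (V_act q s) (V s) (V_act q s) KI (ptV s (V_gen q s) (V_gen q s)) = ptV s (V_gen q s) (V_gen q s)"
  using V_gen_rels[of s]
  by (cases s; simp add: tensor_act_tens_act uq_comult_op_gen ta_pt ta_add VV calgebra_Uq pt_zero)+

private lemma pt_gen_closed: "ptV s (V_gen q s) (V_gen q s) \<in> carrier (VT s)" by (simp add: VV)

lemma lin_V_comult: "lin (V s) (VT s) (V_comult q s)"
  unfolding V_comult_def by (rule lin_V_ext[OF tensor_module pt_gen_closed comult_rel])

lemma V_comult_gen: "V_comult q s (V_gen q s) = ptV s (V_gen q s) (V_gen q s)"
  unfolding V_comult_def by (rule V_ext_gen[OF tensor_module pt_gen_closed comult_rel])

lemma V_comult_act: "\<xi> \<in> carrier U \<Longrightarrow> v \<in> carrier (V s) \<Longrightarrow> V_comult q s (V_act q s \<xi> v) = ta s (uq_comult_op q \<xi>) (V_comult q s v)"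
  unfolding V_comult_def tensor_act_tens_act[symmetric] by (rule V_ext_act[OF tensor_module pt_gen_closed comult_rel])

private abbreviation "tc s a d \<equiv> tensor_ext cplx (\<lambda>x y. V_coord q s x a * V_coord q s y d)"

private lemma bilin_dual: "lin (V s) cplx f \<Longrightarrow> lin (V s) cplx g \<Longrightarrow> bilin (V s) (V s) cplx (\<lambda>x y. f x * g y)"
  by (auto simp: bilin_def lin_def algebra_simps)

private lemma lin_coord: "lin (V s) cplx (\<lambda>x. V_coord q s x a)"
  using lin_V_coord[of s] by (simp add: lin_def)

private lemmas tc_lin = lin_tensor_ext[OF VV(1) VV(1) vs_cplx bilin_dual[OF lin_coord lin_coord]]
private lemmas tc_pt = tensor_ext_ptens[OF VV(1) VV(1) vs_cplx bilin_dual[OF lin_coord lin_coord]]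

text \<open>The power of q^2 comes from K in E tensor K, respectively from K^{-1} in K^{-1} tensor
  F, acting on the factor whose index is not raised; so it depends on d in one case and on a in the
  other.\<close>

private lemma tc_step:
  assumes X: "X \<in> carrier (VT s)"
  shows "tc s a d (ta s (uq_comult_op q (gg s)) X) =
    (case s of Plus \<Rightarrow> (case d of 0 \<Rightarrow> 0 | Suc d' \<Rightarrow> tc s a d' X) + (case a of 0 \<Rightarrow> 0 | Suc a' \<Rightarrow> QQ ^ d * tc s a' d X)
       | Minus \<Rightarrow> (case d of 0 \<Rightarrow> 0 | Suc d' \<Rightarrow> QQ ^ a * tc s a d' X) + (case a of 0 \<Rightarrow> 0 | Suc a' \<Rightarrow> tc s a' d X))"
    (is "?l X = ?r X")
proof (rule lin_eq_on_tensor[where f = ?l and g = ?r, OF VV(1) VV(1) vs_cplx _ _ _ X])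
  have D: "uq_comult_op q (gg s) \<in> carrier (tensor_alg U U)"
    by (rule calg_hom_closed[OF uq_comult_op_hom ugen_closed])
  show "lin (VT s) cplx ?l"
    by (rule lin_comp[OF left_module_lin_r[OF ta_module D] tc_lin])
  show "lin (VT s) cplx ?r"
    using tc_lin[of s] by (cases s; auto simp: lin_def algebra_simps split: nat.split)
  have i: "1 / RR = QQ" "1 / (1 / QQ) = QQ" by simp_all
  fix x y assume "x \<in> carrier (V s)" "y \<in> carrier (V s)"
  then show "?l (ptV s x y) = ?r (ptV s x y)"
    by (cases s; simp add: uq_comult_op_gen ta_add ta_pt VV calgebra_Uq lin_add[OF tc_lin] tc_pt V_coord_act
      V_rep_gen left_module_one[OF V_module] kap_def i split: nat.split)
qed

text \<open>The coefficients are Gaussian binomials. The two recursions in \<open>tc_step\<close>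
  are the two forms of the q-Pascal rule, so both modules give the same answer.\<close>

private lemma tc_comult: "tc s a d (V_comult q s (V_bas q s j)) = (if a + d = j then qf q j / (qf q a * qf q d) else 0)"
proof (induction j arbitrary: a d)
  case 0
  show ?case by (simp add: V_bas_0 V_comult_gen tc_pt VV V_coord_gen)
next
  case (Suc j)
  note nz = qf_nonzero[OF q(1)] qn_nonzero[OF q(1)]
  have C: "V_comult q s (V_bas q s j) \<in> carrier (VT s)" by (rule lin_closed[OF lin_V_comult]) (simp add: VV)
  have e: "V_comult q s (V_bas q s (Suc j)) = ta s (uq_comult_op q (gg s)) (V_comult q s (V_bas q s j))"
    by (simp add: V_bas_Suc V_comult_act VV)
  \<comment> \<open>The Pascal rule over a common denominator, for any splitting of the q-integer
    [a'+d'+2] with weights x and y.\<close>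
  have 1: "qf q (Suc (a' + d')) / (qf q a' * qf q (Suc d')) * x + qf q (Suc (a' + d')) / (qf q (Suc a') * qf q d') * y
      = qf q (Suc (Suc (a' + d'))) / (qf q (Suc a') * qf q (Suc d'))"
    if "x * qn q (Suc a') + qn q (Suc d') * y = qn q (Suc (Suc (a' + d')))" for a' d' x y
  proof -
    have "qf q (Suc (Suc (a' + d'))) / (qf q (Suc a') * qf q (Suc d')) =
        (x * qn q (Suc a') + qn q (Suc d') * y) * qf q (Suc (a' + d')) / (qf q (Suc a') * qf q (Suc d'))"
      by (simp add: that)
    also have "\<dots> = qf q (Suc (a' + d')) / (qf q a' * qf q (Suc d')) * x + qf q (Suc (a' + d')) / (qf q (Suc a') * qf q d') * y"
      using nz by (simp add: field_simps del: qf.simps(2)) (simp add: algebra_simps)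
    finally show ?thesis by simp
  qed
  \<comment> \<open>The q-integer is split after d'+1 or after a'+1 terms; the first serves V_+(0),
    the second V_-(0).\<close>
  have 2: "qn q (Suc d') + QQ ^ Suc d' * qn q (Suc a') = qn q (Suc (Suc (a' + d')))"
    "qn q (Suc a') + QQ ^ Suc a' * qn q (Suc d') = qn q (Suc (Suc (a' + d')))" for a' d'
    using qn_add[of q "Suc d'" "Suc a'"] qn_add[of q "Suc a'" "Suc d'"] by (simp_all add: add.commute)
  have "(case s of Plus \<Rightarrow> (case d of 0 \<Rightarrow> 0 | Suc d' \<Rightarrow> if a + d' = j then qf q j / (qf q a * qf q d') else 0) +
          (case a of 0 \<Rightarrow> 0 | Suc a' \<Rightarrow> QQ ^ d * (if a' + d = j then qf q j / (qf q a' * qf q d) else 0))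
        | Minus \<Rightarrow> (case d of 0 \<Rightarrow> 0 | Suc d' \<Rightarrow> QQ ^ a * (if a + d' = j then qf q j / (qf q a * qf q d') else 0)) +
          (case a of 0 \<Rightarrow> 0 | Suc a' \<Rightarrow> if a' + d = j then qf q j / (qf q a' * qf q d) else 0)) =
        (if a + d = Suc j then qf q (Suc j) / (qf q a * qf q d) else 0)"
  proof (cases a)
    case 0
    then show ?thesis
      using nz by (cases d; cases s) (auto simp del: qf.simps(2))
  next
    case a: (Suc a')
    show ?thesis
    proof (cases d)
      case 0
      then show ?thesis
        using nz a by (cases s) (auto simp del: qf.simps(2))
    next
      case d: (Suc d')
      have "QQ ^ Suc d' * qn q (Suc a') + qn q (Suc d') * 1 = qn q (Suc (Suc (a' + d')))"
        "1 * qn q (Suc a') + qn q (Suc d') * QQ ^ Suc a' = qn q (Suc (Suc (a' + d')))"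
        using 2[where a' = a' and d' = d'] by (simp_all add: mult.commute add.commute del: power_Suc of_real_power)
      note 3 = 1[OF this(1)] 1[OF this(2)]
      show ?thesis
        using a d 3
        by (cases s) (auto simp: mult.commute add.commute simp del: qf.simps(2) power_Suc of_real_power)
    qed
  qed
  then show ?case unfolding e tc_step[OF C] Suc .
qed

subsection \<open>The algebra structure\<close>

private lemma lin_mult: "f \<in> carrier (D s) \<Longrightarrow> g \<in> carrier (D s) \<Longrightarrow> lin (V s) cplx (f \<otimes>\<^bsub>D s\<^esub> g)"
proof -
  assume f: "f \<in> carrier (D s)" and g: "g \<in> carrier (D s)"
  have "lin (V s) cplx (\<lambda>v. tensor_ext cplx (\<lambda>x y. f x * g y) (V_comult q s v))"
    by (rule lin_comp[OF lin_V_comult lin_tensor_ext[OF VV(1) VV(1) vs_cplx bilin_dual[OF dual_lin[OF f] dual_lin[OF g]]]])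
  then show ?thesis by (auto simp: lin_def VV)
qed

text \<open>The factorials in \<open>dbeta\<close> cancel the Gaussian binomial, so the basis
  multiplies like the powers of one variable.\<close>

lemma dual_mult_bas: "dual_bas q s a \<otimes>\<^bsub>D s\<^esub> dual_bas q s d = dual_bas q s (a + d)"
proof (rule dual_eqI)
  fix j
  have C: "V_comult q s (V_bas q s j) \<in> carrier (VT s)" by (rule lin_closed[OF lin_V_comult]) (simp add: VV)
  note nz = qf_nonzero[OF q(1)]
  have "tensor_ext cplx (\<lambda>x y. dual_bas q s a x * dual_bas q s d y) (V_comult q s (V_bas q s j)) =
      dbeta q s a * dbeta q s d * tc s a d (V_comult q s (V_bas q s j))"
  proof (rule lin_eq_on_tensor[where f = "tensor_ext cplx (\<lambda>x y. dual_bas q s a x * dual_bas q s d y)"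
        and g = "\<lambda>X. dbeta q s a * dbeta q s d * tc s a d X", OF VV(1) VV(1) vs_cplx _ _ _ C])
    note b = bilin_dual[OF dual_lin[OF dual_bas_closed] dual_lin[OF dual_bas_closed]]
    show "lin (VT s) cplx (tensor_ext cplx (\<lambda>x y. dual_bas q s a x * dual_bas q s d y))"
      by (rule lin_tensor_ext[OF VV(1) VV(1) vs_cplx b])
    show "lin (VT s) cplx (\<lambda>X. dbeta q s a * dbeta q s d * tc s a d X)"
      using lin_smult_fun[OF vs_cplx tc_lin] by simp
    show "tensor_ext cplx (\<lambda>x y. dual_bas q s a x * dual_bas q s d y) (ptV s x y) = dbeta q s a * dbeta q s d * tc s a d (ptV s x y)"
      if "x \<in> carrier (V s)" "y \<in> carrier (V s)" for x y
      using that by (simp add: tc_pt tensor_ext_ptens[OF VV(1) VV(1) vs_cplx b]) (simp add: dual_bas_def)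
  qed
  then show "(dual_bas q s a \<otimes>\<^bsub>D s\<^esub> dual_bas q s d) (V_bas q s j) = dual_bas q s (a + d) (V_bas q s j)"
    using nz by (auto simp: VV tc_comult dual_bas_bas dbeta_def power_add)
qed (simp_all add: lin_mult dual_lin del: dual_alg_simps(1), simp_all add: dual_bas_def)

private lemma mult_pointwise:
  assumes g: "g \<in> carrier (D s)" and v: "v \<in> carrier (V s)"
  shows "lin (D s) cplx (\<lambda>f. tensor_ext cplx (\<lambda>x y. f x * g y) (V_comult q s v))"
    "lin (D s) cplx (\<lambda>f. tensor_ext cplx (\<lambda>x y. g x * f y) (V_comult q s v))"
proof -
  have C: "V_comult q s v \<in> carrier (VT s)" by (rule lin_closed[OF lin_V_comult v])
  show "lin (D s) cplx (\<lambda>f. tensor_ext cplx (\<lambda>x y. f x * g y) (V_comult q s v))"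
    by (rule lin_tensor_ext_param[OF VV(1) VV(1) vs_cplx vs_dual_alg _ bilin_dual[OF dual_lin dual_lin[OF g]] C])
      (auto simp: lin_def algebra_simps)
  show "lin (D s) cplx (\<lambda>f. tensor_ext cplx (\<lambda>x y. g x * f y) (V_comult q s v))"
    by (rule lin_tensor_ext_param[OF VV(1) VV(1) vs_cplx vs_dual_alg _ bilin_dual[OF dual_lin[OF g] dual_lin] C])
      (auto simp: lin_def algebra_simps)
qed

private lemma mult_add_smult:
  assumes "f \<in> carrier (D s)" "f' \<in> carrier (D s)" "g \<in> carrier (D s)"
  shows "(f \<oplus>\<^bsub>D s\<^esub> f') \<otimes>\<^bsub>D s\<^esub> g = (f \<otimes>\<^bsub>D s\<^esub> g) \<oplus>\<^bsub>D s\<^esub> (f' \<otimes>\<^bsub>D s\<^esub> g)"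
    "g \<otimes>\<^bsub>D s\<^esub> (f \<oplus>\<^bsub>D s\<^esub> f') = (g \<otimes>\<^bsub>D s\<^esub> f) \<oplus>\<^bsub>D s\<^esub> (g \<otimes>\<^bsub>D s\<^esub> f')"
    "(c \<odot>\<^bsub>D s\<^esub> f) \<otimes>\<^bsub>D s\<^esub> g = c \<odot>\<^bsub>D s\<^esub> (f \<otimes>\<^bsub>D s\<^esub> g)"
    "g \<otimes>\<^bsub>D s\<^esub> (c \<odot>\<^bsub>D s\<^esub> f) = c \<odot>\<^bsub>D s\<^esub> (g \<otimes>\<^bsub>D s\<^esub> f)"
proof -
  note m = mult_pointwise[OF assms(3)]
  note [simp] = lin_add[OF m(1) assms(1,2)] lin_add[OF m(2) assms(1,2)] lin_smult[OF m(1) assms(1)] lin_smult[OF m(2) assms(1)]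
  note [simp del] = dual_alg_simps(4,5)
  show "(f \<oplus>\<^bsub>D s\<^esub> f') \<otimes>\<^bsub>D s\<^esub> g = (f \<otimes>\<^bsub>D s\<^esub> g) \<oplus>\<^bsub>D s\<^esub> (f' \<otimes>\<^bsub>D s\<^esub> g)"
    unfolding dual_alg_simps(4)[of s "f \<otimes>\<^bsub>D s\<^esub> g" "f' \<otimes>\<^bsub>D s\<^esub> g"] by (auto simp: fun_eq_iff restrict_def)
  show "g \<otimes>\<^bsub>D s\<^esub> (f \<oplus>\<^bsub>D s\<^esub> f') = (g \<otimes>\<^bsub>D s\<^esub> f) \<oplus>\<^bsub>D s\<^esub> (g \<otimes>\<^bsub>D s\<^esub> f')"
    unfolding dual_alg_simps(4)[of s "g \<otimes>\<^bsub>D s\<^esub> f" "g \<otimes>\<^bsub>D s\<^esub> f'"] by (auto simp: fun_eq_iff restrict_def)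
  show "(c \<odot>\<^bsub>D s\<^esub> f) \<otimes>\<^bsub>D s\<^esub> g = c \<odot>\<^bsub>D s\<^esub> (f \<otimes>\<^bsub>D s\<^esub> g)"
    unfolding dual_alg_simps(5)[of s c "f \<otimes>\<^bsub>D s\<^esub> g"] by (auto simp: fun_eq_iff restrict_def)
  show "g \<otimes>\<^bsub>D s\<^esub> (c \<odot>\<^bsub>D s\<^esub> f) = c \<odot>\<^bsub>D s\<^esub> (g \<otimes>\<^bsub>D s\<^esub> f)"
    unfolding dual_alg_simps(5)[of s c "g \<otimes>\<^bsub>D s\<^esub> f"] by (auto simp: fun_eq_iff restrict_def)
qed

private lemma mult_zero:
  assumes "g \<in> carrier (D s)"
  shows "\<zero>\<^bsub>D s\<^esub> \<otimes>\<^bsub>D s\<^esub> g = \<zero>\<^bsub>D s\<^esub>" "g \<otimes>\<^bsub>D s\<^esub> \<zero>\<^bsub>D s\<^esub> = \<zero>\<^bsub>D s\<^esub>"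
  using lin_zero[OF mult_pointwise(1)[OF assms] vs_dual_alg vs_cplx] lin_zero[OF mult_pointwise(2)[OF assms] vs_dual_alg vs_cplx]
  unfolding dual_alg_simps(1) by (auto simp: fun_eq_iff restrict_def simp del: dual_alg_simps(3)) (auto simp: restrict_def)

text \<open>That a product again vanishes on almost all components is seen on basis elements and
  extended by bilinearity, which holds already for the formulas.\<close>

lemma dual_mult_closed:
  assumes f: "f \<in> carrier (D s)" and g: "g \<in> carrier (D s)"
  shows "f \<otimes>\<^bsub>D s\<^esub> g \<in> carrier (D s)"
proof -
  note [simp del] = dual_alg_simps
  note [simp] = mult_add_smult mult_zero
  have 1: "dual_bas q s a \<otimes>\<^bsub>D s\<^esub> g \<in> carrier (D s)" if "g \<in> carrier (D s)" for a g
    by (rule basis_induct[OF dual_basis that])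
      (auto simp: submodule_vs_iff dual_mult_bas)
  show ?thesis
    by (rule basis_induct[OF dual_basis f]) (use g 1 in \<open>auto simp: submodule_vs_iff\<close>)
qed

lemma dual_mult_bilin: "bilin (D s) (D s) (D s) (\<lambda>f g. f \<otimes>\<^bsub>D s\<^esub> g)"
  by (intro bilinI linI) (simp_all add: mult_add_smult dual_mult_closed del: dual_alg_simps)

private lemma counit_module: "left_module U cplx (\<lambda>\<xi> c. uq_counit \<xi> * c)"
  by (rule left_moduleI)
    (auto simp: bilin_def lin_def algebra_simps calg_hom_mult[OF uq_counit_hom] calg_hom_one[OF uq_counit_hom]
      lin_add[OF calg_hom_lin[OF uq_counit_hom]] lin_smult[OF calg_hom_lin[OF uq_counit_hom]])

lemma dual_one: "\<one>\<^bsub>D s\<^esub> = dual_bas q s 0"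
proof (rule dual_eqI)
  have r: "uq_counit (ugen q (killing s)) * 1 = \<zero>\<^bsub>cplx\<^esub>" "uq_counit KK * 1 = 1" "uq_counit KI * 1 = 1" "1 \<in> carrier cplx"
    using uq_counit_gen by (cases s; simp)+
  note L = lin_V_ext[OF counit_module r(4,1,2,3)] and A = V_ext_act[OF counit_module r(4,1,2,3)]
    and G = V_ext_gen[OF counit_module r(4,1,2,3)]
  show "lin (V s) cplx \<one>\<^bsub>D s\<^esub>"
    using L by (auto simp: lin_def V_counit_def VV)
  show "\<one>\<^bsub>D s\<^esub> (V_bas q s a) = dual_bas q s 0 (V_bas q s a)" for a
  proof (cases a)
    case 0
    then show ?thesis using G dual_bas_bas[of s 0 0] by (simp add: VV V_counit_def V_bas_0)
  next
    case (Suc j)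
    have "uq_counit (gg s) = 0" using uq_counit_gen by (cases s) simp_all
    then show ?thesis using Suc dual_bas_bas[of s 0 "Suc j"] by (simp add: VV V_counit_def V_bas_Suc A)
  qed
qed (auto simp: dual_lin, simp add: dual_bas_def)

subsection \<open>The action\<close>

private lemmas S_hom = uq_antipode_hom
private lemma S_closed: "\<xi> \<in> carrier U \<Longrightarrow> uq_antipode q \<xi> \<in> carrier U"
  using calg_hom_closed[OF S_hom] by simp

private lemma dual_act_bas: "\<xi> \<in> carrier U \<Longrightarrow> v \<in> carrier (V s) \<Longrightarrow>
    dual_act q s \<xi> (dual_bas q s a) v = dbeta q s a * V_rep q s (uq_antipode q \<xi>) (V_coord q s v) a"
  by (simp add: dual_act_def dual_bas_def VV S_closed V_coord_act)

private lemma V_rep_mult: "\<xi> \<in> carrier U \<Longrightarrow> \<eta> \<in> carrier U \<Longrightarrow> V_rep q s ((-1) \<odot>\<^bsub>U\<^esub> (\<xi> \<otimes>\<^bsub>U\<^esub> \<eta>)) u = (\<lambda>i. - V_rep q s \<xi> (V_rep q s \<eta> u) i)"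
  using lin_smult[OF calg_hom_lin[OF V_rep_hom[of s]], of "\<xi> \<otimes>\<^bsub>U\<^esub> \<eta>" "-1"] calg_hom_mult[OF V_rep_hom[of s], of \<xi> \<eta>]
  by (simp add: calgebra_Uq)

private lemma dual_act_eqI:
  assumes "\<xi> \<in> carrier U" "\<And>u. dbeta q s a * V_rep q s (uq_antipode q \<xi>) u a = c * (dbeta q s d * u d)"
  shows "dual_act q s \<xi> (dual_bas q s a) = c \<odot>\<^bsub>D s\<^esub> dual_bas q s d"
proof
  fix v show "dual_act q s \<xi> (dual_bas q s a) v = (c \<odot>\<^bsub>D s\<^esub> dual_bas q s d) v"
    by (cases "v \<in> carrier (V s)") (use assms in \<open>auto simp: dual_act_bas\<close>, simp_all add: dual_act_def dual_bas_def)
qed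

lemma dual_act_K: "dual_act q s KK (dual_bas q s a) = (1 / kap q s) ^ a \<odot>\<^bsub>D s\<^esub> dual_bas q s a"
  by (rule dual_act_eqI) (simp_all add: uq_antipode_gen V_rep_gen)

lemma dual_act_Ki: "dual_act q s KI (dual_bas q s a) = kap q s ^ a \<odot>\<^bsub>D s\<^esub> dual_bas q s a"
  by (rule dual_act_eqI) (simp_all add: uq_antipode_gen V_rep_gen)

text \<open>At a = 0 the truncated index does no harm because \<open>qn q 0 = 0\<close>. The case a
  = 1 gives E a_- = 1 and F a_+ = 1.\<close>

lemma dual_act_generating:
  "dual_act q s (gg s) (dual_bas q s a) = (qn q a * RR ^ (a - 1)) \<odot>\<^bsub>D s\<^esub> dual_bas q s (a - 1)"
proof (rule dual_act_eqI)
  note QR = scal_cancel[OF q0]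
  have 4: "QQ * (RR * x) = x" for x
    using QR by (metis mult.assoc mult.commute mult_1)+
  have i: "1 / QQ = RR" by simp
  note [simp del] = of_real_divide of_real_diff of_real_power
  fix u show "dbeta q s a * V_rep q s (uq_antipode q (gg s)) u a = qn q a * RR ^ (a - 1) * (dbeta q s (a - 1) * u (a - 1))"
    by (cases a; cases s)
      (simp_all add: uq_antipode_gen V_rep_mult V_rep_gen dbeta_Suc tau_def kap_def i 4 mult.assoc mult.left_commute mult.commute)
qed simp

text \<open>\<open>mu\<close> contains q [a+1] [a], and the factor [a+1] is absorbed by passing from
  \<open>dbeta\<close> at a to \<open>dbeta\<close> at a+1. The case a = 1 gives F a_- = -q a_-^2
  and E a_+ = -q a_+^2.\<close>

lemma dual_act_killing:
  "dual_act q s (ugen q (killing s)) (dual_bas q s a) = (- of_real q * qn q a) \<odot>\<^bsub>D s\<^esub> dual_bas q s (Suc a)"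
proof (rule dual_act_eqI)
  note QR = scal_cancel[OF q0]
  have 4: "QQ * (RR * x) = x" "QQ * (x * RR) = x" for x
    using QR by (metis mult.assoc mult.commute mult_1)+
  have 5: "QQ ^ n * (x * RR ^ n) = x" "RR ^ n * (x * QQ ^ n) = x" "QQ ^ n * (RR ^ n * x) = x" "RR ^ n * (QQ ^ n * x) = x"
    "QQ ^ n * RR ^ n = 1" "RR ^ n * QQ ^ n = 1" for n x
    using QR by (metis mult.assoc mult.commute mult_1 power_mult_distrib power_one)+
  have i: "1 / QQ = RR" "1 / RR = QQ" by simp_all
  note [simp del] = of_real_divide of_real_diff of_real_power
  fix u show "dbeta q s a * V_rep q s (uq_antipode q (ugen q (killing s))) u a = - of_real q * qn q a * (dbeta q s (Suc a) * u (Suc a))"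
    by (cases s)
      (simp_all add: uq_antipode_gen V_rep_mult V_rep_gen dbeta_Suc tau_def kap_def i 4 5 mu_def mult.assoc mult.left_commute mult.commute)
qed simp

text \<open>The module identities hold pointwise: S reverses products, and so does precomposition.
  Closure is the substantial part, since finiteness of the support must be preserved; it is checked
  for generators on basis elements and carried along words.\<close>

lemma dual_module: "left_module U (D s) (dual_act q s)"
proof -
  note [simp] = S_closed VV
  have pw: "(dual_act q s \<xi> f) v = f (V_act q s (uq_antipode q \<xi>) v)" if "v \<in> carrier (V s)" for \<xi> f v
    using that by (simp add: dual_act_def)
  have ext: "f = g" if "f \<in> extensional (carrier (V s))" "g \<in> extensional (carrier (V s))" "\<And>v. v \<in> carrier (V s) \<Longrightarrow> f v = g v" for f g :: dq
    using that by (rule extensionalityI)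
  have da: "dual_act q s \<xi> f \<in> extensional (carrier (V s))" for \<xi> f by (simp add: dual_act_def)
  have lf: "dual_act q s \<xi> (f \<oplus>\<^bsub>D s\<^esub> g) = dual_act q s \<xi> f \<oplus>\<^bsub>D s\<^esub> dual_act q s \<xi> g"
    "dual_act q s \<xi> (c \<odot>\<^bsub>D s\<^esub> f) = c \<odot>\<^bsub>D s\<^esub> dual_act q s \<xi> f"
    "dual_act q s \<xi> \<zero>\<^bsub>D s\<^esub> = \<zero>\<^bsub>D s\<^esub>" if "\<xi> \<in> carrier U" for \<xi> f g c
    by (rule ext; use that in \<open>simp add: pw da\<close>)+
  have lx: "dual_act q s (\<xi> \<oplus>\<^bsub>U\<^esub> \<eta>) f = dual_act q s \<xi> f \<oplus>\<^bsub>D s\<^esub> dual_act q s \<eta> f"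
    "dual_act q s (c \<odot>\<^bsub>U\<^esub> \<xi>) f = c \<odot>\<^bsub>D s\<^esub> dual_act q s \<xi> f"
    "dual_act q s (\<xi> \<otimes>\<^bsub>U\<^esub> \<eta>) f = dual_act q s \<xi> (dual_act q s \<eta> f)"
    "dual_act q s \<one>\<^bsub>U\<^esub> f = f" "dual_act q s \<zero>\<^bsub>U\<^esub> f = \<zero>\<^bsub>D s\<^esub>"
    if [simp]: "\<xi> \<in> carrier U" "\<eta> \<in> carrier U" and f: "f \<in> carrier (D s)" for \<xi> \<eta> f c
  proof -
    note [simp] = lin_add[OF calg_hom_lin[OF S_hom], simplified] lin_smult[OF calg_hom_lin[OF S_hom], simplified]
      lin_add[OF left_module_lin_l[OF V_module]] lin_smult[OF left_module_lin_l[OF V_module]]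
      lin_add[OF dual_lin[OF f]] lin_smult[OF dual_lin[OF f]] calg_hom_mult[OF S_hom, simplified]
      left_module_mult[OF V_module] left_module_one[OF V_module] calg_hom_one[OF S_hom, simplified] calgebra_Uq
      lin_zero[OF calg_hom_lin[OF S_hom], simplified] lin_zero[OF left_module_lin_l[OF V_module] vs_Uq]
      lin_zero[OF dual_lin[OF f]]
    show "dual_act q s (\<xi> \<oplus>\<^bsub>U\<^esub> \<eta>) f = dual_act q s \<xi> f \<oplus>\<^bsub>D s\<^esub> dual_act q s \<eta> f"
      "dual_act q s (c \<odot>\<^bsub>U\<^esub> \<xi>) f = c \<odot>\<^bsub>D s\<^esub> dual_act q s \<xi> f"
      "dual_act q s (\<xi> \<otimes>\<^bsub>U\<^esub> \<eta>) f = dual_act q s \<xi> (dual_act q s \<eta> f)"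
      "dual_act q s \<one>\<^bsub>U\<^esub> f = f" "dual_act q s \<zero>\<^bsub>U\<^esub> f = \<zero>\<^bsub>D s\<^esub>"
      by (rule ext; use f in \<open>simp add: pw da carrier_dual_alg\<close>)+
  qed
  note lx' = lx(1,3) lx(2)[of \<xi> \<xi> for \<xi>] lx(4,5)[OF calg_one_closed[OF calgebra_Uq] calg_one_closed[OF calgebra_Uq]]
  note [simp del] = dual_alg_simps
  have sc: "c \<odot>\<^bsub>D s\<^esub> dual_bas q s k \<in> carrier (D s)" for c k
    by (rule vs_smult_closed[OF vs_dual_alg dual_bas_closed])
  have b: "dual_act q s (ugen q x) (dual_bas q s a) \<in> carrier (D s)" for x a
  proof -
    have "x = gK \<or> x = gKi \<or> x = generating s \<or> x = killing s"
      by (cases s; cases x) auto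
    then show ?thesis
      by (elim disjE) (simp_all only: dual_act_K dual_act_Ki dual_act_generating dual_act_killing sc)
  qed
  have g: "dual_act q s (ugen q x) f \<in> carrier (D s)" if "f \<in> carrier (D s)" for x f
    by (rule basis_induct[OF dual_basis that]) (auto simp: submodule_vs_iff lf b)
  have c: "\<forall>f \<in> carrier (D s). dual_act q s \<xi> f \<in> carrier (D s)" if "\<xi> \<in> carrier U" for \<xi>
    by (rule Uq_induct[OF that]) (auto simp: submodule_vs_iff lx' g calgebra_Uq)
  show ?thesis
    by (rule left_moduleI) (auto simp: lx' lf c intro!: bilinI linI)
qed

subsection \<open>The coordinate functionals\<close>

text \<open>S(E^j) v_+(0), respectively S(F^j) v_-(0), is a nonzero multiple of the j-th basis
  vector. The defining conditions thus prescribe a functional on a basis, which settles existence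
  and uniqueness.\<close>

lemma dual_coord_eq: "dual_coord q s = dual_bas q s 1"
proof -
  let ?w = "\<lambda>j::nat. V_act q s (uq_antipode q (gg s [^]\<^bsub>U\<^esub> j)) (V_gen q s)"
  have pc [simp]: "gg s [^]\<^bsub>U\<^esub> (j::nat) \<in> carrier U" for j
  proof -
    interpret ring U by (rule calgebra_ring[OF calgebra_Uq])
    show ?thesis by simp
  qed
  have ps: "gg s [^]\<^bsub>U\<^esub> Suc j = (gg s [^]\<^bsub>U\<^esub> j) \<otimes>\<^bsub>U\<^esub> gg s" for j
  proof -
    interpret ring U by (rule calgebra_ring[OF calgebra_Uq])
    show ?thesis by simp
  qed
  have p0: "gg s [^]\<^bsub>U\<^esub> (0::nat) = \<one>\<^bsub>U\<^esub>"
  proof -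
    interpret ring U by (rule calgebra_ring[OF calgebra_Uq])
    show ?thesis by simp
  qed
  \<comment> \<open>The multiple just mentioned: the step from index i to i+1 contributes
    -1/\<open>tau\<close> and a power of the eigenvalue of K or K^{-1}.\<close>
  define sg where "sg j = (\<Prod>i<j. - (1 / tau q s) * RR ^ i)" for j :: nat
  have i: "1 / QQ = RR" "1 / RR = QQ" by simp_all
  have g: "V_act q s (uq_antipode q (gg s)) (V_bas q s j) = (- (1 / tau q s) * RR ^ j) \<odot>\<^bsub>V s\<^esub> V_bas q s (Suc j)" for j
  proof -
    note [simp del] = of_real_divide of_real_diff of_real_power
    note [simp] = lin_smult[OF left_module_lin_l[OF V_module]] left_module_mult[OF V_module] calgebra_Uq VV
      V_act_K_bas V_act_Ki_bas lin_smult[OF left_module_lin_r[OF V_module]] vs_smult_smult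
    show ?thesis
    proof (cases s)
      case Plus
      then show ?thesis using V_bas_Suc[of Plus j, symmetric]
        by (simp add: uq_antipode_gen i tau_def kap_def)
    next
      case Minus
      then show ?thesis using V_bas_Suc[of Minus j, symmetric]
        by (simp add: uq_antipode_gen i tau_def kap_def)
    qed
  qed
  have w: "?w j = sg j \<odot>\<^bsub>V s\<^esub> V_bas q s j" for j
  proof (induction j)
    case 0
    show ?case by (simp only: p0) (simp add: calg_hom_one[OF S_hom, simplified] left_module_one[OF V_module] VV V_bas_0 sg_def)
  next
    case (Suc j)
    have "?w (Suc j) = V_act q s (uq_antipode q (gg s)) (?w j)"
      by (simp only: ps) (simp add: calg_hom_mult[OF S_hom, simplified] left_module_mult[OF V_module] VV S_closed)
    also have "\<dots> = sg (Suc j) \<odot>\<^bsub>V s\<^esub> V_bas q s (Suc j)"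
      unfolding Suc by (simp add: lin_smult[OF left_module_lin_r[OF V_module]] S_closed VV g vs_smult_smult sg_def)
    finally show ?case .
  qed
  have nz: "sg j \<noteq> 0" for j using tau_nonzero[of s] q0 by (simp add: sg_def)
  have sg1: "sg (Suc 0) = - (1 / tau q s)" by (simp add: sg_def)
  have ev: "f (?w j) = sg j * f (V_bas q s j)" if "f \<in> carrier (D s)" for f j
    unfolding w by (simp add: lin_smult[OF dual_lin[OF that]] VV)
  show ?thesis unfolding dual_coord_def
  proof (rule the_equality)
    show "dual_bas q s 1 \<in> carrier (D s) \<and> (\<forall>j. dual_bas q s 1 (?w j) = (if j = 1 then 1 else 0))"
      using sg1 tau_nonzero[of s] by (auto simp: ev dual_bas_bas dbeta_Suc)
    fix f assume f: "f \<in> carrier (D s) \<and> (\<forall>j. f (?w j) = (if j = 1 then 1 else 0))"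
    show "f = dual_bas q s 1"
    proof (rule dual_eqI)
      fix a
      have "sg a * f (V_bas q s a) = (if a = 1 then 1 else 0)" using f ev by metis
      then show "f (V_bas q s a) = dual_bas q s 1 (V_bas q s a)"
        using nz[of a] tau_nonzero[of s] by (cases "a = Suc 0") (auto simp: dual_bas_bas dbeta_Suc sg1 field_simps minus_equation_iff[of _ "tau q s"])
    qed (use f dual_bas_closed[of s 1] in \<open>auto simp: carrier_dual_alg\<close>)
  qed
qed

subsection \<open>The involution\<close>

text \<open>On the conjugate space the antilinear \<open>uq_theta\<close> gives an ordinary left
  module, so the star map is an instance of the universal property of V.\<close>

private lemma theta_module: "left_module U (conj_sp (V s)) (\<lambda>\<xi>. V_act q s (uq_star q (uq_antipode_inv q \<xi>)))"
proof (rule left_module_cong[OF left_module_comp[OF uq_theta_hom left_module_conj_sp[OF V_module]] calgebra_Uq])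
  show "V_act q s (uq_theta \<xi>) = V_act q s (uq_star q (uq_antipode_inv q \<xi>))" if "\<xi> \<in> carrier U" for \<xi>
    using that by (simp add: uq_theta_def uq_antipode_inv_eq)
qed

private lemma theta_eq: "\<xi> \<in> carrier U \<Longrightarrow> uq_star q (uq_antipode_inv q \<xi>) = uq_theta \<xi>"
  by (simp add: uq_theta_def uq_antipode_inv_eq)

lemma V_star_lin: "lin (V s) (conj_sp (V (flip_sgn s))) (V_star q s)"
  and V_star_bas: "V_star q s (V_bas q s j) = V_bas q (flip_sgn s) j"
proof -
  let ?t = "flip_sgn s" and ?act = "\<lambda>\<xi>. V_act q (flip_sgn s) (uq_star q (uq_antipode_inv q \<xi>))"
  have r: "?act (ugen q (killing s)) (V_gen q ?t) = \<zero>\<^bsub>conj_sp (V ?t)\<^esub>" "?act KK (V_gen q ?t) = V_gen q ?t"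
    "?act KI (V_gen q ?t) = V_gen q ?t" "V_gen q ?t \<in> carrier (conj_sp (V ?t))"
    using V_gen_rels[of ?t] by (cases s; simp add: theta_eq uq_theta_gen VV)+
  note L = lin_V_ext[OF theta_module r(4,1,2,3)] and A = V_ext_act[OF theta_module r(4,1,2,3)]
    and G = V_ext_gen[OF theta_module r(4,1,2,3)]
  show "lin (V s) (conj_sp (V (flip_sgn s))) (V_star q s)" unfolding V_star_def by (rule L)
  have t: "uq_theta (gg s) = gg ?t" using uq_theta_gen by (cases s) simp_all
  show "V_star q s (V_bas q s j) = V_bas q (flip_sgn s) j"
  proof (induction j)
    case 0
    show ?case using G by (simp add: V_bas_0 V_star_def)
  next
    case (Suc j)
    then show ?case by (simp add: V_bas_Suc V_star_def A VV theta_eq t)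
  qed
qed

lemma flip_flip [simp]: "flip_sgn (flip_sgn s) = s" by (cases s) auto

lemma dual_star_lin: "lin (D s) (conj_sp (D (flip_sgn s))) (dual_star q s)"
proof -
  let ?t = "flip_sgn s"
  have vs: "lin (V ?t) (conj_sp (V s)) (V_star q ?t)" using V_star_lin[of ?t] by simp
  note cl = lin_closed[OF vs, simplified]
  show ?thesis
  proof (rule linI)
    fix f assume f: "f \<in> carrier (D s)"
    have b: "dual_star q s f (V_bas q ?t j) = cnj (f (V_bas q s j))" for j
      using V_star_bas[of ?t j] by (simp add: dual_star_def VV)
    have "lin (V ?t) cplx (dual_star q s f)"
      using lin_add[OF vs] lin_smult[OF vs] cl lin_add[OF dual_lin[OF f]] lin_smult[OF dual_lin[OF f]]
      by (auto simp: dual_star_def lin_def VV)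
    then show "dual_star q s f \<in> carrier (conj_sp (D ?t))"
      using f by (simp add: carrier_dual_alg b) (simp add: dual_star_def)
  qed (auto simp: dual_star_def fun_eq_iff cl)
qed

text \<open>The star map fixes the index of basis vectors (\<open>V_star_bas\<close>), so only the
  ratio of the two normalisations \<open>dbeta\<close> remains; all constants are real.\<close>

lemma dual_star_bas: "dual_star q s (dual_bas q s a) = (tau q s / tau q (flip_sgn s)) ^ a \<odot>\<^bsub>D (flip_sgn s)\<^esub> dual_bas q (flip_sgn s) a"
proof (rule dual_eqI)
  let ?t = "flip_sgn s"
  have c: "dual_star q s (dual_bas q s a) \<in> carrier (D ?t)" using lin_closed[OF dual_star_lin dual_bas_closed] by simp
  have c': "(tau q s / tau q ?t) ^ a \<odot>\<^bsub>D ?t\<^esub> dual_bas q ?t a \<in> carrier (D ?t)"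
    by (rule vs_smult_closed[OF vs_dual_alg dual_bas_closed])
  show "lin (V ?t) cplx (dual_star q s (dual_bas q s a))" "dual_star q s (dual_bas q s a) \<in> extensional (carrier (V ?t))"
    "lin (V ?t) cplx ((tau q s / tau q ?t) ^ a \<odot>\<^bsub>D ?t\<^esub> dual_bas q ?t a)"
    "(tau q s / tau q ?t) ^ a \<odot>\<^bsub>D ?t\<^esub> dual_bas q ?t a \<in> extensional (carrier (V ?t))"
    using c c' by (simp_all add: carrier_dual_alg del: dual_alg_simps)
  fix j
  have qnc: "cnj (qn q n) = qn q n" for n by (simp add: qn_def)
  have qfc: "cnj (qf q n) = qf q n" for n by (induction n) (simp_all add: qnc)
  have "cnj (tau q s) = tau q s" by (cases s) (simp_all add: tau_def)
  then have bc: "cnj (dbeta q s a) = dbeta q s a" by (simp add: dbeta_def qfc)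
  have "dbeta q s a = (tau q s / tau q ?t) ^ a * dbeta q ?t a"
    using tau_nonzero by (simp add: dbeta_def power_divide power_minus[of "tau q _"])
  then show "dual_star q s (dual_bas q s a) (V_bas q ?t j) = ((tau q s / tau q ?t) ^ a \<odot>\<^bsub>D ?t\<^esub> dual_bas q ?t a) (V_bas q ?t j)"
    using V_star_bas[of ?t j] bc by (simp add: dual_star_def VV dual_bas_bas)
qed

declare dual_alg_simps [simp del]

end

end

section \<open>The algebra $\mathrm{Pol}(\mathfrak g_{-1})_q$\<close>

subsection \<open>Locally nilpotent operators\<close>

lemma funpow_lin: "lin V V X \<Longrightarrow> lin V V (X ^^ n)"
  by (induction n) (auto simp: lin_def)

text \<open>The index set in \<open>qexp_op\<close> depends on the vector. A common initial segment
  makes the sums for v, w and their sum comparable, as linearity requires.\<close>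

lemma qexp_op_superset:
  assumes V: "vs V" and X: "lin V V X" and v: "v \<in> carrier V" and N: "\<forall>n\<ge>N. (X ^^ n) v = \<zero>\<^bsub>V\<^esub>"
  shows "qexp_op t V X v = (\<Oplus>\<^bsub>V\<^esub>n\<in>{..<N}. of_real (1 / qfact t n) \<odot>\<^bsub>V\<^esub> (X ^^ n) v)"
proof -
  interpret abelian_monoid V by (rule vs_abelian_monoid[OF V])
  have "{n. (X ^^ n) v \<noteq> \<zero>\<^bsub>V\<^esub>} \<subseteq> {..<N}" using N by (metis (mono_tags) lessThan_iff mem_Collect_eq not_le subsetI)
  then show ?thesis unfolding qexp_op_def
    by (intro add.finprod_mono_neutral_cong_left) (use V v lin_closed[OF funpow_lin[OF X]] in auto)
qed

lemma lin_qexp_op: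
  assumes V: "vs V" and X: "lin V V X" and nil: "\<And>v. v \<in> carrier V \<Longrightarrow> \<exists>N. \<forall>n\<ge>N. (X ^^ n) v = \<zero>\<^bsub>V\<^esub>"
  shows "lin V V (qexp_op t V X)"
proof (rule linI)
  interpret abelian_monoid V by (rule vs_abelian_monoid[OF V])
  note Xn = funpow_lin[OF X]
  note [simp] = V lin_closed[OF Xn] lin_add[OF Xn] lin_smult[OF Xn]
  fix v assume v: "v \<in> carrier V"
  obtain N where N: "\<forall>n\<ge>N. (X ^^ n) v = \<zero>\<^bsub>V\<^esub>" using nil[OF v] by blast
  show "qexp_op t V X v \<in> carrier V"
    unfolding qexp_op_superset[OF V X v N] by (intro finsum_closed) (use v in auto)
  fix c
  have cN: "\<forall>n\<ge>N. (X ^^ n) (c \<odot>\<^bsub>V\<^esub> v) = \<zero>\<^bsub>V\<^esub>" using N v by simp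
  show "qexp_op t V X (c \<odot>\<^bsub>V\<^esub> v) = c \<odot>\<^bsub>V\<^esub> qexp_op t V X v"
    unfolding qexp_op_superset[OF V X vs_smult_closed[OF V v] cN] qexp_op_superset[OF V X v N]
    by (subst finsum_smult[OF V]) (use v in \<open>auto simp: vs_smult_smult mult.commute intro!: finsum_cong'\<close>)
  fix w assume w: "w \<in> carrier V"
  obtain M where M: "\<forall>n\<ge>M. (X ^^ n) w = \<zero>\<^bsub>V\<^esub>" using nil[OF w] by blast
  let ?N = "max N M"
  have 1: "\<forall>n\<ge>?N. (X ^^ n) v = \<zero>\<^bsub>V\<^esub>" "\<forall>n\<ge>?N. (X ^^ n) w = \<zero>\<^bsub>V\<^esub>"
    "\<forall>n\<ge>?N. (X ^^ n) (v \<oplus>\<^bsub>V\<^esub> w) = \<zero>\<^bsub>V\<^esub>"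
    using N M v w by simp_all
  show "qexp_op t V X (v \<oplus>\<^bsub>V\<^esub> w) = qexp_op t V X v \<oplus>\<^bsub>V\<^esub> qexp_op t V X w"
    unfolding qexp_op_superset[OF V X v 1(1)] qexp_op_superset[OF V X w 1(2)] qexp_op_superset[OF V X vs_add_closed[OF V v w] 1(3)]
    by (subst finsum_addf[symmetric]) (use v w in \<open>auto simp: vs_smult_r_distr intro!: finsum_cong'\<close>)
qed

lemma qfact_qf: "0 < q \<Longrightarrow> q < 1 \<Longrightarrow> complex_of_real (qfact (q\<^sup>2) n) = qf q n"
proof (induction n)
  case (Suc n)
  have q2: "q\<^sup>2 \<noteq> 1" using Suc.prems by (simp add: power2_eq_1_iff)
  have "(\<Sum>i<m. (q\<^sup>2) ^ i) = (1 - (q\<^sup>2) ^ m) / (1 - q\<^sup>2)" for m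
    using sum_gp_strict[of "q\<^sup>2" m] q2 by simp
  then have qm: "qn q m = complex_of_real ((1 - (q\<^sup>2) ^ m) / (1 - q\<^sup>2))" for m
  proof -
    have "qn q m = complex_of_real (\<Sum>i<m. (q\<^sup>2) ^ i)" by (simp add: qn_def)
    then show ?thesis using \<open>\<And>m. (\<Sum>i<m. (q\<^sup>2) ^ i) = (1 - (q\<^sup>2) ^ m) / (1 - q\<^sup>2)\<close>[of m] by simp
  qed
  then show ?case using Suc by (simp add: qfact_def prod.nat_ivl_Suc' mult.commute)
qed (simp add: qfact_def)

subsection \<open>Normal ordering\<close>

text \<open>The coefficient of F on a_+^n and of E on a_-^n, see \<open>dual_act_generating\<close>;
  at n = 0 the q-integer makes it 0.\<close>

definition ecoef :: "real \<Rightarrow> nat \<Rightarrow> complex" where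
  "ecoef q n = qn q n * of_real (1 / q\<^sup>2) ^ (n - 1)"

text \<open>The coefficient collected in n lowering steps from the power b. For n > b the product
  meets \<open>ecoef q 0\<close>, so truncated differences further on carry the coefficient
  0.\<close>

definition dcoef :: "real \<Rightarrow> nat \<Rightarrow> nat \<Rightarrow> complex" where
  "dcoef q b n = (\<Prod>i<n. ecoef q (b - i))"

text \<open>The coefficient of $a_+^{c-n}\otimes a_-^{b-n}$ in $\check R(a_-^b\otimes a_+^c)$.\<close>

definition ncoef :: "real \<Rightarrow> nat \<Rightarrow> nat \<Rightarrow> nat \<Rightarrow> complex" where
  "ncoef q b c n = of_real (q\<^sup>2) ^ (b * c) * (of_real (1 / q - q) ^ n * dcoef q b n * dcoef q c n / qf q n)"

lemma ecoef_0 [simp]: "ecoef q 0 = 0" by (simp add: ecoef_def)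
lemma ecoef_1 [simp]: "ecoef q (Suc 0) = 1" by (simp add: ecoef_def)

lemma dcoef_Suc: "dcoef q b (Suc n) = dcoef q b n * ecoef q (b - n)"
  by (simp add: dcoef_def)

lemma dcoef_0 [simp]: "dcoef q b 0 = 1" by (simp add: dcoef_def)

lemma dcoef_Suc_Suc: "dcoef q (Suc b) (Suc n) = ecoef q (Suc b) * dcoef q b n"
  unfolding dcoef_def prod.lessThan_Suc_shift by simp

lemma dcoef_zero: "b < n \<Longrightarrow> dcoef q b n = 0"
  unfolding dcoef_def by (rule prod_zero) (auto intro!: bexI[of _ b])

lemma ncoef_zero: "b < n \<or> c < n \<Longrightarrow> ncoef q b c n = 0"
  by (auto simp: ncoef_def dcoef_zero)

lemma ncoef_0: "ncoef q b c 0 = of_real (q\<^sup>2) ^ (b * c)"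
  by (simp add: ncoef_def)

text \<open>The recursion for reordering Y^(b+1) X^c: the coefficient at n+1 arises from the term
  n+1 by moving Y past a power of X, and from the term n by the constant that this leaves behind.
  For c at most n every term is 0.\<close>

lemma ncoef_Suc:
  assumes q: "0 < q" "q < 1" and n: "n \<le> b"
  shows "ncoef q (Suc b) c (Suc n) = of_real (q\<^sup>2) ^ (c - Suc n) * ncoef q b c (Suc n)
    + of_real (q * (1 - q\<^sup>2)) * qn q (c - n) * ncoef q b c n"
proof (cases "n < c")
  case False
  then show ?thesis by (simp add: ncoef_zero)
next
  case True
  define Q R s where "Q = complex_of_real (q\<^sup>2)" "R = complex_of_real (1 / q\<^sup>2)" "s = complex_of_real (1 / q - q)"
  have QR: "Q * R = 1" using q by (simp add: Q_R_s_def)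
  have QRn: "Q ^ k * R ^ k = 1" for k by (metis QR power_mult_distrib power_one)
  \<comment> \<open>The constant of the relation is the product of the weight factor of T on a_-
    tensor a_+ and the prefactor 1/q - q of E tensor F.\<close>
  have c0: "complex_of_real (q * (1 - q\<^sup>2)) = Q * s"
    using q by (simp add: Q_R_s_def field_simps power2_eq_square)
  obtain k where k: "c = Suc (n + k)" using True less_imp_Suc_add by blast
  obtain l where l: "b = n + l" using n le_Suc_ex by blast
  \<comment> \<open>What is left after common factors are removed. With b = n + l it amounts to
    [b+1] = [l] + q^(2l) [n+1].\<close>
  have key: "Q ^ c * (qn q (Suc b) * R ^ b) * R ^ k = Q ^ k * ecoef q l * R ^ k + Q * qn q (Suc n)"
  proof -
    have "Q ^ c * R ^ b * R ^ k = (Q ^ k * R ^ k) * (Q ^ n * R ^ n) * Q * R ^ l"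
      unfolding k l by (simp add: power_add algebra_simps)
    then have 1: "Q ^ c * (qn q (Suc b) * R ^ b) * R ^ k = Q * R ^ l * qn q (l + Suc n)"
      by (simp add: QRn l add.commute mult.commute mult.left_commute)
    have 2: "qn q (l + Suc n) = qn q l + Q ^ l * qn q (Suc n)"
      using qn_add[of q l "Suc n"] unfolding Q_R_s_def .
    have 3: "Q * R ^ l * (Q ^ l * x) = Q * x" for x
      using QRn[of l] by (metis mult.assoc mult.commute mult_1)
    have 4: "Q * R ^ l * qn q l = ecoef q l"
      by (cases l) (simp_all add: ecoef_def Q_R_s_def[symmetric] mult.assoc[symmetric] QR mult.commute
        del: of_real_divide of_real_power)
    have 5: "Q ^ k * ecoef q l * R ^ k = ecoef q l"
      using QRn[of k] by (metis mult.assoc mult.commute mult_1)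
    show ?thesis unfolding 1 2 5 distrib_left 3 4 ..
  qed
  have ec: "ecoef q (Suc k) = qn q (Suc k) * R ^ k" "ecoef q (Suc b) = qn q (Suc b) * R ^ b"
    by (simp_all add: ecoef_def Q_R_s_def)
  have nz: "qf q n \<noteq> 0" "qn q (Suc n) \<noteq> 0" using q by (simp_all add: qf_nonzero qn_nonzero)
  \<comment> \<open>The common factor of the three terms of the recursion, apart from
    q-factorials.\<close>
  define W where "W = Q ^ (b * c) * s ^ n * dcoef q b n * dcoef q c n * qn q (Suc k)"
  have "ncoef q (Suc b) c (Suc n) = W * s * (Q ^ c * (qn q (Suc b) * R ^ b) * R ^ k) / (qn q (Suc n) * qf q n)"
    unfolding ncoef_def W_def Q_R_s_def(1)[symmetric] Q_R_s_def(3)[symmetric] dcoef_Suc_Suc dcoef_Suc[of q c]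
    using k by (simp add: ec power_add algebra_simps)
  also have "\<dots> = W * s * (Q ^ k * ecoef q l * R ^ k) / (qn q (Suc n) * qf q n) + W * s * Q / qf q n"
    unfolding key using nz by (simp add: field_simps)
  also have "W * s * (Q ^ k * ecoef q l * R ^ k) / (qn q (Suc n) * qf q n) = Q ^ (c - Suc n) * ncoef q b c (Suc n)"
    unfolding ncoef_def W_def Q_R_s_def(1)[symmetric] Q_R_s_def(3)[symmetric] dcoef_Suc
    using k l by (simp add: ec algebra_simps)
  also have "W * s * Q / qf q n = of_real (q * (1 - q\<^sup>2)) * qn q (c - n) * ncoef q b c n"
    unfolding c0 ncoef_def W_def Q_R_s_def(1)[symmetric] Q_R_s_def(3)[symmetric]
    using k by (simp add: algebra_simps)
  finally show ?thesis by (simp add: Q_R_s_def)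
qed

text \<open>Left multiplication by X, on the coefficients u (i, j) of X^i Y^j.\<close>

definition X_op :: "(nat \<times> nat \<Rightarrow> complex) \<Rightarrow> nat \<times> nat \<Rightarrow> complex" where
  "X_op u = (\<lambda>(i, j). case i of 0 \<Rightarrow> 0 | Suc i' \<Rightarrow> u (i', j))"

text \<open>Left multiplication by Y on the same coefficients, read off from Y X^i = q^(2i) X^i Y +
  q(1-q^2) [i] X^(i-1). The entry at (i, j) receives the constant term of X^(i+1) Y^j, hence the
  index \<open>Suc i\<close>.\<close>

definition Y_op :: "real \<Rightarrow> (nat \<times> nat \<Rightarrow> complex) \<Rightarrow> nat \<times> nat \<Rightarrow> complex" where
  "Y_op q u = (\<lambda>(i, j). (case j of 0 \<Rightarrow> 0 | Suc j' \<Rightarrow> of_real (q\<^sup>2) ^ i * u (i, j'))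
     + of_real (q * (1 - q\<^sup>2)) * qn q (Suc i) * u (Suc i, j))"

lemma X_op_lin: "lin fun_sp fun_sp X_op"
  by (auto simp: lin_def X_op_def fun_eq_iff split: nat.split)

lemma Y_op_lin: "lin fun_sp fun_sp (Y_op q)"
  by (auto simp: lin_def Y_op_def fun_eq_iff algebra_simps split: nat.split)

lemma Y_X_op: "Y_op q (X_op u) p = of_real (q\<^sup>2) * X_op (Y_op q u) p + of_real (q * (1 - q\<^sup>2)) * u p"
proof -
  have "qn q (Suc (Suc i)) = 1 + of_real (q\<^sup>2) * qn q (Suc i)" for i by (rule qn_Suc')
  then show ?thesis
    by (cases p) (auto simp: X_op_def Y_op_def algebra_simps split: nat.split)
qed

lemma fun_lin_sum:
  assumes f: "lin fun_sp fun_sp f" and A: "finite A"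
  shows "f (\<lambda>p. \<Sum>n\<in>A. k n * u n p) = (\<lambda>p. \<Sum>n\<in>A. k n * f (u n) p)"
  using A
proof (induction A rule: finite_induct)
  case empty
  then show ?case using lin_zero[OF f] by simp
next
  case (insert x A)
  have "f (\<lambda>p. k x * u x p + (\<Sum>n\<in>A. k n * u n p)) = (\<lambda>p. k x * f (u x) p + f (\<lambda>p. \<Sum>n\<in>A. k n * u n p) p)"
    using lin_add[OF f, of "\<lambda>p. k x * u x p" "\<lambda>p. \<Sum>n\<in>A. k n * u n p"] lin_smult[OF f, of "u x" "k x"] by simp
  then show ?case using insert by simp
qed

text \<open>Each of the m exchanges leaves a constant, with weights 1, q^2, ..., q^(2(m-1)); they
  add up to the q-integer [m], which is 0 where \<open>m - 1\<close> is truncated.\<close>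

lemma Y_X_op_power: "Y_op q ((X_op ^^ m) u) p =
    of_real (q\<^sup>2) ^ m * (X_op ^^ m) (Y_op q u) p + of_real (q * (1 - q\<^sup>2)) * qn q m * (X_op ^^ (m - 1)) u p"
proof (induction m arbitrary: p)
  case (Suc m)
  let ?c = "complex_of_real (q * (1 - q\<^sup>2))"
  have IH: "Y_op q ((X_op ^^ m) u) = (\<lambda>p. of_real (q\<^sup>2) ^ m * (X_op ^^ m) (Y_op q u) p + (?c * qn q m) * (X_op ^^ (m - 1)) u p)"
    using Suc by (simp add: fun_eq_iff)
  have "X_op (Y_op q ((X_op ^^ m) u)) p = of_real (q\<^sup>2) ^ m * X_op ((X_op ^^ m) (Y_op q u)) p + (?c * qn q m) * X_op ((X_op ^^ (m - 1)) u) p"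
    unfolding IH by (cases p) (simp add: X_op_def split: nat.split)
  moreover have "(?c * qn q m) * X_op ((X_op ^^ (m - 1)) u) p = (?c * qn q m) * (X_op ^^ m) u p"
    by (cases m) simp_all
  ultimately have "Y_op q (X_op ((X_op ^^ m) u)) p = of_real (q\<^sup>2) * (of_real (q\<^sup>2) ^ m * X_op ((X_op ^^ m) (Y_op q u)) p
      + (?c * qn q m) * (X_op ^^ m) u p) + ?c * (X_op ^^ m) u p"
    unfolding Y_X_op by simp
  then show ?case by (simp add: qn_Suc'[of q m] algebra_simps)
qed simp

text \<open>One more Y is moved through X^(c-n) by \<open>Y_X_op_power\<close>, and the coefficients
  follow \<open>ncoef_Suc\<close>. The sum runs to b even if b > c, because the surplus coefficients
  vanish.\<close>

lemma normal_order:
  assumes q: "0 < q" "q < 1"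
  shows "(Y_op q ^^ b) ((X_op ^^ c) u) = (\<lambda>p. \<Sum>n<Suc b. ncoef q b c n * (X_op ^^ (c - n)) ((Y_op q ^^ (b - n)) u) p)"
proof -
  define k Q where "k = complex_of_real (q * (1 - q\<^sup>2))" and "Q = complex_of_real (q\<^sup>2)"
  note YX = Y_X_op_power[of q, folded k_def Q_def] and nS = ncoef_Suc[OF q, folded k_def Q_def]
    and n0 = ncoef_0[of q, folded Q_def]
  show ?thesis
  proof (induction b)
    case 0
    show ?case by (simp add: ncoef_0)
  next
    case (Suc b)
    let ?t = "\<lambda>n. (X_op ^^ (c - n)) ((Y_op q ^^ (Suc b - n)) u)"
    show ?case
    proof
      fix p
      have "(Y_op q ^^ Suc b) ((X_op ^^ c) u) p = (\<Sum>n<Suc b. ncoef q b c n * Y_op q ((X_op ^^ (c - n)) ((Y_op q ^^ (b - n)) u)) p)"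
        unfolding funpow.simps comp_apply Suc by (subst fun_lin_sum[OF Y_op_lin]) auto
      also have "\<dots> = (\<Sum>n<Suc b. Q ^ (c - n) * ncoef q b c n * ?t n p + k * qn q (c - n) * ncoef q b c n * ?t (Suc n) p)"
      proof (rule sum.cong[OF refl])
        fix n assume "n \<in> {..<Suc b}"
        then have "Y_op q ((Y_op q ^^ (b - n)) u) = (Y_op q ^^ (Suc b - n)) u" by (simp add: Suc_diff_le)
        then show "ncoef q b c n * Y_op q ((X_op ^^ (c - n)) ((Y_op q ^^ (b - n)) u)) p =
            Q ^ (c - n) * ncoef q b c n * ?t n p + k * qn q (c - n) * ncoef q b c n * ?t (Suc n) p"
          unfolding YX by (simp add: algebra_simps)
      qed
      \<comment> \<open>The additional term n = b+1 has coefficient 0; with it the first sum can be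
        split at n = 0 and shifted to match the second.\<close>
      also have "\<dots> = (\<Sum>n<Suc (Suc b). Q ^ (c - n) * ncoef q b c n * ?t n p) + (\<Sum>n<Suc b. k * qn q (c - n) * ncoef q b c n * ?t (Suc n) p)"
        unfolding sum.distrib sum.lessThan_Suc[of _ "Suc b"] by (simp add: ncoef_zero)
      also have "\<dots> = Q ^ c * ncoef q b c 0 * ?t 0 p + ((\<Sum>n<Suc b. Q ^ (c - Suc n) * ncoef q b c (Suc n) * ?t (Suc n) p) +
          (\<Sum>n<Suc b. k * qn q (c - n) * ncoef q b c n * ?t (Suc n) p))"
        unfolding sum.lessThan_Suc_shift[of _ "Suc b"] by (simp only: diff_zero add.assoc)
      also have "\<dots> = Q ^ c * ncoef q b c 0 * ?t 0 p + (\<Sum>n<Suc b. ncoef q (Suc b) c (Suc n) * ?t (Suc n) p)"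
        unfolding sum.distrib[symmetric] by (rule arg_cong[where f = "(+) _"], rule sum.cong) (auto simp: nS algebra_simps)
      also have "\<dots> = (\<Sum>n<Suc (Suc b). ncoef q (Suc b) c n * ?t n p)"
        unfolding sum.lessThan_Suc_shift[of _ "Suc b"] by (simp add: n0 power_add)
      finally show "(Y_op q ^^ Suc b) ((X_op ^^ c) u) p = (\<Sum>n<Suc (Suc b). ncoef q (Suc b) c n * ?t n p)" .
    qed
  qed
qed

text \<open>The lowering term of \<open>Y_op\<close> reads entries with positive first index, and
  these are 0 throughout.\<close>

lemma Y_op_delta: "(Y_op q ^^ b) (\<lambda>p. if p = (0, 0) then 1 else 0) = (\<lambda>p. if p = (0, b) then 1 else 0)"
  by (induction b) (auto simp: Y_op_def fun_eq_iff split: nat.split)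

lemma X_op_delta: "(X_op ^^ a) (\<lambda>p. if p = (0, b) then 1 else 0) = (\<lambda>p. if p = (a, b) then 1 else 0)"
  by (induction a) (auto simp: X_op_def fun_eq_iff split: nat.split)

subsection \<open>The basis of $\mathrm{Pol}(\mathfrak g_{-1})_q$ and the universal R-matrix\<close>

lemma Pol_simps [simp]:
  "carrier (Pol q) = carrier (pol_sp q)" "\<zero>\<^bsub>Pol q\<^esub> = \<zero>\<^bsub>pol_sp q\<^esub>" "X \<oplus>\<^bsub>Pol q\<^esub> Y = X \<oplus>\<^bsub>pol_sp q\<^esub> Y"
  "c \<odot>\<^bsub>Pol q\<^esub> X = c \<odot>\<^bsub>pol_sp q\<^esub> X"
  by (simp_all add: Pol_def)

lemma lin_Pol_dom [simp]: "lin (Pol q) W f = lin (pol_sp q) W f"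
  by (simp add: lin_def)

lemma lin_Pol_cod [simp]: "lin W (Pol q) f = lin W (pol_sp q) f"
  by (simp add: lin_def)

definition pol_bas :: "real \<Rightarrow> nat \<times> nat \<Rightarrow> polq" where
  "pol_bas q = (\<lambda>(a, b). ptens (Cg q) (Cgbar q) (dual_bas q Minus a) (dual_bas q Plus b))"

definition pol_cf :: "real \<Rightarrow> polq \<Rightarrow> nat \<times> nat \<Rightarrow> complex" where
  "pol_cf q = tensor_ext fun_sp (\<lambda>v w (i, j). dual_cf q Minus v i * dual_cf q Plus w j)"

context uq
begin

context
begin

private abbreviation "A \<equiv> Cg q"
private abbreviation "B \<equiv> Cgbar q"
private abbreviation "x \<equiv> dual_bas q Minus"
private abbreviation "y \<equiv> dual_bas q Plus"
abbreviation "m a b \<equiv> pol_bas q (a, b)"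
abbreviation "P \<equiv> pol_sp q"
private abbreviation "T \<equiv> tensor (Cgbar q) (Cg q)"

lemmas DD = vs_dual_alg dual_bas_closed

lemma vs_pol_sp: "vs P" by (simp add: pol_sp_def DD)

lemma vs_Pol: "vs (Pol q)"
  by (rule vsI) (auto simp: vs_pol_sp vs_a_assoc vs_a_comm vs_a_lcomm vs_smult_l_distr vs_smult_r_distr vs_smult_smult)

lemma pol_basis: "basis P (pol_bas q) (pol_cf q)"
  unfolding pol_sp_def pol_bas_def pol_cf_def by (rule basis_tensor[OF dual_basis dual_basis])

lemma pol_bas_closed [simp]: "pol_bas q i \<in> carrier P"
  by (rule basis_closed[OF pol_basis])

section \<open>The R-matrix on the basis tensors\<close>

private abbreviation "tb b c \<equiv> ptens B A (y b) (x c)"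

private lemma T_basis: "basis T (\<lambda>(b, c). tb b c) (tensor_ext fun_sp (\<lambda>v w (i, j). dual_cf q Plus v i * dual_cf q Minus w j))"
  by (rule basis_tensor[OF dual_basis dual_basis])

private lemma vsT: "vs T" by (simp add: DD)

private lemma tb_closed: "tb b c \<in> carrier T" by (simp add: DD)

private lemma T_eqI:
  assumes "vs W" "lin T W f" "lin T W g" "\<And>b c. f (tb b c) = g (tb b c)" "t \<in> carrier T"
  shows "f t = g t"
  by (rule basis_lin_eqI[OF T_basis assms(1-3) _ assms(5)]) (use assms(4) in auto)

private lemma q_powi_inj: "q powi a = q powi b \<Longrightarrow> a = b" for a b :: int
proof -
  assume e: "q powi a = q powi b"
  have "q powi a = q powr a" "q powi b = q powr b" using q by (simp_all add: powr_real_of_int')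
  then have "q powr a = q powr b" using e by simp
  then show "a = b" using q by (simp add: powr_inj)
qed

text \<open>K acts on functionals through S(K) = K^{-1}, so the sign is opposite to that on V_+(0)
  and V_-(0).\<close>

definition wt :: "sgn \<Rightarrow> nat \<Rightarrow> int" where
  "wt s a = (case s of Plus \<Rightarrow> - 2 * int a | Minus \<Rightarrow> 2 * int a)"

private lemma kap_wt: "(1 / kap q s) ^ a = of_real (q powi wt s a)"
proof (cases s)
  case Plus
  have "q powi (- int (2 * a)) = (1 / q\<^sup>2) ^ a"
    unfolding power_int_minus power_int_of_nat power_mult by (simp add: power_inverse divide_inverse)
  then show ?thesis using Plus by (simp add: kap_def wt_def)
next
  case Minus
  have "q powi (int (2 * a)) = (q\<^sup>2) ^ a"
    unfolding power_int_of_nat power_mult by simp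
  then show ?thesis using Minus by (simp add: kap_def wt_def)
qed

private lemma weight_vec_bas: "weight_vec q s (wt s a) (dual_bas q s a)"
  by (simp add: weight_vec_def DD dual_act_K kap_wt)

text \<open>The numbers q^(wt s a) are distinct since 0 < q < 1, so weight spaces are lines through
  basis elements, while 0 has every weight. This identifies the pairs of vectors that the
  specification of T speaks about.\<close>

private lemma weight_vec_cases:
  assumes w: "weight_vec q s n f"
  shows "f = \<zero>\<^bsub>dual_alg q s\<^esub> \<or> (\<exists>k a. f = k \<odot>\<^bsub>dual_alg q s\<^esub> dual_bas q s a \<and> n = wt s a)"
proof -
  let ?D = "dual_alg q s" and ?c = "dual_cf q s"
  note b = dual_basis[of s] and cl = basis_lin[OF dual_basis[of s]]
  have f: "f \<in> carrier ?D" and e: "dual_act q s (ugen q gK) f = of_real (q powi n) \<odot>\<^bsub>?D\<^esub> f"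
    using w by (auto simp: weight_vec_def)
  have e1: "?c (dual_act q s (ugen q gK) f) = (\<lambda>a. of_real (q powi wt s a) * ?c f a)"
  proof (rule basis_lin_eqI[where f = "\<lambda>f. ?c (dual_act q s (ugen q gK) f)" and g = "\<lambda>f a. of_real (q powi wt s a) * ?c f a",
        OF b vs_fun_sp _ _ _ f])
    show "lin ?D fun_sp (\<lambda>f. ?c (dual_act q s (ugen q gK) f))"
      by (rule lin_comp[OF left_module_lin_r[OF dual_module ugen_closed] cl])
    show "lin ?D fun_sp (\<lambda>f a. of_real (q powi wt s a) * ?c f a)"
      using cl by (auto simp: lin_def algebra_simps)
    show "?c (dual_act q s (ugen q gK) (dual_bas q s i)) = (\<lambda>a. of_real (q powi wt s a) * ?c (dual_bas q s i) a)" for i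
      by (auto simp: dual_act_K kap_wt lin_smult[OF cl] DD basis_coord[OF b])
  qed
  have e2: "?c (dual_act q s (ugen q gK) f) = (\<lambda>a. of_real (q powi n) * ?c f a)"
    by (simp only: e lin_smult[OF cl f] fun_sp_simps)
  have ev: "of_real (q powi wt s a) * ?c f a = of_real (q powi n) * ?c f a" for a
    using e1 e2 by metis
  have n: "n = wt s a" if "?c f a \<noteq> 0" for a
    using ev[of a] that q_powi_inj[of "wt s a" n] by (simp del: of_real_power_int)
  show ?thesis
  proof (cases "\<exists>a. ?c f a \<noteq> 0")
    case False
    then have "f = \<zero>\<^bsub>?D\<^esub>"
      by (intro basis_inj[OF b f]) (auto simp: DD lin_zero[OF cl] fun_eq_iff)
    then show ?thesis ..
  next
    case True
    then obtain a where a: "?c f a \<noteq> 0" by blast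
    have "wt s a' = wt s a \<Longrightarrow> a' = a" for a' by (cases s) (auto simp: wt_def)
    then have "?c f a' = 0" if "a' \<noteq> a" for a' using n[OF a] n[of a'] that by metis
    then have "f = ?c f a \<odot>\<^bsub>?D\<^esub> dual_bas q s a"
      by (intro basis_inj[OF b f]) (auto simp: DD lin_smult[OF cl] basis_coord[OF b] fun_eq_iff)
    then show ?thesis using n[OF a] by blast
  qed
qed

text \<open>The exponent is -(-2b)(2c)/2 = 2bc.\<close>

private lemma powr_wt: "complex_of_real (q powr (- of_int (wt Plus b * wt Minus c) / 2)) = QQ ^ (b * c)"
proof -
  have "q powr (- of_int (wt Plus b * wt Minus c) / 2) = q powr real (2 * (b * c))"
    by (simp add: wt_def)
  also have "\<dots> = (q\<^sup>2) ^ (b * c)" using q powr_realpow[of q "2 * (b * c)"] by (simp add: power_mult)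
  finally show ?thesis by simp
qed

text \<open>Resolves the definite description of T. The diagonal map on the tensor basis satisfies
  it, because weight vectors are multiples of basis elements; it is the only solution, because its
  values on a basis are prescribed and \<open>lin_maps\<close> fixes those outside the
  carrier.\<close>

private lemma R_weight_spec: "R_weight q \<in> lin_maps T T \<and>
     (\<forall>k n f g. weight_vec q Plus k f \<longrightarrow> weight_vec q Minus n g \<longrightarrow>
        R_weight q (ptens B A f g) = of_real (q powr (- of_int (k * n) / 2)) \<odot>\<^bsub>T\<^esub> ptens B A f g)"
proof -
  let ?Q = "\<lambda>S. S \<in> lin_maps T T \<and> (\<forall>k n f g. weight_vec q Plus k f \<longrightarrow> weight_vec q Minus n g \<longrightarrow>
        S (ptens B A f g) = of_real (q powr (- of_int (k * n) / 2)) \<odot>\<^bsub>T\<^esub> ptens B A f g)"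
  let ?cf = "tensor_ext fun_sp (\<lambda>v w (i, j). dual_cf q Plus v i * dual_cf q Minus w j)"
  define S0 where "S0 = lin_ext T ?cf (\<lambda>(b, c). QQ ^ (b * c) \<odot>\<^bsub>T\<^esub> tb b c)"
  have cl: "(case i of (b, c) \<Rightarrow> QQ ^ (b * c) \<odot>\<^bsub>T\<^esub> tb b c) \<in> carrier T" for i
    by (cases i) (simp add: vsT tb_closed)
  have S0l: "lin T T S0" unfolding S0_def by (rule lin_lin_ext[OF T_basis vsT cl])
  have S0b: "S0 (tb b c) = QQ ^ (b * c) \<odot>\<^bsub>T\<^esub> tb b c" for b c
    using lin_ext_basis[where h = "\<lambda>(b, c). QQ ^ (b * c) \<odot>\<^bsub>T\<^esub> tb b c" and i = "(b, c)", OF T_basis vsT cl] by (simp add: S0_def)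
  have z1: "ptens B A f \<zero>\<^bsub>A\<^esub> = \<zero>\<^bsub>T\<^esub>" if "f \<in> carrier B" for f
    by (rule lin_zero[OF bilin_r[OF bilin_ptens[OF DD(1) DD(1)] that] DD(1) vsT])
  have z2: "ptens B A \<zero>\<^bsub>B\<^esub> g = \<zero>\<^bsub>T\<^esub>" if "g \<in> carrier A" for g
    by (rule lin_zero[OF bilin_l[OF bilin_ptens[OF DD(1) DD(1)] that] DD(1) vsT])
  have "?Q (restrict S0 (carrier T))"
  proof (intro conjI allI impI)
    show "restrict S0 (carrier T) \<in> lin_maps T T"
      using S0l by (auto simp: lin_maps_def lin_def vsT)
    fix k n f g assume f: "weight_vec q Plus k f" and g: "weight_vec q Minus n g"
    have fc: "f \<in> carrier B" "g \<in> carrier A" using f g by (simp_all add: weight_vec_def)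
    have "S0 (ptens B A f g) = of_real (q powr (- of_int (k * n) / 2)) \<odot>\<^bsub>T\<^esub> ptens B A f g"
      using weight_vec_cases[OF f] weight_vec_cases[OF g]
    proof (elim disjE exE conjE)
      fix k1 b k2 c assume [simp]: "f = k1 \<odot>\<^bsub>B\<^esub> y b" "g = k2 \<odot>\<^bsub>A\<^esub> x c" and kn: "k = wt Plus b" "n = wt Minus c"
      show ?thesis unfolding kn powr_wt
        by (simp add: DD ptens_smult_l ptens_smult_r lin_smult[OF S0l] S0b vs_smult_smult vsT tb_closed mult.commute mult.left_commute)
    qed (use fc in \<open>simp_all add: z1 z2 lin_zero[OF S0l] DD\<close>)
    then show "restrict S0 (carrier T) (ptens B A f g) = of_real (q powr (- of_int (k * n) / 2)) \<odot>\<^bsub>T\<^esub> ptens B A f g"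
      using fc by (simp add: DD)
  qed
  moreover have "S = restrict S0 (carrier T)" if S: "?Q S" for S
  proof (rule extensionalityI[of _ "carrier T"])
    have l: "lin T T S" using S by (auto simp: lin_maps_def lin_def)
    fix t assume t: "t \<in> carrier T"
    have "S t = S0 t"
    proof (rule T_eqI[OF vsT l S0l _ t])
      fix b c
      have "S (tb b c) = of_real (q powr (- of_int (wt Plus b * wt Minus c) / 2)) \<odot>\<^bsub>T\<^esub> tb b c"
        using S weight_vec_bas by blast
      then show "S (tb b c) = S0 (tb b c)" unfolding powr_wt S0b .
    qed
    then show "S t = restrict S0 (carrier T) t" using t by simp
  qed (use S in \<open>auto simp: lin_maps_def PiE_def\<close>)
  ultimately show ?thesis unfolding R_weight_def by (rule theI[where P = ?Q])
qed

private lemma R_weight_lin: "lin T T (R_weight q)"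
  using R_weight_spec by (auto simp: lin_maps_def lin_def)

private lemma R_weight_tb: "R_weight q (tb b c) = QQ ^ (b * c) \<odot>\<^bsub>T\<^esub> tb b c"
  using R_weight_spec weight_vec_bas[of Plus b] weight_vec_bas[of Minus c] powr_wt[of b c] by metis

private lemma EF_bilin: "bilin B A T (\<lambda>f g. ptens B A (dual_act q Plus (ugen q gE) f) (dual_act q Minus (ugen q gF) g))"
  by (rule bilin_lin_comp[OF bilin_ptens[OF DD(1) DD(1)] left_module_lin_r[OF dual_module ugen_closed]
        left_module_lin_r[OF dual_module ugen_closed]])

private lemma R_EF_lin: "lin T T (R_EF q)"
  unfolding R_EF_def[abs_def] by (rule lin_smult_fun[OF vsT lin_tensor_ext[OF DD(1) DD(1) vsT EF_bilin]])

private lemma R_EF_tb: "R_EF q (tb b c) = (of_real (1 / q - q) * ecoef q b * ecoef q c) \<odot>\<^bsub>T\<^esub> tb (b - 1) (c - 1)"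
  using dual_act_generating[of Plus b] dual_act_generating[of Minus c]
  by (simp add: R_EF_def tensor_ext_ptens[OF DD(1) DD(1) vsT EF_bilin] DD ptens_smult_l ptens_smult_r vs_smult_smult vsT tb_closed
      ecoef_def mult.assoc mult.left_commute mult.commute del: of_real_divide of_real_diff of_real_power)

private lemma R_EF_pow_tb: "(R_EF q ^^ n) (tb b c) = (of_real (1 / q - q) ^ n * dcoef q b n * dcoef q c n) \<odot>\<^bsub>T\<^esub> tb (b - n) (c - n)"
proof (induction n)
  case (Suc n)
  show ?case
    by (simp add: Suc lin_smult[OF R_EF_lin] tb_closed R_EF_tb vs_smult_smult vsT dcoef_Suc
        mult.assoc mult.left_commute mult.commute del: of_real_divide of_real_diff of_real_power)
qed (simp add: vsT tb_closed)

text \<open>Each application lowers both powers, so b+1 of them kill \<open>tb b c\<close>; for a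
  sum of two tensors the larger bound serves.\<close>

private lemma R_EF_nil: "t \<in> carrier T \<Longrightarrow> \<exists>N. \<forall>n\<ge>N. (R_EF q ^^ n) t = \<zero>\<^bsub>T\<^esub>"
proof (erule basis_induct[OF T_basis])
  note Xn = funpow_lin[OF R_EF_lin]
  note [simp] = lin_add[OF Xn] lin_smult[OF Xn] lin_zero[OF Xn vsT vsT] vsT
  show "submodule {t \<in> carrier T. \<exists>N. \<forall>n\<ge>N. (R_EF q ^^ n) t = \<zero>\<^bsub>T\<^esub>} cplx T"
    unfolding submodule_vs_iff[OF vsT]
  proof (intro conjI ballI allI)
    fix t u assume "t \<in> {t \<in> carrier T. \<exists>N. \<forall>n\<ge>N. (R_EF q ^^ n) t = \<zero>\<^bsub>T\<^esub>}" "u \<in> {t \<in> carrier T. \<exists>N. \<forall>n\<ge>N. (R_EF q ^^ n) t = \<zero>\<^bsub>T\<^esub>}"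
    then obtain N M where tu: "t \<in> carrier T" "u \<in> carrier T" and
      "\<forall>n\<ge>N. (R_EF q ^^ n) t = \<zero>\<^bsub>T\<^esub>" "\<forall>n\<ge>M. (R_EF q ^^ n) u = \<zero>\<^bsub>T\<^esub>" by auto
    then have "\<forall>n\<ge>max N M. (R_EF q ^^ n) (t \<oplus>\<^bsub>T\<^esub> u) = \<zero>\<^bsub>T\<^esub>" by simp
    then show "t \<oplus>\<^bsub>T\<^esub> u \<in> {t \<in> carrier T. \<exists>N. \<forall>n\<ge>N. (R_EF q ^^ n) t = \<zero>\<^bsub>T\<^esub>}" using tu by (auto simp del: max.bounded_iff)
  next
    fix c t assume "t \<in> {t \<in> carrier T. \<exists>N. \<forall>n\<ge>N. (R_EF q ^^ n) t = \<zero>\<^bsub>T\<^esub>}"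
    then obtain N where t: "t \<in> carrier T" "\<forall>n\<ge>N. (R_EF q ^^ n) t = \<zero>\<^bsub>T\<^esub>" by auto
    then have "\<forall>n\<ge>N. (R_EF q ^^ n) (c \<odot>\<^bsub>T\<^esub> t) = \<zero>\<^bsub>T\<^esub>" by simp
    then show "c \<odot>\<^bsub>T\<^esub> t \<in> {t \<in> carrier T. \<exists>N. \<forall>n\<ge>N. (R_EF q ^^ n) t = \<zero>\<^bsub>T\<^esub>}" using t by (intro CollectI conjI exI[of _ N]) simp_all
  qed auto
  fix i :: "nat \<times> nat"
  obtain b c where i: "i = (b, c)" by (cases i)
  have "(R_EF q ^^ n) (tb b c) = \<zero>\<^bsub>T\<^esub>" if "n \<ge> Suc b" for n
    using that by (simp add: R_EF_pow_tb dcoef_zero tb_closed)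
  then show "\<exists>N. \<forall>n\<ge>N. (R_EF q ^^ n) (case i of (b, c) \<Rightarrow> tb b c) = \<zero>\<^bsub>T\<^esub>" unfolding i by auto
qed

private lemma R_check_lin: "lin T P (R_check q)"
  unfolding R_check_def[abs_def] R_op_def[abs_def] pol_sp_def
  by (rule lin_comp[OF lin_comp[OF R_weight_lin lin_qexp_op[OF vsT R_EF_lin R_EF_nil]] lin_tensor_flip[OF DD(1) DD(1)]])

text \<open>T contributes q^(2bc), the n-th term of the exponential the lowering coefficients over
  [n]!, and the flip puts the power of a_+ in front: together \<open>ncoef\<close>.\<close>

private lemma R_check_tb: "R_check q (tb b c) = (\<Oplus>\<^bsub>P\<^esub>n\<in>{..<Suc b}. ncoef q b c n \<odot>\<^bsub>P\<^esub> m (c - n) (b - n))"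
proof -
  interpret TT: abelian_monoid T by (rule vs_abelian_monoid[OF vsT])
  interpret PP: abelian_monoid P by (rule vs_abelian_monoid[OF vs_pol_sp])
  have nil: "\<forall>n\<ge>Suc b. (R_EF q ^^ n) (tb b c) = \<zero>\<^bsub>T\<^esub>"
    by (auto simp: R_EF_pow_tb dcoef_zero tb_closed vsT)
  note qe = lin_qexp_op[OF vsT R_EF_lin R_EF_nil, of "q\<^sup>2"]
  have mc: "ptens A B (x a') (y b') \<in> carrier P" for a' b' by (simp add: pol_sp_def DD)
  have F: "lin T P (tensor_flip B A)" unfolding pol_sp_def by (rule lin_tensor_flip[OF DD(1) DD(1)])
  have "R_op q (tb b c) = QQ ^ (b * c) \<odot>\<^bsub>T\<^esub> qexp_op (q\<^sup>2) T (R_EF q) (tb b c)"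
    unfolding R_op_def R_weight_tb by (rule lin_smult[OF qe tb_closed])
  also have "\<dots> = (\<Oplus>\<^bsub>T\<^esub>n\<in>{..<Suc b}. ncoef q b c n \<odot>\<^bsub>T\<^esub> tb (b - n) (c - n))"
    unfolding qexp_op_superset[OF vsT R_EF_lin tb_closed nil] R_EF_pow_tb
    by (subst finsum_smult[OF vsT])
      (auto simp: vsT tb_closed vs_smult_smult ncoef_def qfact_qf[OF q] of_real_divide intro!: TT.finsum_cong')
  finally have ro: "R_op q (tb b c) = (\<Oplus>\<^bsub>T\<^esub>n\<in>{..<Suc b}. ncoef q b c n \<odot>\<^bsub>T\<^esub> tb (b - n) (c - n))" .
  have "R_check q (tb b c) = (\<Oplus>\<^bsub>P\<^esub>n\<in>{..<Suc b}. tensor_flip B A (ncoef q b c n \<odot>\<^bsub>T\<^esub> tb (b - n) (c - n)))"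
    unfolding R_check_def ro
    by (subst finsum_lin[OF vsT vs_pol_sp F]) (auto simp: vsT tb_closed)
  also have "\<dots> = (\<Oplus>\<^bsub>P\<^esub>n\<in>{..<Suc b}. ncoef q b c n \<odot>\<^bsub>P\<^esub> m (c - n) (b - n))"
    by (intro PP.finsum_cong')
      (auto simp: vs_pol_sp lin_smult[OF F] tb_closed tensor_flip_ptens DD pol_bas_def mc)
  finally show ?thesis .
qed

subsection \<open>The multiplication\<close>

private lemma mult_inner_bilin:
  assumes "f \<in> carrier A" "g \<in> carrier B"
  shows "bilin A B P (\<lambda>a b. ptens A B (f \<otimes>\<^bsub>A\<^esub> a) (b \<otimes>\<^bsub>B\<^esub> g))"
  unfolding pol_sp_def
  by (rule bilin_lin_comp[OF bilin_ptens[OF DD(1) DD(1)] bilin_r[OF dual_mult_bilin assms(1)] bilin_l[OF dual_mult_bilin assms(2)]])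

private abbreviation "mf \<equiv> (\<lambda>\<phi>p \<phi>m \<psi>p \<psi>m. tensor_ext P (\<lambda>a b. ptens A B (\<phi>p \<otimes>\<^bsub>A\<^esub> a) (b \<otimes>\<^bsub>B\<^esub> \<psi>m)) (R_check q (ptens B A \<phi>m \<psi>p)))"

private lemma R_check_closed: "f \<in> carrier B \<Longrightarrow> g \<in> carrier A \<Longrightarrow> R_check q (ptens B A f g) \<in> carrier P"
  by (rule lin_closed[OF R_check_lin]) (simp add: DD)

private lemma te_lin: "f \<in> carrier A \<Longrightarrow> g \<in> carrier B \<Longrightarrow> lin P P (tensor_ext P (\<lambda>a b. ptens A B (f \<otimes>\<^bsub>A\<^esub> a) (b \<otimes>\<^bsub>B\<^esub> g)))"
  using lin_tensor_ext[OF DD(1) DD(1) vs_pol_sp mult_inner_bilin] by (simp add: pol_sp_def)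

text \<open>\<open>\<phi>p\<close> enters only as a parameter of the bilinear map under
  \<open>tensor_ext\<close>, whereas \<open>\<phi>m\<close> passes through \<open>R_check\<close>;
  hence the two different arguments for linearity. In \<open>mult_right\<close> the roles are taken
  by \<open>\<psi>m\<close> and \<open>\<psi>p\<close>.\<close>

private lemma mult_left: "\<psi>p \<in> carrier A \<Longrightarrow> \<psi>m \<in> carrier B \<Longrightarrow> bilin A B P (\<lambda>\<phi>p \<phi>m. mf \<phi>p \<phi>m \<psi>p \<psi>m)"
proof (rule bilinI)
  fix \<phi>m assume a: "\<psi>p \<in> carrier A" "\<psi>m \<in> carrier B" "\<phi>m \<in> carrier B"
  note [simp] = DD vs_pol_sp bilin_closed[OF dual_mult_bilin]
  show "lin A P (\<lambda>\<phi>p. mf \<phi>p \<phi>m \<psi>p \<psi>m)"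
  proof (rule lin_tensor_ext_param[OF DD(1) DD(1) vs_pol_sp DD(1) _ mult_inner_bilin])
    fix a b assume ab: "a \<in> carrier A" "b \<in> carrier B"
    show "lin A P (\<lambda>p. ptens A B (p \<otimes>\<^bsub>A\<^esub> a) (b \<otimes>\<^bsub>B\<^esub> \<psi>m))"
      unfolding pol_sp_def
      by (rule lin_comp[OF bilin_l[OF dual_mult_bilin ab(1)] bilin_l[OF bilin_ptens[OF DD(1) DD(1)]]])
        (use a ab in simp)
  qed (use a R_check_closed[of \<phi>m \<psi>p] in \<open>simp_all add: pol_sp_def\<close>)
next
  fix \<phi>p assume a: "\<psi>p \<in> carrier A" "\<psi>m \<in> carrier B" "\<phi>p \<in> carrier A"
  show "lin B P (\<lambda>\<phi>m. mf \<phi>p \<phi>m \<psi>p \<psi>m)"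
    by (rule lin_comp[OF lin_comp[OF bilin_l[OF bilin_ptens[OF DD(1) DD(1)] a(1)] R_check_lin] te_lin[OF a(3,2)]])
qed

private lemma mult_right: "\<phi>p \<in> carrier A \<Longrightarrow> \<phi>m \<in> carrier B \<Longrightarrow> bilin A B P (\<lambda>\<psi>p \<psi>m. mf \<phi>p \<phi>m \<psi>p \<psi>m)"
proof (rule bilinI)
  fix \<psi>p assume a: "\<phi>p \<in> carrier A" "\<phi>m \<in> carrier B" "\<psi>p \<in> carrier A"
  note [simp] = DD vs_pol_sp bilin_closed[OF dual_mult_bilin]
  show "lin B P (\<lambda>\<psi>m. mf \<phi>p \<phi>m \<psi>p \<psi>m)"
  proof (rule lin_tensor_ext_param[OF DD(1) DD(1) vs_pol_sp DD(1) _ mult_inner_bilin])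
    fix a' b assume ab: "a' \<in> carrier A" "b \<in> carrier B"
    show "lin B P (\<lambda>p. ptens A B (\<phi>p \<otimes>\<^bsub>A\<^esub> a') (b \<otimes>\<^bsub>B\<^esub> p))"
      unfolding pol_sp_def
      by (rule lin_comp[OF bilin_r[OF dual_mult_bilin ab(2)] bilin_r[OF bilin_ptens[OF DD(1) DD(1)]]])
        (use a ab in simp)
  qed (use a R_check_closed[of \<phi>m \<psi>p] in \<open>simp_all add: pol_sp_def\<close>)
next
  fix \<psi>m assume a: "\<phi>p \<in> carrier A" "\<phi>m \<in> carrier B" "\<psi>m \<in> carrier B"
  show "lin A P (\<lambda>\<psi>p. mf \<phi>p \<phi>m \<psi>p \<psi>m)"
    by (rule lin_comp[OF lin_comp[OF bilin_r[OF bilin_ptens[OF DD(1) DD(1)] a(2)] R_check_lin] te_lin[OF a(1,3)]])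
qed

lemma Pol_mult_bilin: "bilin P P P (\<lambda>X Y. X \<otimes>\<^bsub>Pol q\<^esub> Y)"
  using bilin_tensor_ext2[OF DD(1) DD(1) DD(1) DD(1) vs_pol_sp mult_left mult_right]
  by (simp add: Pol_def pol_sp_def)

lemma Pol_one: "\<one>\<^bsub>Pol q\<^esub> = m 0 0"
  by (simp add: Pol_def dual_one pol_bas_def)

lemma Pol_mult_bas: "m a b \<otimes>\<^bsub>Pol q\<^esub> m c d = (\<Oplus>\<^bsub>P\<^esub>n\<in>{..<Suc b}. ncoef q b c n \<odot>\<^bsub>P\<^esub> m (a + (c - n)) (b - n + d))"
proof -
  interpret PP: abelian_monoid P by (rule vs_abelian_monoid[OF vs_pol_sp])
  have te: "tensor_ext P (\<lambda>u v. ptens A B (x a \<otimes>\<^bsub>A\<^esub> u) (v \<otimes>\<^bsub>B\<^esub> y d)) (m c' b') = m (a + c') (b' + d)" for c' b'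
    unfolding pol_bas_def
    by (simp add: tensor_ext_ptens[OF DD(1) DD(1) vs_pol_sp mult_inner_bilin] DD dual_mult_bas)
  have "m a b \<otimes>\<^bsub>Pol q\<^esub> m c d = mf (x a) (y b) (x c) (y d)"
    using tensor_ext2_ptens[OF DD(1) DD(1) DD(1) DD(1) vs_pol_sp mult_left mult_right DD(2) DD(2) DD(2) DD(2), of c d a b]
    by (simp add: Pol_def pol_bas_def)
  also have "\<dots> = (\<Oplus>\<^bsub>P\<^esub>n\<in>{..<Suc b}. ncoef q b c n \<odot>\<^bsub>P\<^esub> m (a + (c - n)) (b - n + d))"
    unfolding R_check_tb
    by (subst finsum_lin[OF vs_pol_sp vs_pol_sp te_lin])
      (auto simp: DD vs_pol_sp lin_smult[OF te_lin[OF DD(2) DD(2)]] te intro!: PP.finsum_cong')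
  finally show ?thesis .
qed

section \<open>The faithful representation of \<open>Pol\<close> by operators and the product
  formulas that it yields\<close>

definition pol_rep :: "polq \<Rightarrow> (nat \<times> nat \<Rightarrow> complex) \<Rightarrow> nat \<times> nat \<Rightarrow> complex" where
  "pol_rep = lin_ext op_alg (pol_cf q) (\<lambda>(a, b) u. (X_op ^^ a) ((Y_op q ^^ b) u))"

private lemma rep_closed: "(case i of (a, b) \<Rightarrow> \<lambda>u. (X_op ^^ a) ((Y_op q ^^ b) u)) \<in> carrier op_alg"
  using lin_comp[OF funpow_lin[OF Y_op_lin[of q]] funpow_lin[OF X_op_lin]] by (cases i) simp

lemma pol_rep_lin: "lin P op_alg pol_rep"
  unfolding pol_rep_def by (rule lin_lin_ext[OF pol_basis vs_op_alg rep_closed])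

lemma pol_rep_bas: "pol_rep (m a b) = (\<lambda>u. (X_op ^^ a) ((Y_op q ^^ b) u))"
  using lin_ext_basis[where h = "\<lambda>(a, b) u. (X_op ^^ a) ((Y_op q ^^ b) u)" and i = "(a, b)", OF pol_basis vs_op_alg rep_closed]
  by (simp add: pol_rep_def)

text \<open>X^a Y^b takes the indicator of (0, 0) to the indicator of (a, b). Evaluation at this
  vector reads off all coordinates, which gives injectivity.\<close>

private lemma rep_delta: "t \<in> carrier P \<Longrightarrow> pol_rep t (\<lambda>p. if p = (0, 0) then 1 else 0) = pol_cf q t"
proof (rule basis_lin_eqI[where f = "\<lambda>t. pol_rep t (\<lambda>p. if p = (0, 0) then 1 else 0)", OF pol_basis vs_fun_sp _ basis_lin[OF pol_basis]])
  show "lin P fun_sp (\<lambda>t. pol_rep t (\<lambda>p. if p = (0, 0) then 1 else 0))"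
    using pol_rep_lin by (auto simp: lin_def)
  show "pol_rep (pol_bas q i) (\<lambda>p. if p = (0, 0) then 1 else 0) = pol_cf q (pol_bas q i)" for i
    by (cases i) (simp add: pol_rep_bas Y_op_delta X_op_delta basis_coord[OF pol_basis])
qed

lemma pol_rep_inj: "inj_on pol_rep (carrier P)"
  by (rule inj_onI, rule basis_inj[OF pol_basis]) (metis rep_delta)+

private lemma rep_finsum:
  assumes "finite I" "\<And>n. n \<in> I \<Longrightarrow> t n \<in> carrier P"
  shows "pol_rep (\<Oplus>\<^bsub>P\<^esub>n\<in>I. k n \<odot>\<^bsub>P\<^esub> t n) u = (\<lambda>p. \<Sum>n\<in>I. k n * pol_rep (t n) u p)"
proof -
  interpret PP: abelian_monoid P by (rule vs_abelian_monoid[OF vs_pol_sp])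
  show ?thesis using assms
  proof (induction I rule: finite_induct)
    case empty
    then show ?case using lin_zero[OF pol_rep_lin vs_pol_sp vs_op_alg] by simp
  next
    case (insert n I)
    then have c: "(\<Oplus>\<^bsub>P\<^esub>n\<in>I. k n \<odot>\<^bsub>P\<^esub> t n) \<in> carrier P" "k n \<odot>\<^bsub>P\<^esub> t n \<in> carrier P"
      by (auto intro!: PP.finsum_closed simp: vs_pol_sp)
    have "(\<Oplus>\<^bsub>P\<^esub>n\<in>insert n I. k n \<odot>\<^bsub>P\<^esub> t n) = k n \<odot>\<^bsub>P\<^esub> t n \<oplus>\<^bsub>P\<^esub> (\<Oplus>\<^bsub>P\<^esub>n\<in>I. k n \<odot>\<^bsub>P\<^esub> t n)"
      using insert by (intro PP.finsum_insert) (auto simp: vs_pol_sp)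
    then show ?case
      using insert c by (simp add: lin_add[OF pol_rep_lin] lin_smult[OF pol_rep_lin])
  qed
qed

text \<open>The coefficients of the product (\<open>Pol_mult_bas\<close>) and those of the
  reordering of Y^b X^c (\<open>normal_order\<close>) are the same numbers
  \<open>ncoef\<close>.\<close>

private lemma rep_mult_bas: "pol_rep (m a b \<otimes>\<^bsub>Pol q\<^esub> m c d) = (\<lambda>u. pol_rep (m a b) (pol_rep (m c d) u))"
proof
  fix u
  have "pol_rep (m a b \<otimes>\<^bsub>Pol q\<^esub> m c d) u =
      (\<lambda>p. \<Sum>n<Suc b. ncoef q b c n * (X_op ^^ a) ((X_op ^^ (c - n)) ((Y_op q ^^ (b - n)) ((Y_op q ^^ d) u))) p)"
    unfolding Pol_mult_bas by (subst rep_finsum, simp, simp, simp only: pol_rep_bas funpow_add comp_apply)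
  also have "\<dots> = (X_op ^^ a) (\<lambda>p. \<Sum>n<Suc b. ncoef q b c n * (X_op ^^ (c - n)) ((Y_op q ^^ (b - n)) ((Y_op q ^^ d) u)) p)"
    by (rule fun_lin_sum[OF funpow_lin[OF X_op_lin], symmetric]) simp
  also have "\<dots> = pol_rep (m a b) (pol_rep (m c d) u)"
    unfolding pol_rep_bas normal_order[OF q] ..
  finally show "pol_rep (m a b \<otimes>\<^bsub>Pol q\<^esub> m c d) u = pol_rep (m a b) (pol_rep (m c d) u)" .
qed

lemma pol_rep_mult:
  assumes X: "X \<in> carrier P" and Y: "Y \<in> carrier P"
  shows "pol_rep (X \<otimes>\<^bsub>Pol q\<^esub> Y) = pol_rep X \<otimes>\<^bsub>op_alg\<^esub> pol_rep Y"
proof -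
  note ol = calg_lin_l[OF calgebra_op_alg] and or = calg_lin_r[OF calgebra_op_alg]
  have 1: "pol_rep (pol_bas q i \<otimes>\<^bsub>Pol q\<^esub> Y) = pol_rep (pol_bas q i) \<otimes>\<^bsub>op_alg\<^esub> pol_rep Y" if Y: "Y \<in> carrier P" for i Y
  proof (rule basis_lin_eqI[where f = "\<lambda>Y. pol_rep (pol_bas q i \<otimes>\<^bsub>Pol q\<^esub> Y)" and g = "\<lambda>Y. pol_rep (pol_bas q i) \<otimes>\<^bsub>op_alg\<^esub> pol_rep Y",
        OF pol_basis vs_op_alg lin_comp[OF bilin_r[OF Pol_mult_bilin pol_bas_closed] pol_rep_lin]
          lin_comp[OF pol_rep_lin or[OF lin_closed[OF pol_rep_lin pol_bas_closed]]] _ Y])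
    show "pol_rep (pol_bas q i \<otimes>\<^bsub>Pol q\<^esub> pol_bas q j) = pol_rep (pol_bas q i) \<otimes>\<^bsub>op_alg\<^esub> pol_rep (pol_bas q j)" for j
      by (cases i; cases j) (simp add: rep_mult_bas)
  qed
  show ?thesis
    by (rule basis_lin_eqI[where f = "\<lambda>X. pol_rep (X \<otimes>\<^bsub>Pol q\<^esub> Y)" and g = "\<lambda>X. pol_rep X \<otimes>\<^bsub>op_alg\<^esub> pol_rep Y",
        OF pol_basis vs_op_alg lin_comp[OF bilin_l[OF Pol_mult_bilin Y] pol_rep_lin]
          lin_comp[OF pol_rep_lin ol[OF lin_closed[OF pol_rep_lin Y]]] 1[OF Y] X])
qed

text \<open>Composition of operators is associative, and \<open>pol_rep\<close> is injective and
  multiplicative.\<close>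

lemma calgebra_Pol: "calgebra (Pol q)"
proof (rule calgebra_inj[OF vs_Pol _ _ calgebra_op_alg])
  show "bilin (Pol q) (Pol q) (Pol q) (\<lambda>X Y. X \<otimes>\<^bsub>Pol q\<^esub> Y)"
    using Pol_mult_bilin by (simp add: bilin_def)
  show "lin (Pol q) op_alg pol_rep" "inj_on pol_rep (carrier (Pol q))"
    using pol_rep_lin pol_rep_inj by simp_all
  show "pol_rep \<one>\<^bsub>Pol q\<^esub> = \<one>\<^bsub>op_alg\<^esub>" by (simp add: Pol_one pol_rep_bas)
qed (simp_all add: Pol_one pol_rep_mult del: op_alg_simps)

lemma Pol_mult_x: "m a 0 \<otimes>\<^bsub>Pol q\<^esub> m c d = m (a + c) d"
proof -
  interpret PP: abelian_monoid P by (rule vs_abelian_monoid[OF vs_pol_sp])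
  show ?thesis by (simp add: Pol_mult_bas ncoef_0 PP.finsum_Suc[of _ 0, simplified] vs_pol_sp lessThan_Suc)
qed

lemma Pol_mult_y: "m a b \<otimes>\<^bsub>Pol q\<^esub> m 0 d = m a (b + d)"
proof (rule inj_onD[OF pol_rep_inj])
  show "pol_rep (m a b \<otimes>\<^bsub>Pol q\<^esub> m 0 d) = pol_rep (m a (b + d))"
    by (simp add: pol_rep_mult pol_rep_bas funpow_add)
qed (simp_all add: bilin_closed[OF Pol_mult_bilin])

text \<open>Through the injective \<open>pol_rep\<close> this is \<open>Y_X_op_power\<close> with m
  = c. The case c = 1, d = 0 is the defining relation.\<close>

lemma Pol_mult_yx: "m 0 1 \<otimes>\<^bsub>Pol q\<^esub> m c d =
    QQ ^ c \<odot>\<^bsub>P\<^esub> m c (Suc d) \<oplus>\<^bsub>P\<^esub> (of_real (q * (1 - q\<^sup>2)) * qn q c) \<odot>\<^bsub>P\<^esub> m (c - 1) d"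
proof (rule inj_onD[OF pol_rep_inj])
  show "pol_rep (m 0 1 \<otimes>\<^bsub>Pol q\<^esub> m c d) = pol_rep (QQ ^ c \<odot>\<^bsub>P\<^esub> m c (Suc d) \<oplus>\<^bsub>P\<^esub> (of_real (q * (1 - q\<^sup>2)) * qn q c) \<odot>\<^bsub>P\<^esub> m (c - 1) d)"
    by (simp add: pol_rep_mult pol_rep_bas vs_pol_sp lin_add[OF pol_rep_lin] lin_smult[OF pol_rep_lin] fun_eq_iff Y_X_op_power
        del: of_real_mult of_real_diff of_real_power)
qed (simp_all add: bilin_closed[OF Pol_mult_bilin] vs_pol_sp)

lemma ap_eq: "ap q = m 1 0" and am_eq: "am q = m 0 1"
  by (simp_all add: ap_def am_def dual_coord_eq dual_one pol_bas_def)

end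

end

subsection \<open>Generation and the defining relation\<close>

context uq
begin

context
begin

section \<open>Calculation rules and induction principles in \<open>Pol\<close>\<close>

abbreviation pm (infixl "\<star>" 70) where "X \<star> Y \<equiv> X \<otimes>\<^bsub>Pol q\<^esub> Y"

lemmas mc = pol_bas_closed
lemmas vP = vs_pol_sp
lemmas cP = calgebra_Pol
lemmas Pol_mult_closed = bilin_closed[OF Pol_mult_bilin]

lemmas Pol_expand =
  lin_add[OF bilin_l[OF Pol_mult_bilin]] lin_add[OF bilin_r[OF Pol_mult_bilin]]
  lin_smult[OF bilin_l[OF Pol_mult_bilin]] lin_smult[OF bilin_r[OF Pol_mult_bilin]]

lemma Pol_assoc: "X \<in> carrier P \<Longrightarrow> Y \<in> carrier P \<Longrightarrow> Z \<in> carrier P \<Longrightarrow> (X \<star> Y) \<star> Z = X \<star> (Y \<star> Z)"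
  using calg_m_assoc[OF cP] by simp

lemma Pol_one_l: "X \<in> carrier P \<Longrightarrow> m 0 0 \<star> X = X"
  using calg_l_one[OF cP] by (simp add: Pol_one)

lemma Pol_one_r: "X \<in> carrier P \<Longrightarrow> X \<star> m 0 0 = X"
  using calg_r_one[OF cP] by (simp add: Pol_one)

text \<open>Identities in \<open>Pol\<close> become identities of coefficients, which
  \<open>cf_simps\<close> evaluates.\<close>

lemma pol_eqI:
  assumes "X \<in> carrier P" "Y \<in> carrier P" "\<And>i j. pol_cf q X (i, j) = pol_cf q Y (i, j)"
  shows "X = Y"
  by (rule basis_inj[OF pol_basis assms(1,2)]) (use assms(3) in \<open>auto simp: fun_eq_iff\<close>)

lemma cf_add: "X \<in> carrier P \<Longrightarrow> Y \<in> carrier P \<Longrightarrow> pol_cf q (X \<oplus>\<^bsub>P\<^esub> Y) i = pol_cf q X i + pol_cf q Y i"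
  and cf_smult: "X \<in> carrier P \<Longrightarrow> pol_cf q (c \<odot>\<^bsub>P\<^esub> X) i = c * pol_cf q X i"
  and cf_zero: "pol_cf q \<zero>\<^bsub>P\<^esub> i = 0"
  and cf_bas: "pol_cf q (pol_bas q k) i = (if i = k then 1 else 0)"
  using lin_add[OF basis_lin[OF pol_basis]] lin_smult[OF basis_lin[OF pol_basis]]
    lin_zero[OF basis_lin[OF pol_basis] vP vs_fun_sp] basis_coord[OF pol_basis] by simp_all

lemmas cf_simps = cf_add cf_smult cf_zero cf_bas mc vP

lemma submodule_Pol: "submodule H cplx (Pol q) \<longleftrightarrow> submodule H cplx P"
  by (simp add: submodule_vs_iff vP vs_Pol)

text \<open>Left multiplication by the generators reaches all basis elements: a_- builds its own
  powers, then a_+ is multiplied in front.\<close>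

lemma Pol_gen_induct:
  assumes H: "submodule H cplx P" and 1: "\<one>\<^bsub>Pol q\<^esub> \<in> H"
    and step: "\<And>h. h \<in> H \<Longrightarrow> h \<in> carrier P \<Longrightarrow> ap q \<star> h \<in> H" "\<And>h. h \<in> H \<Longrightarrow> h \<in> carrier P \<Longrightarrow> am q \<star> h \<in> H"
  shows "carrier P \<subseteq> H"
proof -
  have y: "m 0 b \<in> H" for b
  proof (induction b)
    case 0
    show ?case using 1 by (simp add: Pol_one)
  next
    case (Suc b)
    show ?case using step(2)[OF Suc mc] Pol_mult_y[of 0 1 b] by (simp add: am_eq)
  qed
  have "m a b \<in> H" for a b
  proof (induction a)
    case (Suc a)
    show ?case using step(1)[OF Suc mc] Pol_mult_x[of 1 a b] by (simp add: ap_eq)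
  qed (rule y)
  then have "range (pol_bas q) \<subseteq> H" by auto
  then show ?thesis using basis_spans[OF pol_basis] H unfolding spans_def by blast
qed

text \<open>
  A bilinear condition on pairs of polynomials that is compatible with associativity needs to be
  checked only on pairs whose product is already normally ordered and on the pair of the relation.
\<close>

lemma Pol_pair_induct:
  assumes R1: "\<And>f. f \<in> carrier P \<Longrightarrow> submodule {g \<in> carrier P. R f g} cplx P"
    and R2: "\<And>g. g \<in> carrier P \<Longrightarrow> submodule {f \<in> carrier P. R f g} cplx P"
    and i: "\<And>f g h. f \<in> carrier P \<Longrightarrow> g \<in> carrier P \<Longrightarrow> h \<in> carrier P \<Longrightarrow> R f g \<Longrightarrow> R (f \<star> g) h \<Longrightarrow> R g h \<Longrightarrow> R f (g \<star> h)"
    and ii: "\<And>f g h. f \<in> carrier P \<Longrightarrow> g \<in> carrier P \<Longrightarrow> h \<in> carrier P \<Longrightarrow> R f g \<Longrightarrow> R f (g \<star> h) \<Longrightarrow> R g h \<Longrightarrow> R (f \<star> g) h"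
    and one: "\<And>f. f \<in> carrier P \<Longrightarrow> R f \<one>\<^bsub>Pol q\<^esub>" "\<And>f. f \<in> carrier P \<Longrightarrow> R \<one>\<^bsub>Pol q\<^esub> f"
    and xl: "\<And>a b. R (m (Suc 0) 0) (m a b)" and yr: "\<And>a b. R (m a b) (m 0 (Suc 0))" and yx: "R (m 0 (Suc 0)) (m (Suc 0) 0)"
    and f: "f \<in> carrier P" and g: "g \<in> carrier P"
  shows "R f g"
proof -
  note [simp] = mc Pol_mult_closed
  note b = basis_induct[OF pol_basis]
  have xl': "R (m (Suc 0) 0) g" if "g \<in> carrier P" for g
    by (rule b[OF that R1]) (use xl in auto)
  have yr': "R f (m 0 (Suc 0))" if "f \<in> carrier P" for f
    by (rule b[OF that R2]) (use yr in auto)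
  have add: "R (c \<odot>\<^bsub>P\<^esub> f \<oplus>\<^bsub>P\<^esub> d \<odot>\<^bsub>P\<^esub> f') g" if "f \<in> carrier P" "f' \<in> carrier P" "g \<in> carrier P" "R f g" "R f' g" for c d f f' g
    using R2[OF that(3)] that unfolding submodule_vs_iff[OF vP] by blast
  have 1: "R (m 0 (Suc 0)) (m a 0)" for a
  proof (induction a)
    case 0
    show ?case using one(1)[of "m 0 (Suc 0)"] by (simp add: Pol_one)
  next
    case (Suc a)
    \<comment> \<open>yx is a combination of xy and 1 by the relation. Both may be paired with x^a:
      1 by \<open>one\<close>, and xy by \<open>ii\<close> and the induction hypothesis.\<close>
    have "R (m 0 (Suc 0) \<star> m (Suc 0) 0) (m a 0)"
    proof -
      have "R (m (Suc 0) 0 \<star> m 0 (Suc 0)) (m a 0)" by (rule ii) (simp_all add: yr xl' Suc)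
      then have "R (m (Suc 0) (Suc 0)) (m a 0)" by (simp add: Pol_mult_x)
      moreover have "R (m 0 0) (m a 0)" using one(2)[of "m a 0"] by (simp add: Pol_one)
      ultimately show ?thesis using Pol_mult_yx[of 1 0] add by simp
    qed
    then have "R (m 0 (Suc 0)) (m (Suc 0) 0 \<star> m a 0)" by (intro i) (simp_all add: yx xl)
    then show ?case by (simp add: Pol_mult_x)
  qed
  have 2: "R (m 0 (Suc 0)) (m a b)" for a b
  proof (induction b)
    case (Suc b)
    have "R (m 0 (Suc 0)) (m a b \<star> m 0 (Suc 0))" by (rule i) (simp_all add: Suc yr yr')
    then show ?case by (simp add: Pol_mult_y)
  qed (rule 1)
  have two: "R (m 0 (Suc 0)) g" if "g \<in> carrier P" for g
    by (rule b[OF that R1]) (use 2 in auto)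
  have 3: "R (m 0 b) g" if "g \<in> carrier P" for b g
  proof (induction b)
    case 0
    show ?case using one(2)[OF that] by (simp add: Pol_one)
  next
    case (Suc b)
    have "R (m 0 (Suc 0) \<star> m 0 b) g" by (rule ii) (simp_all add: two Suc that)
    then show ?case by (simp add: Pol_mult_y)
  qed
  have 4: "R (m a b) g" if "g \<in> carrier P" for a b g
  proof (induction a)
    case (Suc a)
    have "R (m (Suc 0) 0 \<star> m a b) g" by (rule ii) (simp_all add: xl' Suc that)
    then show ?case by (simp add: Pol_mult_x)
  qed (rule 3[OF that])
  show ?thesis
    by (rule b[OF f R2[OF g]]) (use 4[OF g] in auto)
qed

lemma Pol_subalg_gen: "subalg_gen (Pol q) {ap q, am q} = carrier (Pol q)"
proof
  note [simp] = mc
  have "subring (carrier (Pol q)) (Pol q)" using ring.carrier_is_subring[OF calgebra_ring[OF cP]] .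
  then show "subalg_gen (Pol q) {ap q, am q} \<subseteq> carrier (Pol q)"
    unfolding subalg_gen_def using submodule_carrier[OF vs_Pol] by (intro Inter_lower) (auto simp: ap_eq am_eq)
  show "carrier (Pol q) \<subseteq> subalg_gen (Pol q) {ap q, am q}"
    unfolding subalg_gen_def
  proof (rule Inter_greatest)
    fix B assume "B \<in> {B. subring B (Pol q) \<and> submodule B cplx (Pol q) \<and> {ap q, am q} \<subseteq> B}"
    then have B: "subring B (Pol q)" "submodule B cplx P" "ap q \<in> B" "am q \<in> B" by (auto simp: submodule_Pol)
    then show "carrier (Pol q) \<subseteq> B"
      using Pol_gen_induct[OF B(2)] subringE(3,6)[OF B(1)] by simp
  qed
qed

lemma Pol_relation: "am q \<star> ap q = QQ \<odot>\<^bsub>P\<^esub> (ap q \<star> am q) \<oplus>\<^bsub>P\<^esub> c0 \<odot>\<^bsub>P\<^esub> \<one>\<^bsub>Pol q\<^esub>"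
  using Pol_mult_yx[of 1 0] Pol_mult_x[of 1 0 1]
  by (simp add: ap_eq am_eq Pol_one)

section \<open>The presented algebra and its isomorphism with \<open>Pol\<close>\<close>

private abbreviation "gens \<equiv> (\<lambda>z. case z of gAp \<Rightarrow> ap q | gAm \<Rightarrow> am q)"
private abbreviation "PA \<equiv> presented_alg (pol_rels q)"
private abbreviation "gp \<equiv> pgen (pol_rels q) gAp"
private abbreviation "gm \<equiv> pgen (pol_rels q) gAm"
private abbreviation "hh \<equiv> presented_ext (Pol q) gens"

lemma free_ext_pol_rels:
  assumes B: "calgebra B" and g: "\<And>z. g z \<in> carrier B"
  shows "(\<forall>r\<in>pol_rels q. free_ext B g r = \<zero>\<^bsub>B\<^esub>) \<longleftrightarrow>
    g gAm \<otimes>\<^bsub>B\<^esub> g gAp = QQ \<odot>\<^bsub>B\<^esub> (g gAp \<otimes>\<^bsub>B\<^esub> g gAm) \<oplus>\<^bsub>B\<^esub> c0 \<odot>\<^bsub>B\<^esub> \<one>\<^bsub>B\<^esub>"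
proof -
  note h = free_ext_hom[OF B g] and V = calgebra_vs[OF B]
  have mu: "free_ext B g (p * r) = free_ext B g p \<otimes>\<^bsub>B\<^esub> free_ext B g r" for p r
    using calg_hom_mult[OF h] by simp
  have d: "free_ext B g (p - r) = free_ext B g p \<oplus>\<^bsub>B\<^esub> (-1) \<odot>\<^bsub>B\<^esub> free_ext B g r" for p r
    using lin_minus[OF calg_hom_lin[OF h] vs_free_alg V, of p r]
    by (simp add: vs_minus[OF V] vs_minus[OF vs_free_alg] calg_hom_closed[OF h])
  note [simp] = mu d B V g free_ext_fgen[OF B g] free_ext_fconst[OF B g] vs_diff_eq_iff calg_smult_l
  show ?thesis
    unfolding pol_rels_def by (simp del: of_real_mult of_real_diff of_real_power)
qed

private lemma gens_closed: "gens z \<in> carrier (Pol q)"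
  by (cases z) (simp_all add: ap_eq am_eq mc)

private lemma gens_rels: "r \<in> pol_rels q \<Longrightarrow> free_ext (Pol q) gens r = \<zero>\<^bsub>Pol q\<^esub>"
  using free_ext_pol_rels[where g = gens, OF cP gens_closed] Pol_relation by simp

private lemma hh_hom: "hh \<in> calg_hom PA (Pol q)"
  and hh_gen: "hh gp = ap q" "hh gm = am q"
  using presented_ext_hom[where g = gens, OF cP gens_closed gens_rels]
    presented_ext_pgen[where g = gens, OF cP gens_closed gens_rels] by simp_all

private lemma PA_alg: "calgebra PA" by (rule calgebra_presented_alg)
private lemma PA_vs: "vs PA" by (rule calgebra_vs[OF PA_alg])

private lemma PA_rel: "gm \<otimes>\<^bsub>PA\<^esub> gp = QQ \<odot>\<^bsub>PA\<^esub> (gp \<otimes>\<^bsub>PA\<^esub> gm) \<oplus>\<^bsub>PA\<^esub> c0 \<odot>\<^bsub>PA\<^esub> \<one>\<^bsub>PA\<^esub>"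
proof -
  define rel where "rel = fgen gAm * fgen gAp - fconst (of_real (q\<^sup>2)) * fgen gAp * fgen gAm - fconst (of_real (q * (1 - q\<^sup>2)))"
  let ?p = "pres_proj (pol_rels q)"
  note h = pres_proj_hom[of "pol_rels q"]
  have mu: "?p (u * r) = ?p u \<otimes>\<^bsub>PA\<^esub> ?p r" for u r
    using calg_hom_mult[OF h] by simp
  have cl: "?p u \<in> carrier PA" for u by (simp add: carrier_presented_alg)
  have d: "?p (u - r) = ?p u \<oplus>\<^bsub>PA\<^esub> (-1) \<odot>\<^bsub>PA\<^esub> ?p r" for u r
    using lin_minus[OF calg_hom_lin[OF h] vs_free_alg PA_vs, of u r]
    by (simp add: vs_minus[OF PA_vs] vs_minus[OF vs_free_alg] cl)
  have one: "(1 :: pol_gen free) = Poly_Mapping.single [] 1"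
    by (metis single_one zero_list_def)
  have c: "?p (fconst c) = c \<odot>\<^bsub>PA\<^esub> \<one>\<^bsub>PA\<^esub>" for c
    using lin_smult[OF calg_hom_lin[OF h], of 1 c] calg_hom_one[OF h] by (simp add: one)
  have "?p rel = \<zero>\<^bsub>PA\<^esub>" by (rule pres_proj_rel) (simp add: pol_rels_def rel_def)
  then show ?thesis
    unfolding rel_def pgen_pres_proj
    by (simp add: mu d c cl PA_alg PA_vs vs_diff_eq_iff calg_smult_l del: of_real_mult of_real_diff of_real_power)
qed

text \<open>The monomial \<open>gp\<close>^a \<open>gm\<close>^b as iterated left multiplication, so
  that multiplying by \<open>gp\<close> raises a by definition.\<close>

private abbreviation "pb a b \<equiv> ((\<lambda>u. gp \<otimes>\<^bsub>PA\<^esub> u) ^^ a) (((\<lambda>u. gm \<otimes>\<^bsub>PA\<^esub> u) ^^ b) \<one>\<^bsub>PA\<^esub>)"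

private lemma pb_closed: "pb a b \<in> carrier PA"
proof -
  have "((\<lambda>u. gm \<otimes>\<^bsub>PA\<^esub> u) ^^ b) \<one>\<^bsub>PA\<^esub> \<in> carrier PA" by (induction b) (simp_all add: PA_alg)
  then show ?thesis by (induction a) (simp_all add: PA_alg)
qed

private lemma hh_pb: "hh (pb a b) = m a b"
proof -
  define h where "h = hh"
  note hm = hh_hom[folded h_def] and hg = hh_gen[folded h_def]
  have 0: "((\<lambda>u. gm \<otimes>\<^bsub>PA\<^esub> u) ^^ b) \<one>\<^bsub>PA\<^esub> \<in> carrier PA" for b using pb_closed[of 0 b] by simp
  have "h (((\<lambda>u. gm \<otimes>\<^bsub>PA\<^esub> u) ^^ b) \<one>\<^bsub>PA\<^esub>) = m 0 b"
    using 0 Pol_mult_y[of 0 1] by (induction b) (simp_all add: calg_hom_one[OF hm] calg_hom_mult[OF hm] hg Pol_one am_eq)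
  then have "h (pb a b) = m a b"
    using pb_closed[of _ b] Pol_mult_x[of 1] by (induction a) (simp_all add: calg_hom_mult[OF hm] hg ap_eq)
  then show ?thesis by (simp add: h_def)
qed

text \<open>The reordering of \<open>Y_X_op_power\<close>, now from the relation of the presented
  algebra. It keeps the span of normally ordered monomials stable under \<open>gm\<close>.\<close>

private lemma gm_pb: "gm \<otimes>\<^bsub>PA\<^esub> pb a b = QQ ^ a \<odot>\<^bsub>PA\<^esub> pb a (Suc b) \<oplus>\<^bsub>PA\<^esub> (c0 * qn q a) \<odot>\<^bsub>PA\<^esub> pb (a - 1) b"
proof (induction a)
  case 0
  show ?case using pb_closed[of 0 "Suc b"] pb_closed[of 0 b] by (simp add: PA_vs)
next
  case (Suc a)
  note [simp] = PA_alg PA_vs pb_closed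
  note [simp del] = of_real_mult of_real_diff of_real_power
  have "gm \<otimes>\<^bsub>PA\<^esub> pb (Suc a) b = (gm \<otimes>\<^bsub>PA\<^esub> gp) \<otimes>\<^bsub>PA\<^esub> pb a b"
    by (simp add: calg_m_assoc)
  also have "\<dots> = QQ \<odot>\<^bsub>PA\<^esub> (gp \<otimes>\<^bsub>PA\<^esub> (gm \<otimes>\<^bsub>PA\<^esub> pb a b)) \<oplus>\<^bsub>PA\<^esub> c0 \<odot>\<^bsub>PA\<^esub> pb a b"
    unfolding PA_rel by (simp add: calg_l_distr calg_smult_l calg_m_assoc)
  also have "gp \<otimes>\<^bsub>PA\<^esub> (gm \<otimes>\<^bsub>PA\<^esub> pb a b) = QQ ^ a \<odot>\<^bsub>PA\<^esub> pb (Suc a) (Suc b) \<oplus>\<^bsub>PA\<^esub> (c0 * qn q a) \<odot>\<^bsub>PA\<^esub> pb a b"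
  proof -
    have "(c0 * qn q a) \<odot>\<^bsub>PA\<^esub> (gp \<otimes>\<^bsub>PA\<^esub> pb (a - 1) b) = (c0 * qn q a) \<odot>\<^bsub>PA\<^esub> pb a b"
      using pb_closed[of 1 b] pb_closed[of 0 b] by (cases a) simp_all
    moreover have "gp \<otimes>\<^bsub>PA\<^esub> pb a (Suc b) = pb (Suc a) (Suc b)" by simp
    ultimately show ?thesis unfolding Suc
      using pb_closed[of a "Suc b"] pb_closed[of "a - 1" b] by (simp only: calg_r_distr calg_smult_r PA_alg PA_vs vs_smult_closed pgen_closed)
  qed
  also have "QQ \<odot>\<^bsub>PA\<^esub> (QQ ^ a \<odot>\<^bsub>PA\<^esub> pb (Suc a) (Suc b) \<oplus>\<^bsub>PA\<^esub> (c0 * qn q a) \<odot>\<^bsub>PA\<^esub> pb a b) \<oplus>\<^bsub>PA\<^esub> c0 \<odot>\<^bsub>PA\<^esub> pb a b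
      = QQ ^ Suc a \<odot>\<^bsub>PA\<^esub> pb (Suc a) (Suc b) \<oplus>\<^bsub>PA\<^esub> (c0 * qn q (Suc a)) \<odot>\<^bsub>PA\<^esub> pb a b"
  proof -
    have "(c0 * qn q (Suc a)) \<odot>\<^bsub>PA\<^esub> pb a b = (QQ * (c0 * qn q a)) \<odot>\<^bsub>PA\<^esub> pb a b \<oplus>\<^bsub>PA\<^esub> c0 \<odot>\<^bsub>PA\<^esub> pb a b"
      by (subst vs_smult_l_distr[symmetric]) (simp_all add: qn_Suc' algebra_simps)
    then show ?thesis
      using pb_closed[of "Suc a" "Suc b"] pb_closed[of a b] by (simp add: vs_smult_r_distr vs_smult_smult vs_a_assoc del: funpow.simps)
  qed
  finally show ?case by simp
qed

text \<open>Spanning uses the relation, through \<open>gm_pb\<close>; independence is inherited from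
  \<open>Pol\<close>, where the images of these monomials form a basis.\<close>

lemma PA_basis: "basis PA (\<lambda>(a, b). pb a b) (\<lambda>u. pol_cf q (hh u))"
proof -
  let ?S = "range (\<lambda>(a, b). pb a b)"
  define H where "H = \<Inter>{H. submodule H cplx PA \<and> ?S \<subseteq> H}"
  have H: "submodule H cplx PA" unfolding H_def
    by (rule submodule_Inter[OF PA_vs]) (use submodule_carrier[OF PA_vs] pb_closed in auto)
  have Hb: "pb a b \<in> H" for a b unfolding H_def by auto
  have Hl: "H \<subseteq> K" if "submodule K cplx PA" "?S \<subseteq> K" for K
    unfolding H_def using that by auto
  have st: "pgen (pol_rels q) z \<otimes>\<^bsub>PA\<^esub> v \<in> H" if "v \<in> H" for z v
  proof -
    have "pgen (pol_rels q) z \<otimes>\<^bsub>PA\<^esub> pb a b \<in> H" for a b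
    proof (cases z)
      case gAp
      then show ?thesis using Hb[of "Suc a" b] by simp
    next
      case gAm
      then show ?thesis using H Hb[of a "Suc b"] Hb[of "a - 1" b] unfolding gAm gm_pb submodule_vs_iff[OF PA_vs] by blast
    qed
    then have "?S \<subseteq> {v \<in> carrier PA. pgen (pol_rels q) z \<otimes>\<^bsub>PA\<^esub> v \<in> H}" using pb_closed by auto
    from Hl[OF submodule_vimage[OF PA_vs PA_vs calg_lin_r[OF PA_alg pgen_closed] H] this] that
    show ?thesis by auto
  qed
  have "u \<in> H" if "u \<in> carrier PA" for u
    by (rule presented_induct[OF that]) (use H Hb[of 0 0] st in \<open>auto intro: submodule_Int[OF PA_vs submodule_carrier[OF PA_vs] H, simplified Int_def, simplified]\<close>)
  then have "spans PA ?S" unfolding H_def using pb_closed by (intro spansI) auto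
  moreover have "lin PA fun_sp (\<lambda>u. pol_cf q (hh u))"
    using lin_comp[OF calg_hom_lin[OF hh_hom, simplified] basis_lin[OF pol_basis]] .
  ultimately show ?thesis
    by (auto simp: basis_def PA_vs hh_pb basis_coord[OF pol_basis])
qed

text \<open>Injectivity holds because the coordinates of an element are those of its image. For
  surjectivity the image is a subspace that contains 1 and is stable under left multiplication by
  the generators.\<close>

lemma Pol_presentation: "hh \<in> calg_iso PA (Pol q)"
proof -
  have "inj_on hh (carrier PA)"
    by (rule inj_onI, rule basis_inj[OF PA_basis]) auto
  moreover have "hh ` carrier PA = carrier (Pol q)"
  proof
    show "hh ` carrier PA \<subseteq> carrier (Pol q)" using calg_hom_closed[OF hh_hom] by auto
    have "submodule (hh ` carrier PA) cplx P"
      unfolding submodule_vs_iff[OF vP]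
    proof (intro conjI ballI allI)
      show "hh ` carrier PA \<subseteq> carrier P" using calg_hom_closed[OF hh_hom] by auto
      show "\<zero>\<^bsub>P\<^esub> \<in> hh ` carrier PA"
        using lin_zero[OF calg_hom_lin[OF hh_hom] PA_vs vs_Pol] PA_vs by (metis Pol_simps(2) imageI vs_zero_closed)
      fix u v c assume "u \<in> hh ` carrier PA"
      then obtain u' where u: "u = hh u'" "u' \<in> carrier PA" by auto
      show "c \<odot>\<^bsub>P\<^esub> u \<in> hh ` carrier PA"
        using lin_smult[OF calg_hom_lin[OF hh_hom] u(2), of c] u PA_vs by (auto intro!: image_eqI[of _ _ "c \<odot>\<^bsub>PA\<^esub> u'"])
      assume "v \<in> hh ` carrier PA"
      then obtain v' where v: "v = hh v'" "v' \<in> carrier PA" by auto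
      show "u \<oplus>\<^bsub>P\<^esub> v \<in> hh ` carrier PA"
        using lin_add[OF calg_hom_lin[OF hh_hom] u(2) v(2)] u v PA_vs by (auto intro!: image_eqI[of _ _ "u' \<oplus>\<^bsub>PA\<^esub> v'"])
    qed
    moreover have "hh (pgen (pol_rels q) z) \<star> h \<in> hh ` carrier PA" if "h \<in> hh ` carrier PA" for z h
      using that calg_hom_mult[OF hh_hom pgen_closed] PA_alg
      by (auto intro!: image_eqI[of _ _ "pgen (pol_rels q) z \<otimes>\<^bsub>PA\<^esub> _"])
    note this[of _ gAp] this[of _ gAm]
    ultimately show "carrier (Pol q) \<subseteq> hh ` carrier PA"
      using Pol_gen_induct[of "hh ` carrier PA"] calg_hom_one[OF hh_hom] PA_alg
      by (simp add: hh_gen) (metis calg_one_closed image_eqI)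
  qed
  ultimately show ?thesis using hh_hom by (simp add: calg_iso_def bij_betw_def)
qed

end

end

subsection \<open>Module algebras\<close>

context uq
begin

context
  fixes A :: "(complex, 'a) module" and act
  assumes A: "calgebra A" and M: "left_module (Uq q) A act"
begin

private abbreviation "Phi X f g \<equiv> tensor_ext A (\<lambda>\<xi> \<eta>. act \<xi> f \<otimes>\<^bsub>A\<^esub> act \<eta> g) X"

private lemma VA: "vs A" by (rule calgebra_vs[OF A])

private lemma bil: "f \<in> carrier A \<Longrightarrow> g \<in> carrier A \<Longrightarrow> bilin U U A (\<lambda>\<xi> \<eta>. act \<xi> f \<otimes>\<^bsub>A\<^esub> act \<eta> g)"
  by (rule bilin_lin_comp[OF calg_bilin[OF A] left_module_lin_l[OF M] left_module_lin_l[OF M]])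

lemma Phi_lin: "f \<in> carrier A \<Longrightarrow> g \<in> carrier A \<Longrightarrow> lin (tensor U U) A (\<lambda>X. Phi X f g)"
  by (rule lin_tensor_ext[OF vs_Uq vs_Uq VA bil])

private lemma Phi_pt: "f \<in> carrier A \<Longrightarrow> g \<in> carrier A \<Longrightarrow> \<xi> \<in> carrier U \<Longrightarrow> \<eta> \<in> carrier U \<Longrightarrow>
    Phi (ptens U U \<xi> \<eta>) f g = act \<xi> f \<otimes>\<^bsub>A\<^esub> act \<eta> g"
  by (rule tensor_ext_ptens[OF vs_Uq vs_Uq VA bil])

lemma Phi_gen:
  assumes [simp]: "f \<in> carrier A" "g \<in> carrier A"
  shows "Phi (uq_comult q KK) f g = act KK f \<otimes>\<^bsub>A\<^esub> act KK g"
    "Phi (uq_comult q KI) f g = act KI f \<otimes>\<^bsub>A\<^esub> act KI g"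
    "Phi (uq_comult q EE) f g = act EE f \<otimes>\<^bsub>A\<^esub> g \<oplus>\<^bsub>A\<^esub> act KK f \<otimes>\<^bsub>A\<^esub> act EE g"
    "Phi (uq_comult q FF) f g = act FF f \<otimes>\<^bsub>A\<^esub> act KI g \<oplus>\<^bsub>A\<^esub> f \<otimes>\<^bsub>A\<^esub> act FF g"
  by (simp_all add: uq_comult_gen Phi_pt lin_add[OF Phi_lin] calgebra_Uq left_module_one[OF M])

text \<open>If the product rule holds for the generators and for xi, it holds for a generator times
  xi, since the comultiplication is multiplicative; \<open>step\<close> moves the generator through
  the sum that represents the comultiplication of xi.\<close>

lemma module_algebraI:
  assumes one: "\<And>x. act (ugen q x) \<one>\<^bsub>A\<^esub> = uq_counit (ugen q x) \<odot>\<^bsub>A\<^esub> \<one>\<^bsub>A\<^esub>"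
    and mult: "\<And>x f g. f \<in> carrier A \<Longrightarrow> g \<in> carrier A \<Longrightarrow> act (ugen q x) (f \<otimes>\<^bsub>A\<^esub> g) = Phi (uq_comult q (ugen q x)) f g"
  shows "module_algebra q A act"
proof -
  note [simp] = A VA calgebra_Uq left_module_closed[OF M]
  note D = uq_comult_hom
  have Dc: "\<xi> \<in> carrier U \<Longrightarrow> uq_comult q \<xi> \<in> carrier (tensor U U)" for \<xi> using calg_hom_closed[OF D] by simp
  have c: "act \<xi> \<one>\<^bsub>A\<^esub> = uq_counit \<xi> \<odot>\<^bsub>A\<^esub> \<one>\<^bsub>A\<^esub>" if "\<xi> \<in> carrier U" for \<xi>
  proof (rule Uq_induct[OF that])
    show "submodule {\<xi> \<in> carrier U. act \<xi> \<one>\<^bsub>A\<^esub> = uq_counit \<xi> \<odot>\<^bsub>A\<^esub> \<one>\<^bsub>A\<^esub>} cplx U"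
      by (rule submodule_equalizer[OF vs_Uq VA left_module_lin_l[OF M] lin_functional_smult[OF VA calg_hom_lin[OF uq_counit_hom]]]) simp_all
    fix x \<xi> assume "\<xi> \<in> carrier U" "act \<xi> \<one>\<^bsub>A\<^esub> = uq_counit \<xi> \<odot>\<^bsub>A\<^esub> \<one>\<^bsub>A\<^esub>"
    then show "act (ugen q x \<otimes>\<^bsub>U\<^esub> \<xi>) \<one>\<^bsub>A\<^esub> = uq_counit (ugen q x \<otimes>\<^bsub>U\<^esub> \<xi>) \<odot>\<^bsub>A\<^esub> \<one>\<^bsub>A\<^esub>"
      by (simp add: left_module_mult[OF M] lin_smult[OF left_module_lin_r[OF M]] one calg_hom_mult[OF uq_counit_hom] vs_smult_smult mult.commute)
  qed (simp_all add: left_module_one[OF M] calg_hom_one[OF uq_counit_hom])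
  note tc = calgebra_tensor_alg[OF calgebra_Uq[of q] calgebra_Uq[of q]]
  note tl = bilin_l[OF bilin_tensor_alg_mult[OF calgebra_Uq calgebra_Uq]] and tr = bilin_r[OF bilin_tensor_alg_mult[OF calgebra_Uq calgebra_Uq]]
  \<comment> \<open>Multiplying X on the right by a pure tensor means acting on f and g
    first.\<close>
  have pt_mult: "Phi (X \<otimes>\<^bsub>tensor_alg U U\<^esub> ptens U U \<xi> \<eta>) f g = Phi X (act \<xi> f) (act \<eta> g)"
    if X: "X \<in> carrier (tensor U U)" and [simp]: "\<xi> \<in> carrier U" "\<eta> \<in> carrier U" "f \<in> carrier A" "g \<in> carrier A" for X \<xi> \<eta> f g
    by (rule lin_eq_on_tensor[where f = "\<lambda>X. Phi (X \<otimes>\<^bsub>tensor_alg U U\<^esub> ptens U U \<xi> \<eta>) f g" and g = "\<lambda>X. Phi X (act \<xi> f) (act \<eta> g)",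
          OF vs_Uq vs_Uq VA lin_comp[OF tl Phi_lin] Phi_lin _ X])
      (simp_all add: tensor_alg_mult_ptens Phi_pt left_module_mult[OF M])
  have step: "act (ugen q x) (Phi Y f g) = Phi (uq_comult q (ugen q x) \<otimes>\<^bsub>tensor_alg U U\<^esub> Y) f g"
    if Y: "Y \<in> carrier (tensor U U)" and [simp]: "f \<in> carrier A" "g \<in> carrier A" for Y f g x
    by (rule lin_eq_on_tensor[where f = "\<lambda>Y. act (ugen q x) (Phi Y f g)" and g = "\<lambda>Y. Phi (uq_comult q (ugen q x) \<otimes>\<^bsub>tensor_alg U U\<^esub> Y) f g",
          OF vs_Uq vs_Uq VA lin_comp[OF Phi_lin left_module_lin_r[OF M]] lin_comp[OF tr Phi_lin] _ Y])
      (simp_all add: Phi_pt mult pt_mult Dc)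
  have m: "\<forall>f\<in>carrier A. \<forall>g\<in>carrier A. act \<xi> (f \<otimes>\<^bsub>A\<^esub> g) = Phi (uq_comult q \<xi>) f g" if "\<xi> \<in> carrier U" for \<xi>
  proof (rule Uq_induct[OF that])
    note [simp] = lin_add[OF left_module_lin_l[OF M]] lin_smult[OF left_module_lin_l[OF M]] lin_zero[OF left_module_lin_l[OF M] vs_Uq VA]
      lin_add[OF calg_hom_lin[OF D], simplified] lin_smult[OF calg_hom_lin[OF D], simplified]
      lin_add[OF Phi_lin] lin_smult[OF Phi_lin] lin_zero[OF Phi_lin] Dc
    have z: "uq_comult q \<zero>\<^bsub>U\<^esub> = \<zero>\<^bsub>tensor U U\<^esub>"
      using lin_zero[OF calg_hom_lin[OF D, simplified] vs_Uq vs_tensor[OF vs_Uq vs_Uq]] .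
    show "submodule {\<xi> \<in> carrier U. \<forall>f\<in>carrier A. \<forall>g\<in>carrier A. act \<xi> (f \<otimes>\<^bsub>A\<^esub> g) = Phi (uq_comult q \<xi>) f g} cplx U"
      by (auto simp: submodule_vs_iff z)
    show "\<forall>f\<in>carrier A. \<forall>g\<in>carrier A. act \<one>\<^bsub>U\<^esub> (f \<otimes>\<^bsub>A\<^esub> g) = Phi (uq_comult q \<one>\<^bsub>U\<^esub>) f g"
      using calg_hom_one[OF D] by (simp add: left_module_one[OF M] Phi_pt)
    fix x \<xi> assume "\<xi> \<in> carrier U" "\<forall>f\<in>carrier A. \<forall>g\<in>carrier A. act \<xi> (f \<otimes>\<^bsub>A\<^esub> g) = Phi (uq_comult q \<xi>) f g"
    then show "\<forall>f\<in>carrier A. \<forall>g\<in>carrier A. act (ugen q x \<otimes>\<^bsub>U\<^esub> \<xi>) (f \<otimes>\<^bsub>A\<^esub> g) = Phi (uq_comult q (ugen q x \<otimes>\<^bsub>U\<^esub> \<xi>)) f g"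
      using calg_hom_mult[OF D] by (simp add: left_module_mult[OF M] step)
  qed
  show ?thesis unfolding module_algebra_def using c m M A by simp
qed

end

end

subsection \<open>The action on $\mathrm{Pol}(\mathfrak g_{-1})_q$\<close>

context uq
begin

context
begin

private abbreviation "pa \<equiv> Pol_act q"

lemma Pol_act_module_sp: "left_module U P pa"
  unfolding Pol_act_def pol_sp_def
  by (rule left_module_tensor_act[OF dual_module dual_module calgebra_Uq uq_comult_hom])

lemma Pol_act_module: "left_module U (Pol q) pa"
  using Pol_act_module_sp vs_Pol by (simp add: left_module_def)

private lemmas pl = left_module_lin_r[OF Pol_act_module_sp ugen_closed]
private lemmas pa_expand = lin_add[OF pl] lin_smult[OF pl]
private lemmas pa_closed = left_module_closed[OF Pol_act_module_sp ugen_closed]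

private abbreviation "taP \<equiv> tens_act (Cg q) (dual_act q Minus) (Cgbar q) (dual_act q Plus)"

private lemma taP_pt: "\<xi> \<in> carrier U \<Longrightarrow> \<eta> \<in> carrier U \<Longrightarrow> f \<in> carrier (Cg q) \<Longrightarrow> g \<in> carrier (Cgbar q) \<Longrightarrow>
    taP (ptens U U \<xi> \<eta>) (ptens (Cg q) (Cgbar q) f g) = ptens (Cg q) (Cgbar q) (dual_act q Minus \<xi> f) (dual_act q Plus \<eta> g)"
  by (rule left_module_tensor(2)[OF dual_module dual_module calgebra_Uq calgebra_Uq])

private lemma taP_add: "X \<in> carrier (tensor U U) \<Longrightarrow> Y \<in> carrier (tensor U U) \<Longrightarrow> t \<in> carrier P \<Longrightarrow>
    taP (X \<oplus>\<^bsub>tensor U U\<^esub> Y) t = taP X t \<oplus>\<^bsub>P\<^esub> taP Y t"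
  using lin_add[OF left_module_lin_l[OF left_module_tensor(1)[OF dual_module dual_module calgebra_Uq[of q] calgebra_Uq[of q]]]]
  by (simp add: pol_sp_def)

private lemma kap_simps: "1 / kap q Minus = QQ" "1 / kap q Plus = RR" "kap q Minus = RR" "kap q Plus = QQ" "1 / RR = QQ" "1 / QQ = RR"
  by (simp_all add: kap_def)

private lemma pt_m: "ptens (Cg q) (Cgbar q) (dual_bas q Minus a) (dual_bas q Plus b) = m a b"
  by (simp add: pol_bas_def)

text \<open>In the formula for E the factor q^(2a) is K acting on a_+^a, from the summand K tensor
  E; in the one for F the factor q^(2b) is K^{-1} acting on a_-^b, from F tensor K^{-1}.\<close>

lemma Pol_act_bas:
  "pa KK (m a b) = (QQ ^ a * RR ^ b) \<odot>\<^bsub>P\<^esub> m a b"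
  "pa KI (m a b) = (RR ^ a * QQ ^ b) \<odot>\<^bsub>P\<^esub> m a b"
  "pa EE (m a b) = (- of_real q * qn q a) \<odot>\<^bsub>P\<^esub> m (Suc a) b \<oplus>\<^bsub>P\<^esub> (QQ ^ a * ecoef q b) \<odot>\<^bsub>P\<^esub> m a (b - 1)"
  "pa FF (m a b) = (ecoef q a * QQ ^ b) \<odot>\<^bsub>P\<^esub> m (a - 1) b \<oplus>\<^bsub>P\<^esub> (- of_real q * qn q b) \<odot>\<^bsub>P\<^esub> m a (Suc b)"
proof -
  note [simp del] = of_real_divide of_real_diff of_real_power of_real_mult
  have sc: "c \<odot>\<^bsub>Cg q\<^esub> dual_bas q Minus k \<in> carrier (Cg q)" "c \<odot>\<^bsub>Cgbar q\<^esub> dual_bas q Plus k \<in> carrier (Cgbar q)" for c k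
    by (rule vs_smult_closed[OF DD])+
  have pt: "ptens (Cg q) (Cgbar q) (c \<odot>\<^bsub>Cg q\<^esub> dual_bas q Minus k) (d \<odot>\<^bsub>Cgbar q\<^esub> dual_bas q Plus l) = (c * d) \<odot>\<^bsub>P\<^esub> m k l"
    "ptens (Cg q) (Cgbar q) (c \<odot>\<^bsub>Cg q\<^esub> dual_bas q Minus k) (dual_bas q Plus l) = c \<odot>\<^bsub>P\<^esub> m k l"
    "ptens (Cg q) (Cgbar q) (dual_bas q Minus k) (d \<odot>\<^bsub>Cgbar q\<^esub> dual_bas q Plus l) = d \<odot>\<^bsub>P\<^esub> m k l" for c d k l
    using vP mc by (simp_all add: DD sc ptens_smult_l ptens_smult_r pt_m pol_sp_def[symmetric] vs_smult_smult mult.commute)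
  have g: "dual_act q Minus FF (dual_bas q Minus k) = ecoef q k \<odot>\<^bsub>Cg q\<^esub> dual_bas q Minus (k - 1)"
    "dual_act q Plus EE (dual_bas q Plus k) = ecoef q k \<odot>\<^bsub>Cgbar q\<^esub> dual_bas q Plus (k - 1)"
    "dual_act q Minus EE (dual_bas q Minus k) = (- of_real q * qn q k) \<odot>\<^bsub>Cg q\<^esub> dual_bas q Minus (Suc k)"
    "dual_act q Plus FF (dual_bas q Plus k) = (- of_real q * qn q k) \<odot>\<^bsub>Cgbar q\<^esub> dual_bas q Plus (Suc k)" for k
    using dual_act_generating[of Minus k] dual_act_generating[of Plus k]
      dual_act_killing[of Minus k] dual_act_killing[of Plus k] by (simp_all add: ecoef_def)
  note s = Pol_act_def tensor_act_tens_act uq_comult_gen taP_pt DD calgebra_Uq dual_act_K dual_act_Ki kap_simps pt g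
    left_module_one[OF dual_module]
  have mm: "m a b = ptens (Cg q) (Cgbar q) (dual_bas q Minus a) (dual_bas q Plus b)" for a b by (simp add: pol_bas_def)
  have ad: "taP (X \<oplus>\<^bsub>tensor U U\<^esub> Y) (m a b) = taP X (m a b) \<oplus>\<^bsub>P\<^esub> taP Y (m a b)"
    if "X \<in> carrier (tensor U U)" "Y \<in> carrier (tensor U U)" for X Y a b
    by (rule taP_add[OF that mc])
  have ptt: "taP (ptens U U \<xi> \<eta>) (m a b) = ptens (Cg q) (Cgbar q) (dual_act q Minus \<xi> (dual_bas q Minus a)) (dual_act q Plus \<eta> (dual_bas q Plus b))"
    if "\<xi> \<in> carrier U" "\<eta> \<in> carrier U" for \<xi> \<eta> a b
    unfolding mm by (rule taP_pt[OF that DD(2) DD(2)])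
  show "pa KK (m a b) = (QQ ^ a * RR ^ b) \<odot>\<^bsub>P\<^esub> m a b" "pa KI (m a b) = (RR ^ a * QQ ^ b) \<odot>\<^bsub>P\<^esub> m a b"
    "pa EE (m a b) = (- of_real q * qn q a) \<odot>\<^bsub>P\<^esub> m (Suc a) b \<oplus>\<^bsub>P\<^esub> (QQ ^ a * ecoef q b) \<odot>\<^bsub>P\<^esub> m a (b - 1)"
    "pa FF (m a b) = (ecoef q a * QQ ^ b) \<odot>\<^bsub>P\<^esub> m (a - 1) b \<oplus>\<^bsub>P\<^esub> (- of_real q * qn q b) \<odot>\<^bsub>P\<^esub> m a (Suc b)"
    by (simp_all add: s ad ptt)
qed

text \<open>The twisted Leibniz rules that the comultiplication dictates for the four generators,
  compare \<open>Phi_gen\<close>.\<close>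

definition pder :: "polq \<Rightarrow> polq \<Rightarrow> bool" where
  "pder f g \<longleftrightarrow> pa KK (f \<star> g) = pa KK f \<star> pa KK g \<and> pa KI (f \<star> g) = pa KI f \<star> pa KI g \<and>
     pa EE (f \<star> g) = pa EE f \<star> g \<oplus>\<^bsub>P\<^esub> pa KK f \<star> pa EE g \<and>
     pa FF (f \<star> g) = pa FF f \<star> pa KI g \<oplus>\<^bsub>P\<^esub> f \<star> pa FF g"

text \<open>[b+1] = 1 + q^2 [b], divided by q^(2b).\<close>

private lemma ecoef_Suc: "ecoef q (Suc b) = RR ^ b + ecoef q b"
proof -
  have QA: "QQ * (RR * z) = z" for z using scal_cancel[OF q0] by (metis mult.assoc mult_1)
  note [simp del] = of_real_divide of_real_diff of_real_power of_real_mult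
  show ?thesis
    by (cases b) (simp_all add: ecoef_def qn_Suc' algebra_simps QA)
qed

text \<open>The rules for a triple product agree for both bracketings, so
  \<open>Pol_pair_induct\<close> applies. Two families of normally ordered pairs and the pair a_-,
  a_+ are then compared coefficientwise; the last one expresses that the action respects the
  relation.\<close>

lemma pder_all:
  assumes "f \<in> carrier P" "g \<in> carrier P"
  shows "pder f g"
proof (rule Pol_pair_induct[OF _ _ _ _ _ _ _ _ _ assms])
  note [simp] = mc vP Pol_mult_closed pa_closed
  have z: "pa (ugen q x) \<zero>\<^bsub>P\<^esub> = \<zero>\<^bsub>P\<^esub>" for x by (rule lin_zero[OF pl vP vP])
  have zm: "f \<star> \<zero>\<^bsub>P\<^esub> = \<zero>\<^bsub>P\<^esub>" "\<zero>\<^bsub>P\<^esub> \<star> f = \<zero>\<^bsub>P\<^esub>" if "f \<in> carrier P" for f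
    using calg_l_null[OF cP] calg_r_null[OF cP] that by simp_all
  note ac = vs_a_assoc[OF vP] vs_a_comm[OF vP] vs_a_lcomm[OF vP]
  show "submodule {g \<in> carrier P. pder f g} cplx P" if "f \<in> carrier P" for f
    using that by (auto simp: submodule_vs_iff pder_def pa_expand Pol_expand z zm vs_smult_r_distr ac)
  show "submodule {f \<in> carrier P. pder f g} cplx P" if "g \<in> carrier P" for g
    using that by (auto simp: submodule_vs_iff pder_def pa_expand Pol_expand z zm vs_smult_r_distr ac)
  fix f g h assume f: "f \<in> carrier P" and g: "g \<in> carrier P" and h: "h \<in> carrier P"
  show "pder f (g \<star> h)" if "pder f g" "pder (f \<star> g) h" "pder g h"
    using that f g h unfolding pder_def by (simp add: Pol_assoc Pol_expand vs_a_assoc)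
  show "pder (f \<star> g) h" if "pder f g" "pder f (g \<star> h)" "pder g h"
    using that f g h unfolding pder_def by (simp add: Pol_assoc Pol_expand vs_a_assoc)
next
  note [simp] = mc vP Pol_mult_closed pa_closed
  have zm: "f \<star> \<zero>\<^bsub>P\<^esub> = \<zero>\<^bsub>P\<^esub>" "\<zero>\<^bsub>P\<^esub> \<star> f = \<zero>\<^bsub>P\<^esub>" if "f \<in> carrier P" for f
    using calg_l_null[OF cP] calg_r_null[OF cP] that by simp_all
  fix f assume f: "f \<in> carrier P"
  show "pder f \<one>\<^bsub>Pol q\<^esub>" "pder \<one>\<^bsub>Pol q\<^esub> f"
    using f by (simp_all add: pder_def Pol_one Pol_act_bas Pol_one_l Pol_one_r zm)
next
  note QR = scal_cancel[OF q0]
  have QA: "QQ * (RR * z) = z" "RR * (QQ * z) = z" for z using QR by (metis mult.assoc mult_1)+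
  have qs: "qn q (Suc n) = 1 + QQ * qn q n" for n by (rule qn_Suc')
  show "pder (m (Suc 0) 0) (m a b)" for a b
    unfolding pder_def
  proof (intro conjI)
    note [simp] = cf_simps Pol_mult_closed pa_closed
    note s = Pol_act_bas Pol_mult_x Pol_expand pa_expand
    note [simp del] = of_real_divide of_real_diff of_real_power of_real_mult
    show "pa KK (m (Suc 0) 0 \<star> m a b) = pa KK (m (Suc 0) 0) \<star> pa KK (m a b)"
      "pa KI (m (Suc 0) 0 \<star> m a b) = pa KI (m (Suc 0) 0) \<star> pa KI (m a b)"
      by (rule pol_eqI; simp add: s; simp add: QR mult.assoc)+
    show "pa EE (m (Suc 0) 0 \<star> m a b) = pa EE (m (Suc 0) 0) \<star> m a b \<oplus>\<^bsub>P\<^esub> pa KK (m (Suc 0) 0) \<star> pa EE (m a b)"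
      by (rule pol_eqI; simp add: s; auto simp: qs algebra_simps)
    show "pa FF (m (Suc 0) 0 \<star> m a b) = pa FF (m (Suc 0) 0) \<star> pa KI (m a b) \<oplus>\<^bsub>P\<^esub> m (Suc 0) 0 \<star> pa FF (m a b)"
      by (cases a; rule pol_eqI; simp add: s; auto simp: ecoef_Suc algebra_simps)
  qed
  show "pder (m a b) (m 0 (Suc 0))" for a b
    unfolding pder_def
  proof (intro conjI)
    note [simp] = cf_simps Pol_mult_closed pa_closed
    note s = Pol_act_bas Pol_mult_y Pol_expand pa_expand
    note [simp del] = of_real_divide of_real_diff of_real_power of_real_mult
    show "pa KK (m a b \<star> m 0 (Suc 0)) = pa KK (m a b) \<star> pa KK (m 0 (Suc 0))"
      "pa KI (m a b \<star> m 0 (Suc 0)) = pa KI (m a b) \<star> pa KI (m 0 (Suc 0))"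
      by (rule pol_eqI; simp add: s; simp add: QR algebra_simps)+
    show "pa EE (m a b \<star> m 0 (Suc 0)) = pa EE (m a b) \<star> m 0 (Suc 0) \<oplus>\<^bsub>P\<^esub> pa KK (m a b) \<star> pa EE (m 0 (Suc 0))"
      by (cases b; rule pol_eqI; simp add: s; auto simp: ecoef_Suc algebra_simps)
    show "pa FF (m a b \<star> m 0 (Suc 0)) = pa FF (m a b) \<star> pa KI (m 0 (Suc 0)) \<oplus>\<^bsub>P\<^esub> m a b \<star> pa FF (m 0 (Suc 0))"
      by (rule pol_eqI; simp add: s; auto simp: qs algebra_simps)
  qed
  show "pder (m 0 (Suc 0)) (m (Suc 0) 0)"
    unfolding pder_def
  proof (intro conjI)
    note [simp] = cf_simps Pol_mult_closed pa_closed
    note yx = Pol_mult_yx[simplified One_nat_def]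
    \<comment> \<open>F a_- is a multiple of a_-^2, so the rule for F on a_- a_+ requires a_-^2 a_+
      in normal order; it is obtained by using the relation twice.\<close>
    have yyx: "m 0 (Suc (Suc 0)) \<star> m (Suc 0) 0 = m 0 (Suc 0) \<star> (m 0 (Suc 0) \<star> m (Suc 0) 0)"
      using Pol_mult_y[of 0 1 1] Pol_assoc[of "m 0 (Suc 0)" "m 0 (Suc 0)" "m (Suc 0) 0"] by simp
    note s = Pol_act_bas Pol_mult_x Pol_mult_y yyx yx Pol_expand pa_expand
    show "pa KK (m 0 (Suc 0) \<star> m (Suc 0) 0) = pa KK (m 0 (Suc 0)) \<star> pa KK (m (Suc 0) 0)"
      "pa KI (m 0 (Suc 0) \<star> m (Suc 0) 0) = pa KI (m 0 (Suc 0)) \<star> pa KI (m (Suc 0) 0)"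
      by (rule pol_eqI; simp add: s; simp add: field_simps q0)+
    show "pa EE (m 0 (Suc 0) \<star> m (Suc 0) 0) = pa EE (m 0 (Suc 0)) \<star> m (Suc 0) 0 \<oplus>\<^bsub>P\<^esub> pa KK (m 0 (Suc 0)) \<star> pa EE (m (Suc 0) 0)"
      by (rule pol_eqI; simp add: s; auto simp: qs field_simps power2_eq_square power4_eq_xxxx q0)
    show "pa FF (m 0 (Suc 0) \<star> m (Suc 0) 0) = pa FF (m 0 (Suc 0)) \<star> pa KI (m (Suc 0) 0) \<oplus>\<^bsub>P\<^esub> m 0 (Suc 0) \<star> pa FF (m (Suc 0) 0)"
      by (rule pol_eqI; simp add: s; auto simp: qs field_simps power2_eq_square power4_eq_xxxx q0)
  qed
qed

lemma pder_Phi: "pder f g \<longleftrightarrow> pa KK (f \<star> g) = pa KK f \<star> pa KK g \<and> pa KI (f \<star> g) = pa KI f \<star> pa KI g \<and>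
     pa EE (f \<star> g) = pa EE f \<star> g \<oplus>\<^bsub>Pol q\<^esub> pa KK f \<star> pa EE g \<and>
     pa FF (f \<star> g) = pa FF f \<star> pa KI g \<oplus>\<^bsub>Pol q\<^esub> f \<star> pa FF g"
  by (simp add: pder_def)

lemma Pol_module_algebra: "module_algebra q (Pol q) pa"
proof (rule module_algebraI[OF cP Pol_act_module])
  show "pa (ugen q x) \<one>\<^bsub>Pol q\<^esub> = uq_counit (ugen q x) \<odot>\<^bsub>Pol q\<^esub> \<one>\<^bsub>Pol q\<^esub>" for x
    by (cases x) (simp_all add: Pol_one Pol_act_bas uq_counit_gen mc vP)
  fix x f g assume f: "f \<in> carrier (Pol q)" and g: "g \<in> carrier (Pol q)"
  have "pder f g" using pder_all f g by simp
  then show "pa (ugen q x) (f \<star> g) = tensor_ext (Pol q) (\<lambda>\<xi> \<eta>. pa \<xi> f \<star> pa \<eta> g) (uq_comult q (ugen q x))"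
    by (cases x) (simp_all only: pder_Phi Phi_gen[OF cP Pol_act_module f g])
qed

lemma Pol_action_formulas: "action_formulas q pa"
proof -
  have o: "ecoef q 0 = 0" "ecoef q (Suc 0) = 1" by simp_all
  show ?thesis
    using Pol_mult_x[of 1 1 0] Pol_mult_y[of 0 1 1]
    by (simp add: action_formulas_def ap_eq am_eq Pol_act_bas Pol_one mc vP)
qed

text \<open>The product rule determines a generator of U on products from its values on the factors.
  Agreement on a_+ and a_- thus spreads to all of \<open>Pol\<close>, and from the generators along
  words to all of U.\<close>

lemma Pol_act_unique:
  assumes M: "module_algebra q (Pol q) act" and F: "action_formulas q act"
    and \<xi>: "\<xi> \<in> carrier U" and f: "f \<in> carrier P"
  shows "act \<xi> f = pa \<xi> f"
proof -
  have L: "left_module U (Pol q) act" and one: "\<And>\<xi>. \<xi> \<in> carrier U \<Longrightarrow> act \<xi> \<one>\<^bsub>Pol q\<^esub> = uq_counit \<xi> \<odot>\<^bsub>Pol q\<^esub> \<one>\<^bsub>Pol q\<^esub>"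
    and mult: "\<And>\<xi> f g. \<xi> \<in> carrier U \<Longrightarrow> f \<in> carrier P \<Longrightarrow> g \<in> carrier P \<Longrightarrow>
      act \<xi> (f \<star> g) = tensor_ext (Pol q) (\<lambda>\<xi> \<eta>. act \<xi> f \<star> act \<eta> g) (uq_comult q \<xi>)"
    using M by (auto simp: module_algebra_def)
  have one': "pa \<xi> \<one>\<^bsub>Pol q\<^esub> = uq_counit \<xi> \<odot>\<^bsub>Pol q\<^esub> \<one>\<^bsub>Pol q\<^esub>" if "\<xi> \<in> carrier U" for \<xi>
    using Pol_module_algebra that by (auto simp: module_algebra_def)
  note ll = left_module_lin_r[OF L ugen_closed, simplified] and lc = left_module_closed[OF L, simplified]
  have d: "act KK (f \<star> g) = act KK f \<star> act KK g" "act KI (f \<star> g) = act KI f \<star> act KI g"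
     "act EE (f \<star> g) = act EE f \<star> g \<oplus>\<^bsub>Pol q\<^esub> act KK f \<star> act EE g"
     "act FF (f \<star> g) = act FF f \<star> act KI g \<oplus>\<^bsub>Pol q\<^esub> f \<star> act FF g" if "f \<in> carrier P" "g \<in> carrier P" for f g
    using that by (simp_all only: mult ugen_closed Phi_gen[OF cP L, unfolded Pol_simps(1)])
  have d': "pa KK (f \<star> g) = pa KK f \<star> pa KK g" "pa KI (f \<star> g) = pa KI f \<star> pa KI g"
     "pa EE (f \<star> g) = pa EE f \<star> g \<oplus>\<^bsub>Pol q\<^esub> pa KK f \<star> pa EE g"
     "pa FF (f \<star> g) = pa FF f \<star> pa KI g \<oplus>\<^bsub>Pol q\<^esub> f \<star> pa FF g" if "f \<in> carrier P" "g \<in> carrier P" for f g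
    using pder_all[OF that] by (auto simp: pder_Phi)
  have e: "act (ugen q x) (ap q) = pa (ugen q x) (ap q)" "act (ugen q x) (am q) = pa (ugen q x) (am q)" for x
    using F Pol_action_formulas unfolding action_formulas_def by (cases x; metis)+
  have apc: "ap q \<in> carrier P" "am q \<in> carrier P" by (simp_all add: ap_eq am_eq mc)
  have S: "submodule {f \<in> carrier P. \<forall>x. act (ugen q x) f = pa (ugen q x) f} cplx P"
    by (auto simp: submodule_vs_iff vP pa_expand lin_add[OF ll] lin_smult[OF ll] lin_zero[OF ll vP vP] lin_zero[OF pl vP vP])
  have "carrier P \<subseteq> {f \<in> carrier P. \<forall>x. act (ugen q x) f = pa (ugen q x) f}"
  proof (rule Pol_gen_induct[OF S])
    show "\<one>\<^bsub>Pol q\<^esub> \<in> {f \<in> carrier P. \<forall>x. act (ugen q x) f = pa (ugen q x) f}"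
      using one one' by (simp add: Pol_one mc)
    fix h assume h: "h \<in> {f \<in> carrier P. \<forall>x. act (ugen q x) f = pa (ugen q x) f}" "h \<in> carrier P"
    have "act (ugen q x) (ap q \<star> h) = pa (ugen q x) (ap q \<star> h)" "act (ugen q x) (am q \<star> h) = pa (ugen q x) (am q \<star> h)" for x
      using h e d[OF apc(1) h(2)] d'[OF apc(1) h(2)] d[OF apc(2) h(2)] d'[OF apc(2) h(2)] by (cases x; simp)+
    then show "ap q \<star> h \<in> {f \<in> carrier P. \<forall>x. act (ugen q x) f = pa (ugen q x) f}"
      "am q \<star> h \<in> {f \<in> carrier P. \<forall>x. act (ugen q x) f = pa (ugen q x) f}"
      using apc h by (simp_all add: Pol_mult_closed)
  qed
  then have g: "act (ugen q x) f = pa (ugen q x) f" if "f \<in> carrier P" for x f using that by auto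
  have "\<forall>f\<in>carrier P. act \<xi> f = pa \<xi> f"
  proof (rule Uq_induct[OF \<xi>])
    note l1 = left_module_lin_l[OF L, unfolded Pol_simps(1) lin_Pol_cod] and l2 = left_module_lin_l[OF Pol_act_module_sp]
    show "submodule {\<xi> \<in> carrier U. \<forall>f\<in>carrier P. act \<xi> f = pa \<xi> f} cplx U"
      by (auto simp: submodule_vs_iff lin_add[OF l1] lin_add[OF l2] lin_smult[OF l1] lin_smult[OF l2]
        lin_zero[OF l1 vs_Uq vP] lin_zero[OF l2 vs_Uq vP])
    show "\<forall>f\<in>carrier P. act \<one>\<^bsub>U\<^esub> f = pa \<one>\<^bsub>U\<^esub> f"
      using left_module_one[OF L] left_module_one[OF Pol_act_module_sp] by simp
    show "\<forall>f\<in>carrier P. act (ugen q x \<otimes>\<^bsub>U\<^esub> \<xi>) f = pa (ugen q x \<otimes>\<^bsub>U\<^esub> \<xi>) f"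
      if "\<xi> \<in> carrier U" "\<forall>f\<in>carrier P. act \<xi> f = pa \<xi> f" for x \<xi>
      using that g left_module_mult[OF L] left_module_mult[OF Pol_act_module_sp] left_module_closed[OF Pol_act_module_sp]
      by simp
  qed
  then show ?thesis using f by blast
qed

subsection \<open>The involution on $\mathrm{Pol}(\mathfrak g_{-1})_q$\<close>

private abbreviation "st \<equiv> Pol_star q"

private lemma star_bilin: "bilin (Cg q) (Cgbar q) (conj_sp P) (\<lambda>fp fm. ptens (Cg q) (Cgbar q) (dual_star q Plus fm) (dual_star q Minus fp))"
proof (rule bilinI)
  note b = bilin_ptens[OF vs_dual_alg vs_dual_alg, of Minus Plus, folded pol_sp_def]
  have l1: "lin (Cg q) (conj_sp (Cgbar q)) (dual_star q Minus)" and l2: "lin (Cgbar q) (conj_sp (Cg q)) (dual_star q Plus)"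
    using dual_star_lin[of Minus] dual_star_lin[of Plus] by simp_all
  note c1 = lin_closed[OF l1, unfolded conj_sp_simps] and c2 = lin_closed[OF l2, unfolded conj_sp_simps]
  show "lin (Cg q) (conj_sp P) (\<lambda>fp. ptens (Cg q) (Cgbar q) (dual_star q Plus fm) (dual_star q Minus fp))" if "fm \<in> carrier (Cgbar q)" for fm
    by (rule lin_comp[OF l1 lin_conj_sp_conj_sp[OF bilin_r[OF b c2[OF that]]]])
  show "lin (Cgbar q) (conj_sp P) (\<lambda>fm. ptens (Cg q) (Cgbar q) (dual_star q Plus fm) (dual_star q Minus fp))" if "fp \<in> carrier (Cg q)" for fp
    by (rule lin_comp[OF l2 lin_conj_sp_conj_sp[OF bilin_l[OF b c1[OF that]]]])
qed

lemma Pol_star_lin: "lin P (conj_sp P) st"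
  unfolding Pol_star_def using lin_tensor_ext[OF vs_dual_alg vs_dual_alg vs_conj_sp[OF vP] star_bilin]
  by (simp add: pol_sp_def)

text \<open>The involution swaps the tensor factors and also exchanges the two dual algebras, so a
  normally ordered monomial stays normally ordered. The powers of q^2 and q^(-2) are ratios of
  \<open>tau\<close>.\<close>

lemma Pol_star_bas: "st (m a b) = (QQ ^ b * RR ^ a) \<odot>\<^bsub>P\<^esub> m b a"
proof -
  note [simp del] = of_real_divide of_real_diff of_real_power of_real_mult
  have t: "tau q Plus / tau q Minus = QQ" "tau q Minus / tau q Plus = RR" by (simp_all add: tau_def of_real_divide)
  have d: "dual_star q Plus (dual_bas q Plus b) = QQ ^ b \<odot>\<^bsub>Cg q\<^esub> dual_bas q Minus b"
    "dual_star q Minus (dual_bas q Minus a) = RR ^ a \<odot>\<^bsub>Cgbar q\<^esub> dual_bas q Plus a"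
    using dual_star_bas[of Plus b] dual_star_bas[of Minus a] by (simp_all add: t)
  have "st (m a b) = ptens (Cg q) (Cgbar q) (dual_star q Plus (dual_bas q Plus b)) (dual_star q Minus (dual_bas q Minus a))"
    unfolding Pol_star_def pol_bas_def prod.case
    by (rule tensor_ext_ptens[OF vs_dual_alg vs_dual_alg vs_conj_sp[OF vP] star_bilin DD(2) DD(2)])
  also have "\<dots> = (QQ ^ b * RR ^ a) \<odot>\<^bsub>P\<^esub> m b a"
    unfolding d using vP mc
    by (simp add: DD ptens_smult_l ptens_smult_r pt_m pol_sp_def[symmetric] vs_smult_smult mult.commute)
  finally show ?thesis .
qed

private lemmas st_add = lin_add[OF Pol_star_lin, unfolded conj_sp_simps]
private lemmas st_smult = lin_smult[OF Pol_star_lin, unfolded conj_sp_simps]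
private lemmas st_closed = lin_closed[OF Pol_star_lin, unfolded conj_sp_simps]

text \<open>On normally ordered pairs both sides are multiples of a monomial. For the pair a_-, a_+
  the claim is that the relation is self-adjoint: a_- a_+ is fixed because the scalars q^2 and
  q^(-2) cancel.\<close>

lemma Pol_star_mult:
  assumes "f \<in> carrier P" "g \<in> carrier P"
  shows "st (f \<star> g) = st g \<star> st f"
proof (rule Pol_pair_induct[where R = "\<lambda>f g. st (f \<star> g) = st g \<star> st f", OF _ _ _ _ _ _ _ _ _ assms])
  note [simp] = mc vP Pol_mult_closed st_closed
  note b = Pol_mult_bilin
  show "submodule {g \<in> carrier P. st (f \<star> g) = st g \<star> st f} cplx P" if f: "f \<in> carrier P" for f
    by (rule submodule_equalizer[OF vP vs_conj_sp[OF vP] lin_comp[OF bilin_r[OF b f] Pol_star_lin]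
          lin_comp[OF Pol_star_lin lin_conj_sp_conj_sp[OF bilin_l[OF b st_closed[OF f]]]]])
  show "submodule {f \<in> carrier P. st (f \<star> g) = st g \<star> st f} cplx P" if g: "g \<in> carrier P" for g
    by (rule submodule_equalizer[OF vP vs_conj_sp[OF vP] lin_comp[OF bilin_l[OF b g] Pol_star_lin]
          lin_comp[OF Pol_star_lin lin_conj_sp_conj_sp[OF bilin_r[OF b st_closed[OF g]]]]])
  fix f g h assume f: "f \<in> carrier P" and g: "g \<in> carrier P" and h: "h \<in> carrier P"
  show "st (f \<star> (g \<star> h)) = st (g \<star> h) \<star> st f"
    if "st (f \<star> g) = st g \<star> st f" "st ((f \<star> g) \<star> h) = st h \<star> st (f \<star> g)" "st (g \<star> h) = st h \<star> st g"
    using that f g h by (simp add: Pol_assoc)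
  show "st ((f \<star> g) \<star> h) = st h \<star> st (f \<star> g)"
    if "st (f \<star> g) = st g \<star> st f" "st (f \<star> (g \<star> h)) = st (g \<star> h) \<star> st f" "st (g \<star> h) = st h \<star> st g"
    using that f g h by (simp add: Pol_assoc)
next
  note [simp] = mc vP Pol_mult_closed st_closed
  have o: "st (m 0 0) = m 0 0" by (simp add: Pol_star_bas)
  fix f assume "f \<in> carrier P"
  then show "st (f \<star> \<one>\<^bsub>Pol q\<^esub>) = st \<one>\<^bsub>Pol q\<^esub> \<star> st f" "st (\<one>\<^bsub>Pol q\<^esub> \<star> f) = st f \<star> st \<one>\<^bsub>Pol q\<^esub>"
    by (simp_all add: Pol_one o Pol_one_l Pol_one_r)
next
  note [simp] = mc vP Pol_mult_closed st_closed
  note [simp del] = of_real_divide of_real_diff of_real_power of_real_mult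
  note s = Pol_star_bas Pol_mult_x Pol_mult_y Pol_expand vs_smult_smult
  show "st (m (Suc 0) 0 \<star> m a b) = st (m a b) \<star> st (m (Suc 0) 0)" for a b
    by (simp add: s mult.assoc mult.left_commute mult.commute)
  show "st (m a b \<star> m 0 (Suc 0)) = st (m 0 (Suc 0)) \<star> st (m a b)" for a b
    by (simp add: s mult.assoc mult.left_commute mult.commute)
  have yx: "m 0 (Suc 0) \<star> m (Suc 0) 0 = QQ \<odot>\<^bsub>P\<^esub> m (Suc 0) (Suc 0) \<oplus>\<^bsub>P\<^esub> c0 \<odot>\<^bsub>P\<^esub> m 0 0"
    using Pol_mult_yx[of 1 0] by simp
  show "st (m 0 (Suc 0) \<star> m (Suc 0) 0) = st (m (Suc 0) 0) \<star> st (m 0 (Suc 0))"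
    using scal_cancel[OF q0] by (simp add: s yx st_add st_smult)
qed

lemma Pol_star_star: "f \<in> carrier P \<Longrightarrow> st (st f) = f"
proof (rule basis_lin_eqI[where f = "\<lambda>f. st (st f)" and g = "\<lambda>f. f", OF pol_basis vP lin_conj_sp_comp[OF Pol_star_lin Pol_star_lin] lin_id])
  have QRn: "QQ ^ k * RR ^ k = 1" for k using scal_cancel[OF q0] by (metis power_mult_distrib power_one)
  have "(QQ ^ b * RR ^ a) * (QQ ^ a * RR ^ b) = (QQ ^ b * RR ^ b) * (QQ ^ a * RR ^ a)" for a b
    by (simp only: mult.assoc mult.left_commute mult.commute)
  then have "(QQ ^ b * RR ^ a) * (QQ ^ a * RR ^ b) = 1" for a b unfolding QRn by simp
  moreover have "cnj (QQ ^ b * RR ^ a) = QQ ^ b * RR ^ a" for a b by simp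
  ultimately have "st (st (m a b)) = m a b" for a b
    unfolding Pol_star_bas st_smult[OF mc] by (simp only: vs_smult_smult[OF vP mc] vs_smult_one[OF vP mc])
  then show "st (st (pol_bas q i)) = pol_bas q i" for i by (cases i) simp
qed

lemma Pol_star_structure: "star_structure (Pol q) st"
proof -
  have "st \<in> calg_hom (Pol q) (conj_sp (opp_alg (Pol q)))"
  proof (rule calg_homI)
    show "lin (Pol q) (conj_sp (opp_alg (Pol q))) st" using Pol_star_lin by (simp add: lin_def)
  qed (simp_all add: Pol_star_mult Pol_one Pol_star_bas mc vP)
  then show ?thesis using cP Pol_star_star by (simp add: star_structure_def)
qed

lemma Pol_star_formulas: "star_formulas q st"
  by (simp add: star_formulas_def ap_eq am_eq Pol_star_bas)

lemma Pol_star_unique: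
  assumes S: "star_structure (Pol q) st'" and F: "star_formulas q st'" and f: "f \<in> carrier P"
  shows "st' f = st f"
proof -
  have h: "st' \<in> calg_hom (Pol q) (conj_sp (opp_alg (Pol q)))" and h': "st \<in> calg_hom (Pol q) (conj_sp (opp_alg (Pol q)))"
    using S Pol_star_structure by (simp_all add: star_structure_def)
  have l: "lin P (conj_sp P) st'" using calg_hom_lin[OF h] by (simp add: lin_def)
  have apc: "ap q \<in> carrier P" "am q \<in> carrier P" by (simp_all add: ap_eq am_eq mc)
  have e: "st' (ap q) = st (ap q)" "st' (am q) = st (am q)"
    using F Pol_star_formulas by (simp_all add: star_formulas_def)
  have "carrier P \<subseteq> {f \<in> carrier P. st' f = st f}"
    by (rule Pol_gen_induct[OF submodule_equalizer[OF vP vs_conj_sp[OF vP] l Pol_star_lin]])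
      (use calg_hom_one[OF h] calg_hom_one[OF h'] calg_hom_mult[OF h] calg_hom_mult[OF h'] e apc in
        \<open>simp_all add: Pol_mult_closed, simp_all add: Pol_one mc\<close>)
  then show ?thesis using f by auto
qed

end

end

theorem mainTheorem2:
  fixes q :: real
  assumes "0 < q" and "q < 1"
  shows
    "let P = Pol q; st = Pol_star q; z = of_real (q powr (1/2)) \<odot>\<^bsub>P\<^esub> ap q in
       \<comment> \<open>generators and defining relation\<close>
       (calgebra P
        \<and> ap q \<in> carrier P \<and> am q \<in> carrier P
        \<and> subalg_gen P {ap q, am q} = carrier P
        \<and> am q \<otimes>\<^bsub>P\<^esub> ap q =
            of_real (q\<^sup>2) \<odot>\<^bsub>P\<^esub> (ap q \<otimes>\<^bsub>P\<^esub> am q) \<oplus>\<^bsub>P\<^esub> of_real (q * (1 - q\<^sup>2)) \<odot>\<^bsub>P\<^esub> \<one>\<^bsub>P\<^esub>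
        \<and> presented_ext P (\<lambda>x. case x of gAp \<Rightarrow> ap q | gAm \<Rightarrow> am q)
            \<in> calg_iso (presented_alg (pol_rels q)) P)
     \<and> \<comment> \<open>the action is given and determined by the formulas on the generators\<close>
       (module_algebra q P (Pol_act q) \<and> action_formulas q (Pol_act q)
        \<and> (\<forall>act. module_algebra q P act \<and> action_formulas q act \<longrightarrow>
             (\<forall>\<xi> \<in> carrier (Uq q). \<forall>f \<in> carrier P. act \<xi> f = Pol_act q \<xi> f)))
     \<and> \<comment> \<open>the involution is given and determined by the formulas on the generators\<close>
       (star_structure P st \<and> star_formulas q st
        \<and> (\<forall>st'. star_structure P st' \<and> star_formulas q st' \<longrightarrow>
             (\<forall>f \<in> carrier P. st' f = st f)))
     \<and> \<comment> \<open>the normalised generator\<close>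
       st z = of_real (q powr (-3/2)) \<odot>\<^bsub>P\<^esub> am q
     \<and> (st z \<otimes>\<^bsub>P\<^esub> z) \<ominus>\<^bsub>P\<^esub> (of_real (q\<^sup>2) \<odot>\<^bsub>P\<^esub> (z \<otimes>\<^bsub>P\<^esub> st z)) = of_real (1 - q\<^sup>2) \<odot>\<^bsub>P\<^esub> \<one>\<^bsub>P\<^esub>"
proof -
  interpret uq q by unfold_locales (use assms in auto)
  define P where "P = Pol q"
  define z where "z = complex_of_real (q powr (1/2)) \<odot>\<^bsub>P\<^esub> ap q"
  let ?st = "Pol_star q"
  have A: "calgebra P" unfolding P_def by (rule calgebra_Pol)
  note V = calgebra_vs[OF A]
  have c: "ap q \<in> carrier P" "am q \<in> carrier P"
    by (simp_all add: P_def ap_eq am_eq pol_bas_closed)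
  have rel: "am q \<otimes>\<^bsub>P\<^esub> ap q =
      of_real (q\<^sup>2) \<odot>\<^bsub>P\<^esub> (ap q \<otimes>\<^bsub>P\<^esub> am q) \<oplus>\<^bsub>P\<^esub> of_real (q * (1 - q\<^sup>2)) \<odot>\<^bsub>P\<^esub> \<one>\<^bsub>P\<^esub>"
    using Pol_relation by (simp add: P_def)
  have ss: "star_structure P ?st" and sf: "star_formulas q ?st"
    unfolding P_def by (rule Pol_star_structure, rule Pol_star_formulas)
  have sp: "?st (ap q) = of_real (1 / q\<^sup>2) \<odot>\<^bsub>P\<^esub> am q"
    using sf by (simp add: star_formulas_def P_def)
  have pw: "q powr (1/2) * (1 / q\<^sup>2) = q powr (-3/2)"
  proof -
    have "1 / q\<^sup>2 = q powr (-2)" using q by (simp add: powr_minus powr_numeral divide_inverse)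
    then show ?thesis by (simp add: powr_add[symmetric])
  qed
  have "?st z = cnj (of_real (q powr (1/2))) \<odot>\<^bsub>P\<^esub> ?st (ap q)"
    unfolding z_def using ss c by (simp add: star_structure_def calg_hom_def)
  also have "\<dots> = of_real (q powr (1/2) * (1 / q\<^sup>2)) \<odot>\<^bsub>P\<^esub> am q"
    unfolding sp using V c by (simp add: vs_smult_smult)
  finally have stz: "?st z = of_real (q powr (-3/2)) \<odot>\<^bsub>P\<^esub> am q" unfolding pw .
  \<comment> \<open>The scalars of z and of its adjoint multiply to 1/q, which turns the constant
    q(1-q^2) into 1-q^2; this is the reason for the normalisation by q^(1/2).\<close>
  have qq: "q powr (-3/2) * q powr (1/2) = 1 / q"
  proof -
    have "q powr (-3/2) * q powr (1/2) = q powr (-3/2 + 1/2)" by (rule powr_add[symmetric])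
    also have "-3/2 + 1/2 = (-1 :: real)" by simp
    also have "q powr (-1) = 1 / q" using q powr_minus_divide[of q 1] by simp
    finally show ?thesis .
  qed
  define X where "X = ap q \<otimes>\<^bsub>P\<^esub> am q"
  have X: "X \<in> carrier P" "\<one>\<^bsub>P\<^esub> \<in> carrier P" using A c by (simp_all add: X_def)
  have 1: "?st z \<otimes>\<^bsub>P\<^esub> z = of_real (1 / q) \<odot>\<^bsub>P\<^esub> (of_real (q\<^sup>2) \<odot>\<^bsub>P\<^esub> X \<oplus>\<^bsub>P\<^esub> of_real (q * (1 - q\<^sup>2)) \<odot>\<^bsub>P\<^esub> \<one>\<^bsub>P\<^esub>)"
    unfolding stz unfolding z_def X_def rel[symmetric] qq[symmetric] using A V c
    by (simp add: calg_smult_l calg_smult_r vs_smult_smult mult.commute)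
  have 2: "z \<otimes>\<^bsub>P\<^esub> ?st z = of_real (1 / q) \<odot>\<^bsub>P\<^esub> X"
    unfolding stz unfolding z_def X_def qq[symmetric] using A V c
    by (simp add: calg_smult_l calg_smult_r vs_smult_smult mult.commute)
  have 3: "(?st z \<otimes>\<^bsub>P\<^esub> z) \<ominus>\<^bsub>P\<^esub> (of_real (q\<^sup>2) \<odot>\<^bsub>P\<^esub> (z \<otimes>\<^bsub>P\<^esub> ?st z)) = of_real (1 - q\<^sup>2) \<odot>\<^bsub>P\<^esub> \<one>\<^bsub>P\<^esub>"
  proof -
    define ts where "ts = [X, \<one>\<^bsub>P\<^esub>]"
    have ts: "set ts \<subseteq> carrier P" "length ts = 2" using X by (simp_all add: ts_def)
    have l: "X = lcomb P ts [1, 0]" "\<one>\<^bsub>P\<^esub> = lcomb P ts [0, 1]" using X V by (simp_all add: ts_def)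
    have "(?st z \<otimes>\<^bsub>P\<^esub> z) \<ominus>\<^bsub>P\<^esub> (of_real (q\<^sup>2) \<odot>\<^bsub>P\<^esub> (z \<otimes>\<^bsub>P\<^esub> ?st z)) =
        of_real (1 / q) \<odot>\<^bsub>P\<^esub> (of_real (q\<^sup>2) \<odot>\<^bsub>P\<^esub> X \<oplus>\<^bsub>P\<^esub> of_real (q * (1 - q\<^sup>2)) \<odot>\<^bsub>P\<^esub> \<one>\<^bsub>P\<^esub>) \<oplus>\<^bsub>P\<^esub>
        (-1) \<odot>\<^bsub>P\<^esub> (of_real (q\<^sup>2) \<odot>\<^bsub>P\<^esub> (of_real (1 / q) \<odot>\<^bsub>P\<^esub> X))"
      unfolding 1 2 using X V by (simp add: vs_minus)
    also have "\<dots> = of_real (1 - q\<^sup>2) \<odot>\<^bsub>P\<^esub> \<one>\<^bsub>P\<^esub>"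
      unfolding l using q V by (simp add: lcomb_add lcomb_smult ts)
    finally show ?thesis .
  qed
  show ?thesis
    unfolding Let_def P_def[symmetric] z_def[symmetric]
  proof (intro conjI allI impI ballI)
    show "subalg_gen P {ap q, am q} = carrier P" unfolding P_def by (rule Pol_subalg_gen)
    show "presented_ext P (\<lambda>x. case x of gAp \<Rightarrow> ap q | gAm \<Rightarrow> am q) \<in> calg_iso (presented_alg (pol_rels q)) P"
      unfolding P_def by (rule Pol_presentation)
    show "module_algebra q P (Pol_act q)" unfolding P_def by (rule Pol_module_algebra)
    show "act \<xi> f = Pol_act q \<xi> f"
      if "module_algebra q P act \<and> action_formulas q act" "\<xi> \<in> carrier (Uq q)" "f \<in> carrier P" for act \<xi> f
      using that Pol_act_unique[of act \<xi> f] by (simp add: P_def)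
    show "st' f = Pol_star q f" if "star_structure P st' \<and> star_formulas q st'" "f \<in> carrier P" for st' f
      using that Pol_star_unique[of st' f] by (simp add: P_def)
  qed (rule A c rel stz 3 ss sf Pol_action_formulas)+
qed

end
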